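(* Let $n\ge 2$. With the sets and maps defined in the context: (1) The horizontal/vertical encoding $\sigma\mapsto \mathrm{code}(\sigma)$ is injective on the set $\mathcal{S}q_n$ of square permutations of size $n$ (without colored points). The sets $A_n$ and $B_n$ are disjoint subsets of $\mathcal{M}_n$, and $\mathrm{code}(\mathcal{S}q_n)=\mathcal{M}_n\setminus(A_n\cup B_n)$. That is, the encoding is a bijection $\mathcal{S}q_n\to \mathcal{M}_n\setminus (A_n\cup B_n)$. (2) The horizontal/vertical encoding $P\mapsto \mathrm{code}(\phi(P))$ is injective on the set $\mathcal{C}p_n$ of convex permutominoes of size $n$. The sets $A'_n$ and $B'_n$ are disjoint subsets of $\mathcal{M}_n$, and the image of the encoding is $\mathcal{M}_n\setminus(A'_n\cup B'_n)$. That is, the encoding is a bijection $\mathcal{C}p_n\to \mathcal{M}_n\setminus (A'_n\cup B'_n)$.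
   Context: **Records.** A permutation $\sigma$ of $\{1,\dots,n\}$ (size $n$) is identified with the point set $\{(i,\sigma(i))\}$. In a finite planar point set $S$, a point $(x,y)$ is an upper-right (UR) record if no $(x',y')\in S$ has $x'>x$ and $y'>y$. Upper-left (UL), bottom-left (BL) and bottom-right (BR) records are defined similarly (no point strictly to the upper-left, lower-left, lower-right respectively). A point is exterior if it is a record of at least one of the four types, and interior otherwise. A *square permutation* is a permutation with no interior point. A point is an *upper point* if it is a UL or UR record, and a *left point* if it is a UL or BL record. **Colored permutations.** A *free fixed point* of $\sigma$ is a point $(i,\sigma(i))$ with $\sigma(i)=i$ that is neither a BL nor a UR record. A colored permutation is a permutation together with a (possibly empty) subset of its free fixed points, called colored. A colored square permutation is one whose underlying permutation is square. Ordinary permutations are colored permutations with no colored point. A permutation of size $n$ is *co-decomposable* if for some $1\le k\le n-1$ its first $k$ values are exactly $\{n-k+1,\dots,n\}$, and *co-indecomposable* otherwise. **Convex permutominoes.** A polygon is a closed self-avoiding walk on the square lattice (starting point and orientation are irrelevant). Its turnpoints are the lattice vertices where it changes direction, and its sides are the segments between consecutive turnpoints. It is convex if its set of lattice vertices has no interior point. A polygon is a *permutomino of size $n$* if (up to translation, lying in $[1,n]^2$) for each $i=1,\dots,n$ the vertical line of abscissa $i$ contains exactly one side and the horizontal line of ordinate $i$ contains exactly one side. Its upper walk is the part of its boundary going clockwise from the highest of its leftmost points to the highest of its rightmost points. For a convex permutomino $P$ of size $n$, color the bottom turnpoint of the leftmost side black and then color the turnpoints alternately white and black clockwise along the boundary.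 The black points form a permutation, and $\phi(P)$ is this permutation in which exactly those free fixed points that lie on the upper walk of $P$ are colored. It is known that $\phi$ is a bijection from convex permutominoes of size $n\geq 2$ to co-indecomposable colored square permutations of size $n$. **Encoding.** $\mathcal{M}_n$ is the set of marked words $(w,m)$ of length $n$: $w=(u_1,v_1)\cdots(u_n,v_n)$ with $(u_1,v_1)=(u_n,v_n)=(X,Y)$, $u_i\in\{U,D\}$ and $v_i\in\{L,R\}$ for $1<i<n$, and $1\le m\le n$ with $v_m\in\{L,Y\}$. For a colored permutation $\sigma$ of size $n\ge2$, $\mathrm{code}(\sigma)=(w,m)$ where $m=\sigma(1)$, $(u_1,v_1)=(u_n,v_n)=(X,Y)$, and for $1<i<n$: $u_i=U$ if $(i,\sigma(i))$ is an upper point that is not colored, else $u_i=D$; $v_i=L$ if $(\sigma^{-1}(i),i)$ is a left point that is not colored, else $v_i=R$. **Sets of non-coding words.** - $\mathcal{T}^{\swarrow}$ is the set of permutations (size $\ge1$) all of whose points are UL, BL or BR records. - $\mathcal{T}^{\nwarrow}$ is the set of permutations (size $\ge 1$) all of whose points are UL, UR or BL records. - $\mathcal{D}^{\swarrow}$ is the set of colored permutations $\rho$ of size $k\ge1$ obtained from a colored square permutation of size $k+1$ whose last value is $k+1$ by deleting that last point (keeping the coloring). - $\mathcal{D}^{\nwarrow+}$ is the set of (uncolored) co-indecomposable elements of $\mathcal{T}^{\nwarrow}$. For $\rho$ of size $k$ in $\mathcal{T}^{\swarrow}$ or $\mathcal{D}^{\swarrow}$, its *sw-labels* are: $a_1=X$,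 $b_1=Y$; for $2\le i\le k$, $a_i=U$ if $(i,\rho(i))$ is an uncolored UL record of $\rho$, else $a_i=D$; $b_i=L$ if $(\rho^{-1}(i),i)$ is an uncolored left point of $\rho$, else $b_i=R$. For $\rho$ of size $k$ in $\mathcal{T}^{\nwarrow}$, its *nw-labels* are: $a_1=X$, $b_k=Y$; for $2\le i\le k$, $a_i=U$ if $(i,\rho(i))$ is an upper point of $\rho$, else $a_i=D$; for $1\le j\le k-1$, $b_j=L$ if $(\rho^{-1}(j),j)$ is a left point of $\rho$, else $b_j=R$. The following are sets of $(w,m)\in\mathcal{M}_n$: - $A_n$ (denoted $\mathcal{T}^{\swarrow}\cdot\{(D,L),(D,R)\}\cdot\mathcal{W}\cdot\{(X,Y)\}$): for some $1\le k\le n-2$ and $\rho\in\mathcal{T}^{\swarrow}$ of size $k$ with sw-labels $a,b$: $u_i=a_i$, $v_i=b_i$ for $1\le i\le k$, $m=\rho(1)$, and $u_{k+1}=D$. - $B_n$ (denoted $\mathcal{T}^{\nwarrow}\cdot\{(U,R),(D,L)\}\cdot\mathcal{W}\cdot\{(X,Y)\}$): for some $1\le k\le n-2$ and $\rho\in\mathcal{T}^{\nwarrow}$ of size $k$ with nw-labels $a,b$: $u_i=a_i$ and $v_{n-k+i}=b_i$ for $1\le i\le k$, $m=n-k+\rho(1)$, and $(u_{k+1},v_{n-k})\in\{(U,R),(D,L)\}$. - $A'_n$ (denoted $\mathcal{D}^{\swarrow}\cdot\{(D,L)\}\cdot\mathcal{W}\cdot\{(X,Y)\}$): for some $1\le k\le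 n-2$ and $\rho\in\mathcal{D}^{\swarrow}$ of size $k$ with sw-labels $a,b$: $u_i=a_i$, $v_i=b_i$ for $1\le i\le k$, $m=\rho(1)$, and $(u_{k+1},v_{k+1})=(D,L)$. - $B'_n$ (denoted $\mathcal{D}^{\nwarrow+}\cdot\mathcal{W}\cdot\{(X,Y)\}$): for some $1\le k\le n-1$ and $\rho\in\mathcal{D}^{\nwarrow+}$ of size $k$ with nw-labels $a,b$: $u_i=a_i$ and $v_{n-k+i}=b_i$ for $1\le i\le k$, and $m=n-k+\rho(1)$. *)

theory Defs
  imports "HOL-Combinatorics.Permutations"
begin

section \<open>Records of planar point sets\<close>

type_synonym point = "nat \<times> nat"

definition UR_records :: "point set \<Rightarrow> point set" where
  "UR_records S = {(x, y) \<in> S. \<not> (\<exists>(x', y') \<in> S. x' > x \<and> y' > y)}"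

definition UL_records :: "point set \<Rightarrow> point set" where
  "UL_records S = {(x, y) \<in> S. \<not> (\<exists>(x', y') \<in> S. x' < x \<and> y' > y)}"

definition BL_records :: "point set \<Rightarrow> point set" where
  "BL_records S = {(x, y) \<in> S. \<not> (\<exists>(x', y') \<in> S. x' < x \<and> y' < y)}"

definition BR_records :: "point set \<Rightarrow> point set" where
  "BR_records S = {(x, y) \<in> S. \<not> (\<exists>(x', y') \<in> S. x' > x \<and> y' < y)}"

definition exterior_points :: "point set \<Rightarrow> point set" where
  "exterior_points S = UR_records S \<union> UL_records S \<union> BL_records S \<union> BR_records S"

definition interior_points :: "point set \<Rightarrow> point set" where
  "interior_points S = S - exterior_points S"

definition upper_points :: "point set \<Rightarrow> point set" where
  "upper_points S = UL_records S \<union> UR_records S"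

definition left_points :: "point set \<Rightarrow> point set" where
  "left_points S = UL_records S \<union> BL_records S"


section \<open>Square and colored permutations\<close>

definition points :: "nat \<Rightarrow> (nat \<Rightarrow> nat) \<Rightarrow> point set" where
  "points n \<sigma> = (\<lambda>i. (i, \<sigma> i)) ` {1..n}"

definition square_perms :: "nat \<Rightarrow> (nat \<Rightarrow> nat) set" where
  "square_perms n = {\<sigma>. \<sigma> permutes {1..n} \<and> interior_points (points n \<sigma>) = {}}"

definition free_fixed_points :: "nat \<Rightarrow> (nat \<Rightarrow> nat) \<Rightarrow> point set" where
  "free_fixed_points n \<sigma> =
     {(i, j) \<in> points n \<sigma>. i = j} - (BL_records (points n \<sigma>) \<union> UR_records (points n \<sigma>))"

text \<open>A colored permutation is a pair of a permutation and its set of colored points.\<close>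

type_synonym cperm = "(nat \<Rightarrow> nat) \<times> point set"

definition colored_square_perms :: "nat \<Rightarrow> cperm set" where
  "colored_square_perms n = {(\<sigma>, C). \<sigma> \<in> square_perms n \<and> C \<subseteq> free_fixed_points n \<sigma>}"

definition co_decomposable :: "nat \<Rightarrow> (nat \<Rightarrow> nat) \<Rightarrow> bool" where
  "co_decomposable n \<sigma> \<longleftrightarrow> (\<exists>k\<in>{1..n - 1}. \<sigma> ` {1..k} = {n - k + 1..n})"


section \<open>Convex permutominoes\<close>

text \<open>
  A closed self-avoiding walk is given by the list of its distinct vertices, the last vertex being
  followed by the first one. Walks of length two, which run through one edge back and forth, are
  excluded. To forget starting point and orientation, a polygon is the set of the undirected
  unit edges of such a walk. As permutominoes are normalized to lie in \<open>[1, n]\<^sup>2\<close>, it suffices to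
  consider vertices with natural coordinates.
\<close>

definition adjacent :: "point \<Rightarrow> point \<Rightarrow> bool" where
  "adjacent p q \<longleftrightarrow>
     (fst p = fst q \<and> (snd q = snd p + 1 \<or> snd p = snd q + 1)) \<or>
     (snd p = snd q \<and> (fst q = fst p + 1 \<or> fst p = fst q + 1))"

definition cyc_next :: "'a list \<Rightarrow> nat \<Rightarrow> 'a" where
  "cyc_next c i = c ! (Suc i mod length c)"

definition closed_saw :: "point list \<Rightarrow> bool" where
  "closed_saw c \<longleftrightarrow>
     length c > 2 \<and> distinct c \<and> (\<forall>i<length c. adjacent (c ! i) (cyc_next c i))"

type_synonym polygon = "point set set"

definition walk_edges :: "point list \<Rightarrow> polygon" where
  "walk_edges c = {{c ! i, cyc_next c i} | i. i < length c}"

definition is_polygon :: "polygon \<Rightarrow> bool" where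
  "is_polygon P \<longleftrightarrow> (\<exists>c. closed_saw c \<and> walk_edges c = P)"

abbreviation vertices :: "polygon \<Rightarrow> point set" where
  "vertices P \<equiv> \<Union>P"

definition convex_polygon :: "polygon \<Rightarrow> bool" where
  "convex_polygon P \<longleftrightarrow> is_polygon P \<and> interior_points (vertices P) = {}"

text \<open>A polygon changes direction at the vertices incident to a horizontal and a vertical edge.\<close>

definition turnpoints :: "polygon \<Rightarrow> point set" where
  "turnpoints P =
     {v. (\<exists>w. {v, w} \<in> P \<and> fst w \<noteq> fst v) \<and> (\<exists>w. {v, w} \<in> P \<and> snd w \<noteq> snd v)}"

text \<open>
  The sides lying on the vertical line of abscissa \<open>x\<close>, each given by the ordinates of its bottom
  and top turnpoints; and symmetrically for horizontal lines.
\<close>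

definition vertical_sides :: "polygon \<Rightarrow> nat \<Rightarrow> (nat \<times> nat) set" where
  "vertical_sides P x =
     {(y1, y2). y1 < y2 \<and> (x, y1) \<in> turnpoints P \<and> (x, y2) \<in> turnpoints P \<and>
        (\<forall>y\<in>{y1..<y2}. {(x, y), (x, y + 1)} \<in> P) \<and>
        (\<forall>y\<in>{y1<..<y2}. (x, y) \<notin> turnpoints P)}"

definition horizontal_sides :: "polygon \<Rightarrow> nat \<Rightarrow> (nat \<times> nat) set" where
  "horizontal_sides P y =
     {(x1, x2). x1 < x2 \<and> (x1, y) \<in> turnpoints P \<and> (x2, y) \<in> turnpoints P \<and>
        (\<forall>x\<in>{x1..<x2}. {(x, y), (x + 1, y)} \<in> P) \<and>
        (\<forall>x\<in>{x1<..<x2}. (x, y) \<notin> turnpoints P)}"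

definition permutomino :: "nat \<Rightarrow> polygon \<Rightarrow> bool" where
  "permutomino n P \<longleftrightarrow>
     is_polygon P \<and> vertices P \<subseteq> {1..n} \<times> {1..n} \<and>
     (\<forall>i\<in>{1..n}. (\<exists>!s. s \<in> vertical_sides P i) \<and> (\<exists>!s. s \<in> horizontal_sides P i))"

definition convex_permutominoes :: "nat \<Rightarrow> polygon set" where
  "convex_permutominoes n = {P. permutomino n P \<and> convex_polygon P}"

definition xmin :: "polygon \<Rightarrow> nat" where
  "xmin P = Min (fst ` vertices P)"

definition xmax :: "polygon \<Rightarrow> nat" where
  "xmax P = Max (fst ` vertices P)"

text \<open>
  The region enclosed by a polygon lies to the right of its leftmost edges, so clockwise
  traversals are those that run upwards along these edges.
\<close>

definition clockwise_walk :: "polygon \<Rightarrow> point list \<Rightarrow> bool" where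
  "clockwise_walk P c \<longleftrightarrow>
     closed_saw c \<and> walk_edges c = P \<and>
     (\<forall>i<length c. fst (c ! i) = xmin P \<and> fst (cyc_next c i) = xmin P \<longrightarrow>
        snd (c ! i) < snd (cyc_next c i))"

definition highest_leftmost :: "polygon \<Rightarrow> point" where
  "highest_leftmost P = (xmin P, Max {y. (xmin P, y) \<in> vertices P})"

definition highest_rightmost :: "polygon \<Rightarrow> point" where
  "highest_rightmost P = (xmax P, Max {y. (xmax P, y) \<in> vertices P})"

definition upper_walk :: "polygon \<Rightarrow> point set" where
  "upper_walk P =
     {v. \<exists>c k. clockwise_walk P c \<and> hd c = highest_leftmost P \<and>
        k < length c \<and> c ! k = highest_rightmost P \<and> v \<in> set (take (Suc k) c)}"

definition black_points :: "polygon \<Rightarrow> point set" where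
  "black_points P =
     {v. \<exists>c y1 y2 ts j. clockwise_walk P c \<and>
        (y1, y2) \<in> vertical_sides P (xmin P) \<and> hd c = (xmin P, y1) \<and>
        ts = filter (\<lambda>p. p \<in> turnpoints P) c \<and> j < length ts \<and> even j \<and> v = ts ! j}"

definition black_perm :: "nat \<Rightarrow> polygon \<Rightarrow> nat \<Rightarrow> nat" where
  "black_perm n P i = (if i \<in> {1..n} then THE j. (i, j) \<in> black_points P else i)"

definition phi :: "nat \<Rightarrow> polygon \<Rightarrow> cperm" where
  "phi n P = (black_perm n P, free_fixed_points n (black_perm n P) \<inter> upper_walk P)"


section \<open>Marked words and the encoding\<close>

datatype hletter = U | D | X

datatype vletter = L | R | Y

type_synonym mword = "(hletter \<times> vletter) list \<times> nat"

text \<open>Letters of a word are numbered from 1.\<close>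

definition ulet :: "(hletter \<times> vletter) list \<Rightarrow> nat \<Rightarrow> hletter" where
  "ulet w i = fst (w ! (i - 1))"

definition vlet :: "(hletter \<times> vletter) list \<Rightarrow> nat \<Rightarrow> vletter" where
  "vlet w i = snd (w ! (i - 1))"

definition marked_words :: "nat \<Rightarrow> mword set" where
  "marked_words n =
     {(w, m). length w = n \<and>
        ulet w 1 = X \<and> vlet w 1 = Y \<and> ulet w n = X \<and> vlet w n = Y \<and>
        (\<forall>i\<in>{1<..<n}. ulet w i \<in> {U, D} \<and> vlet w i \<in> {L, R}) \<and>
        m \<in> {1..n} \<and> vlet w m \<in> {L, Y}}"

definition code :: "nat \<Rightarrow> cperm \<Rightarrow> mword" where
  "code n = (\<lambda>(\<sigma>, C).
     (map (\<lambda>i. if i = 1 \<or> i = n then (X, Y)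
               else (if (i, \<sigma> i) \<in> upper_points (points n \<sigma>) - C then U else D,
                     if (inv \<sigma> i, i) \<in> left_points (points n \<sigma>) - C then L else R))
        [1..<n + 1],
      \<sigma> 1))"


section \<open>Non-coding words\<close>

definition T_sw :: "nat \<Rightarrow> (nat \<Rightarrow> nat) set" where
  "T_sw k = {\<rho>. \<rho> permutes {1..k} \<and>
     points k \<rho> \<subseteq> UL_records (points k \<rho>) \<union> BL_records (points k \<rho>) \<union> BR_records (points k \<rho>)}"

definition T_nw :: "nat \<Rightarrow> (nat \<Rightarrow> nat) set" where
  "T_nw k = {\<rho>. \<rho> permutes {1..k} \<and>
     points k \<rho> \<subseteq> UL_records (points k \<rho>) \<union> UR_records (points k \<rho>) \<union> BL_records (points k \<rho>)}"

text \<open>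
  A colored point of an element of \<open>D_sw k\<close> is a free fixed point of the permutation of size
  \<open>k + 1\<close>, but it may be a UR record after the deletion of the last point.
\<close>

definition D_sw :: "nat \<Rightarrow> cperm set" where
  "D_sw k = {(\<rho>, C). \<rho> permutes {1..k} \<and>
     (\<exists>\<tau>. (\<tau>, C) \<in> colored_square_perms (k + 1) \<and> \<tau> (k + 1) = k + 1 \<and>
        (\<forall>i\<in>{1..k}. \<rho> i = \<tau> i))}"

definition D_nw_plus :: "nat \<Rightarrow> (nat \<Rightarrow> nat) set" where
  "D_nw_plus k = {\<rho> \<in> T_nw k. \<not> co_decomposable k \<rho>}"

definition sw_a :: "nat \<Rightarrow> cperm \<Rightarrow> nat \<Rightarrow> hletter" where
  "sw_a k = (\<lambda>(\<rho>, C) i. if i = 1 then X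
     else if (i, \<rho> i) \<in> UL_records (points k \<rho>) - C then U else D)"

definition sw_b :: "nat \<Rightarrow> cperm \<Rightarrow> nat \<Rightarrow> vletter" where
  "sw_b k = (\<lambda>(\<rho>, C) i. if i = 1 then Y
     else if (inv \<rho> i, i) \<in> left_points (points k \<rho>) - C then L else R)"

definition nw_a :: "nat \<Rightarrow> (nat \<Rightarrow> nat) \<Rightarrow> nat \<Rightarrow> hletter" where
  "nw_a k \<rho> i = (if i = 1 then X
     else if (i, \<rho> i) \<in> upper_points (points k \<rho>) then U else D)"

definition nw_b :: "nat \<Rightarrow> (nat \<Rightarrow> nat) \<Rightarrow> nat \<Rightarrow> vletter" where
  "nw_b k \<rho> j = (if j = k then Y
     else if (inv \<rho> j, j) \<in> left_points (points k \<rho>) then L else R)"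

definition A_words :: "nat \<Rightarrow> mword set" where
  "A_words n = {(w, m) \<in> marked_words n.
     \<exists>k\<in>{1..n - 2}. \<exists>\<rho>\<in>T_sw k.
       (\<forall>i\<in>{1..k}. ulet w i = sw_a k (\<rho>, {}) i \<and> vlet w i = sw_b k (\<rho>, {}) i) \<and>
       m = \<rho> 1 \<and> ulet w (k + 1) = D}"

definition B_words :: "nat \<Rightarrow> mword set" where
  "B_words n = {(w, m) \<in> marked_words n.
     \<exists>k\<in>{1..n - 2}. \<exists>\<rho>\<in>T_nw k.
       (\<forall>i\<in>{1..k}. ulet w i = nw_a k \<rho> i \<and> vlet w (n - k + i) = nw_b k \<rho> i) \<and>
       m = n - k + \<rho> 1 \<and> (ulet w (k + 1), vlet w (n - k)) \<in> {(U, R), (D, L)}}"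

definition A'_words :: "nat \<Rightarrow> mword set" where
  "A'_words n = {(w, m) \<in> marked_words n.
     \<exists>k\<in>{1..n - 2}. \<exists>(\<rho>, C)\<in>D_sw k.
       (\<forall>i\<in>{1..k}. ulet w i = sw_a k (\<rho>, C) i \<and> vlet w i = sw_b k (\<rho>, C) i) \<and>
       m = \<rho> 1 \<and> (ulet w (k + 1), vlet w (k + 1)) = (D, L)}"

definition B'_words :: "nat \<Rightarrow> mword set" where
  "B'_words n = {(w, m) \<in> marked_words n.
     \<exists>k\<in>{1..n - 1}. \<exists>\<rho>\<in>D_nw_plus k.
       (\<forall>i\<in>{1..k}. ulet w i = nw_a k \<rho> i \<and> vlet w (n - k + i) = nw_b k \<rho> i) \<and>
       m = n - k + \<rho> 1}"

end

theory Submission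
  imports Defs
begin

text \<open>
  A square permutation is drawn along four monotone chains of records. The code tells for each
  column whether its point is above or below, and for each row whether its point is left or right,
  so that each point is assigned to one of the chains UL, UR, BL, BR. Once the first value \<open>m\<close> is
  known, the chains can be drawn: the UL chain matches, in increasing order, the first upper columns
  with the left rows from \<open>m\<close> upwards, the BL chain matches lower columns with the left rows below
  \<open>m\<close> in decreasing order, and the two right chains use the columns and rows that remain
  (\<open>decodes\<close>). Hence the labels and \<open>m\<close> determine the permutation, which gives injectivity.

  Whether the drawing succeeds is controlled by two counters. The diagonal height at \<open>i\<close> compares
  the upper columns up to \<open>i\<close> with the left rows between \<open>m\<close> and \<open>i\<close>, and the antidiagonal height
  compares the lower columns up to \<open>i\<close> with the left rows between \<open>n + 1 - i\<close> and \<open>m\<close>. For a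
  labelled permutation both are nonnegative, and a zero at \<open>k < n\<close> means that the first \<open>k\<close> columns
  carry the lowest, respectively the highest, \<open>k\<close> values (\<open>lab_diag_zero\<close>, \<open>lab_anti_zero\<close>).
  Conversely, nonnegative heights keep the UL and BR chains on the two sides of the diagonal and the
  BL and UR chains on the two sides of the antidiagonal, and together with the count this makes
  every drawn point a record (\<open>labelling_exists\<close>). Both heights cannot have low values in the same
  word (\<open>diag_pos_of_anti_nonpos\<close>), so the two obstructions exclude each other.

  Points that are records of two opposite types need care. A point that is both a UL and a BR record
  is a fixed point between two diagonal blocks; drawing it on the UL or on the BR chain is the
  choice of leaving it uncolored or of coloring it. A point behind the first column that is both a
  BL and a UR record directly follows an antidiagonal block; the code marks its column as upper and
  its row as left, whereas it is drawn on the BL chain. These columns can be recognized from left to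
  right, as they are the marked columns \<open>i\<close> with antidiagonal height zero at \<open>i - 1\<close> and a left row
  \<open>n + 1 - i\<close> (\<open>natural_upto\<close>). With this correction the code is a bijection from the colored square
  permutations onto the words whose diagonal height is nonnegative and in which, behind every zero
  of the antidiagonal height, the next column and the next row agree in being both marked or both
  unmarked (\<open>csq_exists\<close>, \<open>code_image_iff\<close>).

  The sets of non-coding words are described by the same counters. The words in \<open>A'\<close> are those with
  a negative diagonal height: the prefix before the first negative value encodes a permutation in
  \<open>D_sw\<close>. The words in \<open>A\<close> have a diagonal height that is at most zero somewhere before a column
  \<open>D\<close>. The words in \<open>B'\<close> are those whose antidiagonal height vanishes somewhere, and the words in
  \<open>B\<close> are those where it vanishes with a disagreement behind the zero. So the codes of colored
  square permutations are the marked words outside \<open>A'\<close> and \<open>B\<close>, and among them the codes in \<open>A\<close>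
  belong to the permutations with a colored point and the codes in \<open>B'\<close> to the co-decomposable ones.
  Removing the former leaves the first bijection, removing the latter the second one, up to the
  bijection \<open>phi\<close>.

  That \<open>phi\<close> is a bijection from the convex permutominoes onto the co-indecomposable colored square
  permutations rests on a bound for the number of vertices. All vertices are records; on each of the
  four chains of records the coordinate sum or difference is injective, and counting gives at most
  \<open>4 (n - 1)\<close> vertices (\<open>vertex_count\<close>). As a closed walk between the lines \<open>1\<close> and \<open>n\<close> crosses each
  of the \<open>n - 1\<close> cuts between vertical lines, and likewise between horizontal lines, at least twice,
  it crosses each cut exactly twice (\<open>crossings_unique\<close>). A convex permutomino is therefore
  described by its top row and its bottom row over each vertical cut, and on each inner column
  exactly one of the two changes (\<open>cp_skeleton\<close>). The black points are the turnpoints that are left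
  vertically: where the top row changes the black point lies in the old top row, and where the
  bottom row changes it lies in the new bottom row. Knowing which columns are of the former kind,
  which is what the records and the colors tell (\<open>upper_col_iff\<close>), both row sequences can be read
  off from the permutation. Conversely, they define a polygon if the bottom row is below the top row
  over each cut, and this holds when the permutation is co-indecomposable (\<open>bot_less_top\<close>).
\<close>

section \<open>Counting in intervals\<close>

definition cnt :: "nat set \<Rightarrow> nat \<Rightarrow> nat \<Rightarrow> nat" where
  "cnt S a b = card (S \<inter> {a..b})"

lemma cnt_empty: "b < a \<Longrightarrow> cnt S a b = 0"
  by (simp add: cnt_def)

lemma cnt_split:
  assumes "a \<le> Suc b" "b \<le> c"
  shows "cnt S a c = cnt S a b + cnt S (Suc b) c"
proof -
  have "S \<inter> {a..c} = (S \<inter> {a..b}) \<union> (S \<inter> {Suc b..c})" using assms by auto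
  moreover have "(S \<inter> {a..b}) \<inter> (S \<inter> {Suc b..c}) = {}" by auto
  ultimately show ?thesis by (simp add: cnt_def card_Un_disjoint)
qed

lemma cnt_self: "cnt S a a = (if a \<in> S then 1 else 0)"
  by (simp add: cnt_def)

lemma cnt_Suc: "a \<le> Suc b \<Longrightarrow> cnt S a (Suc b) = cnt S a b + (if Suc b \<in> S then 1 else 0)"
  using cnt_split[of a b "Suc b" S] by (simp add: cnt_self)

lemma cnt_Suc_left: "a \<le> b \<Longrightarrow> cnt S a b = (if a \<in> S then 1 else 0) + cnt S (Suc a) b"
  using cnt_split[of a a b S] by (simp add: cnt_self)

lemma cnt_compl: "cnt S a b + cnt (- S) a b = Suc b - a"
proof -
  have "{a..b} = (S \<inter> {a..b}) \<union> (- S \<inter> {a..b})" by auto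
  moreover have "card ((S \<inter> {a..b}) \<union> (- S \<inter> {a..b})) = cnt S a b + cnt (- S) a b"
    unfolding cnt_def by (rule card_Un_disjoint) auto
  ultimately show ?thesis by (metis card_atLeastAtMost)
qed

lemma cnt_mono: "a' \<le> a \<Longrightarrow> b \<le> b' \<Longrightarrow> cnt S a b \<le> cnt S a' b'"
  unfolding cnt_def by (rule card_mono) auto

lemma cnt_mono_set: "S \<inter> {a..b} \<subseteq> T \<Longrightarrow> cnt S a b \<le> cnt T a b"
  unfolding cnt_def by (rule card_mono) auto

lemma cnt_cong: "(\<And>i. a \<le> i \<Longrightarrow> i \<le> b \<Longrightarrow> i \<in> S \<longleftrightarrow> i \<in> T) \<Longrightarrow> cnt S a b = cnt T a b"
  unfolding cnt_def by (rule arg_cong[of _ _ card]) auto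

lemma cnt_le: "cnt S a b \<le> Suc b - a"
  using cnt_compl[of S a b] by linarith

lemma cnt_strict_left:
  assumes "y \<in> S" "a \<le> y" "x < y" shows "cnt S a x < cnt S a y"
proof -
  have "S \<inter> {a..x} \<subseteq> S \<inter> {a..y}" "y \<in> S \<inter> {a..y}" "y \<notin> S \<inter> {a..x}" using assms by auto
  then have "S \<inter> {a..x} \<subset> S \<inter> {a..y}" by blast
  then show ?thesis unfolding cnt_def by (intro psubset_card_mono) auto
qed

lemma cnt_strict_right:
  assumes "y \<in> S" "y \<le> b" "y < x" shows "cnt S x b < cnt S y b"
proof -
  have "S \<inter> {x..b} \<subseteq> S \<inter> {y..b}" "y \<in> S \<inter> {y..b}" "y \<notin> S \<inter> {x..b}" using assms by auto
  then have "S \<inter> {x..b} \<subset> S \<inter> {y..b}" by blast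
  then show ?thesis unfolding cnt_def by (intro psubset_card_mono) auto
qed

lemma cnt_pos: "y \<in> S \<Longrightarrow> a \<le> y \<Longrightarrow> y \<le> b \<Longrightarrow> 1 \<le> cnt S a b"
  unfolding cnt_def using card_gt_0_iff[of "S \<inter> {a..b}"] by fastforce

lemma ex_cnt_left:
  assumes "1 \<le> t" "t \<le> cnt S a b"
  shows "\<exists>y\<in>S. a \<le> y \<and> y \<le> b \<and> cnt S a y = t"
  using assms
proof (induction b)
  case 0
  then show ?case by (cases "a = 0") (auto simp: cnt_self cnt_empty split: if_splits)
next
  case (Suc b)
  show ?case
  proof (cases "t \<le> cnt S a b")
    case True
    then show ?thesis using Suc by force
  next
    case False
    then have "a \<le> Suc b" using Suc.prems by (metis cnt_empty not_less_eq not_one_le_zero le_trans not_less)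
    then show ?thesis using False Suc.prems cnt_Suc[of a b S] by (auto split: if_splits intro!: bexI[of _ "Suc b"])
  qed
qed

lemma ex_cnt_right:
  assumes "1 \<le> t" "t \<le> cnt S a b"
  shows "\<exists>y\<in>S. a \<le> y \<and> y \<le> b \<and> cnt S y b = t"
proof -
  define N where "N = cnt S a b"
  have "1 \<le> N + 1 - t" "N + 1 - t \<le> cnt S a b" using assms by (auto simp: N_def)
  from ex_cnt_left[OF this] obtain y where y: "y \<in> S" "a \<le> y" "y \<le> b" "cnt S a y = N + 1 - t" by blast
  have "cnt S a y = cnt S a b - cnt S (Suc y) b" using cnt_split[of a y b S] y by simp
  moreover have "cnt S y b = Suc (cnt S (Suc y) b)" using cnt_Suc_left[of y b S] y by simp
  moreover have "cnt S (Suc y) b \<le> N" using cnt_mono[of a "Suc y" b b S] y by (simp add: N_def)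
  ultimately have "cnt S y b = t" using y assms by (simp add: N_def)
  then show ?thesis using y by blast
qed

section \<open>Labelled square permutations\<close>

text \<open>
  The set \<open>up\<close> contains the columns read as upper and \<open>lf\<close> the rows read as left. Each point has to
  be a record of the one type that its two labels prescribe; a point that is a record of several
  types admits several labellings. The rows \<open>1\<close>, \<open>n\<close> and \<open>\<sigma> 1\<close> contain left points in every square
  permutation.
\<close>

definition sq_labelling :: "nat \<Rightarrow> (nat \<Rightarrow> nat) \<Rightarrow> nat set \<Rightarrow> nat set \<Rightarrow> bool" where
  "sq_labelling n \<sigma> up lf \<longleftrightarrow> \<sigma> permutes {1..n} \<and> 2 \<le> n \<and> 1 \<in> up \<and> 1 \<in> lf \<and> n \<in> lf \<and> \<sigma> 1 \<in> lf \<and>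
     (\<forall>x y. 1 \<le> x \<longrightarrow> x < y \<longrightarrow> y \<le> n \<longrightarrow>
        (y \<in> up \<longrightarrow> \<sigma> y \<in> lf \<longrightarrow> \<sigma> x < \<sigma> y) \<and> (y \<notin> up \<longrightarrow> \<sigma> y \<in> lf \<longrightarrow> \<sigma> y < \<sigma> x) \<and>
        (x \<in> up \<longrightarrow> \<sigma> x \<notin> lf \<longrightarrow> \<sigma> y < \<sigma> x) \<and> (x \<notin> up \<longrightarrow> \<sigma> x \<notin> lf \<longrightarrow> \<sigma> x < \<sigma> y))"

text \<open>
  Along each chain columns and rows are matched in order. The left chains start next to the row \<open>m\<close>
  of the first point and go up and down from there. The upper columns that the UL chain does not use
  belong to the UR chain, which descends from row \<open>n\<close>; likewise the BR chain climbs from row \<open>1\<close> in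
  the lower columns that the BL chain does not use.
\<close>

definition decodes :: "nat \<Rightarrow> nat \<Rightarrow> nat set \<Rightarrow> nat set \<Rightarrow> nat \<Rightarrow> nat \<Rightarrow> bool" where
  "decodes n m up lf x y \<longleftrightarrow> 1 \<le> y \<and> y \<le> n \<and>
     (if x \<in> up
      then (if y \<in> lf then m \<le> y \<and> cnt up 1 x = cnt lf m y
            else cnt up 1 x = cnt lf m n + cnt (- lf) y n)
      else (if y \<in> lf then y < m \<and> cnt (- up) 1 x = cnt lf y (m - 1)
            else cnt (- up) 1 x = cnt lf 1 (m - 1) + cnt (- lf) 1 y))"

text \<open>
  In a labelled permutation this is the number of upper columns up to \<open>i\<close> whose points are not UL
  points in the rows up to \<open>i\<close>.
\<close>

definition diag_height :: "nat \<Rightarrow> nat set \<Rightarrow> nat set \<Rightarrow> nat \<Rightarrow> int" where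
  "diag_height m up lf i = int (cnt up 1 i) - int (cnt lf m i)"

text \<open>
  The mirror image for lower columns and BL rows. The summand \<open>1\<close> makes up for row \<open>m\<close>, which
  belongs to column \<open>1\<close> and hence to an upper column.
\<close>

definition anti_height :: "nat \<Rightarrow> nat \<Rightarrow> nat set \<Rightarrow> nat set \<Rightarrow> nat \<Rightarrow> int" where
  "anti_height n m up lf i = 1 + int (cnt (- up) 1 i) - int (cnt lf (Suc n - i) m)"

lemma decodes_unique:
  assumes "decodes n m up lf x y" "decodes n m up lf x z"
  shows "y = z"
proof -
  have l: "cnt S a u = cnt S a v \<Longrightarrow> u \<in> S \<Longrightarrow> v \<in> S \<Longrightarrow> a \<le> u \<Longrightarrow> a \<le> v \<Longrightarrow> u = v" for S a u v
    using cnt_strict_left[of v S a u] cnt_strict_left[of u S a v] by (metis less_irrefl linorder_neqE_nat)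
  have r: "cnt S u a = cnt S v a \<Longrightarrow> u \<in> S \<Longrightarrow> v \<in> S \<Longrightarrow> u \<le> a \<Longrightarrow> v \<le> a \<Longrightarrow> u = v" for S a u v
    using cnt_strict_right[of v S a u] cnt_strict_right[of u S a v] by (metis less_irrefl linorder_neqE_nat)
  have yz: "y \<le> n" "z \<le> n" "1 \<le> y" "1 \<le> z" using assms by (auto simp: decodes_def)
  have cm: "cnt lf m u \<le> cnt lf m n" if "u \<le> n" for u using that by (intro cnt_mono) auto
  have cl: "cnt lf u (m - 1) \<le> cnt lf 1 (m - 1)" if "1 \<le> u" for u using that by (intro cnt_mono) auto
  have pr: "1 \<le> cnt (- lf) u n" if "u \<notin> lf" "u \<le> n" for u using cnt_pos[of u "- lf" u n] that by auto
  have pl: "1 \<le> cnt (- lf) 1 u" if "u \<notin> lf" "1 \<le> u" for u using cnt_pos[of u "- lf" 1 u] that by auto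
  show ?thesis
  proof (cases "x \<in> up")
    case True
    then show ?thesis using assms yz cm[of y] cm[of z] pr[of y] pr[of z] l[of lf m y z] r[of "- lf" y n z]
      by (auto simp: decodes_def split: if_splits)
  next
    case False
    then show ?thesis using assms yz cl[of y] cl[of z] pl[of y] pl[of z] r[of lf y "m - 1" z] l[of "- lf" 1 y z]
      by (auto simp: decodes_def split: if_splits)
  qed
qed

context
  fixes n :: nat and \<sigma> :: "nat \<Rightarrow> nat" and up lf :: "nat set"
  assumes lab: "sq_labelling n \<sigma> up lf"
begin

lemma lab_perm: "\<sigma> permutes {1..n}" and lab_n: "2 \<le> n" and lab_up: "1 \<in> up"
  and lab_lf: "1 \<in> lf" "n \<in> lf" "\<sigma> 1 \<in> lf"
  using lab by (auto simp: sq_labelling_def)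

lemma lab_UL: "1 \<le> x \<Longrightarrow> x < y \<Longrightarrow> y \<le> n \<Longrightarrow> y \<in> up \<Longrightarrow> \<sigma> y \<in> lf \<Longrightarrow> \<sigma> x < \<sigma> y"
  and lab_BL: "1 \<le> x \<Longrightarrow> x < y \<Longrightarrow> y \<le> n \<Longrightarrow> y \<notin> up \<Longrightarrow> \<sigma> y \<in> lf \<Longrightarrow> \<sigma> y < \<sigma> x"
  and lab_UR: "1 \<le> x \<Longrightarrow> x < y \<Longrightarrow> y \<le> n \<Longrightarrow> x \<in> up \<Longrightarrow> \<sigma> x \<notin> lf \<Longrightarrow> \<sigma> y < \<sigma> x"
  and lab_BR: "1 \<le> x \<Longrightarrow> x < y \<Longrightarrow> y \<le> n \<Longrightarrow> x \<notin> up \<Longrightarrow> \<sigma> x \<notin> lf \<Longrightarrow> \<sigma> x < \<sigma> y"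
  using lab unfolding sq_labelling_def by blast+

lemma lab_range: "1 \<le> x \<Longrightarrow> x \<le> n \<Longrightarrow> 1 \<le> \<sigma> x \<and> \<sigma> x \<le> n"
  using permutes_in_image[OF lab_perm, of x] by auto

lemma lab_inj: "\<sigma> x = \<sigma> y \<Longrightarrow> x = y"
  using permutes_inj[OF lab_perm] by (auto dest: injD)

lemma lab_surj: "1 \<le> y \<Longrightarrow> y \<le> n \<Longrightarrow> \<exists>x. 1 \<le> x \<and> x \<le> n \<and> \<sigma> x = y"
  using permutes_image[OF lab_perm] by (metis atLeastAtMost_iff imageE)

lemma lab_card: "card (\<sigma> ` S) = card S"
  by (rule card_image) (meson lab_inj inj_onI)

text \<open>Every left point in a later column is extremal with respect to the first point.\<close>

lemma lab_left_up: assumes "1 \<le> x" "x \<le> n" "\<sigma> x \<in> lf" shows "x \<in> up \<longleftrightarrow> \<sigma> 1 \<le> \<sigma> x"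
proof (cases "x = 1")
  case True then show ?thesis using lab_up by simp
next
  case False then show ?thesis using lab_UL[of 1 x] lab_BL[of 1 x] assms by fastforce
qed

text \<open>
  The image of the upper columns up to \<open>x\<close> consists of a full initial part of the UL chain and, if
  \<open>x\<close> is a UR point, of an initial part of the UR chain. Describing it as a set of rows and
  comparing cardinalities gives the equation of each case; the lower columns are treated alike.
\<close>

lemma lab_decodes:
  assumes x: "1 \<le> x" "x \<le> n"
  shows "decodes n (\<sigma> 1) up lf x (\<sigma> x)"
proof -
  let ?m = "\<sigma> 1"
  have m1: "1 \<le> ?m" using lab_range[of 1] lab_n by simp
  consider (UL) "x \<in> up" "\<sigma> x \<in> lf" | (UR) "x \<in> up" "\<sigma> x \<notin> lf" | (BL) "x \<notin> up" "\<sigma> x \<in> lf" | (BR) "x \<notin> up" "\<sigma> x \<notin> lf"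
    by blast
  then show ?thesis
  proof cases
    case UL
    have "\<sigma> ` (up \<inter> {1..x}) = lf \<inter> {?m..\<sigma> x}"
    proof (intro equalityI subsetI)
      fix y assume "y \<in> \<sigma> ` (up \<inter> {1..x})"
      then obtain x' where x': "x' \<in> up" "1 \<le> x'" "x' \<le> x" "y = \<sigma> x'" by auto
      have "\<sigma> x' \<in> lf" using lab_UL[of x' x] lab_UR[of x' x] x x' UL by (cases "x' = x") fastforce+
      moreover have "\<sigma> x' \<le> \<sigma> x" using lab_UL[of x' x] x x' UL by (cases "x' = x") fastforce+
      moreover have "?m \<le> \<sigma> x'" using lab_left_up[of x'] x x' \<open>\<sigma> x' \<in> lf\<close> by auto
      ultimately show "y \<in> lf \<inter> {?m..\<sigma> x}" using x' by auto
    next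
      fix y assume y: "y \<in> lf \<inter> {?m..\<sigma> x}"
      then obtain x' where x': "1 \<le> x'" "x' \<le> n" "\<sigma> x' = y" using lab_surj[of y] lab_range[of x] x m1 by force
      have "x' \<in> up" using lab_left_up[of x'] x' y by auto
      moreover have "x' \<le> x" using lab_UL[of x x'] x x' y \<open>x' \<in> up\<close> by (cases "x < x'") auto
      ultimately show "y \<in> \<sigma> ` (up \<inter> {1..x})" using x' by auto
    qed
    then have "cnt up 1 x = cnt lf ?m (\<sigma> x)" unfolding cnt_def by (metis lab_card)
    then show ?thesis using UL lab_left_up[of x] lab_range[of x] x by (auto simp: decodes_def)
  next
    case UR
    have "\<sigma> ` (up \<inter> {1..x}) = (lf \<inter> {?m..n}) \<union> (- lf \<inter> {\<sigma> x..n})"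
    proof (intro equalityI subsetI)
      fix y assume "y \<in> \<sigma> ` (up \<inter> {1..x})"
      then obtain x' where x': "x' \<in> up" "1 \<le> x'" "x' \<le> x" "y = \<sigma> x'" by auto
      show "y \<in> (lf \<inter> {?m..n}) \<union> (- lf \<inter> {\<sigma> x..n})"
        using x' x lab_range[of x'] lab_left_up[of x'] lab_UR[of x' x] by (cases "x' = x") fastforce+
    next
      fix y assume y: "y \<in> (lf \<inter> {?m..n}) \<union> (- lf \<inter> {\<sigma> x..n})"
      then obtain x' where x': "1 \<le> x'" "x' \<le> n" "\<sigma> x' = y" using lab_surj[of y] lab_range[of x] x m1 by force
      have "x' \<in> up \<and> x' \<le> x"
      proof (cases "y \<in> lf")
        case True
        then have "x' \<in> up" using lab_left_up[of x'] x' y by auto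
        then show ?thesis using lab_UR[of x x'] lab_UL[of x x'] True x x' UR by (cases "x < x'") fastforce+
      next
        case False
        then have ge: "\<sigma> x \<le> \<sigma> x'" using y x' by auto
        have "x' \<le> x" using lab_UR[of x x'] ge x x' UR by (cases "x < x'") fastforce+
        moreover have "x' \<in> up" using lab_BR[of x' x] ge x x' UR False \<open>x' \<le> x\<close> by (cases "x' = x") fastforce+
        ultimately show ?thesis by simp
      qed
      then show "y \<in> \<sigma> ` (up \<inter> {1..x})" using x' by auto
    qed
    then have "card (up \<inter> {1..x}) = card ((lf \<inter> {?m..n}) \<union> (- lf \<inter> {\<sigma> x..n}))" by (metis lab_card)
    also have "\<dots> = cnt lf ?m n + cnt (- lf) (\<sigma> x) n" unfolding cnt_def by (rule card_Un_disjoint) auto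
    finally show ?thesis using UR lab_range[of x] x by (auto simp: decodes_def cnt_def)
  next
    case BL
    have "\<sigma> ` (- up \<inter> {1..x}) = lf \<inter> {\<sigma> x..?m - 1}"
    proof (intro equalityI subsetI)
      fix y assume "y \<in> \<sigma> ` (- up \<inter> {1..x})"
      then obtain x' where x': "x' \<notin> up" "1 \<le> x'" "x' \<le> x" "y = \<sigma> x'" by auto
      have "\<sigma> x' \<in> lf" using lab_BL[of x' x] lab_BR[of x' x] x x' BL by (cases "x' = x") fastforce+
      moreover have "\<sigma> x \<le> \<sigma> x'" using lab_BL[of x' x] x x' BL by (cases "x' = x") fastforce+
      moreover have "\<sigma> x' < ?m" using lab_left_up[of x'] x x' \<open>\<sigma> x' \<in> lf\<close> by auto
      ultimately show "y \<in> lf \<inter> {\<sigma> x..?m - 1}" using x' by auto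
    next
      fix y assume y: "y \<in> lf \<inter> {\<sigma> x..?m - 1}"
      then obtain x' where x': "1 \<le> x'" "x' \<le> n" "\<sigma> x' = y"
        using lab_surj[of y] lab_range[of x] lab_range[of 1] lab_n x m1 by force
      have "x' \<notin> up" using lab_left_up[of x'] x' y m1 by auto
      moreover have "x' \<le> x" using lab_BL[of x x'] x x' y \<open>x' \<notin> up\<close> by (cases "x < x'") auto
      ultimately show "y \<in> \<sigma> ` (- up \<inter> {1..x})" using x' by auto
    qed
    then have "cnt (- up) 1 x = cnt lf (\<sigma> x) (?m - 1)" unfolding cnt_def by (metis lab_card)
    then show ?thesis using BL lab_left_up[of x] lab_range[of x] x by (auto simp: decodes_def)
  next
    case BR
    have "\<sigma> ` (- up \<inter> {1..x}) = (lf \<inter> {1..?m - 1}) \<union> (- lf \<inter> {1..\<sigma> x})"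
    proof (intro equalityI subsetI)
      fix y assume "y \<in> \<sigma> ` (- up \<inter> {1..x})"
      then obtain x' where x': "x' \<notin> up" "1 \<le> x'" "x' \<le> x" "y = \<sigma> x'" by auto
      show "y \<in> (lf \<inter> {1..?m - 1}) \<union> (- lf \<inter> {1..\<sigma> x})"
        using x' x lab_range[of x'] lab_left_up[of x'] lab_BR[of x' x] by (cases "x' = x") fastforce+
    next
      fix y assume y: "y \<in> (lf \<inter> {1..?m - 1}) \<union> (- lf \<inter> {1..\<sigma> x})"
      then obtain x' where x': "1 \<le> x'" "x' \<le> n" "\<sigma> x' = y"
        using lab_surj[of y] lab_range[of x] lab_range[of 1] lab_n x m1 by force
      have "x' \<notin> up \<and> x' \<le> x"
      proof (cases "y \<in> lf")
        case True
        then have "x' \<notin> up" using lab_left_up[of x'] x' y m1 by auto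
        then show ?thesis using lab_BR[of x x'] lab_BL[of x x'] True x x' BR by (cases "x < x'") fastforce+
      next
        case False
        then have ge: "\<sigma> x' \<le> \<sigma> x" using y x' by auto
        have "x' \<le> x" using lab_BR[of x x'] ge x x' BR by (cases "x < x'") fastforce+
        moreover have "x' \<notin> up" using lab_UR[of x' x] ge x x' BR False \<open>x' \<le> x\<close> by (cases "x' = x") fastforce+
        ultimately show ?thesis by simp
      qed
      then show "y \<in> \<sigma> ` (- up \<inter> {1..x})" using x' by auto
    qed
    then have "card (- up \<inter> {1..x}) = card ((lf \<inter> {1..?m - 1}) \<union> (- lf \<inter> {1..\<sigma> x}))" by (metis lab_card)
    also have "\<dots> = cnt lf 1 (?m - 1) + cnt (- lf) 1 (\<sigma> x)" unfolding cnt_def by (rule card_Un_disjoint) auto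
    finally show ?thesis using BR lab_range[of x] x by (auto simp: decodes_def cnt_def)
  qed
qed

lemma card_le_of_maps: "(\<And>x. x \<in> S \<Longrightarrow> \<sigma> x \<in> T) \<Longrightarrow> finite T \<Longrightarrow> card S \<le> card T"
  using card_mono[of T "\<sigma> ` S"] lab_card[of S] by auto

text \<open>
  A record dominates all points before or behind it, so there must be enough rows for them. This
  keeps each chain on one side of the diagonal or of the antidiagonal.
\<close>

lemma lab_UL_diag: assumes "1 \<le> x" "x \<le> n" "x \<in> up" "\<sigma> x \<in> lf" shows "x \<le> \<sigma> x"
proof -
  have "\<sigma> z \<in> {1..\<sigma> x}" if "z \<in> {1..x}" for z
    using lab_UL[of z x] lab_range[of z] assms that by (cases "z = x") auto
  from card_le_of_maps[of "{1..x}", OF this] show ?thesis by simp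
qed

lemma lab_BL_anti: assumes "1 \<le> x" "x \<le> n" "x \<notin> up" "\<sigma> x \<in> lf" shows "x + \<sigma> x \<le> n + 1"
proof -
  have "\<sigma> z \<in> {\<sigma> x..n}" if "z \<in> {1..x}" for z
    using lab_BL[of z x] lab_range[of z] assms that by (cases "z = x") auto
  from card_le_of_maps[of "{1..x}", OF this] show ?thesis using lab_range[of x] assms by simp
qed

lemma lab_UR_anti: assumes "1 \<le> x" "x \<le> n" "x \<in> up" "\<sigma> x \<notin> lf" shows "n + 1 \<le> x + \<sigma> x"
proof -
  have "\<sigma> z \<in> {1..\<sigma> x}" if "z \<in> {x..n}" for z
    using lab_UR[of x z] lab_range[of z] assms that by (cases "z = x") auto
  from card_le_of_maps[of "{x..n}", OF this] show ?thesis by simp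
qed

lemma lab_BR_diag: assumes "1 \<le> x" "x \<le> n" "x \<notin> up" "\<sigma> x \<notin> lf" shows "\<sigma> x \<le> x"
proof -
  have "\<sigma> z \<in> {\<sigma> x..n}" if "z \<in> {x..n}" for z
    using lab_BR[of x z] lab_range[of z] assms that by (cases "z = x") auto
  from card_le_of_maps[of "{x..n}", OF this] show ?thesis using lab_range[of x] assms by simp
qed

lemma lab_diag_image: "lf \<inter> {\<sigma> 1..i} \<subseteq> \<sigma> ` (up \<inter> {1..i})" if "i \<le> n"
proof
  fix y assume y: "y \<in> lf \<inter> {\<sigma> 1..i}"
  then have "1 \<le> y" "y \<le> n" using lab_range[of 1] lab_n that by auto
  then obtain x where x: "1 \<le> x" "x \<le> n" "\<sigma> x = y" using lab_surj[of y] by blast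
  then have "x \<in> up" using lab_left_up[of x] y by auto
  then show "y \<in> \<sigma> ` (up \<inter> {1..i})" using lab_UL_diag[of x] x y by auto
qed

lemma lab_anti_image: "lf \<inter> {Suc n - i..\<sigma> 1 - 1} \<subseteq> \<sigma> ` (- up \<inter> {1..i})" if "i \<le> n"
proof
  fix y assume y: "y \<in> lf \<inter> {Suc n - i..\<sigma> 1 - 1}"
  have "1 \<le> \<sigma> 1" "\<sigma> 1 \<le> n" using lab_range[of 1] lab_n by auto
  then have "1 \<le> y" "y \<le> n" using y that by auto
  then obtain x where x: "1 \<le> x" "x \<le> n" "\<sigma> x = y" using lab_surj[of y] by blast
  then have "x \<notin> up" using lab_left_up[of x] y \<open>1 \<le> \<sigma> 1\<close> by auto
  then show "y \<in> \<sigma> ` (- up \<inter> {1..i})" using lab_BL_anti[of x] x y by auto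
qed

lemma lab_diag_height: assumes "i \<le> n" shows "0 \<le> diag_height (\<sigma> 1) up lf i"
proof -
  have "card (lf \<inter> {\<sigma> 1..i}) \<le> card (\<sigma> ` (up \<inter> {1..i}))"
    by (rule card_mono) (use lab_diag_image assms in auto)
  then show ?thesis by (simp add: diag_height_def cnt_def lab_card)
qed

lemma anti_height_eq:
  assumes "i \<le> n"
  shows "anti_height n (\<sigma> 1) up lf i =
    int (cnt (- up) 1 i) - int (cnt lf (Suc n - i) (\<sigma> 1 - 1)) + (if n < \<sigma> 1 + i then 0 else 1)"
proof (cases "n < \<sigma> 1 + i")
  case True
  moreover have "1 \<le> \<sigma> 1" using lab_range[of 1] lab_n by simp
  ultimately show ?thesis using cnt_Suc[of "Suc n - i" "\<sigma> 1 - 1" lf] lab_lf by (simp add: anti_height_def)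
next
  case False
  then show ?thesis using cnt_empty[of "\<sigma> 1" "Suc n - i" lf] cnt_empty[of "\<sigma> 1 - 1" "Suc n - i" lf]
    by (simp add: anti_height_def)
qed

text \<open>
  If the height vanishes then the points of the upper columns up to \<open>k\<close> are the UL points in the
  rows up to \<open>k\<close>. The lower columns add BR points, which lie below the diagonal, and BL points,
  which lie below the first point. Conversely, a UR point within a diagonal block would have to be
  above the points behind the block.
\<close>

lemma lab_diag_zero:
  assumes k: "1 \<le> k" "k < n"
  shows "diag_height (\<sigma> 1) up lf k = 0 \<longleftrightarrow> \<sigma> ` {1..k} = {1..k}"
proof
  assume "diag_height (\<sigma> 1) up lf k = 0"
  then have "card (lf \<inter> {\<sigma> 1..k}) = card (\<sigma> ` (up \<inter> {1..k}))" by (simp add: diag_height_def cnt_def lab_card)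
  then have eq: "lf \<inter> {\<sigma> 1..k} = \<sigma> ` (up \<inter> {1..k})"
    by (intro card_subset_eq) (use lab_diag_image k in auto)
  have m: "\<sigma> 1 \<le> k" using eq lab_up k by (auto simp: set_eq_iff)
  have "\<sigma> ` {1..k} \<subseteq> {1..k}"
  proof
    fix y assume "y \<in> \<sigma> ` {1..k}"
    then obtain x where x: "1 \<le> x" "x \<le> k" "y = \<sigma> x" by auto
    have "y \<le> k"
    proof (cases "x \<in> up")
      case True then show ?thesis using eq x by auto
    next
      case False then show ?thesis using lab_left_up[of x] lab_BR_diag[of x] x k m by (cases "\<sigma> x \<in> lf") auto
    qed
    then show "y \<in> {1..k}" using x lab_range[of x] k by auto
  qed
  then show "\<sigma> ` {1..k} = {1..k}" by (intro card_subset_eq) (auto simp: lab_card)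
next
  assume im: "\<sigma> ` {1..k} = {1..k}"
  have "\<sigma> ` (up \<inter> {1..k}) \<subseteq> lf \<inter> {\<sigma> 1..k}"
  proof
    fix y assume "y \<in> \<sigma> ` (up \<inter> {1..k})"
    then obtain x where x: "1 \<le> x" "x \<le> k" "y = \<sigma> x" "x \<in> up" by auto
    then have yk: "y \<le> k" using im by auto
    have "\<sigma> n > k"
    proof (rule ccontr)
      assume "\<not> \<sigma> n > k"
      then have "\<sigma> n \<in> \<sigma> ` {1..k}" using im lab_range[of n] lab_n by auto
      then show False using lab_inj k by force
    qed
    then have "y \<in> lf" using lab_UR[of x n] x k yk by fastforce
    then show "y \<in> lf \<inter> {\<sigma> 1..k}" using lab_left_up[of x] x k yk by auto
  qed
  then have "\<sigma> ` (up \<inter> {1..k}) = lf \<inter> {\<sigma> 1..k}" using lab_diag_image[of k] k by auto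
  then have "card (up \<inter> {1..k}) = card (lf \<inter> {\<sigma> 1..k})" by (metis lab_card)
  then show "diag_height (\<sigma> 1) up lf k = 0" by (simp add: diag_height_def cnt_def)
qed

text \<open>
  Again all points in the first \<open>k\<close> columns are confined to the block. That the summand \<open>1\<close> in the
  height is compensated means that the row of the first point belongs to the block.
\<close>

lemma lab_anti_zero:
  assumes k: "1 \<le> k" "k < n"
  shows "anti_height n (\<sigma> 1) up lf k = 0 \<longleftrightarrow> \<sigma> ` {1..k} = {Suc n - k..n}"
proof
  have m: "1 \<le> \<sigma> 1" "\<sigma> 1 \<le> n" using lab_range[of 1] lab_n by auto
  have le: "card (lf \<inter> {Suc n - k..\<sigma> 1 - 1}) \<le> card (\<sigma> ` (- up \<inter> {1..k}))"
    by (rule card_mono) (use lab_anti_image k in auto)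
  assume "anti_height n (\<sigma> 1) up lf k = 0"
  with le have mk: "n < \<sigma> 1 + k" and c: "card (lf \<inter> {Suc n - k..\<sigma> 1 - 1}) = card (\<sigma> ` (- up \<inter> {1..k}))"
    using k by (auto simp: anti_height_eq[OF less_imp_le, OF k(2), unfolded One_nat_def] cnt_def lab_card split:
        if_splits)
  have eq: "lf \<inter> {Suc n - k..\<sigma> 1 - 1} = \<sigma> ` (- up \<inter> {1..k})"
    by (intro card_subset_eq) (use lab_anti_image k c in auto)
  have "\<sigma> ` {1..k} \<subseteq> {Suc n - k..n}"
  proof
    fix y assume "y \<in> \<sigma> ` {1..k}"
    then obtain x where x: "1 \<le> x" "x \<le> k" "y = \<sigma> x" by auto
    have "Suc n - k \<le> y"
    proof (cases "x \<in> up")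
      case False then show ?thesis using eq x by auto
    next
      case True then show ?thesis using lab_left_up[of x] lab_UR_anti[of x] x k mk by (cases "\<sigma> x \<in> lf") auto
    qed
    then show "y \<in> {Suc n - k..n}" using x lab_range[of x] k by auto
  qed
  then show "\<sigma> ` {1..k} = {Suc n - k..n}" by (intro card_subset_eq) (use k in \<open>auto simp: lab_card\<close>)
next
  assume im: "\<sigma> ` {1..k} = {Suc n - k..n}"
  have m: "1 \<le> \<sigma> 1" "\<sigma> 1 \<le> n" using lab_range[of 1] lab_n by auto
  have "\<sigma> 1 \<in> {Suc n - k..n}" using im k by auto
  then have mk: "n < \<sigma> 1 + k" by auto
  have "\<sigma> ` (- up \<inter> {1..k}) \<subseteq> lf \<inter> {Suc n - k..\<sigma> 1 - 1}"
  proof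
    fix y assume "y \<in> \<sigma> ` (- up \<inter> {1..k})"
    then obtain x where x: "1 \<le> x" "x \<le> k" "y = \<sigma> x" "x \<notin> up" by auto
    then have yk: "Suc n - k \<le> y" using im by auto
    have "\<sigma> n < Suc n - k"
    proof (rule ccontr)
      assume "\<not> \<sigma> n < Suc n - k"
      then have "\<sigma> n \<in> \<sigma> ` {1..k}" using im lab_range[of n] lab_n by auto
      then show False using lab_inj k by force
    qed
    then have "y \<in> lf" using lab_BR[of x n] x k yk by fastforce
    then show "y \<in> lf \<inter> {Suc n - k..\<sigma> 1 - 1}" using lab_left_up[of x] x k yk by auto
  qed
  then have "\<sigma> ` (- up \<inter> {1..k}) = lf \<inter> {Suc n - k..\<sigma> 1 - 1}" using lab_anti_image[of k] k by auto
  then have "card (- up \<inter> {1..k}) = card (lf \<inter> {Suc n - k..\<sigma> 1 - 1})" by (metis lab_card)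
  then show "anti_height n (\<sigma> 1) up lf k = 0" unfolding anti_height_eq[OF less_imp_le, OF k(2)] using mk
      by (simp add: cnt_def)
qed

end

lemma labelling_unique:
  assumes "sq_labelling n \<sigma> up lf" "sq_labelling n \<tau> up lf" "\<sigma> 1 = \<tau> 1"
  shows "\<sigma> = \<tau>"
proof
  fix x show "\<sigma> x = \<tau> x"
  proof (cases "x \<in> {1..n}")
    case True
    then show ?thesis
      using decodes_unique[of n "\<sigma> 1" up lf x "\<sigma> x" "\<tau> x"] lab_decodes[OF assms(1)] lab_decodes[OF assms(2)] assms(3)
      by auto
  next
    case False
    then show ?thesis using lab_perm[OF assms(1)] lab_perm[OF assms(2)] by (metis permutes_not_in)
  qed
qed

text \<open>
  Every column obtains a row because the numbers of labels match. Two points of the same chain, or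
  of two chains that share the upper, lower or left label, are in the right position by counting.
  Points on opposite chains are separated by the diagonal or by the antidiagonal, on the correct
  side of which they lie as the heights are nonnegative. Two points on the right chains are compared
  by the total number of right rows.
\<close>

lemma labelling_exists:
  assumes n: "2 \<le> n" and m: "1 \<le> m" "m \<le> n" and mem: "1 \<in> up" "1 \<in> lf" "n \<in> lf" "m \<in> lf"
    and dh: "\<And>i. 1 \<le> i \<Longrightarrow> i \<le> n \<Longrightarrow> 0 \<le> diag_height m up lf i"
    and ah: "\<And>i. 1 \<le> i \<Longrightarrow> i \<le> n \<Longrightarrow> 0 \<le> anti_height n m up lf i"
  shows "\<exists>\<sigma>. sq_labelling n \<sigma> up lf \<and> \<sigma> 1 = m"
proof -
  define p where "p = cnt lf m n"
  define q where "q = cnt lf 1 (m - 1)"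
  have lf: "cnt lf 1 n = p + q" using cnt_split[of 1 "m - 1" n lf] m by (simp add: p_def q_def)
  have rt: "cnt (- lf) 1 n + p + q = n" using cnt_compl[of lf 1 n] lf by simp
  have upn: "cnt up 1 n + cnt (- up) 1 n = n" using cnt_compl[of up 1 n] by simp
  have p: "p \<le> cnt up 1 n" using dh[of n] n by (simp add: diag_height_def p_def)
  have q: "q \<le> cnt (- up) 1 n"
    using ah[of n] n cnt_Suc[of 1 "m - 1" lf] m mem by (simp add: anti_height_def q_def)
  have ex: "\<exists>y. decodes n m up lf x y" if x: "1 \<le> x" "x \<le> n" for x
  proof (cases "x \<in> up")
    case True
    have t: "1 \<le> cnt up 1 x" "cnt up 1 x \<le> cnt up 1 n" using cnt_pos[of x up 1 x] cnt_mono[of 1 1 x n up] True x by auto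
    show ?thesis
    proof (cases "cnt up 1 x \<le> p")
      case True
      then obtain y where "y \<in> lf" "m \<le> y" "y \<le> n" "cnt lf m y = cnt up 1 x" using ex_cnt_left[of "cnt up 1 x" lf m n] t
          by (auto simp: p_def)
      then show ?thesis using \<open>x \<in> up\<close> m by (auto simp: decodes_def intro!: exI[of _ y])
    next
      case False
      then have b: "1 \<le> cnt up 1 x - p \<and> cnt up 1 x - p \<le> cnt (- lf) 1 n" using t rt upn q by linarith
      then obtain y where "y \<in> - lf" "1 \<le> y" "y \<le> n" "cnt (- lf) y n = cnt up 1 x - p"
        using ex_cnt_right[of "cnt up 1 x - p" "- lf" 1 n] b by blast
      then show ?thesis using \<open>x \<in> up\<close> m False by (auto simp: decodes_def p_def intro!: exI[of _ y])
    qed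
  next
    case False
    have t: "1 \<le> cnt (- up) 1 x" "cnt (- up) 1 x \<le> cnt (- up) 1 n"
      using cnt_pos[of x "- up" 1 x] cnt_mono[of 1 1 x n "- up"] False x by auto
    show ?thesis
    proof (cases "cnt (- up) 1 x \<le> q")
      case True
      then obtain y where "y \<in> lf" "1 \<le> y" "y \<le> m - 1" "cnt lf y (m - 1) = cnt (- up) 1 x"
        using ex_cnt_right[of "cnt (- up) 1 x" lf 1 "m - 1"] t by (auto simp: q_def)
      then show ?thesis using \<open>x \<notin> up\<close> m by (auto simp: decodes_def intro!: exI[of _ y])
    next
      case False
      then have b: "1 \<le> cnt (- up) 1 x - q \<and> cnt (- up) 1 x - q \<le> cnt (- lf) 1 n" using t rt upn p by linarith
      then obtain y where "y \<in> - lf" "1 \<le> y" "y \<le> n" "cnt (- lf) 1 y = cnt (- up) 1 x - q"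
        using ex_cnt_left[of "cnt (- up) 1 x - q" "- lf" 1 n] b by blast
      then show ?thesis using \<open>x \<notin> up\<close> m False by (auto simp: decodes_def q_def intro!: exI[of _ y])
    qed
  qed
  define \<sigma> where "\<sigma> x = (if 1 \<le> x \<and> x \<le> n then SOME y. decodes n m up lf x y else x)" for x
  have dec: "decodes n m up lf x (\<sigma> x)" if "1 \<le> x" "x \<le> n" for x
    using someI_ex[OF ex[OF that]] that by (simp add: \<sigma>_def)
  have rng: "1 \<le> \<sigma> x" "\<sigma> x \<le> n" if "1 \<le> x" "x \<le> n" for x using dec[OF that] by (auto simp: decodes_def)
  have UL: "m \<le> \<sigma> x" "cnt up 1 x = cnt lf m (\<sigma> x)" if "1 \<le> x" "x \<le> n" "x \<in> up" "\<sigma> x \<in> lf" for x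
    using dec[of x] that by (auto simp: decodes_def)
  have UR: "cnt up 1 x = p + cnt (- lf) (\<sigma> x) n" if "1 \<le> x" "x \<le> n" "x \<in> up" "\<sigma> x \<notin> lf" for x
    using dec[of x] that by (auto simp: decodes_def p_def)
  have BL: "\<sigma> x < m" "cnt (- up) 1 x = cnt lf (\<sigma> x) (m - 1)" if "1 \<le> x" "x \<le> n" "x \<notin> up" "\<sigma> x \<in> lf" for x
    using dec[of x] that by (auto simp: decodes_def)
  have BR: "cnt (- up) 1 x = q + cnt (- lf) 1 (\<sigma> x)" if "1 \<le> x" "x \<le> n" "x \<notin> up" "\<sigma> x \<notin> lf" for x
    using dec[of x] that by (auto simp: decodes_def q_def)
  have less_up: "cnt up 1 x < cnt up 1 y" if "1 \<le> x" "x < y" "y \<in> up" for x y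
    using cnt_strict_left[of y up 1 x] that by auto
  have less_dn: "cnt (- up) 1 x < cnt (- up) 1 y" if "1 \<le> x" "x < y" "y \<notin> up" for x y
    using cnt_strict_left[of y "- up" 1 x] that by auto
  \<comment> \<open>A point of the UL chain below the diagonal would make the diagonal height negative one column
    earlier. The other three chains are located alike.\<close>
  have UL_diag: "x \<le> \<sigma> x" if x: "1 \<le> x" "x \<le> n" "x \<in> up" "\<sigma> x \<in> lf" for x
  proof (rule ccontr)
    assume "\<not> x \<le> \<sigma> x"
    then have lt: "\<sigma> x \<le> x - 1" and x2: "1 \<le> x - 1" using rng[of x] x by auto
    have "cnt lf m (\<sigma> x) \<le> cnt lf m (x - 1)" using lt by (intro cnt_mono) auto
    moreover have "cnt lf m (x - 1) \<le> cnt up 1 (x - 1)" using dh[of "x - 1"] x2 x by (simp add: diag_height_def)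
    ultimately show False using UL[of x] less_up[of "x - 1" x] x x2 by simp
  qed
  have BR_diag: "\<sigma> x \<le> x" if x: "1 \<le> x" "x \<le> n" "x \<notin> up" "\<sigma> x \<notin> lf" for x
  proof (rule ccontr)
    assume "\<not> \<sigma> x \<le> x"
    then have lt: "x < \<sigma> x" by simp
    have 1: "cnt lf m x \<le> cnt up 1 x" using dh[of x] x by (simp add: diag_height_def)
    have 2: "cnt up 1 x + cnt (- up) 1 x = x" using cnt_compl[of up 1 x] by simp
    have 3: "cnt lf 1 x + cnt (- lf) 1 x = x" using cnt_compl[of lf 1 x] by simp
    have 4: "cnt lf 1 x \<le> q + cnt lf m x"
    proof (cases "m \<le> x")
      case True then show ?thesis using cnt_split[of 1 "m - 1" x lf] m by (simp add: q_def)
    next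
      case False
      then have "x \<le> m - 1" by simp
      then have "cnt lf 1 x \<le> q" unfolding q_def by (intro cnt_mono) auto
      then show ?thesis by simp
    qed
    have 5: "cnt (- lf) 1 x < cnt (- lf) 1 (\<sigma> x)" using cnt_strict_left[of "\<sigma> x" "- lf" 1 x] x lt by simp
    show False using 1 2 3 4 5 BR[of x] x by simp
  qed
  have BL_anti: "x + \<sigma> x \<le> n + 1" if x: "1 \<le> x" "x \<le> n" "x \<notin> up" "\<sigma> x \<in> lf" for x
  proof (rule ccontr)
    assume "\<not> x + \<sigma> x \<le> n + 1"
    then have lt: "Suc n - (x - 1) \<le> \<sigma> x" using x by simp
    have "x \<noteq> 1" using x mem by auto
    then have x2: "1 \<le> x - 1" using x by simp
    have "cnt lf (\<sigma> x) m \<le> cnt lf (Suc n - (x - 1)) m" using lt by (intro cnt_mono) auto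
    moreover have "cnt lf (\<sigma> x) m = cnt lf (\<sigma> x) (m - 1) + 1"
      using cnt_Suc[of "\<sigma> x" "m - 1" lf] m mem BL[of x] x by simp
    moreover have "cnt lf (Suc n - (x - 1)) m \<le> cnt (- up) 1 (x - 1) + 1"
      using ah[OF x2 le_trans[OF diff_le_self x(2)]] x by (simp add: anti_height_def)
    ultimately show False using BL[of x] less_dn[of "x - 1" x] x x2 by simp
  qed
  have UR_anti: "n + 1 \<le> x + \<sigma> x" if x: "1 \<le> x" "x \<le> n" "x \<in> up" "\<sigma> x \<notin> lf" for x
  proof (rule ccontr)
    assume "\<not> n + 1 \<le> x + \<sigma> x"
    then have lt: "\<sigma> x < Suc n - x" by simp
    have 1: "cnt lf (Suc n - x) m \<le> cnt (- up) 1 x + 1" using ah[of x] x by (simp add: anti_height_def)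
    have 2: "cnt up 1 x + cnt (- up) 1 x = x" using cnt_compl[of up 1 x] by simp
    have 3: "cnt lf (Suc n - x) n + cnt (- lf) (Suc n - x) n = x" using cnt_compl[of lf "Suc n - x" n] x by simp
    have 4: "cnt lf (Suc n - x) n + 1 \<le> cnt lf (Suc n - x) m + p"
    proof (cases "Suc n - x \<le> m")
      case True
      then show ?thesis using cnt_split[of "Suc n - x" m n lf] m mem cnt_Suc_left[of m n lf] by (simp add: p_def)
    next
      case False
      then show ?thesis using cnt_strict_right[of m lf n "Suc n - x"] mem m by (simp add: p_def)
    qed
    have 5: "cnt (- lf) (Suc n - x) n < cnt (- lf) (\<sigma> x) n"
      using cnt_strict_right[of "\<sigma> x" "- lf" n "Suc n - x"] x lt rng[of x] by simp
    show False using 1 2 3 4 5 UR[of x] x by simp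
  qed
  have key: "(y \<in> up \<longrightarrow> \<sigma> y \<in> lf \<longrightarrow> \<sigma> x < \<sigma> y) \<and> (y \<notin> up \<longrightarrow> \<sigma> y \<in> lf \<longrightarrow> \<sigma> y < \<sigma> x) \<and>
        (x \<in> up \<longrightarrow> \<sigma> x \<notin> lf \<longrightarrow> \<sigma> y < \<sigma> x) \<and> (x \<notin> up \<longrightarrow> \<sigma> x \<notin> lf \<longrightarrow> \<sigma> x < \<sigma> y)"
    if xy: "1 \<le> x" "x < y" "y \<le> n" for x y
  proof (intro conjI impI)
    have x: "1 \<le> x" "x \<le> n" and y: "1 \<le> y" "y \<le> n" using xy by auto
    have mono_l: "cnt S a v \<le> cnt S a u" if "v \<le> u" for S a u v using that by (intro cnt_mono) auto
    have mono_r: "cnt S u b \<le> cnt S v b" if "v \<le> u" for S b u v using that by (intro cnt_mono) auto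
    { assume c: "y \<in> up" "\<sigma> y \<in> lf"
      show "\<sigma> x < \<sigma> y"
      proof (cases "x \<in> up"; cases "\<sigma> x \<in> lf")
        assume "x \<in> up" "\<sigma> x \<in> lf"
        then show ?thesis using UL[OF x] UL[OF y] c less_up[of x y] xy mono_l[of "\<sigma> y" "\<sigma> x" lf m]
            by (cases "\<sigma> y \<le> \<sigma> x") simp_all
      next
        assume "x \<in> up" "\<sigma> x \<notin> lf"
        then show ?thesis using UR[OF x] UL[OF y] c less_up[of x y] xy mono_l[of "\<sigma> y" n lf m] rng[OF y]
            by (simp add: p_def)
      next
        assume "x \<notin> up" "\<sigma> x \<in> lf"
        then show ?thesis using BL[OF x] UL[OF y] c by simp
      next
        assume "x \<notin> up" "\<sigma> x \<notin> lf"
        then show ?thesis using BR_diag[OF x] UL_diag[OF y] c xy by simp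
      qed }
    { assume c: "y \<notin> up" "\<sigma> y \<in> lf"
      show "\<sigma> y < \<sigma> x"
      proof (cases "x \<in> up"; cases "\<sigma> x \<in> lf")
        assume "x \<notin> up" "\<sigma> x \<in> lf"
        then show ?thesis using BL[OF x] BL[OF y] c less_dn[of x y] xy mono_r[of "\<sigma> x" "\<sigma> y" lf "m - 1"]
            by (cases "\<sigma> x \<le> \<sigma> y") simp_all
      next
        assume "x \<notin> up" "\<sigma> x \<notin> lf"
        then show ?thesis using BR[OF x] BL[OF y] c less_dn[of x y] xy mono_r[of 1 "\<sigma> y" lf "m - 1"] rng[OF y]
            by (simp add: q_def)
      next
        assume "x \<in> up" "\<sigma> x \<in> lf"
        then show ?thesis using UL[OF x] BL[OF y] c by simp
      next
        assume "x \<in> up" "\<sigma> x \<notin> lf"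
        then show ?thesis using UR_anti[OF x] BL_anti[OF y] c xy by simp
      qed }
    { assume c: "x \<in> up" "\<sigma> x \<notin> lf"
      show "\<sigma> y < \<sigma> x"
      proof (cases "y \<in> up"; cases "\<sigma> y \<in> lf")
        assume "y \<in> up" "\<sigma> y \<in> lf"
        then show ?thesis using UR[OF x] UL[OF y] c less_up[of x y] xy mono_l[of "\<sigma> y" n lf m] rng[OF y]
            by (simp add: p_def)
      next
        assume "y \<in> up" "\<sigma> y \<notin> lf"
        then show ?thesis using UR[OF x] UR[OF y] c less_up[of x y] xy mono_r[of "\<sigma> x" "\<sigma> y" "- lf" n]
            by (cases "\<sigma> x \<le> \<sigma> y") simp_all
      next
        assume "y \<notin> up" "\<sigma> y \<in> lf"
        then show ?thesis using UR_anti[OF x] BL_anti[OF y] c xy by simp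
      next
        assume d: "y \<notin> up" "\<sigma> y \<notin> lf"
        have 0: "cnt up 1 x + cnt (- up) 1 y \<le> n"
          using upn mono_l[of x n up 1] mono_l[of y n "- up" 1] x y by simp
        show ?thesis
        proof (rule ccontr)
          assume "\<not> \<sigma> y < \<sigma> x"
          then have le: "\<sigma> x \<le> \<sigma> y" by simp
          have "cnt (- lf) 1 (\<sigma> x - 1) + cnt (- lf) (\<sigma> x) n = cnt (- lf) 1 n"
            using cnt_split[of 1 "\<sigma> x - 1" n "- lf"] rng[OF x] by simp
          moreover have "cnt (- lf) 1 (\<sigma> x - 1) < cnt (- lf) 1 (\<sigma> y)"
            using cnt_strict_left[of "\<sigma> y" "- lf" 1 "\<sigma> x - 1"] d rng[OF x] rng[OF y] le by simp
          ultimately show False using 0 UR[OF x] BR[OF y] c d rt by simp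
        qed
      qed }
    { assume c: "x \<notin> up" "\<sigma> x \<notin> lf"
      show "\<sigma> x < \<sigma> y"
      proof (cases "y \<in> up"; cases "\<sigma> y \<in> lf")
        assume "y \<notin> up" "\<sigma> y \<in> lf"
        then show ?thesis using BR[OF x] BL[OF y] c less_dn[of x y] xy mono_r[of 1 "\<sigma> y" lf "m - 1"] rng[OF y]
            by (simp add: q_def)
      next
        assume "y \<notin> up" "\<sigma> y \<notin> lf"
        then show ?thesis using BR[OF x] BR[OF y] c less_dn[of x y] xy mono_l[of "\<sigma> y" "\<sigma> x" "- lf" 1]
            by (cases "\<sigma> y \<le> \<sigma> x") simp_all
      next
        assume "y \<in> up" "\<sigma> y \<in> lf"
        then show ?thesis using BR_diag[OF x] UL_diag[OF y] c xy by simp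
      next
        assume d: "y \<in> up" "\<sigma> y \<notin> lf"
        have 0: "cnt up 1 y + cnt (- up) 1 x \<le> n"
          using upn mono_l[of y n up 1] mono_l[of x n "- up" 1] x y by simp
        show ?thesis
        proof (rule ccontr)
          assume "\<not> \<sigma> x < \<sigma> y"
          then have le: "\<sigma> y \<le> \<sigma> x" by simp
          have "cnt (- lf) 1 (\<sigma> y - 1) + cnt (- lf) (\<sigma> y) n = cnt (- lf) 1 n"
            using cnt_split[of 1 "\<sigma> y - 1" n "- lf"] rng[OF y] by simp
          moreover have "cnt (- lf) 1 (\<sigma> y - 1) < cnt (- lf) 1 (\<sigma> x)"
            using cnt_strict_left[of "\<sigma> x" "- lf" 1 "\<sigma> y - 1"] c rng[OF x] rng[OF y] le by simp
          ultimately show False using 0 UR[OF y] BR[OF x] c d rt by simp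
        qed
      qed }
  qed
  have inj: "inj_on \<sigma> {1..n}"
  proof (rule inj_onI)
    fix x y assume xy: "x \<in> {1..n}" "y \<in> {1..n}" "\<sigma> x = \<sigma> y"
    have "\<not> u < v" if "1 \<le> u" "u \<le> n" "1 \<le> v" "v \<le> n" "\<sigma> u = \<sigma> v" for u v
      using key[of u v] that by (metis less_irrefl)
    then show "x = y" using xy by (metis atLeastAtMost_iff linorder_neqE_nat)
  qed
  moreover have "\<sigma> ` {1..n} \<subseteq> {1..n}" using rng by auto
  ultimately have "bij_betw \<sigma> {1..n} {1..n}" using endo_inj_surj[of "{1..n}" \<sigma>] by (simp add: bij_betw_def)
  then have perm: "\<sigma> permutes {1..n}" by (rule bij_imp_permutes) (auto simp: \<sigma>_def)
  have "decodes n m up lf 1 m" using mem m cnt_self[of up 1] cnt_self[of lf m] by (simp add: decodes_def)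
  then have s1: "\<sigma> 1 = m" using decodes_unique[of n m up lf 1 m "\<sigma> 1"] dec[of 1] n by simp
  show ?thesis unfolding sq_labelling_def using perm n mem s1 key by (intro exI[of _ \<sigma>]) auto
qed

text \<open>
  For permutations this says that there cannot be blocks on both diagonals. Here the labels are
  arbitrary and the reason is a count: a small antidiagonal height requires many left rows up to
  \<open>m\<close>, a small diagonal height many left rows from \<open>m\<close> on, and there is no room for both.
\<close>

lemma diag_pos_of_anti_nonpos:
  assumes m: "1 \<le> m" "m \<le> n" and mem: "1 \<in> up" "n \<in> lf"
    and k: "1 \<le> k" "k < n" "anti_height n m up lf k \<le> 0" and i: "1 \<le> i" "i < n"
  shows "1 \<le> diag_height m up lf i"
proof (rule ccontr)
  assume "\<not> ?thesis"
  then have h: "cnt up 1 i \<le> cnt lf m i" by (simp add: diag_height_def)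
  have g: "cnt (- up) 1 k + 1 \<le> cnt lf (Suc n - k) m" using k by (simp add: anti_height_def)
  then have km: "Suc n - k \<le> m" using cnt_empty[of m "Suc n - k" lf] by (cases "m < Suc n - k") simp_all
  show False
  proof (cases "k \<le> i")
    case True
    \<comment> \<open>The \<open>k\<close> rows from \<open>n + 1 - k\<close> on would contain at least \<open>k + 1\<close> left rows.\<close>
    have 1: "cnt up 1 k \<le> cnt up 1 i" using True by (intro cnt_mono) auto
    have 2: "cnt up 1 k + cnt (- up) 1 k = k" using cnt_compl[of up 1 k] by simp
    have 3: "cnt lf (Suc n - k) n = cnt lf (Suc n - k) m + cnt lf (Suc m) n" using cnt_split[of "Suc n - k" m n lf] km m
        by simp
    have 4: "cnt lf (Suc n - k) n \<le> k" using cnt_le[of lf "Suc n - k" n] k by simp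
    have 5: "cnt lf m i < cnt lf m n" using cnt_strict_left[of n lf m i] mem m i by simp
    have 6: "cnt lf m n \<le> 1 + cnt lf (Suc m) n" using cnt_Suc_left[of m n lf] m by simp
    show False using 1 2 3 4 5 6 h g by linarith
  next
    case False
    have m2: "2 \<le> m" using km k by simp
    have "1 \<le> cnt up 1 i" using cnt_pos[of 1 up 1 i] mem i by simp
    then have mi: "m \<le> i" using h cnt_empty[of i m lf] by (cases "i < m") simp_all
    \<comment> \<open>Of the first \<open>i\<close> columns at most \<open>i + 1 - m\<close> would be upper and at most \<open>m - 2\<close> lower.\<close>
    have 1: "cnt (- up) 1 i \<le> cnt (- up) 1 k" using False by (intro cnt_mono) auto
    have 2: "cnt up 1 i + cnt (- up) 1 i = i" using cnt_compl[of up 1 i] by simp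
    have 3: "cnt lf m i + m \<le> Suc i" using cnt_le[of lf m i] mi by linarith
    have 5: "cnt lf (Suc n - k) (m - 1) \<le> cnt lf 2 (m - 1)" using k by (intro cnt_mono) auto
    have 6: "cnt lf (Suc n - k) m \<le> cnt lf (Suc n - k) (m - 1) + 1" using cnt_Suc[of "Suc n - k" "m - 1" lf] km m
        by simp
    have 7: "cnt lf 2 (m - 1) + 2 \<le> m" using cnt_le[of lf 2 "m - 1"] m2 by simp
    show False using 1 2 3 5 6 7 h g by linarith
  qed
qed

section \<open>Records of permutations\<close>

definition ulr :: "(nat \<Rightarrow> nat) \<Rightarrow> nat \<Rightarrow> bool" where
  "ulr \<sigma> x \<longleftrightarrow> (\<forall>z. 1 \<le> z \<longrightarrow> z < x \<longrightarrow> \<sigma> z < \<sigma> x)"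

definition blr :: "(nat \<Rightarrow> nat) \<Rightarrow> nat \<Rightarrow> bool" where
  "blr \<sigma> x \<longleftrightarrow> (\<forall>z. 1 \<le> z \<longrightarrow> z < x \<longrightarrow> \<sigma> x < \<sigma> z)"

definition urr :: "nat \<Rightarrow> (nat \<Rightarrow> nat) \<Rightarrow> nat \<Rightarrow> bool" where
  "urr n \<sigma> x \<longleftrightarrow> (\<forall>z. x < z \<longrightarrow> z \<le> n \<longrightarrow> \<sigma> z < \<sigma> x)"

definition brr :: "nat \<Rightarrow> (nat \<Rightarrow> nat) \<Rightarrow> nat \<Rightarrow> bool" where
  "brr n \<sigma> x \<longleftrightarrow> (\<forall>z. x < z \<longrightarrow> z \<le> n \<longrightarrow> \<sigma> x < \<sigma> z)"

lemma perm_inj: "\<sigma> permutes S \<Longrightarrow> \<sigma> x = \<sigma> y \<Longrightarrow> x = y"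
  using permutes_inj by (auto dest: injD)

lemma perm_range: "\<sigma> permutes {1..n::nat} \<Longrightarrow> 1 \<le> x \<Longrightarrow> x \<le> n \<Longrightarrow> 1 \<le> \<sigma> x \<and> \<sigma> x \<le> n"
  using permutes_in_image[of \<sigma> "{1..n}" x] by auto

lemma perm_ex: "\<sigma> permutes {1..n::nat} \<Longrightarrow> 1 \<le> y \<Longrightarrow> y \<le> n \<Longrightarrow> \<exists>x. 1 \<le> x \<and> x \<le> n \<and> \<sigma> x = y"
  using permutes_image[of \<sigma> "{1..n}"] by (metis atLeastAtMost_iff imageE)

lemma inj_less: "(\<sigma> :: nat \<Rightarrow> nat) permutes S \<Longrightarrow> x \<noteq> y \<Longrightarrow> \<not> \<sigma> y < \<sigma> x \<longleftrightarrow> \<sigma> x < \<sigma> y"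
  using perm_inj[of \<sigma> S x y] by (meson less_asym linorder_neqE_nat)

lemma UL_records_points:
  assumes "\<sigma> permutes {1..n}"
  shows "(x, y) \<in> UL_records (points n \<sigma>) \<longleftrightarrow> 1 \<le> x \<and> x \<le> n \<and> y = \<sigma> x \<and> ulr \<sigma> x"
proof -
  have "(x, y) \<in> UL_records (points n \<sigma>) \<longleftrightarrow> 1 \<le> x \<and> x \<le> n \<and> y = \<sigma> x \<and> (\<forall>z. 1 \<le> z \<longrightarrow> z < x \<longrightarrow> \<not> \<sigma> x < \<sigma> z)"
    by (fastforce simp: UL_records_def points_def)
  then show ?thesis using inj_less[OF assms] by (auto simp: ulr_def)
qed

lemma BL_records_points:
  assumes "\<sigma> permutes {1..n}"
  shows "(x, y) \<in> BL_records (points n \<sigma>) \<longleftrightarrow> 1 \<le> x \<and> x \<le> n \<and> y = \<sigma> x \<and> blr \<sigma> x"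
proof -
  have "(x, y) \<in> BL_records (points n \<sigma>) \<longleftrightarrow> 1 \<le> x \<and> x \<le> n \<and> y = \<sigma> x \<and> (\<forall>z. 1 \<le> z \<longrightarrow> z < x \<longrightarrow> \<not> \<sigma> z < \<sigma> x)"
    by (fastforce simp: BL_records_def points_def)
  then show ?thesis using inj_less[OF assms] by (auto simp: blr_def)
qed

lemma UR_records_points:
  assumes "\<sigma> permutes {1..n}"
  shows "(x, y) \<in> UR_records (points n \<sigma>) \<longleftrightarrow> 1 \<le> x \<and> x \<le> n \<and> y = \<sigma> x \<and> urr n \<sigma> x"
proof -
  have "(x, y) \<in> UR_records (points n \<sigma>) \<longleftrightarrow> 1 \<le> x \<and> x \<le> n \<and> y = \<sigma> x \<and> (\<forall>z. x < z \<longrightarrow> z \<le> n \<longrightarrow> \<not> \<sigma> x < \<sigma> z)"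
    by (fastforce simp: UR_records_def points_def)
  then show ?thesis using inj_less[OF assms] by (auto simp: urr_def)
qed

lemma BR_records_points:
  assumes "\<sigma> permutes {1..n}"
  shows "(x, y) \<in> BR_records (points n \<sigma>) \<longleftrightarrow> 1 \<le> x \<and> x \<le> n \<and> y = \<sigma> x \<and> brr n \<sigma> x"
proof -
  have "(x, y) \<in> BR_records (points n \<sigma>) \<longleftrightarrow> 1 \<le> x \<and> x \<le> n \<and> y = \<sigma> x \<and> (\<forall>z. x < z \<longrightarrow> z \<le> n \<longrightarrow> \<not> \<sigma> z < \<sigma> x)"
    by (fastforce simp: BR_records_def points_def)
  then show ?thesis using inj_less[OF assms] by (auto simp: brr_def)
qed

lemmas records_points = UL_records_points BL_records_points UR_records_points BR_records_points

lemma square_iff: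
  "\<sigma> \<in> square_perms n \<longleftrightarrow> \<sigma> permutes {1..n} \<and>
     (\<forall>x. 1 \<le> x \<longrightarrow> x \<le> n \<longrightarrow> ulr \<sigma> x \<or> blr \<sigma> x \<or> urr n \<sigma> x \<or> brr n \<sigma> x)"
proof (cases "\<sigma> permutes {1..n}")
  case True
  have "interior_points (points n \<sigma>) = {} \<longleftrightarrow> (\<forall>x\<in>{1..n}. (x, \<sigma> x) \<in> exterior_points (points n \<sigma>))"
    by (auto simp: interior_points_def points_def)
  then show ?thesis using True by (auto simp: square_perms_def exterior_points_def records_points[OF True])
qed (simp add: square_perms_def)

lemma free_fixed_iff:
  assumes "\<sigma> permutes {1..n}"
  shows "p \<in> free_fixed_points n \<sigma> \<longleftrightarrow> (\<exists>x. p = (x, x) \<and> 1 \<le> x \<and> x \<le> n \<and> \<sigma> x = x \<and> \<not> blr \<sigma> x \<and> \<not> urr n \<sigma> x)"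
proof -
  have "(a, b) \<in> points n \<sigma> \<longleftrightarrow> 1 \<le> a \<and> a \<le> n \<and> b = \<sigma> a" for a b by (auto simp: points_def)
  then show ?thesis by (cases p) (auto simp: free_fixed_points_def records_points[OF assms])
qed

text \<open>
  A fixed point has as many columns before it as rows below it, so being above all earlier points
  and being below all later points both mean that the earlier columns fill the lower rows.
\<close>

lemma fixed_ulr_iff:
  assumes "\<sigma> permutes {1..n}" "1 \<le> x" "x \<le> n" "\<sigma> x = x"
  shows "ulr \<sigma> x \<longleftrightarrow> \<sigma> ` {1..x} = {1..x}" "brr n \<sigma> x \<longleftrightarrow> \<sigma> ` {1..x} = {1..x}"
proof -
  have inj: "inj_on \<sigma> S" for S using permutes_inj[OF assms(1)] by (auto intro: inj_onI dest: injD)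
  have A: "\<sigma> ` {1..x} = {1..x}" if "\<sigma> ` {1..x} \<subseteq> {1..x}"
    by (rule card_subset_eq) (use that in \<open>auto simp: card_image[OF inj]\<close>)
  show "ulr \<sigma> x \<longleftrightarrow> \<sigma> ` {1..x} = {1..x}"
  proof
    assume u: "ulr \<sigma> x"
    have "\<sigma> ` {1..x} \<subseteq> {1..x}"
    proof
      fix y assume "y \<in> \<sigma> ` {1..x}"
      then obtain z where z: "1 \<le> z" "z \<le> x" "y = \<sigma> z" by auto
      then show "y \<in> {1..x}" using u perm_range[OF assms(1), of z] assms
          by (cases "z = x") (auto simp: ulr_def intro!: less_imp_le)
    qed
    then show "\<sigma> ` {1..x} = {1..x}" by (rule A)
  next
    assume b: "\<sigma> ` {1..x} = {1..x}"
    show "ulr \<sigma> x" unfolding ulr_def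
    proof (intro allI impI)
      fix z assume z: "1 \<le> z" "z < x"
      then have "\<sigma> z \<in> {1..x}" using b by auto
      moreover have "\<sigma> z \<noteq> \<sigma> x" using perm_inj[OF assms(1), of z x] z by auto
      ultimately show "\<sigma> z < \<sigma> x" using assms by auto
    qed
  qed
  show "brr n \<sigma> x \<longleftrightarrow> \<sigma> ` {1..x} = {1..x}"
  proof
    assume u: "brr n \<sigma> x"
    have "{1..x} \<subseteq> \<sigma> ` {1..x}"
    proof
      fix y assume y: "y \<in> {1..x}"
      then obtain z where z: "1 \<le> z" "z \<le> n" "\<sigma> z = y" using perm_ex[OF assms(1), of y] assms by auto
      then have "z \<le> x" using u y assms unfolding brr_def by (metis atLeastAtMost_iff not_less)
      then show "y \<in> \<sigma> ` {1..x}" using z by auto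
    qed
    then show "\<sigma> ` {1..x} = {1..x}" by (metis card_image card_subset_eq finite_atLeastAtMost finite_imageI inj)
  next
    assume b: "\<sigma> ` {1..x} = {1..x}"
    show "brr n \<sigma> x" unfolding brr_def
    proof (intro allI impI)
      fix z assume z: "x < z" "z \<le> n"
      have "\<sigma> z \<notin> \<sigma> ` {1..x}" using perm_inj[OF assms(1), of z] z by auto
      then show "\<sigma> x < \<sigma> z" using b assms perm_range[OF assms(1), of z] z by auto
    qed
  qed
qed

text \<open>The points before \<open>x\<close> are exactly the points below \<open>\<sigma> x\<close>.\<close>

lemma ulr_brr_fixed:
  assumes "\<sigma> permutes {1..n}" "1 \<le> x" "x \<le> n" "ulr \<sigma> x" "brr n \<sigma> x"
  shows "\<sigma> x = x"
proof -
  have inj: "inj_on \<sigma> S" for S using permutes_inj[OF assms(1)] by (auto intro: inj_onI dest: injD)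
  have "\<sigma> ` {1..x} \<subseteq> {1..\<sigma> x}"
  proof
    fix y assume "y \<in> \<sigma> ` {1..x}"
    then obtain z where z: "1 \<le> z" "z \<le> x" "y = \<sigma> z" by auto
    then show "y \<in> {1..\<sigma> x}" using assms perm_range[OF assms(1), of z]
        by (cases "z = x") (auto simp: ulr_def intro!: less_imp_le)
  qed
  from card_mono[OF _ this] have 1: "x \<le> \<sigma> x" by (simp add: card_image[OF inj])
  have "\<sigma> ` {x..n} \<subseteq> {\<sigma> x..n}"
  proof
    fix y assume "y \<in> \<sigma> ` {x..n}"
    then obtain z where z: "x \<le> z" "z \<le> n" "y = \<sigma> z" by auto
    then show "y \<in> {\<sigma> x..n}" using assms perm_range[OF assms(1), of z]
        by (cases "z = x") (auto simp: brr_def intro!: less_imp_le)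
  qed
  from card_mono[OF _ this] have 2: "\<sigma> x \<le> x"
    using perm_range[OF assms(1,2,3)] assms by (simp add: card_image[OF inj])
  show ?thesis using 1 2 by simp
qed

text \<open>The points before \<open>x\<close> are exactly the points above \<open>\<sigma> x\<close>, so they form an antidiagonal block.\<close>

lemma blr_urr_iff:
  assumes "\<sigma> permutes {1..n}" "1 \<le> x" "x \<le> n"
  shows "blr \<sigma> x \<and> urr n \<sigma> x \<longleftrightarrow> \<sigma> ` {1..x - 1} = {Suc n - (x - 1)..n} \<and> \<sigma> x = Suc n - x"
proof
  have inj: "inj_on \<sigma> S" for S using permutes_inj[OF assms(1)] by (auto intro: inj_onI dest: injD)
  note r = perm_range[OF assms(1,2,3)]
  assume a: "blr \<sigma> x \<and> urr n \<sigma> x"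
  have "\<sigma> ` {1..x} \<subseteq> {\<sigma> x..n}"
  proof
    fix y assume "y \<in> \<sigma> ` {1..x}"
    then obtain z where z: "1 \<le> z" "z \<le> x" "y = \<sigma> z" by auto
    then show "y \<in> {\<sigma> x..n}" using a assms perm_range[OF assms(1), of z]
        by (cases "z = x") (auto simp: blr_def intro!: less_imp_le)
  qed
  from card_mono[OF _ this] have 1: "x + \<sigma> x \<le> Suc n" using r by (simp add: card_image[OF inj]) linarith
  have "\<sigma> ` {x..n} \<subseteq> {1..\<sigma> x}"
  proof
    fix y assume "y \<in> \<sigma> ` {x..n}"
    then obtain z where z: "x \<le> z" "z \<le> n" "y = \<sigma> z" by auto
    then show "y \<in> {1..\<sigma> x}" using a assms perm_range[OF assms(1), of z]
        by (cases "z = x") (auto simp: urr_def intro!: less_imp_le)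
  qed
  from card_mono[OF _ this] have 2: "Suc n - x \<le> \<sigma> x" by (simp add: card_image[OF inj])
  have sx: "\<sigma> x = Suc n - x" using 1 2 by simp
  have sub: "\<sigma> ` {1..x - 1} \<subseteq> {Suc n - (x - 1)..n}"
  proof
    fix y assume "y \<in> \<sigma> ` {1..x - 1}"
    then obtain z where z: "1 \<le> z" "z < x" "y = \<sigma> z" using assms by fastforce
    then have "Suc n - x < y" using a sx unfolding blr_def by metis
    then show "y \<in> {Suc n - (x - 1)..n}" using assms perm_range[OF assms(1), of z] z by auto
  qed
  have "\<sigma> ` {1..x - 1} = {Suc n - (x - 1)..n}"
    by (rule card_subset_eq[OF _ sub]) (use assms in \<open>auto simp: card_image[OF inj]\<close>)
  then show "\<sigma> ` {1..x - 1} = {Suc n - (x - 1)..n} \<and> \<sigma> x = Suc n - x" using sx by simp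
next
  assume a: "\<sigma> ` {1..x - 1} = {Suc n - (x - 1)..n} \<and> \<sigma> x = Suc n - x"
  have "blr \<sigma> x" unfolding blr_def
  proof (intro allI impI)
    fix z assume "1 \<le> z" "z < x"
    then have "\<sigma> z \<in> {Suc n - (x - 1)..n}" using a
        by (metis One_nat_def Suc_pred assms(2) atLeastAtMost_iff image_eqI less_Suc_eq_le less_eq_Suc_le)
    then show "\<sigma> x < \<sigma> z" using a assms by auto
  qed
  moreover have "urr n \<sigma> x" unfolding urr_def
  proof (intro allI impI)
    fix z assume z: "x < z" "z \<le> n"
    have "\<sigma> z \<notin> \<sigma> ` {1..x - 1}" using perm_inj[OF assms(1), of z] z by force
    then have "\<sigma> z \<le> Suc n - x" using a perm_range[OF assms(1), of z] z assms by auto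
    moreover have "\<sigma> z \<noteq> \<sigma> x" using perm_inj[OF assms(1), of z x] z by auto
    ultimately show "\<sigma> z < \<sigma> x" using a by simp
  qed
  ultimately show "blr \<sigma> x \<and> urr n \<sigma> x" by simp
qed

lemma ulr_blr_first: assumes "1 \<le> x" "ulr \<sigma> x" "blr \<sigma> x" shows "x = 1"
  using assms unfolding ulr_def blr_def by (metis le_neq_implies_less less_asym' order_refl)

lemma urr_brr_last: assumes "x \<le> n" "urr n \<sigma> x" "brr n \<sigma> x" shows "x = n"
  using assms unfolding urr_def brr_def by (metis le_neq_implies_less less_asym' order_refl)

lemma ulr_urr_top:
  assumes "\<sigma> permutes {1..n}" "1 \<le> x" "x \<le> n" shows "ulr \<sigma> x \<and> urr n \<sigma> x \<longleftrightarrow> \<sigma> x = n"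
proof
  assume a: "ulr \<sigma> x \<and> urr n \<sigma> x"
  obtain z where z: "1 \<le> z" "z \<le> n" "\<sigma> z = n" using perm_ex[OF assms(1), of n] assms by auto
  then show "\<sigma> x = n" using a perm_range[OF assms] unfolding ulr_def urr_def
    by (metis linorder_neqE_nat not_less)
next
  assume "\<sigma> x = n"
  then show "ulr \<sigma> x \<and> urr n \<sigma> x" unfolding ulr_def urr_def
    using perm_range[OF assms(1)] perm_inj[OF assms(1)] assms
        by (metis le_neq_implies_less less_imp_le less_irrefl order_trans)
qed

lemma blr_brr_bottom:
  assumes "\<sigma> permutes {1..n}" "1 \<le> x" "x \<le> n" shows "blr \<sigma> x \<and> brr n \<sigma> x \<longleftrightarrow> \<sigma> x = 1"
proof
  assume a: "blr \<sigma> x \<and> brr n \<sigma> x"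
  obtain z where z: "1 \<le> z" "z \<le> n" "\<sigma> z = 1" using perm_ex[OF assms(1), of 1] assms by auto
  then show "\<sigma> x = 1" using a perm_range[OF assms] unfolding blr_def brr_def
    by (metis linorder_neqE_nat not_less)
next
  assume "\<sigma> x = 1"
  then show "blr \<sigma> x \<and> brr n \<sigma> x" unfolding blr_def brr_def
    using perm_range[OF assms(1)] perm_inj[OF assms(1)] assms
        by (metis le_neq_implies_less less_imp_le less_irrefl order_trans)
qed

section \<open>The labelling of a colored square permutation\<close>

definition upper_cols :: "nat \<Rightarrow> (nat \<Rightarrow> nat) \<Rightarrow> point set \<Rightarrow> nat set" where
  "upper_cols n \<sigma> C = {x. x = 1 \<or> x = n \<or> 1 < x \<and> x < n \<and> (ulr \<sigma> x \<or> urr n \<sigma> x) \<and> (x, \<sigma> x) \<notin> C}"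

text \<open>
  The upper columns in the sense of the chains: in contrast to \<open>upper_cols\<close>, which follows the code,
  a point that is both a BL and a UR record is drawn on the BL chain. Otherwise its labels would be
  upper and left although it is not a UL record.
\<close>

definition nat_cols :: "nat \<Rightarrow> (nat \<Rightarrow> nat) \<Rightarrow> point set \<Rightarrow> nat set" where
  "nat_cols n \<sigma> C = {x. 1 \<le> x \<and> x \<le> n \<and> (ulr \<sigma> x \<or> urr n \<sigma> x \<and> \<not> blr \<sigma> x) \<and> (x, \<sigma> x) \<notin> C}"

definition left_rows :: "nat \<Rightarrow> (nat \<Rightarrow> nat) \<Rightarrow> point set \<Rightarrow> nat set" where
  "left_rows n \<sigma> C = {\<sigma> x | x. 1 \<le> x \<and> x \<le> n \<and> (ulr \<sigma> x \<or> blr \<sigma> x) \<and> (x, \<sigma> x) \<notin> C}"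

lemma left_rows_iff: "\<sigma> permutes {1..n} \<Longrightarrow> 1 \<le> x \<Longrightarrow> x \<le> n \<Longrightarrow>
    \<sigma> x \<in> left_rows n \<sigma> C \<longleftrightarrow> (ulr \<sigma> x \<or> blr \<sigma> x) \<and> (x, \<sigma> x) \<notin> C"
  unfolding left_rows_def using perm_inj[of \<sigma> "{1..n}"] by blast

lemma ulr_1: "ulr \<sigma> (Suc 0)" "blr \<sigma> (Suc 0)" and urr_n: "urr n \<sigma> n" "brr n \<sigma> n"
  by (auto simp: ulr_def blr_def urr_def brr_def)

context
  fixes n :: nat and \<sigma> :: "nat \<Rightarrow> nat" and C :: "point set"
  assumes csq: "(\<sigma>, C) \<in> colored_square_perms n" and n2: "2 \<le> n"
begin

lemma csq_perm: "\<sigma> permutes {1..n}" and csq_square: "\<sigma> \<in> square_perms n"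
  and csq_sub: "C \<subseteq> free_fixed_points n \<sigma>"
  using csq by (auto simp: colored_square_perms_def square_perms_def)

lemma csq_ext: "1 \<le> x \<Longrightarrow> x \<le> n \<Longrightarrow> ulr \<sigma> x \<or> blr \<sigma> x \<or> urr n \<sigma> x \<or> brr n \<sigma> x"
  using csq_square by (auto simp: square_iff)

text \<open>
  A point of a square permutation that is neither a BL nor a UR record has to be a UL or a BR
  record, and for a fixed point these two are equivalent.
\<close>

lemma csq_free:
  assumes "(x, y) \<in> free_fixed_points n \<sigma>"
  shows "y = x \<and> 1 < x \<and> x < n \<and> \<sigma> x = x \<and> \<not> blr \<sigma> x \<and> \<not> urr n \<sigma> x \<and> ulr \<sigma> x \<and> brr n \<sigma> x \<and> \<sigma> ` {1..x} = {1..x}"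
proof -
  have a: "y = x" "1 \<le> x" "x \<le> n" "\<sigma> x = x" "\<not> blr \<sigma> x" "\<not> urr n \<sigma> x"
    using assms by (auto simp: free_fixed_iff[OF csq_perm])
  then have "x \<noteq> 1" "x \<noteq> n" using ulr_1 urr_n by auto
  then show ?thesis using a csq_ext[of x] fixed_ulr_iff[OF csq_perm a(2-4)] by auto
qed

lemma csq_C: "(x, y) \<in> C \<Longrightarrow> y = x \<and> 1 < x \<and> x < n \<and> \<sigma> x = x \<and> \<not> blr \<sigma> x \<and> \<not> urr n \<sigma> x \<and> ulr \<sigma> x \<and> brr n \<sigma> x \<and>
    \<sigma> ` {1..x} = {1..x}"
  using csq_free csq_sub by blast

text \<open>
  A colored point has lost its labels upper and left and is drawn on the BR chain, which is possible
  since free fixed points are both UL and BR records.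
\<close>

lemma csq_labelling: "sq_labelling n \<sigma> (nat_cols n \<sigma> C) (left_rows n \<sigma> C)"
proof -
  have s1: "1 \<in> nat_cols n \<sigma> C" "\<sigma> 1 \<in> left_rows n \<sigma> C"
    using n2 ulr_1 csq_C[of 1] left_rows_iff[OF csq_perm, of 1 C] by (auto simp: nat_cols_def)
  obtain x where x: "1 \<le> x" "x \<le> n" "\<sigma> x = n" using perm_ex[OF csq_perm, of n] n2 by auto
  then have xn: "n \<in> left_rows n \<sigma> C"
    using ulr_urr_top[OF csq_perm x(1,2)] csq_C[of x] left_rows_iff[OF csq_perm x(1,2)] by auto
  obtain z where z: "1 \<le> z" "z \<le> n" "\<sigma> z = 1" using perm_ex[OF csq_perm, of 1] n2 by auto
  then have x1: "1 \<in> left_rows n \<sigma> C"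
    using blr_brr_bottom[OF csq_perm z(1,2)] csq_C[of z] left_rows_iff[OF csq_perm z(1,2)] by metis
  have cls: "(y \<in> nat_cols n \<sigma> C \<longrightarrow> \<sigma> y \<in> left_rows n \<sigma> C \<longrightarrow> \<sigma> x < \<sigma> y) \<and> (y \<notin> nat_cols n \<sigma> C \<longrightarrow> \<sigma> y \<in> left_rows n \<sigma> C \<longrightarrow>
      \<sigma> y < \<sigma> x) \<and>
        (x \<in> nat_cols n \<sigma> C \<longrightarrow> \<sigma> x \<notin> left_rows n \<sigma> C \<longrightarrow> \<sigma> y < \<sigma> x) \<and> (x \<notin> nat_cols n \<sigma> C \<longrightarrow> \<sigma> x \<notin> left_rows n \<sigma> C \<longrightarrow> \<sigma> x < \<sigma>
            y)"
    if "1 \<le> x" "x < y" "y \<le> n" for x y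
  proof -
    have x: "1 \<le> x" "x \<le> n" and y: "1 \<le> y" "y \<le> n" and y1: "y \<noteq> 1" using that by auto
    have u: "ulr \<sigma> y \<longrightarrow> \<sigma> x < \<sigma> y" "blr \<sigma> y \<longrightarrow> \<sigma> y < \<sigma> x" "urr n \<sigma> x \<longrightarrow> \<sigma> y < \<sigma> x" "brr n \<sigma> x \<longrightarrow> \<sigma> x < \<sigma> y"
      using that by (auto simp: ulr_def blr_def urr_def brr_def)
    show ?thesis
      using u csq_ext[OF x] csq_C[of x "\<sigma> x"] left_rows_iff[OF csq_perm x] left_rows_iff[OF csq_perm y]
        ulr_blr_first[OF y(1), of \<sigma>] y1 x y
      unfolding nat_cols_def mem_Collect_eq by blast
  qed
  show ?thesis unfolding sq_labelling_def using csq_perm n2 s1 x1 xn cls by blast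
qed

text \<open>Every point behind an antidiagonal block lies to the lower right of the block.\<close>

lemma csq_block_blr:
  assumes "1 < i" "i \<le> n" "anti_height n (\<sigma> 1) (nat_cols n \<sigma> C) (left_rows n \<sigma> C) (i - 1) = 0"
  shows "blr \<sigma> i" "\<not> ulr \<sigma> i" "\<sigma> ` {1..i - 1} = {Suc n - (i - 1)..n}" "\<sigma> i \<le> Suc n - i" "(i, \<sigma> i) \<notin> C"
proof -
  show im: "\<sigma> ` {1..i - 1} = {Suc n - (i - 1)..n}"
    using lab_anti_zero[OF csq_labelling, of "i - 1"] assms by simp
  have "\<sigma> i \<notin> \<sigma> ` {1..i - 1}" using perm_inj[OF csq_perm, of i] assms by force
  then show le: "\<sigma> i \<le> Suc n - i" using im perm_range[OF csq_perm, of i] assms by auto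
  show b: "blr \<sigma> i" unfolding blr_def
  proof (intro allI impI)
    fix z assume "1 \<le> z" "z < i"
    then have "\<sigma> z \<in> \<sigma> ` {1..i - 1}" by auto
    then have "\<sigma> z \<in> {Suc n - (i - 1)..n}" using im by simp
    then show "\<sigma> i < \<sigma> z" using le assms by auto
  qed
  then show "\<not> ulr \<sigma> i" using ulr_blr_first[of i \<sigma>] assms by auto
  show "(i, \<sigma> i) \<notin> C" using csq_C[of i] b by auto
qed

end

section \<open>Recovering the labelling from the code\<close>

text \<open>
  The rule that recovers the chain labels \<open>up\<close> from the labels \<open>uw\<close> of the code: a column marked
  upper is dropped if its point is both a BL and a UR record, that is, if it lies in row \<open>n + 1 - i\<close>
  behind an antidiagonal block of size \<open>i - 1\<close>. The rule for column \<open>i\<close> refers only to smaller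
  columns. The bound \<open>k\<close> allows it to be applied to a block inside of a longer word.
\<close>

definition natural_upto :: "nat \<Rightarrow> nat \<Rightarrow> nat set \<Rightarrow> nat set \<Rightarrow> nat set \<Rightarrow> nat \<Rightarrow> bool" where
  "natural_upto n m uw lf up k \<longleftrightarrow> 1 \<in> up \<and>
     (\<forall>i. 1 < i \<longrightarrow> i \<le> k \<longrightarrow> (i \<in> up \<longleftrightarrow> i \<in> uw \<and> \<not> (anti_height n m up lf (i - 1) = 0 \<and> Suc n - i \<in> lf)))"

lemma anti_height_cong:
  "(\<And>j. 1 \<le> j \<Longrightarrow> j \<le> i \<Longrightarrow> j \<in> up \<longleftrightarrow> j \<in> up') \<Longrightarrow> (\<And>j. Suc n - i \<le> j \<Longrightarrow> j \<le> m \<Longrightarrow> j \<in> lf \<longleftrightarrow> j \<in> lf')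
    \<Longrightarrow> anti_height n m up lf i = anti_height n m up' lf' i"
  unfolding anti_height_def
  using cnt_cong[of 1 i "- up" "- up'"] cnt_cong[of "Suc n - i" m lf lf'] by auto

lemma diag_height_cong:
  "(\<And>j. 1 \<le> j \<Longrightarrow> j \<le> i \<Longrightarrow> j \<in> up \<longleftrightarrow> j \<in> up') \<Longrightarrow> (\<And>j. m \<le> j \<Longrightarrow> j \<le> i \<Longrightarrow> j \<in> lf \<longleftrightarrow> j \<in> lf')
    \<Longrightarrow> diag_height m up lf i = diag_height m up' lf' i"
  unfolding diag_height_def
  using cnt_cong[of 1 i up up'] cnt_cong[of m i lf lf'] by auto

lemma cnt_shift: "cnt {r. r + s \<in> S} a b = cnt S (a + s) (b + s)"
proof -
  have "S \<inter> {a + s..b + s} = (\<lambda>r. r + s) ` ({r. r + s \<in> S} \<inter> {a..b})"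
  proof (intro equalityI subsetI)
    fix y assume y: "y \<in> S \<inter> {a + s..b + s}"
    then show "y \<in> (\<lambda>r. r + s) ` ({r. r + s \<in> S} \<inter> {a..b})" by (intro image_eqI[of _ _ "y - s"]) auto
  qed auto
  then show ?thesis unfolding cnt_def by (simp add: card_image)
qed

lemma anti_height_shift:
  assumes "i \<le> n"
  shows "anti_height (n + s) (m + s) up lf i = anti_height n m up {r. r + s \<in> lf} i"
  unfolding anti_height_def cnt_shift using assms by (simp add: Suc_diff_le)

text \<open>
  The rule for a column refers to the height one column earlier, which depends on the earlier
  columns and the rows opposite to them, so the two solutions agree by induction.
\<close>

lemma natural_agree:
  assumes "natural_upto n m uw lf up k" "natural_upto n m uw' lf' up' k" "k \<le> n"
    and uw: "\<And>j. 1 < j \<Longrightarrow> j \<le> k \<Longrightarrow> j \<in> uw \<longleftrightarrow> j \<in> uw'"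
    and lf: "\<And>j. Suc n - k \<le> j \<Longrightarrow> j \<le> n \<Longrightarrow> j \<in> lf \<longleftrightarrow> j \<in> lf'" and m: "m \<le> n"
  shows "1 \<le> i \<Longrightarrow> i \<le> k \<Longrightarrow> i \<in> up \<longleftrightarrow> i \<in> up'"
proof (induction i rule: less_induct)
  case (less i)
  show ?case
  proof (cases "i = 1")
    case True then show ?thesis using assms by (simp add: natural_upto_def)
  next
    case False
    then have i: "1 < i" "i \<le> k" using less by auto
    have "anti_height n m up lf (i - 1) = anti_height n m up' lf' (i - 1)"
      by (rule anti_height_cong) (use less i lf m \<open>k \<le> n\<close> in auto)
    moreover have "Suc n - i \<in> lf \<longleftrightarrow> Suc n - i \<in> lf'" using lf[of "Suc n - i"] i \<open>k \<le> n\<close> by auto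
    ultimately show ?thesis using assms(1,2) uw[of i] i by (simp add: natural_upto_def)
  qed
qed

text \<open>The solution of \<open>natural_upto\<close>, computed from left to right.\<close>

primrec nat_rec :: "nat \<Rightarrow> nat \<Rightarrow> nat set \<Rightarrow> nat set \<Rightarrow> nat \<Rightarrow> nat set" where
  "nat_rec n m uw lf 0 = {}"
| "nat_rec n m uw lf (Suc i) = nat_rec n m uw lf i \<union>
     (if i = 0 \<or> Suc i \<in> uw \<and> \<not> (anti_height n m (nat_rec n m uw lf i) lf i = 0 \<and> Suc n - Suc i \<in> lf) then {Suc i} else
         {})"

definition nat_set :: "nat \<Rightarrow> nat \<Rightarrow> nat set \<Rightarrow> nat set \<Rightarrow> nat set" where
  "nat_set n m uw lf = nat_rec n m uw lf n"

lemma nat_rec_sub: "nat_rec n m uw lf k \<subseteq> {1..k}"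
  by (induction k) auto

lemma nat_rec_mono: "i \<le> k \<Longrightarrow> nat_rec n m uw lf k \<inter> {1..i} = nat_rec n m uw lf i"
proof (induction k)
  case (Suc k)
  then show ?case
  proof (cases "i = Suc k")
    case True then show ?thesis using nat_rec_sub[of n m uw lf "Suc k"] by blast
  next
    case False
    then have "i \<le> k" using Suc by simp
    then show ?thesis using Suc by auto
  qed
qed auto

lemma nat_set_natural:
  assumes "1 \<le> n"
  shows "natural_upto n m uw lf (nat_set n m uw lf) n"
  unfolding natural_upto_def
proof (intro conjI allI impI)
  let ?N = "nat_rec n m uw lf"
  have mem: "i \<in> ?N n \<longleftrightarrow> i \<in> ?N i" if "1 \<le> i" "i \<le> n" for i using nat_rec_mono[of i n n m uw lf] that by force
  show "1 \<in> nat_set n m uw lf" using mem[of 1] assms by (simp add: nat_set_def)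
  fix i assume i: "1 < i" "i \<le> n"
  then obtain j where j: "i = Suc j" "j \<noteq> 0" by (cases i) auto
  have "Suc j \<notin> ?N j" using nat_rec_sub[of n m uw lf j] by auto
  moreover have "anti_height n m (?N j) lf j = anti_height n m (?N n) lf j"
  proof (rule anti_height_cong)
    fix z assume "1 \<le> z" "z \<le> j"
    then have "z \<in> {1..j}" by simp
    moreover have "?N n \<inter> {1..j} = ?N j" using nat_rec_mono i j by simp
    ultimately show "z \<in> ?N j \<longleftrightarrow> z \<in> ?N n" by blast
  qed simp
  ultimately show "i \<in> nat_set n m uw lf \<longleftrightarrow> i \<in> uw \<and> \<not> (anti_height n m (nat_set n m uw lf) lf (i - 1) = 0 \<and>
      Suc n - i \<in> lf)"
    using mem[of i] i j by (simp add: nat_set_def)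
qed

lemma nat_set_sub: "nat_set n m uw lf \<subseteq> {1..n}"
  unfolding nat_set_def by (rule nat_rec_sub)

lemma nat_set_eqI:
  assumes "natural_upto n m uw lf up n" "up \<subseteq> {1..n}" "m \<le> n" "1 \<le> n"
  shows "nat_set n m uw lf = up"
proof -
  have "i \<in> nat_set n m uw lf \<longleftrightarrow> i \<in> up" if "1 \<le> i" "i \<le> n" for i
    by (rule natural_agree[OF nat_set_natural[OF assms(4)] assms(1)]) (use that assms in auto)
  then show ?thesis using assms(2) nat_set_sub[of n m uw lf] by (auto simp: subset_eq)
qed

text \<open>
  A point that is both a BL and a UR record has the antidiagonal block of \<open>blr_urr_iff\<close> before it.
  Behind such a block every point is a BL record, so a column marked upper there must be a UR record
  as well.
\<close>

lemma csq_natural: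
  assumes csq: "(\<sigma>, C) \<in> colored_square_perms n" and n2: "2 \<le> n"
  shows "natural_upto n (\<sigma> 1) (upper_cols n \<sigma> C) (left_rows n \<sigma> C) (nat_cols n \<sigma> C) n"
  unfolding natural_upto_def
proof (intro conjI allI impI)
  note lab = csq_labelling[OF csq n2]
  show "1 \<in> nat_cols n \<sigma> C" using lab_up[OF lab] .
  fix i assume i: "1 < i" "i \<le> n"
  let ?a = "anti_height n (\<sigma> 1) (nat_cols n \<sigma> C) (left_rows n \<sigma> C) (i - 1) = 0"
  have 1: "i \<in> nat_cols n \<sigma> C \<longleftrightarrow> i \<in> upper_cols n \<sigma> C \<and> \<not> (blr \<sigma> i \<and> urr n \<sigma> i)"
    using i ulr_blr_first[of i \<sigma>] urr_n[of n \<sigma>] csq_C[OF csq n2, of n] unfolding nat_cols_def upper_cols_def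
        by fastforce
  have 2: "blr \<sigma> i \<and> urr n \<sigma> i \<longleftrightarrow> ?a \<and> Suc n - i \<in> left_rows n \<sigma> C" if "i \<in> upper_cols n \<sigma> C"
  proof
    assume a: "blr \<sigma> i \<and> urr n \<sigma> i"
    then have b: "\<sigma> ` {1..i - 1} = {Suc n - (i - 1)..n}" "\<sigma> i = Suc n - i"
      using blr_urr_iff[OF csq_perm[OF csq n2], of i] i by auto
    have "(i, \<sigma> i) \<notin> C" using csq_C[OF csq n2, of i] a by auto
    then have "\<sigma> i \<in> left_rows n \<sigma> C" using a i left_rows_iff[OF csq_perm[OF csq n2], of i C] by auto
    then show "?a \<and> Suc n - i \<in> left_rows n \<sigma> C" using lab_anti_zero[OF lab, of "i - 1"] b i by auto
  next
    assume a: "?a \<and> Suc n - i \<in> left_rows n \<sigma> C"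
    then show "blr \<sigma> i \<and> urr n \<sigma> i"
      using csq_block_blr[OF csq n2, of i] i that urr_n[of n \<sigma>] by (auto simp: upper_cols_def)
  qed
  show "i \<in> nat_cols n \<sigma> C \<longleftrightarrow> i \<in> upper_cols n \<sigma> C \<and> \<not> (?a \<and> Suc n - i \<in> left_rows n \<sigma> C)"
    using 1 2 by blast
qed

lemma csq_nat_set:
  assumes csq: "(\<sigma>, C) \<in> colored_square_perms n" and n2: "2 \<le> n"
  shows "nat_set n (\<sigma> 1) (upper_cols n \<sigma> C) (left_rows n \<sigma> C) = nat_cols n \<sigma> C"
  by (rule nat_set_eqI) (use csq_natural[OF assms] n2 lab_range[OF csq_labelling[OF assms], of 1] in \<open>auto simp:
      nat_cols_def\<close>)

text \<open>Free fixed points are UL records, hence the code marks their columns unless they are colored.\<close>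

lemma csq_C_eq:
  assumes csq: "(\<sigma>, C) \<in> colored_square_perms n" and n2: "2 \<le> n"
  shows "C = {(x, y) \<in> free_fixed_points n \<sigma>. x \<notin> upper_cols n \<sigma> C}"
  using csq_sub[OF assms] csq_C[OF assms] csq_free[OF assms] unfolding upper_cols_def by fastforce

lemma csq_determined:
  assumes "(\<sigma>, C) \<in> colored_square_perms n" "(\<tau>, E) \<in> colored_square_perms n" "2 \<le> n"
    and "\<sigma> 1 = \<tau> 1" "upper_cols n \<sigma> C = upper_cols n \<tau> E" "left_rows n \<sigma> C = left_rows n \<tau> E"
  shows "\<sigma> = \<tau> \<and> C = E"
proof -
  have "nat_cols n \<sigma> C = nat_cols n \<tau> E"
    using csq_nat_set[OF assms(1,3)] csq_nat_set[OF assms(2,3)] assms(4-6) by simp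
  then have "\<sigma> = \<tau>"
    using labelling_unique[of n \<sigma> _ _ \<tau>] csq_labelling[OF assms(1,3)] csq_labelling[OF assms(2,3)] assms by metis
  then show ?thesis using csq_C_eq[OF assms(1,3)] csq_C_eq[OF assms(2,3)] assms(5) by simp
qed

section \<open>Which labels come from colored square permutations\<close>

text \<open>
  Behind an antidiagonal block the next column and the row next to the block can only be marked by
  one and the same point, the one in which they meet. The nonnegativity of the antidiagonal height
  is a consequence of \<open>natural_upto\<close>.
\<close>

definition admissible :: "nat \<Rightarrow> nat \<Rightarrow> nat set \<Rightarrow> nat set \<Rightarrow> nat set \<Rightarrow> bool" where
  "admissible n m uw lf up \<longleftrightarrow> (\<forall>i. 1 \<le> i \<longrightarrow> i < n \<longrightarrow> 0 \<le> diag_height m up lf i) \<and>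
     (\<forall>i. 1 < i \<longrightarrow> i < n \<longrightarrow> anti_height n m up lf (i - 1) = 0 \<longrightarrow> (i \<in> uw \<longleftrightarrow> Suc n - i \<in> lf))"

text \<open>
  The point behind an antidiagonal block is a BL record. If its column is marked upper, it is also a
  UR record and lies directly next to the block; and only this point can be a left point in the row
  next to the block, as any other point there has the first point to its upper left and the point in
  column \<open>i\<close> to its lower left.
\<close>

lemma csq_admissible:
  assumes csq: "(\<sigma>, C) \<in> colored_square_perms n" and n2: "2 \<le> n"
  shows "admissible n (\<sigma> 1) (upper_cols n \<sigma> C) (left_rows n \<sigma> C) (nat_cols n \<sigma> C)"
  unfolding admissible_def
proof (intro conjI allI impI)
  note lab = csq_labelling[OF csq n2] and perm = csq_perm[OF csq n2]
  fix i
  { assume "1 \<le> i" "i < n"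
    then show "0 \<le> diag_height (\<sigma> 1) (nat_cols n \<sigma> C) (left_rows n \<sigma> C) i" using lab_diag_height[OF lab, of i] by simp }
  assume i: "1 < i" "i < n" and a: "anti_height n (\<sigma> 1) (nat_cols n \<sigma> C) (left_rows n \<sigma> C) (i - 1) = 0"
  note b = csq_block_blr[OF csq n2 i(1) less_imp_le[OF i(2)] a]
  have i': "1 \<le> i" "i \<le> n" using i by auto
  show "i \<in> upper_cols n \<sigma> C \<longleftrightarrow> Suc n - i \<in> left_rows n \<sigma> C"
  proof
    assume "i \<in> upper_cols n \<sigma> C"
    then have "urr n \<sigma> i" using i b by (auto simp: upper_cols_def)
    then have "\<sigma> i = Suc n - i" using blr_urr_iff[OF perm i'] b by simp
    then show "Suc n - i \<in> left_rows n \<sigma> C" using left_rows_iff[OF perm i', of C] b by simp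
  next
    assume l: "Suc n - i \<in> left_rows n \<sigma> C"
    then obtain x where x: "1 \<le> x" "x \<le> n" "\<sigma> x = Suc n - i" "ulr \<sigma> x \<or> blr \<sigma> x" by (auto simp: left_rows_def)
    have "\<not> x < i"
    proof
      assume "x < i"
      then have "x \<in> {1..i - 1}" using x by auto
      then have "\<sigma> x \<in> \<sigma> ` {1..i - 1}" by (rule imageI)
      then show False using b(3) x i by auto
    qed
    moreover have "\<not> i < x"
    proof
      assume ix: "i < x"
      have "1 \<in> {1..i - 1}" using i by auto
      then have "\<sigma> 1 \<in> \<sigma> ` {1..i - 1}" by (rule imageI)
      then have "\<sigma> x < \<sigma> 1" unfolding b(3) using x i by auto
      then have "\<not> ulr \<sigma> x" using ix i unfolding ulr_def by (metis less_trans not_less_iff_gr_or_eq order_refl)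
      then have "\<sigma> x < \<sigma> i" using x ix i' by (auto simp: blr_def)
      then show False using b(4) x by simp
    qed
    ultimately have "x = i" by simp
    then have "\<sigma> i = Suc n - i" using x by simp
    then have "urr n \<sigma> i" using blr_urr_iff[OF perm i'] b by simp
    then show "i \<in> upper_cols n \<sigma> C" using i b by (simp add: upper_cols_def)
  qed
qed

lemma anti_height_0: "m \<le> n \<Longrightarrow> anti_height n m up lf 0 = 1"
  by (simp add: anti_height_def cnt_empty)

lemma anti_height_Suc:
  assumes "i < n"
  shows "anti_height n m up lf (Suc i) = anti_height n m up lf i + (if Suc i \<in> up then 0 else 1) - (if n - i \<in> lf \<and>
      n - i \<le> m then 1 else 0)"
proof -
  have 1: "cnt (- up) 1 (Suc i) = cnt (- up) 1 i + (if Suc i \<in> up then 0 else 1)" using cnt_Suc[of 1 i "- up"] by simp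
  have 2: "Suc (n - i) = Suc n - i" using assms by simp
  have "cnt lf (n - i) m = cnt lf (Suc n - i) m + (if n - i \<in> lf \<and> n - i \<le> m then 1 else 0)"
  proof (cases "n - i \<le> m")
    case True then show ?thesis using cnt_Suc_left[of "n - i" m lf] 2 by simp
  next
    case False then show ?thesis using cnt_empty[of m "n - i" lf] cnt_empty[of m "Suc n - i" lf] 2 by simp
  qed
  then show ?thesis using 1 by (simp add: anti_height_def)
qed

lemma diag_height_Suc:
  "1 \<le> m \<Longrightarrow> diag_height m up lf (Suc i) = diag_height m up lf i + (if Suc i \<in> up then 1 else 0) - (if Suc i \<in> lf \<and>
      m \<le> Suc i then 1 else 0)"
proof -
  assume "1 \<le> m"
  have "cnt lf m (Suc i) = cnt lf m i + (if Suc i \<in> lf \<and> m \<le> Suc i then 1 else 0)"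
    using cnt_Suc[of m i lf] cnt_empty[of i m lf] cnt_empty[of "Suc i" m lf] by (cases "m \<le> Suc i") auto
  then show ?thesis using cnt_Suc[of 1 i up] by (simp add: diag_height_def)
qed

lemma diag_height_1: "1 \<le> m \<Longrightarrow> 1 \<in> up \<Longrightarrow> 0 \<le> diag_height m up lf 1"
  using cnt_le[of lf m 1] cnt_self[of up 1] by (simp add: diag_height_def)

text \<open>
  At height zero a further drop would need an upper column and a left row that meet behind the
  block, and in this situation the column is declared lower.
\<close>

lemma natural_anti_nonneg:
  assumes "natural_upto n m uw lf up k" "m \<le> n" "k \<le> n"
  shows "i \<le> k \<Longrightarrow> 0 \<le> anti_height n m up lf i"
proof (induction i)
  case 0 then show ?case using anti_height_0[OF assms(2)] by simp
next
  case (Suc i)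
  then have IH: "0 \<le> anti_height n m up lf i" and i: "i < n" using assms by auto
  show ?case
  proof (cases "i = 0")
    case True then show ?thesis using anti_height_Suc[OF i, of m up lf] anti_height_0[OF assms(2), of up lf] by simp
  next
    case False
    then have "Suc i \<in> up \<longleftrightarrow> Suc i \<in> uw \<and> \<not> (anti_height n m up lf i = 0 \<and> Suc n - Suc i \<in> lf)"
      using assms(1) Suc.prems unfolding natural_upto_def by (metis One_nat_def Suc_less_eq diff_Suc_1 neq0_conv)
    then show ?thesis using anti_height_Suc[OF i, of m up lf] IH by auto
  qed
qed

text \<open>
  The permutation is drawn from the chain labels, and the free fixed points drawn on the BR chain
  are colored. The records of the result may be of more types than its labels prescribe. A second
  type on the opposite chain occurs only at UL-BR points, where the coloring removes it, and at
  BL-UR points, where \<open>admissible\<close> ensures that the code has the labels of both types.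
\<close>

lemma csq_exists:
  assumes n: "2 \<le> n" and m: "1 \<le> m" "m \<le> n" and mem: "1 \<in> uw" "n \<in> uw" "1 \<in> lf" "n \<in> lf" "m \<in> lf"
    and sub: "uw \<subseteq> {1..n}" "lf \<subseteq> {1..n}" "up \<subseteq> {1..n}"
    and nat: "natural_upto n m uw lf up n" and adm: "admissible n m uw lf up"
  shows "\<exists>\<sigma> C. (\<sigma>, C) \<in> colored_square_perms n \<and> \<sigma> 1 = m \<and> upper_cols n \<sigma> C = uw \<and> left_rows n \<sigma> C = lf \<and>
      nat_cols n \<sigma> C = up"
proof -
  have up1: "1 \<in> up" using nat by (simp add: natural_upto_def)
  have up_uw: "i \<in> up \<Longrightarrow> i \<in> uw" for i
    using nat sub mem(1) unfolding natural_upto_def by (metis atLeastAtMost_iff le_neq_implies_less subsetD)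
  have ah: "0 \<le> anti_height n m up lf i" if "i \<le> n" for i using natural_anti_nonneg[OF nat m(2)] that by simp
  have dh: "0 \<le> diag_height m up lf i" if i: "1 \<le> i" "i \<le> n" for i
  \<comment> \<open>The bound at \<open>n\<close> follows from the one at \<open>n - 1\<close> if column \<open>n\<close> is upper. If it is lower, the
    antidiagonal height vanishes at \<open>n - 1\<close> and the diagonal height is positive there.\<close>
  proof (cases "i < n")
    case True then show ?thesis using adm i by (simp add: admissible_def)
  next
    case False
    then obtain k where k: "n = Suc k" "i = Suc k" "1 \<le> k" using i n by (cases n) auto
    have d: "0 \<le> diag_height m up lf k" using adm k by (simp add: admissible_def)
    show ?thesis
    proof (cases "n \<in> up")
      case True then show ?thesis using diag_height_Suc[OF m(1), of up lf k] d k by simp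
    next
      case False
      then have "anti_height n m up lf k = 0" using nat mem(2) k unfolding natural_upto_def
        by (metis One_nat_def Suc_le_eq diff_Suc_1 less_Suc_eq_le order_refl n numeral_2_eq_2)
      then have "1 \<le> diag_height m up lf k" using diag_pos_of_anti_nonpos[OF m up1 mem(4), of k k] k by simp
      then show ?thesis using diag_height_Suc[OF m(1), of up lf k] k by simp
    qed
  qed
  from labelling_exists[OF n m up1 mem(3,4,5) dh ah] obtain \<sigma> where lab: "sq_labelling n \<sigma> up lf" and s1: "\<sigma> 1 = m"
      by auto
  note perm = lab_perm[OF lab]
  have cUL: "ulr \<sigma> x" if "1 \<le> x" "x \<le> n" "x \<in> up" "\<sigma> x \<in> lf" for x using lab_UL[OF lab, of _ x] that
      by (auto simp: ulr_def)
  have cBL: "blr \<sigma> x" if "1 \<le> x" "x \<le> n" "x \<notin> up" "\<sigma> x \<in> lf" for x using lab_BL[OF lab, of _ x] that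
      by (auto simp: blr_def)
  have cUR: "urr n \<sigma> x" if "1 \<le> x" "x \<le> n" "x \<in> up" "\<sigma> x \<notin> lf" for x using lab_UR[OF lab, of x] that
      by (auto simp: urr_def)
  have cBR: "brr n \<sigma> x" if "1 \<le> x" "x \<le> n" "x \<notin> up" "\<sigma> x \<notin> lf" for x using lab_BR[OF lab, of x] that
      by (auto simp: brr_def)
  have sq: "\<sigma> \<in> square_perms n" unfolding square_iff using perm cUL cBL cUR cBR by blast
  define C where "C = {(x, y) \<in> free_fixed_points n \<sigma>. x \<notin> up}"
  have csq: "(\<sigma>, C) \<in> colored_square_perms n" using sq by (auto simp: colored_square_perms_def C_def)
  \<comment> \<open>The two situations in which a point has a second record type on the opposite chain: next to an
    antidiagonal block for a BL point, and at a colored point for a BR point.\<close>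
  have az: "anti_height n m up lf (x - 1) = 0 \<and> \<sigma> x = Suc n - x"
    if x: "1 < x" "x \<le> n" "blr \<sigma> x" "urr n \<sigma> x" for x
    using blr_urr_iff[OF perm, of x] lab_anti_zero[OF lab, of "x - 1"] x s1 by auto
  have brC: "(x, \<sigma> x) \<in> C" if x: "1 \<le> x" "x \<le> n" "x \<notin> up" "\<sigma> x \<notin> lf" "ulr \<sigma> x" for x
  proof -
    have b: "brr n \<sigma> x" using cBR x by blast
    have "\<sigma> x = x" using ulr_brr_fixed[OF perm x(1,2,5) b] .
    moreover have "\<not> blr \<sigma> x" using blr_brr_bottom[OF perm x(1,2)] b x mem by metis
    moreover have "\<not> urr n \<sigma> x" using ulr_urr_top[OF perm x(1,2)] x mem by metis
    ultimately show ?thesis using x by (auto simp: C_def free_fixed_iff[OF perm])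
  qed
  have left: "\<sigma> x \<in> left_rows n \<sigma> C \<longleftrightarrow> \<sigma> x \<in> lf" if x: "1 \<le> x" "x \<le> n" for x
  proof
    assume l: "\<sigma> x \<in> left_rows n \<sigma> C"
    then have l': "ulr \<sigma> x \<or> blr \<sigma> x" "(x, \<sigma> x) \<notin> C" using left_rows_iff[OF perm x] by auto
    show "\<sigma> x \<in> lf"
    proof (rule ccontr)
      assume nl: "\<sigma> x \<notin> lf"
      show False
      proof (cases "x \<in> up")
        case True
        then have u: "urr n \<sigma> x" using cUR x nl by blast
        then have "\<not> ulr \<sigma> x" using ulr_urr_top[OF perm x] nl mem by metis
        then have b: "blr \<sigma> x" and x1: "1 < x" using l' ulr_1 x by (auto simp: le_less)
        have z: "anti_height n m up lf (x - 1) = 0" "\<sigma> x = Suc n - x" using az[OF x1 x(2) b u] by auto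
        have "x \<noteq> n" using z nl mem n by auto
        then have "x \<in> uw \<longleftrightarrow> Suc n - x \<in> lf" using adm z x1 x by (simp add: admissible_def)
        then show False using up_uw True z nl by simp
      next
        case False
        then show False using brC[OF x False nl] l' blr_brr_bottom[OF perm x] cBR[OF x False nl] nl mem by metis
      qed
    qed
  next
    assume "\<sigma> x \<in> lf"
    moreover have "(x, \<sigma> x) \<notin> C" using cBL[of x] calculation x by (auto simp: C_def free_fixed_iff[OF perm])
    ultimately show "\<sigma> x \<in> left_rows n \<sigma> C" using left_rows_iff[OF perm x] cUL[OF x] cBL[OF x] by blast
  qed
  have "y \<in> left_rows n \<sigma> C \<longleftrightarrow> y \<in> lf" for y
  proof (cases "1 \<le> y \<and> y \<le> n")
    case True
    then obtain x where "1 \<le> x" "x \<le> n" "\<sigma> x = y" using perm_ex[OF perm] by blast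
    then show ?thesis using left by auto
  next
    case False
    then show ?thesis using sub perm_range[OF perm] by (auto simp: left_rows_def)
  qed
  then have L: "left_rows n \<sigma> C = lf" by auto
  have upper: "(ulr \<sigma> x \<or> urr n \<sigma> x) \<and> (x, \<sigma> x) \<notin> C \<longleftrightarrow> x \<in> uw" if x: "1 < x" "x < n" for x
  proof -
    have x': "1 \<le> x" "x \<le> n" using x by auto
    have nx: "x \<in> up \<longleftrightarrow> x \<in> uw \<and> \<not> (anti_height n m up lf (x - 1) = 0 \<and> Suc n - x \<in> lf)"
      using nat x unfolding natural_upto_def by auto
    show ?thesis
    proof
      assume xu: "x \<in> uw"
      show "(ulr \<sigma> x \<or> urr n \<sigma> x) \<and> (x, \<sigma> x) \<notin> C"
      proof (cases "x \<in> up")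
        case True
        then show ?thesis using cUL[OF x'] cUR[OF x'] by (auto simp: C_def)
      next
        case False
        then have a: "anti_height n m up lf (x - 1) = 0" and l: "Suc n - x \<in> lf" using nx xu by auto
        obtain k where k: "x = Suc k" "1 \<le> k" using x by (cases x) auto
        have b1: "\<sigma> ` {1..k} = {Suc n - k..n}" using lab_anti_zero[OF lab, of k] a k x s1 by simp
        have "1 \<in> {1..k}" using k by auto
        then have "\<sigma> 1 \<in> \<sigma> ` {1..k}" by (rule imageI)
        then have "Suc n - k \<le> m" unfolding b1 using s1 by simp
        then have "anti_height n m up lf x = 0" using anti_height_Suc[of k n m up lf] a l False k x
            by (auto simp: Suc_diff_le)
        then have b2: "\<sigma> ` {1..x} = {Suc n - x..n}" using lab_anti_zero[OF lab, of x] x s1 by simp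
        have "\<sigma> x \<notin> \<sigma> ` {1..k}" using perm_inj[OF perm, of x] k(1)
          by (metis atLeastAtMost_iff imageE not_less_eq_eq order_refl)
        moreover have "\<sigma> x \<in> {Suc n - x..n}" using b2 x by auto
        ultimately have "\<sigma> x = Suc n - x" using b1 k by auto
        then have "blr \<sigma> x \<and> urr n \<sigma> x" using blr_urr_iff[OF perm x'] b1 k by simp
        then show ?thesis by (auto simp: C_def free_fixed_iff[OF perm])
      qed
    next
      assume a: "(ulr \<sigma> x \<or> urr n \<sigma> x) \<and> (x, \<sigma> x) \<notin> C"
      show "x \<in> uw"
      proof (rule ccontr)
        assume nu: "x \<notin> uw"
        then have np: "x \<notin> up" using nx by simp
        show False
        proof (cases "\<sigma> x \<in> lf")
          case True
          then have b: "blr \<sigma> x" using cBL x' np by blast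
          then have "urr n \<sigma> x" using a ulr_blr_first[of x \<sigma>] x by auto
          then have "anti_height n m up lf (x - 1) = 0" "\<sigma> x = Suc n - x" using az[of x] x b by auto
          then show False using adm x True nu by (simp add: admissible_def)
        next
          case False
          then have "brr n \<sigma> x" using cBR x' np by blast
          then show False using a brC[OF x' np False] urr_brr_last[OF x'(2)] x by auto
        qed
      qed
    qed
  qed
  have U: "upper_cols n \<sigma> C = uw"
  proof (rule set_eqI)
    fix x
    consider "x = 1 \<or> x = n" | "1 < x \<and> x < n" | "\<not> (1 \<le> x \<and> x \<le> n)" by linarith
    then show "x \<in> upper_cols n \<sigma> C \<longleftrightarrow> x \<in> uw"
    proof cases
      case 1 then show ?thesis using mem by (auto simp: upper_cols_def)
    next
      case 2
      then have "x \<noteq> 1" "x \<noteq> n" by auto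
      then show ?thesis using upper[of x] 2 unfolding upper_cols_def mem_Collect_eq by blast
    next
      case 3
      then have "x \<notin> uw" using sub(1) by auto
      moreover have "x \<noteq> 1" "x \<noteq> n" "\<not> (1 < x \<and> x < n)" using 3 n by auto
      ultimately show ?thesis unfolding upper_cols_def by blast
    qed
  qed
  have "nat_cols n \<sigma> C = up"
    using csq_nat_set[OF csq n] L U s1 nat_set_eqI[OF nat sub(3) m(2)] n by simp
  then show ?thesis using csq s1 U L by blast
qed

section \<open>Marked words as labelled sets\<close>

text \<open>
  The letters \<open>X\<close> and \<open>Y\<close> at both ends count as upper and left, in accordance with \<open>upper_cols\<close> and
  \<open>left_rows\<close>.
\<close>

definition wup :: "nat \<Rightarrow> (hletter \<times> vletter) list \<Rightarrow> nat set" where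
  "wup n w = {i. i = 1 \<or> i = n \<or> 1 < i \<and> i < n \<and> ulet w i = U}"

definition wlf :: "nat \<Rightarrow> (hletter \<times> vletter) list \<Rightarrow> nat set" where
  "wlf n w = {i. i = 1 \<or> i = n \<or> 1 < i \<and> i < n \<and> vlet w i = L}"

lemma marked_word_eqI:
  assumes "(w, m) \<in> marked_words n" "(w', m) \<in> marked_words n" "wup n w = wup n w'" "wlf n w = wlf n w'"
  shows "w = w'"
proof (rule nth_equalityI)
  show "length w = length w'" using assms by (simp add: marked_words_def)
  fix j assume "j < length w"
  then have i: "1 \<le> Suc j" "Suc j \<le> n" using assms by (auto simp: marked_words_def)
  let ?i = "Suc j"
  have "ulet w ?i = ulet w' ?i \<and> vlet w ?i = vlet w' ?i"
  proof (cases "?i = 1 \<or> ?i = n")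
    case True then show ?thesis using assms(1,2) by (auto simp: marked_words_def)
  next
    case False
    then have i: "1 < ?i" "?i < n" using i by auto
    then have "ulet w ?i \<in> {U, D}" "ulet w' ?i \<in> {U, D}" "vlet w ?i \<in> {L, R}" "vlet w' ?i \<in> {L, R}"
      using assms(1,2) by (auto simp: marked_words_def)
    moreover have "ulet w ?i = U \<longleftrightarrow> ulet w' ?i = U" "vlet w ?i = L \<longleftrightarrow> vlet w' ?i = L"
      using assms(3,4) i unfolding wup_def wlf_def set_eq_iff mem_Collect_eq by (metis nat_neq_iff)+
    ultimately show ?thesis by auto
  qed
  then show "w ! j = w' ! j" by (simp add: ulet_def vlet_def prod_eq_iff)
qed

lemma marked_word_sets:
  assumes "(w, m) \<in> marked_words n" "2 \<le> n"
  shows "1 \<in> wup n w" "n \<in> wup n w" "1 \<in> wlf n w" "n \<in> wlf n w" "m \<in> wlf n w" "1 \<le> m" "m \<le> n"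
    "wup n w \<subseteq> {1..n}" "wlf n w \<subseteq> {1..n}"
proof -
  have m: "1 \<le> m" "m \<le> n" "vlet w m \<in> {L, Y}" "\<forall>i\<in>{1<..<n}. vlet w i \<in> {L, R}" using assms
      by (auto simp: marked_words_def)
  then show "m \<in> wlf n w" by (force simp: wlf_def)
qed (use assms in \<open>auto simp: wup_def wlf_def marked_words_def\<close>)

lemma left_points_iff:
  assumes "\<sigma> permutes {1..n}" "1 \<le> i" "i \<le> n"
  shows "(inv \<sigma> i, i) \<in> left_points (points n \<sigma>) - C \<longleftrightarrow> i \<in> left_rows n \<sigma> C"
proof -
  obtain x where x: "1 \<le> x" "x \<le> n" "\<sigma> x = i" using perm_ex[OF assms] by blast
  then have "inv \<sigma> i = x" using permutes_inj[OF assms(1)] by (auto intro: inv_f_eq)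
  then show ?thesis using x left_rows_iff[OF assms(1) x(1,2)]
      by (auto simp: left_points_def records_points[OF assms(1)])
qed

lemma upper_points_iff:
  assumes "\<sigma> permutes {1..n}" "1 \<le> i" "i \<le> n"
  shows "(i, \<sigma> i) \<in> upper_points (points n \<sigma>) - C \<longleftrightarrow> (ulr \<sigma> i \<or> urr n \<sigma> i) \<and> (i, \<sigma> i) \<notin> C"
  using assms by (auto simp: upper_points_def records_points[OF assms(1)])

lemma code_props:
  assumes csq: "(\<sigma>, C) \<in> colored_square_perms n" and n2: "2 \<le> n"
  shows "code n (\<sigma>, C) \<in> marked_words n" "snd (code n (\<sigma>, C)) = \<sigma> 1"
    "wup n (fst (code n (\<sigma>, C))) = upper_cols n \<sigma> C" "wlf n (fst (code n (\<sigma>, C))) = left_rows n \<sigma> C"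
proof -
  note perm = csq_perm[OF assms] and lab = csq_labelling[OF assms]
  define w where "w = fst (code n (\<sigma>, C))"
  show s1: "snd (code n (\<sigma>, C)) = \<sigma> 1" by (simp add: code_def)
  then have c: "code n (\<sigma>, C) = (w, \<sigma> 1)" by (simp add: w_def prod_eq_iff)
  have len: "length w = n" by (simp add: w_def code_def)
  have nth: "w ! (i - 1) = (if i = 1 \<or> i = n then (X, Y)
               else (if (i, \<sigma> i) \<in> upper_points (points n \<sigma>) - C then U else D,
                     if (inv \<sigma> i, i) \<in> left_points (points n \<sigma>) - C then L else R))" if "1 \<le> i" "i \<le> n" for i
  proof -
    have "[1..<n + 1] ! (i - 1) = i" using nth_upt[of 1 "i - 1" "n + 1"] that by simp
    then show ?thesis unfolding w_def code_def using that by (simp del: upt_Suc add: nth_map)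
  qed
  have u: "ulet w i = (if i = 1 \<or> i = n then X else if i \<in> upper_cols n \<sigma> C then U else D)" if i: "1 \<le> i" "i \<le> n" for i
    using nth[OF i] upper_points_iff[OF perm i, of C] i by (auto simp: ulet_def upper_cols_def le_less)
  have v: "vlet w i = (if i = 1 \<or> i = n then Y else if i \<in> left_rows n \<sigma> C then L else R)" if i: "1 \<le> i" "i \<le> n" for i
    using nth[OF i] left_points_iff[OF perm i, of C] by (auto simp: vlet_def)
  have m: "1 \<le> \<sigma> 1" "\<sigma> 1 \<le> n" using lab_range[OF lab, of 1] n2 by auto
  show "code n (\<sigma>, C) \<in> marked_words n"
    unfolding c marked_words_def using len u v m lab_lf[OF lab] n2 by auto
  show "wup n (fst (code n (\<sigma>, C))) = upper_cols n \<sigma> C"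
  proof (rule set_eqI)
    fix i
    have "ulet w i = U \<longleftrightarrow> i \<in> upper_cols n \<sigma> C" if "1 < i" "i < n" using u[of i] that by simp
    then show "i \<in> wup n (fst (code n (\<sigma>, C))) \<longleftrightarrow> i \<in> upper_cols n \<sigma> C"
      unfolding c by (auto simp: wup_def upper_cols_def)
  qed
  have "left_rows n \<sigma> C \<subseteq> {1..n}"
  proof
    fix y assume "y \<in> left_rows n \<sigma> C"
    then obtain x where "1 \<le> x" "x \<le> n" "y = \<sigma> x" by (auto simp: left_rows_def)
    then show "y \<in> {1..n}" using perm_range[OF perm, of x] by simp
  qed
  then have "i \<in> left_rows n \<sigma> C \<Longrightarrow> i = 1 \<or> i = n \<or> 1 < i \<and> i < n" for i
      using le_less[of 1 i] le_less[of i n] atLeastAtMost_iff[of i 1 n] by blast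
  moreover have "vlet w i = L \<longleftrightarrow> i \<in> left_rows n \<sigma> C" if "1 < i" "i < n" for i using v[of i] that by simp
  ultimately show "wlf n (fst (code n (\<sigma>, C))) = left_rows n \<sigma> C"
    unfolding c wlf_def fst_conv using lab_lf[OF lab] by blast
qed

lemma code_inj_on: assumes "2 \<le> n" shows "inj_on (code n) (colored_square_perms n)"
proof (rule inj_onI)
  fix a b assume ab: "a \<in> colored_square_perms n" "b \<in> colored_square_perms n" "code n a = code n b"
  obtain \<sigma> C \<tau> E where e: "a = (\<sigma>, C)" "b = (\<tau>, E)" by (cases a; cases b) auto
  show "a = b" using csq_determined[of \<sigma> C n \<tau> E] code_props[of \<sigma> C n] code_props[of \<tau> E n] ab assms unfolding e
      by metis
qed

text \<open>
  The colored square permutation produced by \<open>csq_exists\<close> has the labels of the word as its code.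
\<close>

lemma code_image_iff:
  assumes w: "(w, m) \<in> marked_words n" and n: "2 \<le> n"
  shows "(w, m) \<in> code n ` colored_square_perms n \<longleftrightarrow>
    admissible n m (wup n w) (wlf n w) (nat_set n m (wup n w) (wlf n w))"
proof
  assume "(w, m) \<in> code n ` colored_square_perms n"
  then obtain \<sigma> C where c: "(\<sigma>, C) \<in> colored_square_perms n" "code n (\<sigma>, C) = (w, m)" by (metis imageE surj_pair)
  then show "admissible n m (wup n w) (wlf n w) (nat_set n m (wup n w) (wlf n w))"
    using csq_admissible[OF c(1) n] code_props[OF c(1) n] csq_nat_set[OF c(1) n] by simp
next
  assume a: "admissible n m (wup n w) (wlf n w) (nat_set n m (wup n w) (wlf n w))"
  note s = marked_word_sets[OF assms]
  obtain \<sigma> C where c: "(\<sigma>, C) \<in> colored_square_perms n" "\<sigma> 1 = m" "upper_cols n \<sigma> C = wup n w"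
      "left_rows n \<sigma> C = wlf n w"
    using csq_exists[OF n s(6,7) s(1-5) s(8,9) nat_set_sub nat_set_natural a] n by auto
  then have "code n (\<sigma>, C) = (fst (code n (\<sigma>, C)), m)" using code_props[OF c(1) n] by (simp add: prod_eq_iff)
  then have "fst (code n (\<sigma>, C)) = w"
    using marked_word_eqI[of "fst (code n (\<sigma>, C))" m n w] code_props[OF c(1) n] c w by simp
  then show "(w, m) \<in> code n ` colored_square_perms n" using c \<open>code n (\<sigma>, C) = _\<close> by (metis imageI)
qed

section \<open>Bottom-left blocks and the diagonal height\<close>

text \<open>
  A permutation that fixes \<open>k + 1\<close> and its restriction to \<open>1..k\<close> are the same function on all
  natural numbers.
\<close>

lemma D_sw_iff: "(\<rho>, C) \<in> D_sw k \<longleftrightarrow> \<rho> permutes {1..k} \<and> (\<rho>, C) \<in> colored_square_perms (Suc k)"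
proof
  assume a: "(\<rho>, C) \<in> D_sw k"
  then obtain \<tau> where t: "(\<tau>, C) \<in> colored_square_perms (Suc k)" "\<tau> (Suc k) = Suc k" "\<forall>i\<in>{1..k}. \<rho> i = \<tau> i"
    and p: "\<rho> permutes {1..k}" by (auto simp: D_sw_def)
  have "\<tau> permutes {1..Suc k}" using t by (auto simp: colored_square_perms_def square_perms_def)
  have "\<rho> x = \<tau> x" for x
  proof -
    consider "x \<in> {1..k}" | "x = Suc k" | "x \<notin> {1..Suc k}" by fastforce
    then show ?thesis
    proof cases
      case 3
      then have "x \<notin> {1..k}" by auto
      then show ?thesis using 3 permutes_not_in[OF p] permutes_not_in[OF \<open>\<tau> permutes {1..Suc k}\<close>] by metis
    qed (use t permutes_not_in[OF p, of x] in auto)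
  qed
  then have "\<rho> = \<tau>" by auto
  then show "\<rho> permutes {1..k} \<and> (\<rho>, C) \<in> colored_square_perms (Suc k)" using p t by simp
next
  assume a: "\<rho> permutes {1..k} \<and> (\<rho>, C) \<in> colored_square_perms (Suc k)"
  then have "\<rho> (Suc k) = Suc k" using permutes_not_in[of \<rho> "{1..k}" "Suc k"] by simp
  then show "(\<rho>, C) \<in> D_sw k" using a by (auto simp: D_sw_def)
qed

text \<open>A new point at the top right hides all UR records and leaves the other records unchanged.\<close>

lemma T_sw_iff: assumes "1 \<le> k" shows "\<rho> \<in> T_sw k \<longleftrightarrow> (\<rho>, {}) \<in> D_sw k"
proof (cases "\<rho> permutes {1..k}")
  case True
  then have last: "\<rho> (Suc k) = Suc k" using permutes_not_in[of \<rho> "{1..k}" "Suc k"] by simp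
  have p': "\<rho> permutes {1..Suc k}" using permutes_subset[OF True] by simp
  have T: "\<rho> \<in> T_sw k \<longleftrightarrow> (\<forall>x. 1 \<le> x \<longrightarrow> x \<le> k \<longrightarrow> ulr \<rho> x \<or> blr \<rho> x \<or> brr k \<rho> x)"
  proof -
    have "\<rho> \<in> T_sw k \<longleftrightarrow> (\<forall>x\<in>{1..k}. (x, \<rho> x) \<in> UL_records (points k \<rho>) \<union> BL_records (points k \<rho>) \<union> BR_records (points k
        \<rho>))"
      using True by (auto simp: T_sw_def points_def)
    then show ?thesis using True by (auto simp: records_points[OF True])
  qed
  have "urr (Suc k) \<rho> x \<longleftrightarrow> False" "brr (Suc k) \<rho> x \<longleftrightarrow> brr k \<rho> x" if x: "1 \<le> x" "x \<le> k" for x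
  proof -
    have lt: "\<rho> x < \<rho> (Suc k)" using perm_range[OF True x] last by simp
    then show "urr (Suc k) \<rho> x \<longleftrightarrow> False" unfolding urr_def using x by (metis less_Suc_eq_le less_asym order_refl)
    show "brr (Suc k) \<rho> x \<longleftrightarrow> brr k \<rho> x" unfolding brr_def using lt by (metis le_Suc_eq)
  qed
  moreover have "(\<rho>, {}) \<in> D_sw k \<longleftrightarrow> (\<forall>x. 1 \<le> x \<longrightarrow> x \<le> Suc k \<longrightarrow> ulr \<rho> x \<or> blr \<rho> x \<or> urr (Suc k) \<rho> x \<or> brr (Suc k) \<rho> x)"
    using True p' by (simp add: D_sw_iff colored_square_perms_def square_iff)
  ultimately show ?thesis using T urr_n[of "Suc k" \<rho>] by (metis le_Suc_eq)
qed (simp add: T_sw_def D_sw_def)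

context
  fixes k :: nat and \<rho> :: "nat \<Rightarrow> nat" and C :: "point set"
  assumes Dsw: "(\<rho>, C) \<in> D_sw k" and k1: "1 \<le> k"
begin

lemma Dsw_csq: "(\<rho>, C) \<in> colored_square_perms (Suc k)" and Dsw_perm: "\<rho> permutes {1..k}"
  and Dsw_perm': "\<rho> permutes {1..Suc k}" and Dsw_last: "\<rho> (Suc k) = Suc k" and Dsw_k: "2 \<le> Suc k"
  and Dsw_lab: "sq_labelling (Suc k) \<rho> (nat_cols (Suc k) \<rho> C) (left_rows (Suc k) \<rho> C)"
proof -
  show c: "(\<rho>, C) \<in> colored_square_perms (Suc k)" and p: "\<rho> permutes {1..k}" using Dsw D_sw_iff by auto
  show "2 \<le> Suc k" using k1 by simp
  then show "sq_labelling (Suc k) \<rho> (nat_cols (Suc k) \<rho> C) (left_rows (Suc k) \<rho> C)" using csq_labelling c by blast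
  show "\<rho> permutes {1..Suc k}" using c by (auto simp: colored_square_perms_def square_perms_def)
  show "\<rho> (Suc k) = Suc k" using permutes_not_in[OF p, of "Suc k"] by simp
qed

lemma Dsw_a: assumes "1 < i" "i \<le> k" shows "sw_a k (\<rho>, C) i = (if i \<in> nat_cols (Suc k) \<rho> C then U else D)"
proof -
  have "\<rho> i < \<rho> (Suc k)" using perm_range[OF Dsw_perm, of i] Dsw_last assms by simp
  then have "\<not> urr (Suc k) \<rho> i" unfolding urr_def using assms by (metis less_Suc_eq_le less_asym order_refl)
  then show ?thesis using assms by (simp add: sw_a_def nat_cols_def records_points[OF Dsw_perm])
qed

lemma Dsw_b: assumes "1 < i" "i \<le> k" shows "sw_b k (\<rho>, C) i = (if i \<in> left_rows (Suc k) \<rho> C then L else R)"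
proof -
  obtain x where x: "1 \<le> x" "x \<le> k" "\<rho> x = i" using perm_ex[OF Dsw_perm, of i] assms by auto
  have "i \<in> left_rows k \<rho> C \<longleftrightarrow> i \<in> left_rows (Suc k) \<rho> C"
    using left_rows_iff[OF Dsw_perm x(1,2), of C] left_rows_iff[OF Dsw_perm' x(1), of C] x by simp
  then show ?thesis using left_points_iff[OF Dsw_perm, of i C] assms by (simp add: sw_b_def)
qed

lemma Dsw_match:
  assumes w: "(w, m) \<in> marked_words n" and k: "k < n"
  shows "(\<forall>i\<in>{1..k}. ulet w i = sw_a k (\<rho>, C) i \<and> vlet w i = sw_b k (\<rho>, C) i) \<longleftrightarrow>
    (\<forall>i. 1 < i \<longrightarrow> i \<le> k \<longrightarrow> (i \<in> wup n w \<longleftrightarrow> i \<in> nat_cols (Suc k) \<rho> C) \<and> (i \<in> wlf n w \<longleftrightarrow> i \<in> left_rows (Suc k) \<rho> C))"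
proof -
  have "(ulet w i = sw_a k (\<rho>, C) i \<longleftrightarrow> (i \<in> wup n w \<longleftrightarrow> i \<in> nat_cols (Suc k) \<rho> C)) \<and>
      (vlet w i = sw_b k (\<rho>, C) i \<longleftrightarrow> (i \<in> wlf n w \<longleftrightarrow> i \<in> left_rows (Suc k) \<rho> C))" if i: "1 < i" "i \<le> k" for i
  proof -
    have "ulet w i \<in> {U, D}" "vlet w i \<in> {L, R}" using w i k by (auto simp: marked_words_def)
    then show ?thesis using Dsw_a[OF i] Dsw_b[OF i] i k by (auto simp: wup_def wlf_def)
  qed
  moreover have "ulet w 1 = sw_a k (\<rho>, C) 1" "vlet w 1 = sw_b k (\<rho>, C) 1"
    using w by (auto simp: marked_words_def sw_a_def sw_b_def)
  ultimately show ?thesis unfolding Ball_def atLeastAtMost_iff by (metis le_neq_implies_less less_imp_le)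
qed

lemma Dsw_heights:
  assumes w: "(w, m) \<in> marked_words n" and k: "k < n" and m: "m = \<rho> 1"
    and ma: "\<forall>i\<in>{1..k}. ulet w i = sw_a k (\<rho>, C) i \<and> vlet w i = sw_b k (\<rho>, C) i" and i: "i \<le> k"
  shows "diag_height m (wup n w) (wlf n w) i = diag_height (\<rho> 1) (nat_cols (Suc k) \<rho> C) (left_rows (Suc k) \<rho> C) i"
proof -
  have agree: "(j \<in> wup n w \<longleftrightarrow> j \<in> nat_cols (Suc k) \<rho> C) \<and> (j \<in> wlf n w \<longleftrightarrow> j \<in> left_rows (Suc k) \<rho> C)"
    if "1 \<le> j" "j \<le> k" for j
  proof (cases "j = 1")
    case True
    then show ?thesis using lab_up[OF Dsw_lab] lab_lf[OF Dsw_lab] by (simp add: wup_def wlf_def)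
  next
    case False
    then show ?thesis using Dsw_match[OF w k] ma that by auto
  qed
  have "1 \<le> m" using lab_range[OF Dsw_lab, of 1] m by simp
  then show ?thesis unfolding m[symmetric] by (intro diag_height_cong) (use agree i in auto)
qed

end

text \<open>
  The first \<open>k\<close> letters, completed by an upper column and a left row \<open>k + 1\<close>, are the labels of a
  colored square permutation of size \<open>k + 1\<close>: as the diagonal height vanishes at \<open>k\<close>, the
  antidiagonal height is positive, hence the word is admissible. The zero at \<open>k\<close> is a diagonal
  block, so the last value is \<open>k + 1\<close>.
\<close>

lemma sw_block_exists:
  assumes w: "(w, m) \<in> marked_words n" and n: "2 \<le> n" and k: "1 \<le> k" "k < n"
    and z: "diag_height m (wup n w) (wlf n w) k = 0"
    and nn: "\<And>i. 1 \<le> i \<Longrightarrow> i \<le> k \<Longrightarrow> 0 \<le> diag_height m (wup n w) (wlf n w) i"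
  shows "\<exists>\<rho> C. (\<rho>, C) \<in> D_sw k \<and> m = \<rho> 1 \<and>
    (\<forall>i\<in>{1..k}. ulet w i = sw_a k (\<rho>, C) i \<and> vlet w i = sw_b k (\<rho>, C) i)"
proof -
  note s = marked_word_sets[OF w n]
  let ?N = "Suc k"
  have N: "2 \<le> ?N" "1 \<le> ?N" using k by auto
  have "1 \<le> cnt (wup n w) 1 k" using cnt_pos[of 1 "wup n w" 1 k] s(1) k by auto
  then have mk: "m \<le> k" using z cnt_empty[of k m "wlf n w"] by (cases "m \<le> k") (auto simp: diag_height_def)
  define uw where "uw = wup n w \<inter> {1..k} \<union> {?N}"
  define lf where "lf = wlf n w \<inter> {1..k} \<union> {?N}"
  have dh: "diag_height m uw lf i = diag_height m (wup n w) (wlf n w) i" if "i \<le> k" for i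
    by (rule diag_height_cong) (use that s in \<open>auto simp: uw_def lf_def\<close>)
  have mem: "1 \<in> uw" "?N \<in> uw" "1 \<in> lf" "?N \<in> lf" "m \<in> lf" using s k mk by (auto simp: uw_def lf_def)
  have sub: "uw \<subseteq> {1..?N}" "lf \<subseteq> {1..?N}" by (auto simp: uw_def lf_def)
  have mN: "m \<le> ?N" using mk by simp
  have ah: "anti_height ?N m uw lf i > 0" if "1 \<le> i" "i < ?N" for i
  proof (rule ccontr)
    assume "\<not> ?thesis"
    then have "1 \<le> diag_height m uw lf k"
      using diag_pos_of_anti_nonpos[OF s(6) mN mem(1,4) that, of k] k by simp
    then show False using dh[of k] z by simp
  qed
  have nat: "natural_upto ?N m uw lf uw ?N" unfolding natural_upto_def
  proof (intro conjI allI impI)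
    fix i assume "1 < i" "i \<le> ?N"
    then have "1 \<le> i - 1" "i - 1 < ?N" by auto
    then have "anti_height ?N m uw lf (i - 1) \<noteq> 0" using ah[of "i - 1"] by simp
    then show "i \<in> uw \<longleftrightarrow> i \<in> uw \<and> \<not> (anti_height ?N m uw lf (i - 1) = 0 \<and> Suc ?N - i \<in> lf)" by simp
  qed (rule mem)
  have adm: "admissible ?N m uw lf uw" unfolding admissible_def
  proof (intro conjI allI impI)
    fix i
    { assume "1 \<le> i" "i < ?N" then show "0 \<le> diag_height m uw lf i" using dh[of i] nn[of i] by simp }
    assume "1 < i" "i < ?N" and a: "anti_height ?N m uw lf (i - 1) = 0"
    then have "1 \<le> i - 1" "i - 1 < ?N" by auto
    then show "i \<in> uw \<longleftrightarrow> Suc ?N - i \<in> lf" using ah[of "i - 1"] a by simp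
  qed
  obtain \<rho> C where c: "(\<rho>, C) \<in> colored_square_perms ?N" "\<rho> 1 = m" "left_rows ?N \<rho> C = lf" "nat_cols ?N \<rho> C = uw"
    using csq_exists[OF N(1) s(6) mN mem sub sub(1) nat adm] by blast
  note lab = csq_labelling[OF c(1) N(1)]
  have im: "\<rho> ` {1..k} = {1..k}" using lab_diag_zero[OF lab, of k] dh[of k] z k c by simp
  have "\<rho> ?N \<notin> \<rho> ` {1..k}" using lab_inj[OF lab, of ?N] by (metis atLeastAtMost_iff imageE not_less_eq_eq order_refl)
  moreover have "1 \<le> \<rho> ?N" "\<rho> ?N \<le> ?N" using lab_range[OF lab, of ?N] by auto
  ultimately have "\<rho> ?N = ?N" unfolding im by (simp add: le_Suc_eq)
  then have "\<rho> permutes {1..k}" using permutes_superset[OF lab_perm[OF lab], of "{1..k}"] by (auto simp: le_Suc_eq)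
  then have D: "(\<rho>, C) \<in> D_sw k" using c D_sw_iff by simp
  have "\<forall>i. 1 < i \<longrightarrow> i \<le> k \<longrightarrow> (i \<in> wup n w \<longleftrightarrow> i \<in> nat_cols ?N \<rho> C) \<and> (i \<in> wlf n w \<longleftrightarrow> i \<in> left_rows ?N \<rho> C)"
    unfolding c by (auto simp: uw_def lf_def)
  then have "\<forall>i\<in>{1..k}. ulet w i = sw_a k (\<rho>, C) i \<and> vlet w i = sw_b k (\<rho>, C) i"
    using Dsw_match[OF D k(1) w k(2)] by blast
  then show ?thesis using D c by metis
qed

lemma Dsw_diag_heights:
  assumes D: "(\<rho>, C) \<in> D_sw k" and k: "1 \<le> k" "k < n" and w: "(w, m) \<in> marked_words n" and m: "m = \<rho> 1"
    and ma: "\<forall>i\<in>{1..k}. ulet w i = sw_a k (\<rho>, C) i \<and> vlet w i = sw_b k (\<rho>, C) i"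
  shows "diag_height m (wup n w) (wlf n w) k = 0"
    and "\<And>i. i \<le> k \<Longrightarrow> 0 \<le> diag_height m (wup n w) (wlf n w) i"
proof -
  note lab = Dsw_lab[OF D k(1)]
  show "diag_height m (wup n w) (wlf n w) k = 0"
    using Dsw_heights[OF D k(1) w k(2) m ma, of k] lab_diag_zero[OF lab, of k] permutes_image[OF Dsw_perm[OF D k(1)]] k
        by simp
  fix i assume "i \<le> k"
  then show "0 \<le> diag_height m (wup n w) (wlf n w) i"
    using Dsw_heights[OF D k(1) w k(2) m ma, of i] lab_diag_height[OF lab, of i] by simp
qed

text \<open>
  The height is nonnegative at \<open>1\<close> and changes by at most one in each step, so it becomes negative
  by a descent from zero, which takes a lower column and a left row.
\<close>

lemma first_diag_descent:
  assumes m: "1 \<le> m" and up: "1 \<in> up" and i: "1 \<le> i" "diag_height m up lf i < 0"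
  obtains k where "1 \<le> k" "k < i" "diag_height m up lf k = 0" "Suc k \<notin> up" "Suc k \<in> lf"
    "\<And>j. 1 \<le> j \<Longrightarrow> j \<le> k \<Longrightarrow> 0 \<le> diag_height m up lf j"
proof -
  define l where "l = (LEAST i. 1 \<le> i \<and> diag_height m up lf i < 0)"
  have l: "1 \<le> l" "diag_height m up lf l < 0" using LeastI[of "\<lambda>i. 1 \<le> i \<and> diag_height m up lf i < 0"] i
      by (auto simp: l_def)
  have min: "0 \<le> diag_height m up lf j" if "1 \<le> j" "j < l" for j
    using not_less_Least[of j "\<lambda>i. 1 \<le> i \<and> diag_height m up lf i < 0"] that by (auto simp: l_def)
  have "l \<le> i" using Least_le[of "\<lambda>i. 1 \<le> i \<and> diag_height m up lf i < 0"] i by (auto simp: l_def)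
  moreover have "l \<noteq> 1" using diag_height_1[OF m up, of lf] l(2) by (intro notI) simp
  then obtain k where k: "l = Suc k" "1 \<le> k" using l by (cases l) auto
  moreover have "0 \<le> diag_height m up lf k" using min[of k] k by simp
  moreover have "diag_height m up lf k = 0 \<and> Suc k \<notin> up \<and> Suc k \<in> lf"
    using diag_height_Suc[OF m, of up lf k] l(2) calculation k by (simp split: if_splits)
  ultimately show ?thesis using that[of k] min k by simp
qed

lemma image_drop_fixed:
  assumes "\<sigma> permutes S" "\<sigma> ` {1..Suc k} = {1..Suc k}" "\<sigma> (Suc k) = Suc k"
  shows "\<sigma> ` {1..k} = {1..k}"
proof -
  have "{1..k} = {1..Suc k} - {Suc k}" by auto
  then show ?thesis using image_set_diff[OF permutes_inj[OF assms(1)], of "{1..Suc k}" "{Suc k}"] assms(2,3) by simp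
qed

text \<open>
  At the end of a block from \<open>D_sw\<close> the height is zero, and the letters \<open>(D, L)\<close> lower it to \<open>-1\<close>.
  Conversely, the word is cut before its first negative height.
\<close>

lemma A'_iff:
  assumes w: "(w, m) \<in> marked_words n" and n: "2 \<le> n"
  shows "(w, m) \<in> A'_words n \<longleftrightarrow> (\<exists>i. 1 \<le> i \<and> i < n \<and> diag_height m (wup n w) (wlf n w) i < 0)"
proof
  note s = marked_word_sets[OF w n]
  assume "(w, m) \<in> A'_words n"
  then obtain k \<rho> C where k: "1 \<le> k" "k \<le> n - 2" and D: "(\<rho>, C) \<in> D_sw k" and m: "m = \<rho> 1"
    and ma: "\<forall>i\<in>{1..k}. ulet w i = sw_a k (\<rho>, C) i \<and> vlet w i = sw_b k (\<rho>, C) i"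
    and l: "ulet w (k + 1) = D" "vlet w (k + 1) = L" by (auto simp: A'_words_def)
  have k': "k < n" "Suc k < n" using k by auto
  have z: "diag_height m (wup n w) (wlf n w) k = 0" by (rule Dsw_diag_heights[OF D k(1) k'(1) w m ma])
  have "m \<le> k" using perm_range[OF Dsw_perm[OF D k(1)], of 1] m k by simp
  then have "diag_height m (wup n w) (wlf n w) (Suc k) = -1"
    using diag_height_Suc[OF s(6), of "wup n w" "wlf n w" k] z l k k' by (simp add: wup_def wlf_def)
  then show "\<exists>i. 1 \<le> i \<and> i < n \<and> diag_height m (wup n w) (wlf n w) i < 0" using k' by (intro exI[of _ "Suc k"]) simp
next
  note s = marked_word_sets[OF w n]
  assume "\<exists>i. 1 \<le> i \<and> i < n \<and> diag_height m (wup n w) (wlf n w) i < 0"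
  then obtain i where i: "1 \<le> i" "i < n" "diag_height m (wup n w) (wlf n w) i < 0" by blast
  obtain k where k: "1 \<le> k" "k < i" "diag_height m (wup n w) (wlf n w) k = 0" "Suc k \<notin> wup n w" "Suc k \<in> wlf n w"
    "\<And>j. 1 \<le> j \<Longrightarrow> j \<le> k \<Longrightarrow> 0 \<le> diag_height m (wup n w) (wlf n w) j"
    using first_diag_descent[OF s(6,1) i(1,3)] by blast
  have kn: "k < n" "Suc k < n" "k \<in> {1..n - 2}" using k i by auto
  obtain \<rho> C where r: "(\<rho>, C) \<in> D_sw k" "m = \<rho> 1"
    "\<forall>i\<in>{1..k}. ulet w i = sw_a k (\<rho>, C) i \<and> vlet w i = sw_b k (\<rho>, C) i"
    using sw_block_exists[OF w n k(1) kn(1) k(3,6)] by blast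
  have "ulet w (Suc k) \<in> {U, D}" using w kn k by (auto simp: marked_words_def)
  then have "ulet w (k + 1) = D" "vlet w (k + 1) = L" using k kn by (auto simp: wup_def wlf_def)
  then show "(w, m) \<in> A'_words n" using w r kn unfolding A'_words_def by blast
qed

text \<open>
  Cutting at the smallest \<open>k\<close> keeps the block uncolored, since before a colored point there is a
  shorter diagonal block followed by the letter \<open>D\<close>.
\<close>

lemma A_iff:
  assumes w: "(w, m) \<in> marked_words n" and n: "2 \<le> n"
  shows "(w, m) \<in> A_words n \<longleftrightarrow>
    (\<exists>k. 1 \<le> k \<and> Suc k < n \<and> diag_height m (wup n w) (wlf n w) k \<le> 0 \<and> Suc k \<notin> wup n w)"
proof
  assume "(w, m) \<in> A_words n"
  then obtain k \<rho> where k: "1 \<le> k" "k \<le> n - 2" and D: "\<rho> \<in> T_sw k" and m: "m = \<rho> 1"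
    and ma: "\<forall>i\<in>{1..k}. ulet w i = sw_a k (\<rho>, {}) i \<and> vlet w i = sw_b k (\<rho>, {}) i"
    and l: "ulet w (k + 1) = D" by (auto simp: A_words_def)
  have k': "k < n" "Suc k < n" using k by auto
  have D': "(\<rho>, {}) \<in> D_sw k" using D T_sw_iff k by simp
  have "diag_height m (wup n w) (wlf n w) k = 0" by (rule Dsw_diag_heights[OF D' k(1) k'(1) w m ma])
  moreover have "Suc k \<notin> wup n w" using l k k' by (simp add: wup_def)
  ultimately show "\<exists>k. 1 \<le> k \<and> Suc k < n \<and> diag_height m (wup n w) (wlf n w) k \<le> 0 \<and> Suc k \<notin> wup n w"
    using k k' by auto
next
  note s = marked_word_sets[OF w n]
  let ?P = "\<lambda>k. 1 \<le> k \<and> Suc k < n \<and> diag_height m (wup n w) (wlf n w) k \<le> 0 \<and> Suc k \<notin> wup n w"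
  assume "\<exists>k. ?P k"
  then obtain k where k: "?P k" and min: "\<And>j. j < k \<Longrightarrow> \<not> ?P j" using exists_least_iff[of ?P] by blast
  have nn: "0 \<le> diag_height m (wup n w) (wlf n w) j" if j: "1 \<le> j" "j \<le> k" for j
  proof (rule ccontr)
    assume "\<not> ?thesis"
    then obtain k' where "1 \<le> k'" "k' < j" "diag_height m (wup n w) (wlf n w) k' = 0" "Suc k' \<notin> wup n w"
      using first_diag_descent[OF s(6,1) j(1), of "wlf n w"] by force
    then show False using min[of k'] j k by simp
  qed
  have z: "diag_height m (wup n w) (wlf n w) k = 0" using nn[of k] k by simp
  have kn: "1 \<le> k" "k < n" using k by auto
  obtain \<rho> C where r: "(\<rho>, C) \<in> D_sw k" "m = \<rho> 1"
    "\<forall>i\<in>{1..k}. ulet w i = sw_a k (\<rho>, C) i \<and> vlet w i = sw_b k (\<rho>, C) i"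
    using sw_block_exists[OF w n kn z nn] by blast
  note csq = Dsw_csq[OF r(1) kn(1)] and lab = Dsw_lab[OF r(1) kn(1)] and k2 = Dsw_k[OF r(1) kn(1)]
  have "C = {}"
  proof (rule ccontr)
    assume "C \<noteq> {}"
    then obtain p where "p \<in> C" by auto
    then obtain x y where xy: "(x, y) \<in> C" by (metis surj_pair)
    have x: "y = x" "1 < x" "x < Suc k" "\<rho> x = x" "\<rho> ` {1..x} = {1..x}" using csq_C[OF csq k2 xy] by auto
    have "\<rho> ` {1..x - 1} = {1..x - 1}"
      using image_drop_fixed[OF Dsw_perm'[OF r(1) kn(1)], of "x - 1"] x by simp
    then have "diag_height (\<rho> 1) (nat_cols (Suc k) \<rho> C) (left_rows (Suc k) \<rho> C) (x - 1) = 0"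
      using lab_diag_zero[OF lab, of "x - 1"] x by simp
    then have "diag_height m (wup n w) (wlf n w) (x - 1) = 0"
      using Dsw_heights[OF r(1) kn(1) w kn(2) r(2,3), of "x - 1"] x by simp
    moreover have "x \<notin> nat_cols (Suc k) \<rho> C" using xy x by (auto simp: nat_cols_def)
    then have "x \<notin> wup n w" using Dsw_match[OF r(1) kn(1) w kn(2)] r(3) x by auto
    moreover obtain z where "x = Suc z" "1 \<le> z" using x by (cases x) auto
    ultimately show False using min[of z] x k by simp
  qed
  then have "\<rho> \<in> T_sw k" using r T_sw_iff kn by simp
  moreover have "ulet w (Suc k) \<in> {U, D}" using w k by (auto simp: marked_words_def)
  then have "ulet w (k + 1) = D" using k by (auto simp: wup_def)
  moreover have "k \<in> {1..n - 2}" using k by auto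
  ultimately show "(w, m) \<in> A_words n" using w r \<open>C = {}\<close> unfolding A_words_def by blast
qed

section \<open>Top-left blocks and the antidiagonal height\<close>

text \<open>
  A new point is added at the bottom right, where it hides all BR records. So the permutations whose
  points are UL, UR and BL records become the square permutations of this shape.
\<close>

definition nw_ext :: "nat \<Rightarrow> (nat \<Rightarrow> nat) \<Rightarrow> nat \<Rightarrow> nat" where
  "nw_ext k \<rho> x = (if 1 \<le> x \<and> x \<le> k then Suc (\<rho> x) else if x = Suc k then 1 else x)"

lemma nw_ext_records:
  assumes "\<rho> permutes {1..k}" "1 \<le> x" "x \<le> k"
  shows "ulr (nw_ext k \<rho>) x \<longleftrightarrow> ulr \<rho> x" "blr (nw_ext k \<rho>) x \<longleftrightarrow> blr \<rho> x"
    "urr (Suc k) (nw_ext k \<rho>) x \<longleftrightarrow> urr k \<rho> x" "\<not> brr (Suc k) (nw_ext k \<rho>) x"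
proof -
  have v: "nw_ext k \<rho> z = Suc (\<rho> z)" if "1 \<le> z" "z \<le> k" for z using that by (simp add: nw_ext_def)
  have r: "1 \<le> \<rho> x" using perm_range[OF assms] by simp
  show "ulr (nw_ext k \<rho>) x \<longleftrightarrow> ulr \<rho> x" "blr (nw_ext k \<rho>) x \<longleftrightarrow> blr \<rho> x" using v assms by (auto simp: ulr_def blr_def)
  show "urr (Suc k) (nw_ext k \<rho>) x \<longleftrightarrow> urr k \<rho> x"
    unfolding urr_def
  proof (intro iffI allI impI)
    fix z assume a: "\<forall>z>x. z \<le> Suc k \<longrightarrow> nw_ext k \<rho> z < nw_ext k \<rho> x" and z: "x < z" "z \<le> k"
    then have "nw_ext k \<rho> z < nw_ext k \<rho> x" by simp
    then show "\<rho> z < \<rho> x" using v[of z] v[of x] z assms by simp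
  next
    fix z assume a: "\<forall>z>x. z \<le> k \<longrightarrow> \<rho> z < \<rho> x" and z: "x < z" "z \<le> Suc k"
    show "nw_ext k \<rho> z < nw_ext k \<rho> x"
    proof (cases "z = Suc k")
      case True then show ?thesis using v[of x] r assms by (simp add: nw_ext_def)
    next
      case False then show ?thesis using a z v[of z] v[of x] assms by simp
    qed
  qed
  have "\<not> nw_ext k \<rho> x < nw_ext k \<rho> (Suc k)" using v[of x] r assms by (simp add: nw_ext_def)
  then show "\<not> brr (Suc k) (nw_ext k \<rho>) x" unfolding brr_def using assms(3) by (meson le_imp_less_Suc order_refl)
qed

lemma T_nw_iff_records:
  assumes "\<rho> permutes {1..k}"
  shows "\<rho> \<in> T_nw k \<longleftrightarrow> (\<forall>x. 1 \<le> x \<longrightarrow> x \<le> k \<longrightarrow> ulr \<rho> x \<or> urr k \<rho> x \<or> blr \<rho> x)"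
proof -
  have "\<rho> \<in> T_nw k \<longleftrightarrow> (\<forall>x\<in>{1..k}. (x, \<rho> x) \<in> UL_records (points k \<rho>) \<union> UR_records (points k \<rho>) \<union> BL_records (points k
      \<rho>))"
    using assms by (auto simp: T_nw_def points_def)
  then show ?thesis by (auto simp: records_points[OF assms])
qed

lemma nw_ext_permutes:
  assumes "\<rho> permutes {1..k}"
  shows "nw_ext k \<rho> permutes {1..Suc k}"
proof (rule bij_imp_permutes)
  have inj: "inj_on (nw_ext k \<rho>) {1..Suc k}"
  proof (rule inj_onI)
    fix x y assume a: "x \<in> {1..Suc k}" "y \<in> {1..Suc k}" "nw_ext k \<rho> x = nw_ext k \<rho> y"
    have r: "1 \<le> \<rho> z" if "1 \<le> z" "z \<le> k" for z using perm_range[OF assms that] by simp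
    show "x = y" using a r[of x] r[of y] perm_inj[OF assms, of x y]
        by (auto simp: nw_ext_def le_Suc_eq split: if_splits)
  qed
  have "nw_ext k \<rho> ` {1..Suc k} \<subseteq> {1..Suc k}"
  proof
    fix y assume "y \<in> nw_ext k \<rho> ` {1..Suc k}"
    then obtain x where "1 \<le> x" "x \<le> Suc k" "y = nw_ext k \<rho> x" by auto
    then show "y \<in> {1..Suc k}" using perm_range[OF assms, of x] by (auto simp: nw_ext_def)
  qed
  then show "bij_betw (nw_ext k \<rho>) {1..Suc k} {1..Suc k}"
    using inj endo_inj_surj[of "{1..Suc k}" "nw_ext k \<rho>"] by (simp add: bij_betw_def)
qed (auto simp: nw_ext_def)

lemma T_nw_iff:
  assumes "\<rho> permutes {1..k}"
  shows "\<rho> \<in> T_nw k \<longleftrightarrow> (nw_ext k \<rho>, {}) \<in> colored_square_perms (Suc k)"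
proof -
  have "(nw_ext k \<rho>, {}) \<in> colored_square_perms (Suc k) \<longleftrightarrow>
    (\<forall>x. 1 \<le> x \<longrightarrow> x \<le> Suc k \<longrightarrow> ulr (nw_ext k \<rho>) x \<or> blr (nw_ext k \<rho>) x \<or> urr (Suc k) (nw_ext k \<rho>) x \<or> brr (Suc k) (nw_ext
        k \<rho>) x)"
    using nw_ext_permutes[OF assms] by (simp add: colored_square_perms_def square_iff)
  then show ?thesis using nw_ext_records[OF assms] T_nw_iff_records[OF assms] urr_n[of "Suc k" "nw_ext k \<rho>"]
      by (metis le_Suc_eq)
qed

context
  fixes k :: nat and \<rho> \<tau> :: "nat \<Rightarrow> nat" and n m :: nat and w up
  assumes T: "\<rho> \<in> T_nw k" and k1: "1 \<le> k" "k < n"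
    and w: "(w, m) \<in> marked_words n" and m: "m = n - k + \<rho> 1"
  defines "\<tau> \<equiv> nw_ext k \<rho>" and "up \<equiv> nat_set n m (wup n w) (wlf n w)"
begin

lemma Tnw_perm: "\<rho> permutes {1..k}" and Tnw_csq: "(\<tau>, {}) \<in> colored_square_perms (Suc k)"
  and Tnw_perm': "\<tau> permutes {1..Suc k}"
      and Tnw_lab: "sq_labelling (Suc k) \<tau> (nat_cols (Suc k) \<tau> {}) (left_rows (Suc k) \<tau> {})"
proof -
  show p: "\<rho> permutes {1..k}" using T by (simp add: T_nw_def)
  then show c: "(\<tau>, {}) \<in> colored_square_perms (Suc k)" using T T_nw_iff by (simp add: \<tau>_def)
  show "\<tau> permutes {1..Suc k}" using nw_ext_permutes[OF p] by (simp add: \<tau>_def)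
  show "sq_labelling (Suc k) \<tau> (nat_cols (Suc k) \<tau> {}) (left_rows (Suc k) \<tau> {})"
    using csq_labelling[OF c] k1 by simp
qed

lemma Tnw_match:
  "(\<forall>i\<in>{1..k}. ulet w i = nw_a k \<rho> i \<and> vlet w (n - k + i) = nw_b k \<rho> i) \<longleftrightarrow>
    (\<forall>i. 1 < i \<longrightarrow> i \<le> k \<longrightarrow> (i \<in> wup n w \<longleftrightarrow> i \<in> upper_cols (Suc k) \<tau> {})) \<and>
    (\<forall>j. 1 \<le> j \<longrightarrow> j < k \<longrightarrow> (n - k + j \<in> wlf n w \<longleftrightarrow> Suc j \<in> left_rows (Suc k) \<tau> {}))"
proof -
  have a: "ulet w i = nw_a k \<rho> i \<longleftrightarrow> (i \<in> wup n w \<longleftrightarrow> i \<in> upper_cols (Suc k) \<tau> {})" if i: "1 < i" "i \<le> k" for i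
  proof -
    have "ulet w i \<in> {U, D}" using w i k1 by (auto simp: marked_words_def)
    moreover have "(i, \<rho> i) \<in> upper_points (points k \<rho>) \<longleftrightarrow> i \<in> upper_cols (Suc k) \<tau> {}"
      using i nw_ext_records[OF Tnw_perm, of i]
          by (auto simp: upper_points_def records_points[OF Tnw_perm] upper_cols_def \<tau>_def)
    ultimately show ?thesis using i k1 by (auto simp: nw_a_def wup_def)
  qed
  have b: "vlet w (n - k + j) = nw_b k \<rho> j \<longleftrightarrow> (n - k + j \<in> wlf n w \<longleftrightarrow> Suc j \<in> left_rows (Suc k) \<tau> {})"
    if j: "1 \<le> j" "j < k" for j
  proof -
    have "n - k + j \<in> {1<..<n}" using j k1 by auto
    then have "vlet w (n - k + j) \<in> {L, R}" using w unfolding marked_words_def by blast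
    moreover obtain x where x: "1 \<le> x" "x \<le> k" "\<rho> x = j" using perm_ex[OF Tnw_perm, of j] j by auto
    have "\<tau> x = Suc j" using x by (simp add: \<tau>_def nw_ext_def)
    then have "j \<in> left_rows k \<rho> {} \<longleftrightarrow> Suc j \<in> left_rows (Suc k) \<tau> {}"
      using left_rows_iff[OF Tnw_perm x(1,2), of "{}"] left_rows_iff[OF Tnw_perm' x(1), of "{}"] x
        nw_ext_records[OF Tnw_perm x(1,2)] by (simp add: \<tau>_def)
    ultimately show ?thesis using left_points_iff[OF Tnw_perm, of j "{}"] j k1 by (auto simp: nw_b_def wlf_def)
  qed
  have c: "ulet w 1 = nw_a k \<rho> 1" "vlet w (n - k + k) = nw_b k \<rho> k"
    using w k1 by (auto simp: nw_a_def nw_b_def marked_words_def)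
  have "(\<forall>i\<in>{1..k}. ulet w i = nw_a k \<rho> i \<and> vlet w (n - k + i) = nw_b k \<rho> i) \<longleftrightarrow>
    (\<forall>i. 1 < i \<longrightarrow> i \<le> k \<longrightarrow> ulet w i = nw_a k \<rho> i) \<and> (\<forall>j. 1 \<le> j \<longrightarrow> j < k \<longrightarrow> vlet w (n - k + j) = nw_b k \<rho> j)"
    unfolding Ball_def atLeastAtMost_iff using c by (metis le_neq_implies_less less_imp_le)
  then show ?thesis using a b by simp
qed

text \<open>
  The chain labels of the word and of the block obey the same rule and the same code labels, up to a
  shift of the rows by \<open>n - k - 1\<close>, so they agree on the columns of the block.
\<close>

lemma Tnw_heights:
  assumes ma: "\<forall>i\<in>{1..k}. ulet w i = nw_a k \<rho> i \<and> vlet w (n - k + i) = nw_b k \<rho> i"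
  shows "i \<le> k \<Longrightarrow> anti_height n m up (wlf n w) i = anti_height (Suc k) (\<tau> 1) (nat_cols (Suc k) \<tau> {}) (left_rows (Suc k) \<tau>
      {}) i"
    and "1 < i \<Longrightarrow> i \<le> k \<Longrightarrow> i \<in> wup n w \<longleftrightarrow> i \<in> upper_cols (Suc k) \<tau> {}"
    and "1 < i \<Longrightarrow> i \<le> k \<Longrightarrow> Suc n - i \<in> wlf n w \<longleftrightarrow> Suc (Suc k) - i \<in> left_rows (Suc k) \<tau> {}"
proof -
  define s where "s = n - Suc k"
  have n: "n = Suc k + s" using k1 by (simp add: s_def)
  have t1: "\<tau> 1 = Suc (\<rho> 1)" using k1 by (simp add: \<tau>_def nw_ext_def)
  have ms: "m = \<tau> 1 + s" using m n t1 by simp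
  have tN: "\<tau> 1 \<le> Suc k" using lab_range[OF Tnw_lab, of 1] by simp
  have mn: "2 \<le> n" "m \<le> n" using n k1 ms tN by auto
  define lf where "lf = {r. r + s \<in> wlf n w}"
  have match: "\<And>i. 1 < i \<Longrightarrow> i \<le> k \<Longrightarrow> (i \<in> wup n w \<longleftrightarrow> i \<in> upper_cols (Suc k) \<tau> {})"
    "\<And>j. 1 \<le> j \<Longrightarrow> j < k \<Longrightarrow> (n - k + j \<in> wlf n w \<longleftrightarrow> Suc j \<in> left_rows (Suc k) \<tau> {})" using ma Tnw_match by auto
  have lf: "j \<in> lf \<longleftrightarrow> j \<in> left_rows (Suc k) \<tau> {}" if j: "2 \<le> j" "j \<le> Suc k" for j
  proof (cases "j = Suc k")
    case True
    then show ?thesis using n lab_lf[OF Tnw_lab] by (simp add: lf_def wlf_def)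
  next
    case False
    obtain z where z: "j = Suc z" "1 \<le> z" using j by (cases j) auto
    then show ?thesis using match(2)[of z] j n False by (simp add: lf_def add.commute)
  qed
  have sh: "anti_height n m up (wlf n w) i = anti_height (Suc k) (\<tau> 1) up lf i" if "i \<le> Suc k" for i
    unfolding lf_def n ms by (rule anti_height_shift[OF that])
  have nat: "natural_upto n m (wup n w) (wlf n w) up n" using nat_set_natural[of n] mn by (simp add: up_def)
  have nat': "natural_upto (Suc k) (\<tau> 1) (wup n w) lf up k"
    unfolding natural_upto_def
  proof (intro conjI allI impI)
    show "1 \<in> up" using nat by (simp add: natural_upto_def)
    fix i assume i: "1 < i" "i \<le> k"
    have "Suc n - i \<in> wlf n w \<longleftrightarrow> Suc (Suc k) - i \<in> lf" using i n by (simp add: lf_def Suc_diff_le)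
    then show "i \<in> up \<longleftrightarrow> i \<in> wup n w \<and> \<not> (anti_height (Suc k) (\<tau> 1) up lf (i - 1) = 0 \<and> Suc (Suc k) - i \<in> lf)"
      using nat sh[of "i - 1"] i n by (simp add: natural_upto_def)
  qed
  have nat'': "natural_upto (Suc k) (\<tau> 1) (upper_cols (Suc k) \<tau> {}) (left_rows (Suc k) \<tau> {}) (nat_cols (Suc k) \<tau> {}) k"
    using csq_natural[OF Tnw_csq] k1 by (simp add: natural_upto_def)
  have agree: "j \<in> up \<longleftrightarrow> j \<in> nat_cols (Suc k) \<tau> {}" if "1 \<le> j" "j \<le> k" for j
    by (rule natural_agree[OF nat' nat'']) (use match(1) lf that tN in auto)
  show "anti_height n m up (wlf n w) i = anti_height (Suc k) (\<tau> 1) (nat_cols (Suc k) \<tau> {}) (left_rows (Suc k) \<tau> {}) i"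
    if "i \<le> k"
  proof -
    have "anti_height (Suc k) (\<tau> 1) up lf i = anti_height (Suc k) (\<tau> 1) (nat_cols (Suc k) \<tau> {}) (left_rows (Suc k) \<tau> {})
        i"
      by (rule anti_height_cong) (use agree lf that tN in auto)
    then show ?thesis using sh that by simp
  qed
  show "1 < i \<Longrightarrow> i \<le> k \<Longrightarrow> i \<in> wup n w \<longleftrightarrow> i \<in> upper_cols (Suc k) \<tau> {}" using match by simp
  show "1 < i \<Longrightarrow> i \<le> k \<Longrightarrow> Suc n - i \<in> wlf n w \<longleftrightarrow> Suc (Suc k) - i \<in> left_rows (Suc k) \<tau> {}"
    using lf[of "Suc (Suc k) - i"] n by (simp add: lf_def Suc_diff_le)
qed

text \<open>
  The added point moves all values up by one, so the antidiagonal blocks of the extended permutation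
  are those of the permutation itself.
\<close>

lemma Tnw_block_iff:
  assumes j: "1 \<le> j" "j \<le> k"
  shows "anti_height (Suc k) (\<tau> 1) (nat_cols (Suc k) \<tau> {}) (left_rows (Suc k) \<tau> {}) j = 0 \<longleftrightarrow> \<rho> ` {1..j} = {k - j + 1..k}"
proof -
  have 1: "\<tau> ` {1..j} = Suc ` (\<rho> ` {1..j})" unfolding image_image
      by (rule image_cong) (use j in \<open>auto simp: \<tau>_def nw_ext_def\<close>)
  have 2: "{Suc (Suc k) - j..Suc k} = Suc ` {k - j + 1..k}" using j by (simp add: Suc_diff_le)
  have "\<tau> ` {1..j} = {Suc (Suc k) - j..Suc k} \<longleftrightarrow> \<rho> ` {1..j} = {k - j + 1..k}"
    unfolding 1 2 by (rule inj_image_eq_iff) simp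
  then show ?thesis using lab_anti_zero[OF Tnw_lab, of j] j by simp
qed

lemma Tnw_admissible:
  assumes ma: "\<forall>i\<in>{1..k}. ulet w i = nw_a k \<rho> i \<and> vlet w (n - k + i) = nw_b k \<rho> i"
  shows "anti_height n m up (wlf n w) k = 0"
    and "1 < i \<Longrightarrow> i \<le> k \<Longrightarrow> anti_height n m up (wlf n w) (i - 1) = 0 \<Longrightarrow> i \<in> wup n w \<longleftrightarrow> Suc n - i \<in> wlf n w"
    and "co_decomposable k \<rho> \<longleftrightarrow> (\<exists>j. 1 \<le> j \<and> j < k \<and> anti_height n m up (wlf n w) j = 0)"
proof -
  note h = Tnw_heights[OF ma]
  have "\<rho> ` {1..k} = {k - k + 1..k}" using permutes_image[OF Tnw_perm] by simp
  then show "anti_height n m up (wlf n w) k = 0" using Tnw_block_iff[of k] k1 h(1)[of k] by simp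
  have "admissible (Suc k) (\<tau> 1) (upper_cols (Suc k) \<tau> {}) (left_rows (Suc k) \<tau> {}) (nat_cols (Suc k) \<tau> {})"
    using csq_admissible[OF Tnw_csq] k1 by simp
  then show "1 < i \<Longrightarrow> i \<le> k \<Longrightarrow> anti_height n m up (wlf n w) (i - 1) = 0 \<Longrightarrow> i \<in> wup n w \<longleftrightarrow> Suc n - i \<in> wlf n w"
    using h(1)[of "i - 1"] h(2,3)[of i] by (simp add: admissible_def)
  have "\<rho> ` {1..j} = {k - j + 1..k} \<longleftrightarrow> anti_height n m up (wlf n w) j = 0" if "1 \<le> j" "j \<le> k" for j
    using Tnw_block_iff[OF that] h(1)[OF that(2)] by simp
  then show "co_decomposable k \<rho> \<longleftrightarrow> (\<exists>j. 1 \<le> j \<and> j < k \<and> anti_height n m up (wlf n w) j = 0)"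
    unfolding co_decomposable_def Bex_def atLeastAtMost_iff using k1
    by (metis One_nat_def Suc_pred' less_Suc_eq_le less_eq_Suc_le less_imp_le)
qed

end

text \<open>
  The first \<open>k\<close> columns and the last \<open>k\<close> rows, completed by a column at the right and a row at the
  bottom, are admissible labels of size \<open>k + 1\<close>: as the antidiagonal height vanishes at \<open>k\<close>, the
  diagonal height is positive. The zero at \<open>k\<close> is an antidiagonal block, so the last value is \<open>1\<close>;
  this excludes diagonal blocks and thereby colored points.
\<close>

lemma nw_block_exists:
  assumes w: "(w, m) \<in> marked_words n" and n: "2 \<le> n" and k: "1 \<le> k" "k < n"
  defines "up \<equiv> nat_set n m (wup n w) (wlf n w)"
  assumes z: "anti_height n m up (wlf n w) k = 0"
    and st: "\<And>i. 1 < i \<Longrightarrow> i \<le> k \<Longrightarrow> anti_height n m up (wlf n w) (i - 1) = 0 \<Longrightarrow> i \<in> wup n w \<longleftrightarrow> Suc n - i \<in> wlf n w"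
  shows "\<exists>\<rho>\<in>T_nw k. m = n - k + \<rho> 1 \<and> (\<forall>i\<in>{1..k}. ulet w i = nw_a k \<rho> i \<and> vlet w (n - k + i) = nw_b k \<rho> i)"
proof -
  note s = marked_word_sets[OF w n]
  define t where "t = n - Suc k"
  let ?N = "Suc k"
  have nt: "n = ?N + t" using k by (simp add: t_def)
  have N: "2 \<le> ?N" using k by simp
  have nat: "natural_upto n m (wup n w) (wlf n w) up n" using nat_set_natural[of n] n by (simp add: up_def)
  have up1: "1 \<in> up" using nat by (simp add: natural_upto_def)
  have km: "Suc n - k \<le> m"
  proof (rule ccontr)
    assume "\<not> ?thesis"
    then show False using z cnt_empty[of m "Suc n - k" "wlf n w"] by (simp add: anti_height_def)
  qed
  define m' where "m' = m - t"
  have m': "m = m' + t" "1 \<le> m'" "m' \<le> ?N" using km nt s by (auto simp: m'_def)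
  define lf where "lf = {r. r + t \<in> wlf n w} \<inter> {1..?N} \<union> {1}"
  define uw where "uw = wup n w \<inter> {1..k} \<union> {?N}"
  define up' where "up' = up \<inter> {1..k}"
  have ah: "anti_height ?N m' up' lf i = anti_height n m up (wlf n w) i" if i: "i \<le> k" for i
  proof -
    have "anti_height n m up (wlf n w) i = anti_height ?N m' up {r. r + t \<in> wlf n w} i"
      unfolding nt m'(1) by (rule anti_height_shift) (use i in simp)
    also have "\<dots> = anti_height ?N m' up' lf i"
      by (rule anti_height_cong) (use i m' in \<open>auto simp: up'_def lf_def\<close>)
    finally show ?thesis by simp
  qed
  have row: "Suc ?N - i \<in> lf \<longleftrightarrow> Suc n - i \<in> wlf n w" if "1 < i" "i \<le> k" for i
    using that nt by (auto simp: lf_def Suc_diff_le)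
  have mem: "1 \<in> uw" "?N \<in> uw" "1 \<in> lf" "?N \<in> lf" "m' \<in> lf" using s k m' nt by (auto simp: uw_def lf_def)
  have sub: "uw \<subseteq> {1..?N}" "lf \<subseteq> {1..?N}" "up' \<subseteq> {1..?N}" by (auto simp: uw_def lf_def up'_def)
  have nat': "natural_upto ?N m' uw lf up' ?N" unfolding natural_upto_def
  proof (intro conjI allI impI)
    show "1 \<in> up'" using up1 k by (simp add: up'_def)
    fix i assume i: "1 < i" "i \<le> ?N"
    show "i \<in> up' \<longleftrightarrow> i \<in> uw \<and> \<not> (anti_height ?N m' up' lf (i - 1) = 0 \<and> Suc ?N - i \<in> lf)"
    proof (cases "i = ?N")
      case True
      then show ?thesis using ah[of k] z mem by (auto simp: up'_def)
    next
      case False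
      then have ik: "i \<le> k" using i by simp
      have "i \<in> up \<longleftrightarrow> i \<in> wup n w \<and> \<not> (anti_height n m up (wlf n w) (i - 1) = 0 \<and> Suc n - i \<in> wlf n w)"
        using nat i ik k by (simp add: natural_upto_def)
      then show ?thesis using ah[of "i - 1"] row[of i] i ik by (auto simp: up'_def uw_def)
    qed
  qed
  have adm: "admissible ?N m' uw lf up'" unfolding admissible_def
  proof (intro conjI allI impI)
    fix i
    { assume i: "1 \<le> i" "i < ?N"
      have "1 \<le> diag_height m' up' lf i"
        using diag_pos_of_anti_nonpos[OF m'(2,3) _ mem(4) k(1), of up' i] ah[of k] z i nat'
            by (simp add: natural_upto_def)
      then show "0 \<le> diag_height m' up' lf i" by simp }
    assume i: "1 < i" "i < ?N" "anti_height ?N m' up' lf (i - 1) = 0"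
    then show "i \<in> uw \<longleftrightarrow> Suc ?N - i \<in> lf" using st[of i] ah[of "i - 1"] row[of i] by (auto simp: uw_def)
  qed
  obtain \<tau> C where c: "(\<tau>, C) \<in> colored_square_perms ?N" "\<tau> 1 = m'" "upper_cols ?N \<tau> C = uw" "left_rows ?N \<tau> C = lf"
      "nat_cols ?N \<tau> C = up'"
    using csq_exists[OF N m'(2,3) mem sub nat' adm] by blast
  note lab = csq_labelling[OF c(1) N]
  have im: "\<tau> ` {1..k} = {Suc ?N - k..?N}" using lab_anti_zero[OF lab, of k] ah[of k] z k c by simp
  then have im2: "\<tau> ` {1..k} = {2..?N}" by (simp add: Suc_diff_le numeral_2_eq_2)
  have "\<tau> ?N \<notin> \<tau> ` {1..k}" using lab_inj[OF lab, of ?N] by (metis atLeastAtMost_iff imageE not_less_eq_eq order_refl)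
  moreover have "1 \<le> \<tau> ?N" "\<tau> ?N \<le> ?N" using lab_range[OF lab, of ?N] by auto
  ultimately have tN: "\<tau> ?N = 1" unfolding im2 by simp
  have C: "C = {}"
  proof (rule ccontr)
    assume "C \<noteq> {}"
    then obtain p where "p \<in> C" by auto
    then obtain x y where xy: "(x, y) \<in> C" by (metis surj_pair)
    have x: "1 < x" "x < ?N" "\<tau> ` {1..x} = {1..x}" using csq_C[OF c(1) N xy] by auto
    have "\<tau> ` {1..x} \<subseteq> {2..?N}" unfolding im2[symmetric] by (rule image_mono) (use x in auto)
    moreover have "1 \<in> {1..x}" using x by auto
    ultimately show False using x(3) by (metis Suc_1 Suc_n_not_le_n atLeastAtMost_iff subsetD)
  qed
  define \<rho> where "\<rho> x = (if 1 \<le> x \<and> x \<le> k then \<tau> x - 1 else x)" for x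
  have two: "2 \<le> \<tau> x" "\<tau> x \<le> ?N" if "1 \<le> x" "x \<le> k" for x
  proof -
    have "\<tau> x \<in> \<tau> ` {1..k}" using that by auto
    then show "2 \<le> \<tau> x" "\<tau> x \<le> ?N" unfolding im2 by auto
  qed
  have p: "\<rho> permutes {1..k}"
  proof (rule bij_imp_permutes)
    have inj: "inj_on \<rho> {1..k}"
    proof (rule inj_onI)
      fix x y assume a: "x \<in> {1..k}" "y \<in> {1..k}" "\<rho> x = \<rho> y"
      then have "\<tau> x = \<tau> y" using two[of x] two[of y] by (auto simp: \<rho>_def)
      then show "x = y" by (rule lab_inj[OF lab])
    qed
    have "\<rho> ` {1..k} \<subseteq> {1..k}" using two by (fastforce simp: \<rho>_def)
    then show "bij_betw \<rho> {1..k} {1..k}" using inj endo_inj_surj[of "{1..k}" \<rho>] by (simp add: bij_betw_def)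
  qed (auto simp: \<rho>_def)
  have ext: "nw_ext k \<rho> = \<tau>"
  proof
    fix x
    consider "1 \<le> x \<and> x \<le> k" | "x = ?N" | "x \<notin> {1..?N}" by fastforce
    then show "nw_ext k \<rho> x = \<tau> x"
    proof cases
      case 1 then show ?thesis using two[of x] by (simp add: nw_ext_def \<rho>_def)
    next
      case 2 then show ?thesis using tN by (simp add: nw_ext_def)
    next
      case 3
      then have "\<not> (1 \<le> x \<and> x \<le> k)" "x \<noteq> ?N" by auto
      then show ?thesis using permutes_not_in[OF lab_perm[OF lab] 3] unfolding nw_ext_def by presburger
    qed
  qed
  have T: "\<rho> \<in> T_nw k" using T_nw_iff[OF p] ext c(1) C by simp
  have "m' = Suc (\<rho> 1)" using c(2) two[of 1] k by (simp add: \<rho>_def)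
  then have m\<rho>: "m = n - k + \<rho> 1" using m' nt by simp
  have match: "\<forall>i\<in>{1..k}. ulet w i = nw_a k \<rho> i \<and> vlet w (n - k + i) = nw_b k \<rho> i"
    unfolding Tnw_match[OF T k w m\<rho>] ext using c C nt by (auto simp: uw_def lf_def add.commute)
  then show ?thesis using T m\<rho> by blast
qed

context
  fixes n m w up
  assumes w: "(w, m) \<in> marked_words n" and n: "2 \<le> n"
  defines "up \<equiv> nat_set n m (wup n w) (wlf n w)"
begin

text \<open>
  A block at the smallest zero is co-indecomposable, and conversely the end of every block is a
  zero.
\<close>

lemma B'_iff: "(w, m) \<in> B'_words n \<longleftrightarrow> (\<exists>k. 1 \<le> k \<and> k < n \<and> anti_height n m up (wlf n w) k = 0)"
proof
  assume "(w, m) \<in> B'_words n"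
  then obtain k \<rho> where k: "1 \<le> k" "k \<le> n - 1" "\<rho> \<in> T_nw k"
    "\<forall>i\<in>{1..k}. ulet w i = nw_a k \<rho> i \<and> vlet w (n - k + i) = nw_b k \<rho> i" "m = n - k + \<rho> 1"
    by (auto simp: B'_words_def D_nw_plus_def)
  then have "k < n" using n by simp
  then show "\<exists>k. 1 \<le> k \<and> k < n \<and> anti_height n m up (wlf n w) k = 0"
    using Tnw_admissible(1)[OF k(3,1) _ w k(5,4)] k(1) unfolding up_def by blast
next
  assume "\<exists>k. 1 \<le> k \<and> k < n \<and> anti_height n m up (wlf n w) k = 0"
  then obtain k where k: "1 \<le> k" "k < n" "anti_height n m up (wlf n w) k = 0"
    and min: "\<And>j. j < k \<Longrightarrow> \<not> (1 \<le> j \<and> j < n \<and> anti_height n m up (wlf n w) j = 0)"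
    using exists_least_iff[of "\<lambda>k. 1 \<le> k \<and> k < n \<and> anti_height n m up (wlf n w) k = 0"] by blast
  have "\<exists>\<rho>\<in>T_nw k. m = n - k + \<rho> 1 \<and> (\<forall>i\<in>{1..k}. ulet w i = nw_a k \<rho> i \<and> vlet w (n - k + i) = nw_b k \<rho> i)"
  proof (rule nw_block_exists[OF w n k(1,2)])
    show "anti_height n m (nat_set n m (wup n w) (wlf n w)) (wlf n w) k = 0" using k(3) by (simp add: up_def)
    fix i assume "1 < i" "i \<le> k" "anti_height n m (nat_set n m (wup n w) (wlf n w)) (wlf n w) (i - 1) = 0"
    moreover from this have "1 \<le> i - 1" "i - 1 < k" "i - 1 < n" using k by auto
    ultimately show "i \<in> wup n w \<longleftrightarrow> Suc n - i \<in> wlf n w" using min[of "i - 1"] by (simp add: up_def)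
  qed
  then obtain \<rho> where r: "\<rho> \<in> T_nw k" "m = n - k + \<rho> 1"
    "\<forall>i\<in>{1..k}. ulet w i = nw_a k \<rho> i \<and> vlet w (n - k + i) = nw_b k \<rho> i" by blast
  have "\<not> co_decomposable k \<rho>"
    using Tnw_admissible(3)[OF r(1) k(1,2) w r(2,3)] min k(2) unfolding up_def by (meson less_trans)
  then have "\<rho> \<in> D_nw_plus k" using r by (simp add: D_nw_plus_def)
  moreover have "k \<in> {1..n - 1}" using k by auto
  ultimately show "(w, m) \<in> B'_words n" using w r unfolding B'_words_def by blast
qed

text \<open>
  The letters behind the block are those which \<open>admissible\<close> forbids. At the smallest violation the
  labels behind all earlier zeros agree, so the block is encoded correctly.
\<close>

lemma B_iff: "(w, m) \<in> B_words n \<longleftrightarrow> (\<exists>k. 1 \<le> k \<and> Suc k < n \<and> anti_height n m up (wlf n w) k = 0 \<and> (Suc k \<in> wup n w \<longleftrightarrow>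
    n - k \<notin> wlf n w))"
proof
  assume "(w, m) \<in> B_words n"
  then obtain k \<rho> where k: "1 \<le> k" "k \<le> n - 2" "\<rho> \<in> T_nw k"
    "\<forall>i\<in>{1..k}. ulet w i = nw_a k \<rho> i \<and> vlet w (n - k + i) = nw_b k \<rho> i" "m = n - k + \<rho> 1"
    and l: "(ulet w (k + 1), vlet w (n - k)) \<in> {(U, R), (D, L)}"
    by (auto simp: B_words_def)
  then have kn: "k < n" "Suc k < n" "1 < n - k" "n - k < n" using n by auto
  have "anti_height n m up (wlf n w) k = 0"
    using Tnw_admissible(1)[OF k(3,1) kn(1) w k(5,4)] unfolding up_def by blast
  moreover have "Suc k \<in> wup n w \<longleftrightarrow> n - k \<notin> wlf n w" using l kn k(1) by (auto simp: wup_def wlf_def)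
  ultimately show "\<exists>k. 1 \<le> k \<and> Suc k < n \<and> anti_height n m up (wlf n w) k = 0 \<and> (Suc k \<in> wup n w \<longleftrightarrow> n - k \<notin> wlf n w)"
    using k kn by blast
next
  let ?P = "\<lambda>k. 1 \<le> k \<and> Suc k < n \<and> anti_height n m up (wlf n w) k = 0 \<and> (Suc k \<in> wup n w \<longleftrightarrow> n - k \<notin> wlf n w)"
  assume "\<exists>k. ?P k"
  then obtain k where k: "?P k" and min: "\<And>j. j < k \<Longrightarrow> \<not> ?P j" using exists_least_iff[of ?P] by blast
  then have kn: "1 \<le> k" "k < n" "1 < n - k" "n - k < n" by auto
  have "\<exists>\<rho>\<in>T_nw k. m = n - k + \<rho> 1 \<and> (\<forall>i\<in>{1..k}. ulet w i = nw_a k \<rho> i \<and> vlet w (n - k + i) = nw_b k \<rho> i)"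
  proof (rule nw_block_exists[OF w n kn(1,2)])
    show "anti_height n m (nat_set n m (wup n w) (wlf n w)) (wlf n w) k = 0" using k by (simp add: up_def)
    fix i assume i: "1 < i" "i \<le> k" "anti_height n m (nat_set n m (wup n w) (wlf n w)) (wlf n w) (i - 1) = 0"
    have "n - (i - 1) = Suc n - i" "1 \<le> i - 1" "i - 1 < k" "Suc (i - 1) = i" "i < n" using i k by auto
    then show "i \<in> wup n w \<longleftrightarrow> Suc n - i \<in> wlf n w" using min[of "i - 1"] i(3) by (auto simp: up_def)
  qed
  then obtain \<rho> where r: "\<rho> \<in> T_nw k" "m = n - k + \<rho> 1"
    "\<forall>i\<in>{1..k}. ulet w i = nw_a k \<rho> i \<and> vlet w (n - k + i) = nw_b k \<rho> i" by blast
  have "ulet w (k + 1) \<in> {U, D}" "vlet w (n - k) \<in> {L, R}" using w k kn by (auto simp: marked_words_def)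
  then have "(ulet w (k + 1), vlet w (n - k)) \<in> {(U, R), (D, L)}" using k kn by (auto simp: wup_def wlf_def)
  moreover have "k \<in> {1..n - 2}" using k by auto
  ultimately show "(w, m) \<in> B_words n" using w r unfolding B_words_def by blast
qed

lemma up_natural: "natural_upto n m (wup n w) (wlf n w) up n"
  using nat_set_natural[of n] n by (simp add: up_def)

lemma up_sub_wup: "1 \<le> i \<Longrightarrow> i \<in> up \<Longrightarrow> i \<in> wup n w"
  using up_natural marked_word_sets(1)[OF w n] nat_set_sub[of n m "wup n w" "wlf n w"]
  unfolding natural_upto_def up_def by (metis atLeastAtMost_iff le_neq_implies_less subsetD)

lemma diag_pos_if_B':
  assumes "(w, m) \<in> B'_words n" "1 \<le> i" "i < n"
  shows "1 \<le> diag_height m up (wlf n w) i" "1 \<le> diag_height m (wup n w) (wlf n w) i"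
proof -
  note s = marked_word_sets[OF w n]
  obtain k where k: "1 \<le> k" "k < n" "anti_height n m up (wlf n w) k = 0" using assms B'_iff by blast
  show 1: "1 \<le> diag_height m up (wlf n w) i"
    using diag_pos_of_anti_nonpos[OF s(6,7) _ s(4) k(1,2), of up i] k assms up_natural by (simp add: natural_upto_def)
  have "cnt up 1 i \<le> cnt (wup n w) 1 i" using up_sub_wup by (intro cnt_mono_set) auto
  then show "1 \<le> diag_height m (wup n w) (wlf n w) i" using 1 by (simp add: diag_height_def)
qed

text \<open>
  Without zeros of the antidiagonal height there is nothing to correct in the labels of the code.
\<close>

lemma up_eq_wup: assumes "(w, m) \<notin> B'_words n" "1 \<le> i" "i \<le> n" shows "i \<in> up \<longleftrightarrow> i \<in> wup n w"
proof (cases "i = 1")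
  case True then show ?thesis using up_natural marked_word_sets(1)[OF w n] by (simp add: natural_upto_def)
next
  case False
  then have "anti_height n m up (wlf n w) (i - 1) \<noteq> 0" using assms B'_iff by auto
  then show ?thesis using up_natural assms False by (simp add: natural_upto_def)
qed

lemma diag_height_up: assumes "(w, m) \<notin> B'_words n" "i \<le> n"
  shows "diag_height m up (wlf n w) i = diag_height m (wup n w) (wlf n w) i"
  by (rule diag_height_cong) (use up_eq_wup assms in auto)

lemma A'_B'_disjoint: "\<not> ((w, m) \<in> A'_words n \<and> (w, m) \<in> B'_words n)"
  using A'_iff[OF w n] diag_pos_if_B' by force

lemma B_sub_B': "(w, m) \<in> B_words n \<Longrightarrow> (w, m) \<in> B'_words n"
  unfolding B_iff B'_iff by (meson Suc_lessD)

lemma A'_sub_A: "(w, m) \<in> A'_words n \<Longrightarrow> (w, m) \<in> A_words n"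
proof -
  note s = marked_word_sets[OF w n]
  assume "(w, m) \<in> A'_words n"
  then obtain i where "1 \<le> i" "i < n" "diag_height m (wup n w) (wlf n w) i < 0" using A'_iff[OF w n] by blast
  then show ?thesis using first_diag_descent[OF s(6,1), of i "wlf n w"] A_iff[OF w n] by force
qed

text \<open>
  The set \<open>A'\<close> consists of the violations of the first condition of \<open>admissible\<close> and \<open>B\<close> of those of
  the second one.
\<close>

lemma code_image_iff': "(w, m) \<in> code n ` colored_square_perms n \<longleftrightarrow> (w, m) \<notin> A'_words n \<and> (w, m) \<notin> B_words n"
proof -
  have 1: "(\<forall>i. 1 \<le> i \<longrightarrow> i < n \<longrightarrow> 0 \<le> diag_height m up (wlf n w) i) \<longleftrightarrow> (w, m) \<notin> A'_words n"
  proof (cases "(w, m) \<in> B'_words n")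
    case True
    then show ?thesis using A'_B'_disjoint diag_pos_if_B'(1) by force
  next
    case False
    then show ?thesis using A'_iff[OF w n] diag_height_up[OF False] by (metis less_imp_le linorder_not_less)
  qed
  have 2: "(\<forall>i. 1 < i \<longrightarrow> i < n \<longrightarrow> anti_height n m up (wlf n w) (i - 1) = 0 \<longrightarrow> (i \<in> wup n w \<longleftrightarrow> Suc n - i \<in> wlf n w))
    \<longleftrightarrow> (w, m) \<notin> B_words n" (is "?l \<longleftrightarrow> ?r")
  proof
    assume l: ?l
    show ?r
    proof
      assume "(w, m) \<in> B_words n"
      then obtain k where "1 \<le> k" "Suc k < n" "anti_height n m up (wlf n w) k = 0" "Suc k \<in> wup n w \<longleftrightarrow> n - k \<notin> wlf n w"
        unfolding B_iff by blast
      then show False using l[rule_format, of "Suc k"] by simp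
    qed
  next
    assume r: ?r
    show ?l
    proof (intro allI impI)
      fix i assume i: "1 < i" "i < n" "anti_height n m up (wlf n w) (i - 1) = 0"
      have e: "n - (i - 1) = Suc n - i" "Suc (i - 1) = i" "1 \<le> i - 1" using i by auto
      have "\<not> (Suc (i - 1) \<in> wup n w \<longleftrightarrow> n - (i - 1) \<notin> wlf n w)" using r i e unfolding B_iff by metis
      then show "i \<in> wup n w \<longleftrightarrow> Suc n - i \<in> wlf n w" unfolding e by blast
    qed
  qed
  show ?thesis unfolding code_image_iff[OF w n] admissible_def using 1 2 by (simp add: up_def)
qed

end

text \<open>The zeros of the antidiagonal height are the antidiagonal blocks.\<close>

lemma code_in_B':
  assumes c: "(\<sigma>, C) \<in> colored_square_perms n" and n: "2 \<le> n"
  shows "code n (\<sigma>, C) \<in> B'_words n \<longleftrightarrow> co_decomposable n \<sigma>"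
proof -
  note p = code_props[OF assms] and lab = csq_labelling[OF assms]
  obtain w where w: "code n (\<sigma>, C) = (w, \<sigma> 1)" using p(2) by (metis prod.collapse)
  have "code n (\<sigma>, C) \<in> B'_words n \<longleftrightarrow>
    (\<exists>k. 1 \<le> k \<and> k < n \<and> anti_height n (\<sigma> 1) (nat_cols n \<sigma> C) (left_rows n \<sigma> C) k = 0)"
    using B'_iff[of w "\<sigma> 1" n] p w n csq_nat_set[OF assms] by simp
  also have "\<dots> \<longleftrightarrow> (\<exists>k. 1 \<le> k \<and> k < n \<and> \<sigma> ` {1..k} = {Suc n - k..n})" using lab_anti_zero[OF lab] by blast
  also have "\<dots> \<longleftrightarrow> co_decomposable n \<sigma>" unfolding co_decomposable_def Bex_def atLeastAtMost_iff
    using n by (intro ex_cong1) (auto simp: Suc_diff_le)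
  finally show ?thesis .
qed

text \<open>
  Before a colored point there is a diagonal block, so the height is zero and the column of the
  point has the letter \<open>D\<close>. Conversely, if the height is zero before a column that is not upper, it
  stays zero as it cannot become negative. The column thus contains a fixed point between two
  diagonal blocks. Being a UL record, it would be marked upper if it were not colored.
\<close>

lemma code_in_A:
  assumes c: "(\<sigma>, C) \<in> colored_square_perms n" and n: "2 \<le> n"
  shows "code n (\<sigma>, C) \<in> A_words n \<longleftrightarrow> C \<noteq> {}"
proof -
  note p = code_props[OF assms] and lab = csq_labelling[OF assms]
  let ?up = "nat_cols n \<sigma> C" and ?uw = "upper_cols n \<sigma> C" and ?lf = "left_rows n \<sigma> C"
  obtain w where w: "code n (\<sigma>, C) = (w, \<sigma> 1)" using p(2) by (metis prod.collapse)
  have ws: "(w, \<sigma> 1) \<in> marked_words n" "wup n w = ?uw" "wlf n w = ?lf" using p w by auto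
  have A: "code n (\<sigma>, C) \<in> A_words n \<longleftrightarrow>
    (\<exists>k. 1 \<le> k \<and> Suc k < n \<and> diag_height (\<sigma> 1) ?uw ?lf k \<le> 0 \<and> Suc k \<notin> ?uw)"
    using A_iff[OF ws(1) n] ws w by simp
  have m1: "1 \<le> \<sigma> 1" using lab_range[OF lab, of 1] n by simp
  show ?thesis
  proof
    assume "code n (\<sigma>, C) \<in> A_words n"
    then obtain k where k: "1 \<le> k" "Suc k < n" "diag_height (\<sigma> 1) ?uw ?lf k \<le> 0" "Suc k \<notin> ?uw" using A by blast
    have sub: "i \<in> ?up \<Longrightarrow> 1 \<le> i \<Longrightarrow> i \<in> ?uw" for i
      using up_sub_wup[OF ws(1) n, of i] csq_nat_set[OF assms] ws by simp
    have "cnt ?up 1 k \<le> cnt ?uw 1 k" using sub by (intro cnt_mono_set) auto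
    then have z: "diag_height (\<sigma> 1) ?up ?lf k = 0" using lab_diag_height[OF lab, of k] k by (simp add: diag_height_def)
    have nu: "Suc k \<notin> ?up" using sub k by auto
    then have z': "diag_height (\<sigma> 1) ?up ?lf (Suc k) = 0"
      using lab_diag_height[OF lab, of "Suc k"] diag_height_Suc[OF m1, of ?up ?lf k] z k by (auto split: if_splits)
    have im: "\<sigma> ` {1..k} = {1..k}" "\<sigma> ` {1..Suc k} = {1..Suc k}" using lab_diag_zero[OF lab] z z' k by auto
    have "\<sigma> (Suc k) \<in> \<sigma> ` {1..Suc k}" by (rule imageI) simp
    then have r: "\<sigma> (Suc k) \<in> {1..Suc k}" unfolding im .
    have "\<sigma> (Suc k) \<notin> \<sigma> ` {1..k}" using lab_inj[OF lab, of "Suc k"]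
        by (metis atLeastAtMost_iff imageE not_less_eq_eq order_refl)
    then have fx: "\<sigma> (Suc k) = Suc k" unfolding im using r by auto
    then have "ulr \<sigma> (Suc k)" using fixed_ulr_iff(1)[OF lab_perm[OF lab], of "Suc k"] im k by simp
    then show "C \<noteq> {}" using k fx by (auto simp: upper_cols_def)
  next
    assume "C \<noteq> {}"
    then obtain q where "q \<in> C" by auto
    then obtain x y where xy: "(x, y) \<in> C" by (metis surj_pair)
    note x = csq_C[OF assms xy]
    obtain k where k: "x = Suc k" "1 \<le> k" using x by (cases x) auto
    have im: "\<sigma> ` {1..k} = {1..k}"
      using image_drop_fixed[OF csq_perm[OF assms], of k] x k by simp
    then have z: "diag_height (\<sigma> 1) ?up ?lf k = 0" using lab_diag_zero[OF lab, of k] k x by simp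
    have nB: "(w, \<sigma> 1) \<notin> B'_words n"
      using diag_pos_if_B'(1)[OF ws(1) n, of k] csq_nat_set[OF assms] ws z k x by auto
    have "diag_height (\<sigma> 1) ?uw ?lf k = 0"
      using diag_height_up[OF ws(1) n nB, of k] csq_nat_set[OF assms] ws z k x by simp
    moreover have "Suc k \<notin> ?uw" using x xy k by (auto simp: upper_cols_def)
    ultimately show "code n (\<sigma>, C) \<in> A_words n" using A k x by auto
  qed
qed

text \<open>
  Both images are parts of the image of all colored square permutations, which is the complement of
  \<open>A'\<close> and \<open>B\<close>; they are selected by \<open>code_in_A\<close> and \<open>code_in_B'\<close>.
\<close>

theorem code_square_perms:
  assumes n: "2 \<le> n"
  shows "inj_on (\<lambda>\<sigma>. code n (\<sigma>, {})) (square_perms n)"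
    and "A_words n \<inter> B_words n = {}" and "A'_words n \<inter> B'_words n = {}"
    and "(\<lambda>\<sigma>. code n (\<sigma>, {})) ` square_perms n = marked_words n - (A_words n \<union> B_words n)"
    and "code n ` {(\<sigma>, C) \<in> colored_square_perms n. \<not> co_decomposable n \<sigma>} = marked_words n - (A'_words n \<union> B'_words n)"
proof -
  have sub: "A_words n \<subseteq> marked_words n" "B_words n \<subseteq> marked_words n" "A'_words n \<subseteq> marked_words n"
      "B'_words n \<subseteq> marked_words n"
    unfolding A_words_def B_words_def A'_words_def B'_words_def
        by (simp_all add: subset_eq Ball_def split_paired_all del: One_nat_def)
  have csq0: "\<sigma> \<in> square_perms n \<longleftrightarrow> (\<sigma>, {}) \<in> colored_square_perms n" for \<sigma> by (simp add: colored_square_perms_def)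
  show "inj_on (\<lambda>\<sigma>. code n (\<sigma>, {})) (square_perms n)"
  proof (rule inj_onI)
    fix \<sigma> \<tau> assume a: "\<sigma> \<in> square_perms n" "\<tau> \<in> square_perms n" "code n (\<sigma>, {}) = code n (\<tau>, {})"
    have "(\<sigma>, {}) = (\<tau>, {} :: point set)"
      by (rule inj_onD[OF code_inj_on[OF n] a(3)]) (use a csq0 in simp_all)
    then show "\<sigma> = \<tau>" by simp
  qed
  show d': "A'_words n \<inter> B'_words n = {}"
  proof (rule ccontr)
    assume "A'_words n \<inter> B'_words n \<noteq> {}"
    then obtain w m where "(w, m) \<in> A'_words n" "(w, m) \<in> B'_words n" by auto
    then show False using A'_B'_disjoint n sub by blast
  qed
  have AB': "(w, m) \<notin> B'_words n" if a: "(w, m) \<in> A_words n" for w m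
  proof
    assume b: "(w, m) \<in> B'_words n"
    have ws: "(w, m) \<in> marked_words n" using a sub by auto
    obtain k where "1 \<le> k" "Suc k < n" "diag_height m (wup n w) (wlf n w) k \<le> 0"
      using A_iff[OF ws n] a by blast
    then show False using diag_pos_if_B'(2)[OF ws n b, of k] by simp
  qed
  show "A_words n \<inter> B_words n = {}" using AB' B_sub_B' n sub by fastforce
  have img: "(w, m) \<in> code n ` colored_square_perms n \<longleftrightarrow> (w, m) \<notin> A'_words n \<and> (w, m) \<notin> B_words n"
    if "(w, m) \<in> marked_words n" for w m using code_image_iff'[OF that n] .
  have M: "code n x \<in> marked_words n" if "x \<in> colored_square_perms n" for x using code_props(1)[of "fst x"
      "snd x" n] that n by simp
  show "(\<lambda>\<sigma>. code n (\<sigma>, {})) ` square_perms n = marked_words n - (A_words n \<union> B_words n)"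
  proof (intro equalityI subsetI)
    fix x assume "x \<in> (\<lambda>\<sigma>. code n (\<sigma>, {})) ` square_perms n"
    then obtain \<sigma> where s: "(\<sigma>, {}) \<in> colored_square_perms n" "x = code n (\<sigma>, {})" using csq0 by auto
    then have "x \<in> marked_words n" "x \<in> code n ` colored_square_perms n" using M by auto
    then show "x \<in> marked_words n - (A_words n \<union> B_words n)"
      using img[of "fst x" "snd x"] code_in_A[OF s(1) n] s by auto
  next
    fix x assume x: "x \<in> marked_words n - (A_words n \<union> B_words n)"
    then have "x \<in> code n ` colored_square_perms n" using img[of "fst x" "snd x"] A'_sub_A[of "fst x" "snd x" n] n
        by auto
    then obtain \<sigma> C where s: "(\<sigma>, C) \<in> colored_square_perms n" "x = code n (\<sigma>, C)" by auto
    then have "C = {}" using code_in_A[OF s(1) n] x by auto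
    then show "x \<in> (\<lambda>\<sigma>. code n (\<sigma>, {})) ` square_perms n" using s csq0 by auto
  qed
  show "code n ` {(\<sigma>, C) \<in> colored_square_perms n. \<not> co_decomposable n \<sigma>} = marked_words n - (A'_words n \<union> B'_words n)"
  proof (intro equalityI subsetI)
    fix x assume "x \<in> code n ` {(\<sigma>, C) \<in> colored_square_perms n. \<not> co_decomposable n \<sigma>}"
    then obtain \<sigma> C where s: "(\<sigma>, C) \<in> colored_square_perms n" "x = code n (\<sigma>, C)" "\<not> co_decomposable n \<sigma>" by auto
    then have "x \<in> marked_words n" "x \<in> code n ` colored_square_perms n" using M by auto
    then show "x \<in> marked_words n - (A'_words n \<union> B'_words n)"
      using img[of "fst x" "snd x"] code_in_B'[OF s(1) n] s by auto
  next
    fix x assume x: "x \<in> marked_words n - (A'_words n \<union> B'_words n)"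
    then have "x \<in> code n ` colored_square_perms n" using img[of "fst x" "snd x"] B_sub_B'[of "fst x" "snd x" n] n
        by auto
    then obtain \<sigma> C where s: "(\<sigma>, C) \<in> colored_square_perms n" "x = code n (\<sigma>, C)" by auto
    then show "x \<in> code n ` {(\<sigma>, C) \<in> colored_square_perms n. \<not> co_decomposable n \<sigma>}"
      using code_in_B'[OF s(1) n] x by auto
  qed
qed

section \<open>Closed self-avoiding walks\<close>

text \<open>The vertex sequence of a closed walk, extended periodically.\<close>

definition at :: "'a list \<Rightarrow> nat \<Rightarrow> 'a" where
  "at c i = c ! (i mod length c)"

text \<open>A unit edge on a line is represented by its end with the smaller coordinate.\<close>

definition vert_edges :: "polygon \<Rightarrow> nat \<Rightarrow> nat set" where
  "vert_edges P x = {y. {(x, y), (x, Suc y)} \<in> P}"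

definition hor_edges :: "polygon \<Rightarrow> nat \<Rightarrow> nat set" where
  "hor_edges P y = {x. {(x, y), (Suc x, y)} \<in> P}"

lemma adjacent_sym: "adjacent p q \<longleftrightarrow> adjacent q p"
  by (auto simp: adjacent_def)

context
  fixes c :: "point list"
  assumes saw: "closed_saw c"
begin

lemma saw_len: "2 < length c" and saw_distinct: "distinct c"
  using saw by (auto simp: closed_saw_def)

lemma at_nth: "i < length c \<Longrightarrow> at c i = c ! i"
  by (simp add: at_def)

lemma at_add: "at c (i + length c) = at c i" by (simp add: at_def)

lemma at_mod: "at c (i mod length c) = at c i" by (simp add: at_def)

lemma saw_mod: "i mod length c < length c"
  by (rule mod_less_divisor) (use saw_len in linarith)

lemma at_eq_iff: "at c i = at c j \<longleftrightarrow> i mod length c = j mod length c"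
proof -
  have "i mod length c < length c" "j mod length c < length c" using saw_mod by auto
  then show ?thesis using nth_eq_iff_index_eq[OF saw_distinct] by (simp add: at_def)
qed

lemma mod_Suc_cancel: "Suc i mod length c = Suc j mod length c \<Longrightarrow> i mod length c = j mod length c"
proof -
  assume "Suc i mod length c = Suc j mod length c"
  then have "(Suc i + (length c - 1)) mod length c = (Suc j + (length c - 1)) mod length c"
    by (metis mod_add_left_eq)
  moreover have "Suc x + (length c - 1) = x + length c" for x using saw_len by simp
  ultimately show ?thesis by (simp only: mod_add_self2)
qed

lemma at_Suc_eq: "at c (Suc i) = at c (Suc j) \<Longrightarrow> at c i = at c j"
  unfolding at_eq_iff by (rule mod_Suc_cancel)

lemma at_eq_Suc: "at c i = at c j \<Longrightarrow> at c (Suc i) = at c (Suc j)"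
  unfolding at_eq_iff by (metis mod_Suc_eq)

lemma at_adjacent: "adjacent (at c i) (at c (Suc i))"
proof -
  have "i mod length c < length c" by (rule saw_mod)
  then have "adjacent (c ! (i mod length c)) (cyc_next c (i mod length c))" using saw by (auto simp: closed_saw_def)
  then show ?thesis by (simp add: at_def cyc_next_def mod_Suc_eq)
qed

lemma at_surj: "v \<in> set c \<Longrightarrow> \<exists>i. v = at c (Suc i)"
proof -
  assume "v \<in> set c"
  then obtain i where i: "i < length c" "v = c ! i" by (metis in_set_conv_nth)
  have "Suc (i + length c - 1) = i + length c" using saw_len by simp
  then have "at c (Suc (i + length c - 1)) = v" using i by (simp add: at_add at_nth)
  then show ?thesis by metis
qed

lemma at_in_set: "at c i \<in> set c"
  unfolding at_def by (rule nth_mem[OF saw_mod])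

lemma walk_edges_iff: "{v, w} \<in> walk_edges c \<longleftrightarrow> (\<exists>i. v = at c i \<and> w = at c (Suc i) \<or> w = at c i \<and> v = at c (Suc i))"
proof
  assume "{v, w} \<in> walk_edges c"
  then obtain i where i: "i < length c" "{v, w} = {c ! i, cyc_next c i}" by (auto simp: walk_edges_def)
  then have "{v, w} = {at c i, at c (Suc i)}" by (simp add: at_def cyc_next_def)
  then show "\<exists>i. v = at c i \<and> w = at c (Suc i) \<or> w = at c i \<and> v = at c (Suc i)" by (auto simp: doubleton_eq_iff)
next
  assume "\<exists>i. v = at c i \<and> w = at c (Suc i) \<or> w = at c i \<and> v = at c (Suc i)"
  then obtain i where i: "{v, w} = {at c i, at c (Suc i)}" by auto
  have "i mod length c < length c" by (rule saw_mod)
  moreover have "at c i = c ! (i mod length c)" "at c (Suc i) = cyc_next c (i mod length c)"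
    by (auto simp: at_def cyc_next_def mod_Suc_eq)
  ultimately show "{v, w} \<in> walk_edges c" unfolding i walk_edges_def by auto
qed

lemma walk_edge_form: "E \<in> walk_edges c \<Longrightarrow> \<exists>i. E = {at c i, at c (Suc i)}"
  unfolding walk_edges_def at_def cyc_next_def mem_Collect_eq by (metis mod_less)

lemma edge_vertices: "{v, w} \<in> walk_edges c \<Longrightarrow> v \<in> set c \<and> w \<in> set c"
  unfolding walk_edges_iff using at_in_set by auto

lemma edge_adjacent: "{v, w} \<in> walk_edges c \<Longrightarrow> adjacent v w"
  unfolding walk_edges_iff using at_adjacent adjacent_sym by metis

lemma walk_vertices: "\<Union> (walk_edges c) = set c"
proof (intro equalityI subsetI)
  fix v assume "v \<in> \<Union> (walk_edges c)"
  then show "v \<in> set c" using walk_edge_form at_in_set by fastforce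
next
  fix v assume "v \<in> set c"
  then obtain i where "v = at c (Suc i)" using at_surj by blast
  then have "{v, at c i} \<in> walk_edges c" unfolding walk_edges_iff by blast
  then show "v \<in> \<Union> (walk_edges c)" by blast
qed

lemma at_ne: "at c i \<noteq> at c (Suc i)" "at c i \<noteq> at c (Suc (Suc i))"
proof -
  show "at c i \<noteq> at c (Suc i)" using at_adjacent[of i] by (auto simp: adjacent_def)
  show "at c i \<noteq> at c (Suc (Suc i))"
  proof
    assume "at c i = at c (Suc (Suc i))"
    then have "i mod length c = Suc (Suc i) mod length c" unfolding at_eq_iff .
    then have "length c dvd Suc (Suc i) - i" by (metis le_add2 mod_eq_dvd_iff_nat plus_1_eq_Suc add_2_eq_Suc)
    then show False using saw_len by (auto dest: dvd_imp_le)
  qed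
qed

lemma edge_at_iff: "{at c (Suc i), w} \<in> walk_edges c \<longleftrightarrow> w = at c i \<or> w = at c (Suc (Suc i))"
  unfolding walk_edges_iff using at_Suc_eq at_eq_Suc by metis

text \<open>
  A vertex is on exactly two edges, so it is a turnpoint if exactly one of the two edges that could
  be vertical is present. Here the edge below is the one with index \<open>y - 1\<close>.
\<close>

lemma turnpoint_iff_vert: "(x, y) \<in> turnpoints (walk_edges c) \<longleftrightarrow> (y \<in> vert_edges (walk_edges c) x) \<noteq> (0 < y \<and>
    y - 1 \<in> vert_edges (walk_edges c) x)"
proof (cases "(x, y) \<in> set c")
  case True
  then obtain i where i: "(x, y) = at c (Suc i)" using at_surj by blast
  obtain ux uy wx wy where uw: "at c i = (ux, uy)" "at c (Suc (Suc i)) = (wx, wy)" by (metis surj_pair)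
  have E: "{(x, y), v} \<in> walk_edges c \<longleftrightarrow> v = (ux, uy) \<or> v = (wx, wy)" for v using edge_at_iff[of i v] i uw by simp
  have a: "adjacent (ux, uy) (x, y)" "adjacent (x, y) (wx, wy)" "(ux, uy) \<noteq> (wx, wy)"
    using at_adjacent[of i] at_adjacent[of "Suc i"] at_ne(2)[of i] i uw by auto
  have T: "(x, y) \<in> turnpoints (walk_edges c) \<longleftrightarrow> (ux \<noteq> x \<or> wx \<noteq> x) \<and> (uy \<noteq> y \<or> wy \<noteq> y)"
    unfolding turnpoints_def mem_Collect_eq E by auto
  have 1: "y \<in> vert_edges (walk_edges c) x \<longleftrightarrow> (ux = x \<and> uy = Suc y) \<or> (wx = x \<and> wy = Suc y)"
    unfolding vert_edges_def mem_Collect_eq E by auto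
  have 2: "0 < y \<and> y - 1 \<in> vert_edges (walk_edges c) x \<longleftrightarrow> (ux = x \<and> Suc uy = y) \<or> (wx = x \<and> Suc wy = y)"
  proof -
    have "0 < y \<Longrightarrow> {(x, y - 1), (x, Suc (y - 1))} = {(x, y), (x, y - 1)}" by (simp add: insert_commute)
    then have "0 < y \<and> y - 1 \<in> vert_edges (walk_edges c) x \<longleftrightarrow> 0 < y \<and> ((x, y - 1) = (ux, uy) \<or> (x, y - 1) = (wx, wy))"
      unfolding vert_edges_def mem_Collect_eq by (metis E)
    then show ?thesis by auto
  qed
  show ?thesis unfolding T 1 2 using a unfolding adjacent_def by auto
next
  case False
  have "{(x, y - 1), (x, Suc (y - 1))} \<notin> walk_edges c" if "0 < y"
    using edge_vertices[of "(x, y - 1)" "(x, y)"] False that by auto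
  then show ?thesis using False edge_vertices unfolding turnpoints_def vert_edges_def by blast
qed

lemma turnpoint_iff_hor: "(x, y) \<in> turnpoints (walk_edges c) \<longleftrightarrow> (x \<in> hor_edges (walk_edges c) y) \<noteq> (0 < x \<and>
    x - 1 \<in> hor_edges (walk_edges c) y)"
proof (cases "(x, y) \<in> set c")
  case True
  then obtain i where i: "(x, y) = at c (Suc i)" using at_surj by blast
  obtain ux uy wx wy where uw: "at c i = (ux, uy)" "at c (Suc (Suc i)) = (wx, wy)" by (metis surj_pair)
  have E: "{(x, y), v} \<in> walk_edges c \<longleftrightarrow> v = (ux, uy) \<or> v = (wx, wy)" for v using edge_at_iff[of i v] i uw by simp
  have a: "adjacent (ux, uy) (x, y)" "adjacent (x, y) (wx, wy)" "(ux, uy) \<noteq> (wx, wy)"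
    using at_adjacent[of i] at_adjacent[of "Suc i"] at_ne(2)[of i] i uw by auto
  have T: "(x, y) \<in> turnpoints (walk_edges c) \<longleftrightarrow> (ux \<noteq> x \<or> wx \<noteq> x) \<and> (uy \<noteq> y \<or> wy \<noteq> y)"
    unfolding turnpoints_def mem_Collect_eq E by auto
  have 1: "x \<in> hor_edges (walk_edges c) y \<longleftrightarrow> (uy = y \<and> ux = Suc x) \<or> (wy = y \<and> wx = Suc x)"
    unfolding hor_edges_def mem_Collect_eq E by auto
  have 2: "0 < x \<and> x - 1 \<in> hor_edges (walk_edges c) y \<longleftrightarrow> (uy = y \<and> Suc ux = x) \<or> (wy = y \<and> Suc wx = x)"
  proof -
    have "0 < x \<Longrightarrow> {(x - 1, y), (Suc (x - 1), y)} = {(x, y), (x - 1, y)}" by (simp add: insert_commute)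
    then have "0 < x \<and> x - 1 \<in> hor_edges (walk_edges c) y \<longleftrightarrow> 0 < x \<and> ((x - 1, y) = (ux, uy) \<or> (x - 1, y) = (wx, wy))"
      unfolding hor_edges_def mem_Collect_eq by (metis E)
    then show ?thesis by auto
  qed
  show ?thesis unfolding T 1 2 using a unfolding adjacent_def by auto
next
  case False
  have "{(x - 1, y), (Suc (x - 1), y)} \<notin> walk_edges c" if "0 < x"
    using edge_vertices[of "(x - 1, y)" "(x, y)"] False that by auto
  then show ?thesis using False edge_vertices unfolding turnpoints_def hor_edges_def by blast
qed

lemma vert_vertex: "(x, y) \<in> set c \<Longrightarrow> (x, y) \<notin> turnpoints (walk_edges c) \<Longrightarrow> x \<in> hor_edges (walk_edges c) y \<or>
    y \<in> vert_edges (walk_edges c) x"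
proof -
  assume v: "(x, y) \<in> set c" and t: "(x, y) \<notin> turnpoints (walk_edges c)"
  then obtain i where i: "(x, y) = at c (Suc i)" using at_surj by blast
  have "{(x, y), at c i} \<in> walk_edges c" using edge_at_iff[of i "at c i"] i by simp
  moreover obtain ux uy where u: "at c i = (ux, uy)" by (metis surj_pair)
  ultimately have e: "{(x, y), (ux, uy)} \<in> walk_edges c" by simp
  have "adjacent (x, y) (ux, uy)" using edge_adjacent[OF e] .
  then consider "ux = x" "uy = Suc y" | "ux = x" "y = Suc uy" | "uy = y" "ux = Suc x" | "uy = y" "x = Suc ux"
    by (auto simp: adjacent_def)
  then show ?thesis
  proof cases
    case 2
    then have "0 < y \<and> y - 1 \<in> vert_edges (walk_edges c) x" using e by (auto simp: vert_edges_def insert_commute)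
    then show ?thesis using t turnpoint_iff_vert by blast
  next
    case 4
    then have "0 < x \<and> x - 1 \<in> hor_edges (walk_edges c) y" using e by (auto simp: hor_edges_def insert_commute)
    then show ?thesis using t turnpoint_iff_hor by blast
  qed (use e in \<open>auto simp: vert_edges_def hor_edges_def\<close>)
qed

end

section \<open>Sides on a line\<close>

text \<open>
  The sides on a line in terms of the edges \<open>E\<close> and of the turnpoints \<open>T\<close> on it, so that vertical
  and horizontal lines can be treated together.
\<close>

definition line_sides :: "nat set \<Rightarrow> (nat \<Rightarrow> bool) \<Rightarrow> (nat \<times> nat) set" where
  "line_sides E T = {(a, b). a < b \<and> T a \<and> T b \<and> (\<forall>y\<in>{a..<b}. y \<in> E) \<and> (\<forall>y\<in>{a<..<b}. \<not> T y)}"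

lemma vertical_sides_line: "vertical_sides P x = line_sides (vert_edges P x) (\<lambda>y. (x, y) \<in> turnpoints P)"
  by (auto simp: vertical_sides_def line_sides_def vert_edges_def)

lemma horizontal_sides_line: "horizontal_sides P y = line_sides (hor_edges P y) (\<lambda>x. (x, y) \<in> turnpoints P)"
  by (auto simp: horizontal_sides_def line_sides_def hor_edges_def)

lemma line_side_containing:
  assumes E: "finite E" "y \<in> E" and T: "\<And>y. T y \<longleftrightarrow> (y \<in> E) \<noteq> (0 < y \<and> y - 1 \<in> E)"
  shows "\<exists>a b. (a, b) \<in> line_sides E T \<and> a \<le> y \<and> y < b"
proof -
  define b where "b = (LEAST b. y < b \<and> b \<notin> E)"
  obtain m where "\<forall>n\<in>E. n < m" using E(1) finite_nat_set_iff_bounded by blast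
  then have "y < Suc (y + m) \<and> Suc (y + m) \<notin> E" by auto
  then have "\<exists>b. y < b \<and> b \<notin> E" by blast
  then have b: "y < b" "b \<notin> E" using LeastI_ex[of "\<lambda>b. y < b \<and> b \<notin> E"] by (auto simp: b_def)
  have bmin: "z \<in> E" if "y \<le> z" "z < b" for z
  proof (cases "z = y")
    case False
    then show ?thesis using not_less_Least[of z "\<lambda>b. y < b \<and> b \<notin> E"] that by (auto simp: b_def)
  qed (use E in simp)
  define a where "a = (LEAST a. \<forall>z. a \<le> z \<and> z \<le> y \<longrightarrow> z \<in> E)"
  have a0: "\<forall>z. y \<le> z \<and> z \<le> y \<longrightarrow> z \<in> E" using E by auto
  then have a: "\<forall>z. a \<le> z \<and> z \<le> y \<longrightarrow> z \<in> E" unfolding a_def by (rule LeastI)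
  have ay: "a \<le> y" unfolding a_def using a0 by (rule Least_le)
  have "T a"
  proof (cases "a = 0")
    case True then show ?thesis using T[of a] a ay by auto
  next
    case False
    then have "\<not> (\<forall>z. a - 1 \<le> z \<and> z \<le> y \<longrightarrow> z \<in> E)" using not_less_Least[of "a - 1" "\<lambda>a. \<forall>z. a \<le> z \<and> z \<le> y \<longrightarrow> z \<in> E"]
      unfolding a_def[symmetric] by auto
    then obtain z where z: "a - 1 \<le> z" "z \<le> y" "z \<notin> E" by blast
    have "z = a - 1"
    proof (rule ccontr)
      assume "z \<noteq> a - 1"
      then have "a \<le> z" using z False by simp
      then show False using a z by blast
    qed
    then show ?thesis using T[of a] a ay z by auto
  qed
  moreover have "T b" using T[of b] b bmin[of "b - 1"] by auto
  moreover have in_E: "z \<in> E" if "a \<le> z" "z < b" for z using a bmin[of z] that by (cases "z \<le> y") auto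
  moreover have "\<not> T z" if "a < z" "z < b" for z using T[of z] in_E[of z] in_E[of "z - 1"] that by auto
  ultimately have "(a, b) \<in> line_sides E T" using ay b by (auto simp: line_sides_def)
  then show ?thesis using ay b by blast
qed

text \<open>
  Turnpoints are the ends of the maximal runs of edges, and every edge is on a side. Hence a line
  with a single side carries a single run.
\<close>

lemma line_sides_unique:
  assumes E: "finite E" and T: "\<And>y. T y \<longleftrightarrow> (y \<in> E) \<noteq> (0 < y \<and> y - 1 \<in> E)"
    and u: "\<exists>!s. s \<in> line_sides E T"
  shows "\<exists>a b. a < b \<and> E = {a..<b} \<and> (\<forall>y. T y \<longleftrightarrow> y = a \<or> y = b)"
proof -
  obtain a b where s: "(a, b) \<in> line_sides E T" and u': "\<And>s. s \<in> line_sides E T \<Longrightarrow> s = (a, b)" using u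
      by (metis surj_pair)
  have ab: "a < b" "{a..<b} \<subseteq> E" using s by (auto simp: line_sides_def)
  have "E \<subseteq> {a..<b}"
  proof
    fix y assume "y \<in> E"
    then obtain a' b' where "(a', b') \<in> line_sides E T" "a' \<le> y" "y < b'" using line_side_containing[of E y T] E T
        by blast
    then show "y \<in> {a..<b}" using u' by fastforce
  qed
  then have Eq: "E = {a..<b}" using ab by auto
  have "T y \<longleftrightarrow> y = a \<or> y = b" for y unfolding T Eq using ab by auto
  then show ?thesis using ab Eq by blast
qed

lemma line_sides_interval:
  assumes T: "\<And>y. T y \<longleftrightarrow> (y \<in> {a..<b}) \<noteq> (0 < y \<and> y - 1 \<in> {a..<b})" and ab: "a < b"
  shows "line_sides {a..<b} T = {(a, b)}"
proof -
  have "T y \<longleftrightarrow> y = a \<or> y = b" for y unfolding T using ab by auto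
  then show ?thesis using ab by (auto simp: line_sides_def)
qed

section \<open>Balanced crossings\<close>

text \<open>
  Up to any time the difference of the two numbers of crossings is determined by the sides of the
  cut on which the walk started and is now.
\<close>

lemma crossings_balanced:
  fixes f :: "nat \<Rightarrow> nat"
  assumes step: "\<And>i. f (Suc i) = f i \<or> f (Suc i) = Suc (f i) \<or> f i = Suc (f (Suc i))" and per: "f N = f 0"
  shows "card {i. i < N \<and> f i = k \<and> f (Suc i) = Suc k} = card {i. i < N \<and> f i = Suc k \<and> f (Suc i) = k}"
proof -
  define g :: "nat \<Rightarrow> int" where "g i = (if f i \<le> k then 1 else 0)" for i
  let ?E = "{i. i < N \<and> f i = k \<and> f (Suc i) = Suc k}" and ?W = "{i. i < N \<and> f i = Suc k \<and> f (Suc i) = k}"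
  have "(\<Sum>i<N. g (Suc i) - g i) = 0" unfolding sum_lessThan_telescope using per by (simp add: g_def)
  moreover have "g (Suc i) - g i = (if i \<in> ?W then 1 else 0) - (if i \<in> ?E then 1 else 0)" if "i < N" for i
    using step[of i] that by (auto simp: g_def)
  then have "(\<Sum>i<N. g (Suc i) - g i) = (\<Sum>i<N. (if i \<in> ?W then 1 else 0) - (if i \<in> ?E then 1 else 0))"
    by (intro sum.cong) auto
  ultimately have "(\<Sum>i<N. (if i \<in> ?W then 1 else 0) - (if i \<in> ?E then 1 else 0 :: int)) = 0" by metis
  then have eq: "(\<Sum>i<N. if i \<in> ?W then 1 else 0 :: int) = (\<Sum>i<N. if i \<in> ?E then 1 else 0)" unfolding sum_subtractf
      by linarith
  have cs: "(\<Sum>i<N. if i \<in> S then 1 else 0 :: int) = int (card S)" if "S \<subseteq> {..<N}" for S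
    using that by (simp add: sum.If_cases Int_absorb1)
  have sub: "?W \<subseteq> {..<N}" "?E \<subseteq> {..<N}" by auto
  have "int (card ?W) = int (card ?E)"
    unfolding cs[OF sub(1), symmetric] cs[OF sub(2), symmetric] by (rule eq)
  then show ?thesis by linarith
qed

lemma crossing_between:
  fixes f :: "nat \<Rightarrow> nat"
  assumes step: "\<And>i. f (Suc i) = f i \<or> f (Suc i) = Suc (f i) \<or> f i = Suc (f (Suc i))"
    and a: "f a \<le> k" and b: "k < f b" and ab: "a \<le> b"
  shows "\<exists>i. a \<le> i \<and> i < b \<and> f i = k \<and> f (Suc i) = Suc k"
proof -
  define j where "j = (LEAST j. a \<le> j \<and> k < f j)"
  have j: "a \<le> j" "k < f j" using LeastI[of "\<lambda>j. a \<le> j \<and> k < f j" b] b ab by (auto simp: j_def)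
  have "j \<le> b" unfolding j_def using b ab by (intro Least_le) auto
  have "j \<noteq> a" using a j by auto
  then obtain i where i: "j = Suc i" "a \<le> i" using j by (cases j) auto
  have "\<not> k < f i" using not_less_Least[of i "\<lambda>j. a \<le> j \<and> k < f j"] i unfolding j_def[symmetric] by auto
  then have "f i = k" "f (Suc i) = Suc k" using step[of i] j i by auto
  then show ?thesis using i \<open>j \<le> b\<close> by auto
qed

lemma crossing_exists:
  fixes f :: "nat \<Rightarrow> nat"
  assumes step: "\<And>i. f (Suc i) = f i \<or> f (Suc i) = Suc (f i) \<or> f i = Suc (f (Suc i))" and per: "f N = f 0"
    and a: "a < N" "f a \<le> k" and b: "b < N" "k < f b"
  shows "1 \<le> card {i. i < N \<and> f i = k \<and> f (Suc i) = Suc k}"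
proof -
  have "\<exists>i. i < N \<and> f i = k \<and> f (Suc i) = Suc k"
  proof (cases "a \<le> b")
    case True
    then show ?thesis using crossing_between[of f a k b, OF step a(2) b(2)] b by (meson less_trans)
  next
    case False
    show ?thesis
    proof (cases "f 0 \<le> k")
      case True
      then show ?thesis using crossing_between[of f 0 k b, OF step True b(2)] b by (meson less_trans zero_le)
    next
      case False
      then have "k < f N" using per by simp
      then show ?thesis using crossing_between[of f a k N, OF step a(2)] a by (meson less_imp_le)
    qed
  qed
  then obtain i where "{i} \<subseteq> {i. i < N \<and> f i = k \<and> f (Suc i) = Suc k}" by auto
  from card_mono[OF _ this] show ?thesis by simp
qed

text \<open>
  The coordinates \<open>f\<close> and \<open>g\<close> of a closed walk cross each of their \<open>n - 1\<close> cuts at least once in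
  both directions. These are already \<open>4 (n - 1)\<close> steps, all different as a step changes one
  coordinate only, so there are no further crossings.
\<close>

lemma crossings_unique:
  fixes f g :: "nat \<Rightarrow> nat"
  assumes f: "\<And>i. f (Suc i) = f i \<or> f (Suc i) = Suc (f i) \<or> f i = Suc (f (Suc i))" "f N = f 0"
    and g: "\<And>i. g (Suc i) = g i \<or> g (Suc i) = Suc (g i) \<or> g i = Suc (g (Suc i))" "g N = g 0"
    and one: "\<And>i. f (Suc i) = f i \<or> g (Suc i) = g i"
    and f1: "a < N" "f a = 1" and fn: "b < N" "f b = n" and g1: "a' < N" "g a' = 1" and gn: "b' < N" "g b' = n"
    and N: "N \<le> 4 * (n - 1)" and k: "1 \<le> k" "k < n"
  shows "card {i. i < N \<and> f i = k \<and> f (Suc i) = Suc k} = 1"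
proof -
  define E where "E h k = {i. i < N \<and> h i = k \<and> h (Suc i) = Suc k}" for h :: "nat \<Rightarrow> nat" and k
  define W where "W h k = {i. i < N \<and> h i = Suc k \<and> h (Suc i) = k}" for h :: "nat \<Rightarrow> nat" and k
  define S where "S k = (E f k \<union> W f k) \<union> (E g k \<union> W g k)" for k
  have fin: "finite (E h k)" "finite (W h k)" for h k by (auto simp: E_def W_def)
  have cS: "card (S k) = 2 * card (E f k) + 2 * card (E g k)" for k
  proof -
    have "card (E f k \<union> W f k) = card (E f k) + card (W f k)"
        by (rule card_Un_disjoint) (use fin in \<open>auto simp: E_def W_def\<close>)
    moreover have "card (E g k \<union> W g k) = card (E g k) + card (W g k)"
        by (rule card_Un_disjoint) (use fin in \<open>auto simp: E_def W_def\<close>)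
    moreover have "(E f k \<union> W f k) \<inter> (E g k \<union> W g k) = {}"
    proof -
      have False if "i \<in> E f k \<union> W f k" "i \<in> E g k \<union> W g k" for i using one[of i] that by (auto simp: E_def W_def)
      then show ?thesis by blast
    qed
    then have "card (S k) = card (E f k \<union> W f k) + card (E g k \<union> W g k)" unfolding S_def
        by (intro card_Un_disjoint) (use fin in auto)
    ultimately show ?thesis using crossings_balanced[OF f, of k] crossings_balanced[OF g, of k]
        by (simp add: E_def W_def)
  qed
  have pos: "1 \<le> card (E f k)" "1 \<le> card (E g k)" if "1 \<le> k" "k < n" for k
    using crossing_exists[OF f f1(1) _ fn(1), of k] crossing_exists[OF g g1(1) _ gn(1), of k] f1 fn g1 gn that
        by (auto simp: E_def)
  have "disjoint_family_on S {1..<n}" unfolding disjoint_family_on_def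
  proof (intro ballI impI)
    fix k l assume "k \<noteq> (l::nat)"
    have key: "f i = k \<and> f (Suc i) = Suc k \<or> f i = Suc k \<and> f (Suc i) = k \<or> g i = k \<and> g (Suc i) = Suc k \<or> g i = Suc k \<and>
        g (Suc i) = k"
      if "i \<in> S k" for i k using that unfolding S_def E_def W_def by blast
    have False if "i \<in> S k" "i \<in> S l" for i
      using one[of i] key[OF that(1)] key[OF that(2)] \<open>k \<noteq> l\<close> by linarith
    then show "S k \<inter> S l = {}" by blast
  qed
  then have "card (\<Union>k\<in>{1..<n}. S k) = (\<Sum>k\<in>{1..<n}. card (S k))"
  proof (rule card_UN_disjoint')
    show "finite (S k)" for k using fin by (simp add: S_def)
  qed simp
  moreover have "card (\<Union>k\<in>{1..<n}. S k) \<le> card {..<N}" by (rule card_mono) (auto simp: S_def E_def W_def)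
  ultimately have le: "(\<Sum>k\<in>{1..<n}. card (S k)) \<le> N" by simp
  show ?thesis
  proof (rule ccontr)
    assume "\<not> ?thesis"
    then have "2 \<le> card (E f k)" using pos[OF k] by (simp add: E_def)
    then have k6: "4 < card (S k)" using cS pos(2)[OF k] by simp
    have "(\<Sum>k\<in>{1..<n}. 4) < (\<Sum>k\<in>{1..<n}. card (S k))"
    proof (rule sum_strict_mono_ex1)
      show "\<forall>x\<in>{1..<n}. 4 \<le> card (S x)" using cS pos by fastforce
      show "\<exists>a\<in>{1..<n}. 4 < card (S a)" using k k6 by auto
    qed simp
    then show False using le N by simp
  qed
qed

section \<open>Steps of a walk\<close>

text \<open>
  The directed steps do not depend on the starting point and are reversed with the orientation.
  Clockwise walks and black points can be described by them, independently of a list of vertices.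
\<close>

definition walk_step :: "'a list \<Rightarrow> 'a \<Rightarrow> 'a \<Rightarrow> bool" where
  "walk_step c u v \<longleftrightarrow> (\<exists>i. at c i = u \<and> at c (Suc i) = v)"

lemma closed_saw_step:
  "closed_saw c \<longleftrightarrow> 2 < length c \<and> distinct c \<and> (\<forall>u v. walk_step c u v \<longrightarrow> adjacent u v)"
proof
  assume "closed_saw c"
  then show "2 < length c \<and> distinct c \<and> (\<forall>u v. walk_step c u v \<longrightarrow> adjacent u v)"
    using at_adjacent saw_len saw_distinct unfolding walk_step_def by blast
next
  assume a: "2 < length c \<and> distinct c \<and> (\<forall>u v. walk_step c u v \<longrightarrow> adjacent u v)"
  have "adjacent (c ! i) (cyc_next c i)" if "i < length c" for i
  proof -
    have "walk_step c (c ! i) (cyc_next c i)"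
      unfolding walk_step_def by (rule exI[of _ i]) (use that in \<open>simp add: at_def cyc_next_def\<close>)
    then show ?thesis using a by blast
  qed
  then show "closed_saw c" using a by (simp add: closed_saw_def)
qed

lemma walk_edges_step: "walk_edges c = {{u, v} | u v. walk_step c u v}" if "0 < length c"
proof (intro equalityI subsetI)
  fix E assume "E \<in> walk_edges c"
  then obtain i where i: "i < length c" "E = {c ! i, cyc_next c i}" by (auto simp: walk_edges_def)
  then have "walk_step c (c ! i) (cyc_next c i)"
    unfolding walk_step_def by (intro exI[of _ i]) (simp add: at_def cyc_next_def)
  then show "E \<in> {{u, v} | u v. walk_step c u v}" using i by blast
next
  fix E assume "E \<in> {{u, v} | u v. walk_step c u v}"
  then obtain i where i: "E = {at c i, at c (Suc i)}" unfolding walk_step_def by blast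
  have "i mod length c < length c" using that by (rule mod_less_divisor)
  moreover have "at c i = c ! (i mod length c)" "at c (Suc i) = cyc_next c (i mod length c)"
    by (auto simp: at_def cyc_next_def mod_Suc_eq)
  ultimately show "E \<in> walk_edges c" unfolding i walk_edges_def by auto
qed

lemma step_rotate: assumes "0 < length c" shows "walk_step (rotate m c) = walk_step c"
proof -
  have at: "at (rotate m c) i = at c (m + i)" for i
    using nth_rotate[of "i mod length c" c m] mod_less_divisor[OF assms, of i] by (simp add: at_def mod_add_right_eq)
  have "walk_step (rotate m c) u v \<longleftrightarrow> walk_step c u v" for u v
  proof
    assume "walk_step (rotate m c) u v"
    then show "walk_step c u v" unfolding walk_step_def at by (metis add_Suc_right)
  next
    assume "walk_step c u v"
    then obtain i where i: "at c i = u" "at c (Suc i) = v" by (auto simp: walk_step_def)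
    have le: "m \<le> m * length c" using assms by (cases "length c") auto
    obtain d where "m * length c = m + d" using le le_Suc_ex by blast
    then have e: "m + (i + (m * length c - m)) = i + m * length c"
        "m + Suc (i + (m * length c - m)) = Suc i + m * length c" by simp_all
    have "at (rotate m c) (i + (m * length c - m)) = u" "at (rotate m c) (Suc (i + (m * length c - m))) = v"
      unfolding at e using i by (simp_all add: at_def)
    then show "walk_step (rotate m c) u v" unfolding walk_step_def by blast
  qed
  then show ?thesis by blast
qed

lemma step_rev_imp: assumes "0 < length c" "walk_step (rev c) u v" shows "walk_step c v u"
proof -
  let ?N = "length c"
  obtain i where i: "at (rev c) i = u" "at (rev c) (Suc i) = v" using assms by (auto simp: walk_step_def)
  define j where "j = i mod ?N"
  have j: "j < ?N" unfolding j_def by (rule mod_less_divisor[OF assms(1)])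
  have u: "u = c ! (?N - Suc j)" using i(1) j by (simp add: at_def rev_nth j_def)
  show ?thesis
  proof (cases "Suc j = ?N")
    case True
    then have "Suc i mod ?N = 0" using mod_Suc[of i ?N] by (simp add: j_def)
    then have "v = c ! (?N - 1)" using i(2) assms(1) by (simp add: at_def rev_nth)
    then have "at c (?N - 1) = v" "at c (Suc (?N - 1)) = u" using u True assms(1) by (auto simp: at_def)
    then show ?thesis unfolding walk_step_def by blast
  next
    case False
    then have "Suc i mod ?N = Suc j" using mod_Suc[of i ?N] by (simp add: j_def)
    then have "v = c ! (?N - Suc (Suc j))" using i(2) j False by (simp add: at_def rev_nth)
    moreover have "Suc (?N - Suc (Suc j)) = ?N - Suc j" using j False by simp
    ultimately have "at c (?N - Suc (Suc j)) = v" "at c (Suc (?N - Suc (Suc j))) = u" using u j by (auto simp: at_def)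
    then show ?thesis unfolding walk_step_def by blast
  qed
qed

lemma step_rev: assumes "0 < length c" shows "walk_step (rev c) u v \<longleftrightarrow> walk_step c v u"
  using step_rev_imp[of c] step_rev_imp[of "rev c"] assms by auto

lemma saw_rotate: "closed_saw c \<Longrightarrow> closed_saw (rotate m c) \<and> walk_edges (rotate m c) = walk_edges c"
proof -
  assume s: "closed_saw c"
  then have "0 < length c" using saw_len by fastforce
  then show ?thesis using s step_rotate[of c m] walk_edges_step[of c] walk_edges_step[of "rotate m c"]
      by (simp add: closed_saw_step)
qed

lemma saw_rev: "closed_saw c \<Longrightarrow> closed_saw (rev c) \<and> walk_edges (rev c) = walk_edges c"
proof -
  assume s: "closed_saw c"
  then have l: "0 < length c" using saw_len by fastforce
  have "walk_edges (rev c) = {{u, v} | u v. walk_step c v u}" using walk_edges_step[of "rev c"] step_rev[OF l] l by simp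
  also have "\<dots> = walk_edges c" unfolding walk_edges_step[OF l] by (auto simp: insert_commute)
  finally have "walk_edges (rev c) = walk_edges c" .
  moreover have "closed_saw (rev c)" using s step_rev[OF l] adjacent_sym unfolding closed_saw_step
      by (metis distinct_rev length_rev)
  ultimately show ?thesis by simp
qed

lemma clockwise_step:
  "clockwise_walk P c \<longleftrightarrow> closed_saw c \<and> walk_edges c = P \<and>
     (\<forall>u v. walk_step c u v \<longrightarrow> fst u = xmin P \<longrightarrow> fst v = xmin P \<longrightarrow> snd u < snd v)"
proof -
  have "(\<forall>i<length c. fst (c ! i) = xmin P \<and> fst (cyc_next c i) = xmin P \<longrightarrow> snd (c ! i) < snd (cyc_next c i)) \<longleftrightarrow>
     (\<forall>u v. walk_step c u v \<longrightarrow> fst u = xmin P \<longrightarrow> fst v = xmin P \<longrightarrow> snd u < snd v)" (is "?l \<longleftrightarrow> ?r") if s: "closed_saw c"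
  proof
    assume l: ?l
    show ?r
    proof (intro allI impI)
      fix u v assume a: "walk_step c u v" "fst u = xmin P" "fst v = xmin P"
      then obtain i where i: "u = at c i" "v = at c (Suc i)" by (auto simp: walk_step_def)
      have "at c i = c ! (i mod length c)" "at c (Suc i) = cyc_next c (i mod length c)"
        by (auto simp: at_def cyc_next_def mod_Suc_eq)
      then show "snd u < snd v" using l saw_mod[OF s, of i] a i by auto
    qed
  next
    assume r: ?r
    show ?l
    proof (intro allI impI)
      fix i assume i: "i < length c" "fst (c ! i) = xmin P \<and> fst (cyc_next c i) = xmin P"
      have "walk_step c (c ! i) (cyc_next c i)"
        unfolding walk_step_def by (rule exI[of _ i]) (use i in \<open>simp add: at_def cyc_next_def\<close>)
      then show "snd (c ! i) < snd (cyc_next c i)" using r i by blast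
    qed
  qed
  then show ?thesis unfolding clockwise_walk_def by blast
qed

context
  fixes c :: "point list"
  assumes saw: "closed_saw c"
begin

lemma step_succ_unique: "walk_step c u v \<Longrightarrow> walk_step c u w \<Longrightarrow> v = w"
  unfolding walk_step_def using at_eq_Suc[OF saw] by metis

lemma step_pred_unique: "walk_step c u w \<Longrightarrow> walk_step c v w \<Longrightarrow> u = v"
  unfolding walk_step_def using at_Suc_eq[OF saw] by metis

lemma step_no_return: "walk_step c u v \<Longrightarrow> \<not> walk_step c v u"
  unfolding walk_step_def using at_eq_Suc[OF saw] at_ne(2)[OF saw] by metis

lemma step_ex: "v \<in> set c \<Longrightarrow> \<exists>u w. walk_step c u v \<and> walk_step c v w"
  unfolding walk_step_def using at_surj[OF saw] by metis

lemma step_edge: "{u, v} \<in> walk_edges c \<longleftrightarrow> walk_step c u v \<or> walk_step c v u"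
  unfolding walk_edges_iff[OF saw] walk_step_def by metis

lemma step_in: "walk_step c u v \<Longrightarrow> u \<in> set c \<and> v \<in> set c"
  unfolding walk_step_def using at_in_set[OF saw] by auto

lemma step_adjacent: "walk_step c u v \<Longrightarrow> adjacent u v"
  using saw closed_saw_step by blast

lemma step_turn:
  assumes "walk_step c u v" "walk_step c v w"
  shows "v \<in> turnpoints (walk_edges c) \<longleftrightarrow> (fst u = fst v) \<noteq> (fst v = fst w)"
proof -
  have nb: "{v, z} \<in> walk_edges c \<longleftrightarrow> z = u \<or> z = w" for z
    using step_edge step_succ_unique step_pred_unique assms by metis
  have ne: "u \<noteq> w" using step_no_return assms by blast
  have "v \<in> turnpoints (walk_edges c) \<longleftrightarrow> (fst u \<noteq> fst v \<or> fst w \<noteq> fst v) \<and> (snd u \<noteq> snd v \<or> snd w \<noteq> snd v)"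
    unfolding turnpoints_def mem_Collect_eq nb by blast
  moreover have a: "adjacent u v" "adjacent v w" using step_adjacent[OF assms(1)] step_adjacent[OF assms(2)] by auto
  have "(fst u \<noteq> fst v \<or> fst w \<noteq> fst v) \<and> (snd u \<noteq> snd v \<or> snd w \<noteq> snd v) \<longleftrightarrow> (fst u = fst v) \<noteq> (fst v = fst w)"
  proof -
    have d: "(fst u = fst v) \<noteq> (snd u = snd v)" "(fst v = fst w) \<noteq> (snd v = snd w)"
      using a unfolding adjacent_def by linarith+
    then show ?thesis by metis
  qed
  ultimately show ?thesis by blast
qed

text \<open>The two horizontal edges already are the edges by which the walk arrives and leaves.\<close>

lemma straight_no_vert:
  assumes "Suc x \<in> hor_edges (walk_edges c) y" "x \<in> hor_edges (walk_edges c) y"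
  shows "y \<notin> vert_edges (walk_edges c) (Suc x)"
proof
  assume v: "y \<in> vert_edges (walk_edges c) (Suc x)"
  have e: "{(Suc x, y), (x, y)} \<in> walk_edges c" "{(Suc x, y), (Suc (Suc x), y)} \<in> walk_edges c"
      "{(Suc x, y), (Suc x, Suc y)} \<in> walk_edges c"
    using assms v by (auto simp: hor_edges_def vert_edges_def insert_commute)
  have "(Suc x, y) \<in> set c" using edge_vertices[OF saw e(1)] by simp
  then obtain u w where uw: "walk_step c u (Suc x, y)" "walk_step c (Suc x, y) w" using step_ex by blast
  have nb: "{(Suc x, y), z} \<in> walk_edges c \<longleftrightarrow> z = u \<or> z = w" for z
    using step_edge step_succ_unique step_pred_unique uw by metis
  show False using e unfolding nb by auto
qed

end

lemma filter_nth_position: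
  "j < length (filter Q xs) \<Longrightarrow> \<exists>i<length xs. filter Q xs ! j = xs ! i \<and> Q (xs ! i) \<and> length (filter Q (take i xs)) = j"
proof (induction xs rule: rev_induct)
  case (snoc x xs)
  show ?case
  proof (cases "j < length (filter Q xs)")
    case True
    then obtain i where i: "i < length xs" "filter Q xs ! j = xs ! i" "Q (xs ! i)" "length (filter Q (take i xs)) = j"
        using snoc.IH by blast
    show ?thesis by (rule exI[of _ i]) (use i True in \<open>simp add: nth_append\<close>)
  next
    case False
    then have "Q x" "j = length (filter Q xs)" using snoc.prems by (auto split: if_splits)
    then show ?thesis by (intro exI[of _ "length xs"]) (simp add: nth_append)
  qed
qed simp

lemma filter_nth_at:
  assumes "i < length xs" "Q (xs ! i)"
  shows "length (filter Q (take i xs)) < length (filter Q xs) \<and> filter Q xs ! length (filter Q (take i xs)) = xs ! i"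
proof -
  have "filter Q xs = filter Q (take i xs) @ xs ! i # filter Q (drop (Suc i) xs)"
    using id_take_nth_drop[OF assms(1)] assms(2) by (metis filter.simps(2) filter_append)
  then show ?thesis by (metis length_append less_add_same_cancel1 length_greater_0_conv list.distinct(1)
      nth_append_length)
qed

text \<open>
  The walk alternates between vertical and horizontal directions at each turnpoint, and its first
  step is vertical.
\<close>

lemma turn_parity:
  assumes saw: "closed_saw c" and hd: "c ! 0 \<in> turnpoints (walk_edges c)" "fst (at c 0) = fst (at c 1)"
  shows "i < length c \<Longrightarrow> fst (at c i) = fst (at c (Suc i)) \<longleftrightarrow> odd (length (filter (\<lambda>p. p \<in> turnpoints (walk_edges c))
      (take (Suc i) c)))"
proof (induction i)
  case 0
  have "take (Suc 0) c = [c ! 0]" using 0 by (metis One_nat_def append_Nil take0 take_Suc_conv_app_nth)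
  then show ?case using hd by simp
next
  case (Suc i)
  have s: "walk_step c (at c i) (at c (Suc i))" "walk_step c (at c (Suc i)) (at c (Suc (Suc i)))"
      by (auto simp: walk_step_def)
  have t: "take (Suc (Suc i)) c = take (Suc i) c @ [at c (Suc i)]"
    using Suc.prems take_Suc_conv_app_nth[of "Suc i" c] at_nth[OF saw, of "Suc i"] by simp
  show ?case unfolding t using step_turn[OF saw s] Suc by auto
qed

text \<open>
  The colors alternate along the turnpoints just as the directions do, so the black turnpoints are
  those that are left in the direction of the first step, which is vertical.
\<close>

lemma black_points_step:
  assumes cw: "clockwise_walk P c" and side: "(y1, y2) \<in> vertical_sides P (xmin P)" and hd: "hd c = (xmin P, y1)"
    and out: "walk_step c (xmin P, y1) u0" "fst u0 = xmin P"
  shows "(\<exists>j. j < length (filter (\<lambda>p. p \<in> turnpoints P) c) \<and> even j \<and> v = filter (\<lambda>p. p \<in> turnpoints P) c ! j) \<longleftrightarrow>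
    v \<in> turnpoints P \<and> (\<exists>u. walk_step c v u \<and> fst u = fst v)"
proof -
  let ?Q = "\<lambda>p. p \<in> turnpoints P"
  have saw: "closed_saw c" and P: "walk_edges c = P" using cw by (auto simp: clockwise_walk_def)
  have l: "0 < length c" using saw_len[OF saw] by (cases c) auto
  have c0: "c ! 0 = (xmin P, y1)" "at c 0 = (xmin P, y1)" using hd l by (auto simp: hd_conv_nth at_def)
  have "(xmin P, y1) \<in> turnpoints P" using side by (auto simp: vertical_sides_def)
  moreover have "walk_step c (at c 0) (at c 1)" by (auto simp: walk_step_def)
  then have "fst (at c 0) = fst (at c 1)" using out step_succ_unique[OF saw] c0 by fastforce
  ultimately have par: "fst (at c i) = fst (at c (Suc i)) \<longleftrightarrow> odd (length (filter ?Q (take (Suc i) c)))" if "i < length c"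
      for i
    using turn_parity[OF saw] that c0 P by simp
  have cnt: "length (filter ?Q (take (Suc i) c)) = Suc (length (filter ?Q (take i c)))" if "i < length c" "?Q (c ! i)"
      for i
    using that take_Suc_conv_app_nth[of i c] by simp
  show ?thesis
  proof
    assume "\<exists>j. j < length (filter ?Q c) \<and> even j \<and> v = filter ?Q c ! j"
    then obtain j where j: "j < length (filter ?Q c)" "even j" "v = filter ?Q c ! j" by blast
    obtain i where i: "i < length c" "filter ?Q c ! j = c ! i" "?Q (c ! i)" "length (filter ?Q (take i c)) = j"
      using filter_nth_position[OF j(1)] by blast
    have v: "v = at c i" using i j at_nth[OF saw] by simp
    have "fst (at c i) = fst (at c (Suc i))" using par[OF i(1)] cnt[OF i(1,3)] i j by simp
    then show "v \<in> turnpoints P \<and> (\<exists>u. walk_step c v u \<and> fst u = fst v)"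
      using i j v unfolding walk_step_def by metis
  next
    assume a: "v \<in> turnpoints P \<and> (\<exists>u. walk_step c v u \<and> fst u = fst v)"
    then obtain u k where k: "at c k = v" "at c (Suc k) = u" "fst u = fst v" by (auto simp: walk_step_def)
    define i where "i = k mod length c"
    have i: "i < length c" unfolding i_def by (rule saw_mod[OF saw])
    have ai: "at c i = v" "at c (Suc i) = u" using k at_mod[OF saw, of k] at_eq_Suc[OF saw, of i k]
        by (auto simp: i_def)
    have v: "c ! i = v" using ai at_nth[OF saw i] by simp
    have "odd (length (filter ?Q (take (Suc i) c)))" using par[OF i] ai k by simp
    then have "even (length (filter ?Q (take i c)))" using cnt[OF i] v a by simp
    then show "\<exists>j. j < length (filter ?Q c) \<and> even j \<and> v = filter ?Q c ! j"
      using filter_nth_at[OF i, of ?Q] v a by metis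
  qed
qed

section \<open>Convex permutominoes cross each cut twice\<close>

lemma UL_records_iff: "(x, y) \<in> UL_records V \<longleftrightarrow> (x, y) \<in> V \<and> (\<forall>x' y'. (x', y') \<in> V \<longrightarrow> x' < x \<longrightarrow> y' \<le> y)"
  by (simp add: UL_records_def Bex_def) (meson not_less)

lemma UR_records_iff: "(x, y) \<in> UR_records V \<longleftrightarrow> (x, y) \<in> V \<and> (\<forall>x' y'. (x', y') \<in> V \<longrightarrow> x < x' \<longrightarrow> y' \<le> y)"
  by (simp add: UR_records_def Bex_def) (meson not_less)

lemma BL_records_iff: "(x, y) \<in> BL_records V \<longleftrightarrow> (x, y) \<in> V \<and> (\<forall>x' y'. (x', y') \<in> V \<longrightarrow> x' < x \<longrightarrow> y \<le> y')"
  by (simp add: BL_records_def Bex_def) (meson not_less)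

lemma BR_records_iff: "(x, y) \<in> BR_records V \<longleftrightarrow> (x, y) \<in> V \<and> (\<forall>x' y'. (x', y') \<in> V \<longrightarrow> x < x' \<longrightarrow> y \<le> y')"
  by (simp add: BR_records_def Bex_def) (meson not_less)

text \<open>
  For a convex permutomino each cut is crossed once in each direction, which makes these
  descriptions unique.
\<close>

definition east_row :: "point list \<Rightarrow> nat \<Rightarrow> nat" where
  "east_row c k = (THE y. walk_step c (k, y) (Suc k, y))"

definition west_row :: "point list \<Rightarrow> nat \<Rightarrow> nat" where
  "west_row c k = (THE y. walk_step c (Suc k, y) (k, y))"

lemma east_row_rev: "0 < length c \<Longrightarrow> east_row (rev c) k = west_row c k"
    "0 < length c \<Longrightarrow> west_row (rev c) k = east_row c k"
  by (auto simp: east_row_def west_row_def step_rev)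

context
  fixes n :: nat and P :: polygon
  assumes n: "2 \<le> n" and Pm: "permutomino n P" and conv: "interior_points (\<Union> P) = {}"
begin

lemma vertex_range: "(x, y) \<in> \<Union> P \<Longrightarrow> 1 \<le> x \<and> x \<le> n \<and> 1 \<le> y \<and> y \<le> n"
  using Pm unfolding permutomino_def by auto

lemma saw_exists: "\<exists>c. closed_saw c \<and> walk_edges c = P"
  using Pm by (auto simp: permutomino_def is_polygon_def)

lemma vert_edges_sub: "vert_edges P x \<subseteq> {1..<n}"
  and hor_edges_sub: "hor_edges P y \<subseteq> {1..<n}"
proof -
  have "1 \<le> z \<and> z < n" if "{(x, z), (x, Suc z)} \<in> P" for z proof -
    have "(x, z) \<in> \<Union> P" "(x, Suc z) \<in> \<Union> P" using that by blast+
    then show ?thesis using vertex_range[of x z] vertex_range[of x "Suc z"] by linarith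
  qed
  then show "vert_edges P x \<subseteq> {1..<n}" by (auto simp: vert_edges_def)
  have "1 \<le> z \<and> z < n" if "{(z, y), (Suc z, y)} \<in> P" for z proof -
    have "(z, y) \<in> \<Union> P" "(Suc z, y) \<in> \<Union> P" using that by blast+
    then show ?thesis using vertex_range[of z y] vertex_range[of "Suc z" y] by linarith
  qed
  then show "hor_edges P y \<subseteq> {1..<n}" by (auto simp: hor_edges_def)
qed

lemma col_line: assumes "1 \<le> x" "x \<le> n"
  shows "\<exists>a b. a < b \<and> vert_edges P x = {a..<b} \<and> (\<forall>y. (x, y) \<in> turnpoints P \<longleftrightarrow> y = a \<or> y = b)"
proof (rule line_sides_unique)
  show "finite (vert_edges P x)" using vert_edges_sub finite_subset by blast
  show "(x, y) \<in> turnpoints P \<longleftrightarrow> (y \<in> vert_edges P x) \<noteq> (0 < y \<and> y - 1 \<in> vert_edges P x)" for y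
    using saw_exists turnpoint_iff_vert by blast
  have "x \<in> {1..n}" using assms by simp
  then show "\<exists>!s. s \<in> line_sides (vert_edges P x) (\<lambda>y. (x, y) \<in> turnpoints P)"
    using Pm unfolding permutomino_def vertical_sides_line by blast
qed

lemma row_line: assumes "1 \<le> y" "y \<le> n"
  shows "\<exists>a b. a < b \<and> hor_edges P y = {a..<b} \<and> (\<forall>x. (x, y) \<in> turnpoints P \<longleftrightarrow> x = a \<or> x = b)"
proof (rule line_sides_unique)
  show "finite (hor_edges P y)" using hor_edges_sub finite_subset by blast
  show "(x, y) \<in> turnpoints P \<longleftrightarrow> (x \<in> hor_edges P y) \<noteq> (0 < x \<and> x - 1 \<in> hor_edges P y)" for x
    using saw_exists turnpoint_iff_hor by blast
  have "y \<in> {1..n}" using assms by simp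
  then show "\<exists>!s. s \<in> line_sides (hor_edges P y) (\<lambda>x. (x, y) \<in> turnpoints P)"
    using Pm unfolding permutomino_def horizontal_sides_line by blast
qed

text \<open>
  No horizontal edges pass straight through the outermost lines, so that all their vertices belong
  to the vertical side.
\<close>

lemma extreme_col:
  assumes x: "x = 1 \<or> x = n"
  shows "\<exists>a b. a < b \<and> vert_edges P x = {a..<b} \<and> (\<forall>y. (x, y) \<in> turnpoints P \<longleftrightarrow> y = a \<or> y = b) \<and> (\<forall>y. (x, y) \<in> \<Union> P \<longleftrightarrow>
      a \<le> y \<and> y \<le> b)"
proof -
  have "1 \<le> x" "x \<le> n" using x n by auto
  from col_line[OF this] obtain a b where ab: "a < b" "vert_edges P x = {a..<b}" "\<forall>y. (x, y) \<in> turnpoints P \<longleftrightarrow> y = a \<or>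
      y = b"
    by blast
  obtain c where c: "closed_saw c" "walk_edges c = P" using saw_exists by blast
  have "(x, y) \<in> \<Union> P \<longleftrightarrow> a \<le> y \<and> y \<le> b" for y
  proof
    assume v: "(x, y) \<in> \<Union> P"
    show "a \<le> y \<and> y \<le> b"
    proof (cases "(x, y) \<in> turnpoints P")
      case True then show ?thesis using ab by auto
    next
      case False
      have "\<not> (x \<in> hor_edges P y)"
      proof
        assume h: "x \<in> hor_edges P y"
        then have "0 < x \<and> x - 1 \<in> hor_edges P y" using turnpoint_iff_hor[OF c(1), of x y] c False by auto
        then show False using h x hor_edges_sub[of y] by auto
      qed
      then have "y \<in> vert_edges P x" using vert_vertex[OF c(1), of x y] v c walk_vertices[OF c(1)] False by auto
      then show ?thesis using ab by auto
    qed
  next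
    assume y: "a \<le> y \<and> y \<le> b"
    show "(x, y) \<in> \<Union> P"
    proof (cases "y < b")
      case True
      then have "y \<in> vert_edges P x" using y ab by auto
      then show ?thesis by (auto simp: vert_edges_def)
    next
      case False
      then have "y - 1 \<in> vert_edges P x" "Suc (y - 1) = y" using y ab by auto
      then show ?thesis by (auto simp: vert_edges_def)
    qed
  qed
  then show ?thesis using ab by blast
qed

lemma extreme_row:
  assumes y: "y = 1 \<or> y = n"
  shows "\<exists>a b. a < b \<and> (\<forall>x. (x, y) \<in> \<Union> P \<longleftrightarrow> a \<le> x \<and> x \<le> b)"
proof -
  have "1 \<le> y" "y \<le> n" using y n by auto
  from row_line[OF this] obtain a b where ab: "a < b" "hor_edges P y = {a..<b}" "\<forall>x. (x, y) \<in> turnpoints P \<longleftrightarrow> x = a \<or>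
      x = b"
    by blast
  obtain c where c: "closed_saw c" "walk_edges c = P" using saw_exists by blast
  have "(x, y) \<in> \<Union> P \<longleftrightarrow> a \<le> x \<and> x \<le> b" for x
  proof
    assume v: "(x, y) \<in> \<Union> P"
    show "a \<le> x \<and> x \<le> b"
    proof (cases "(x, y) \<in> turnpoints P")
      case True then show ?thesis using ab by auto
    next
      case False
      have "\<not> (y \<in> vert_edges P x)"
      proof
        assume h: "y \<in> vert_edges P x"
        then have "0 < y \<and> y - 1 \<in> vert_edges P x" using turnpoint_iff_vert[OF c(1), of x y] c False by auto
        then show False using h y vert_edges_sub[of x] by auto
      qed
      then have "x \<in> hor_edges P y" using vert_vertex[OF c(1), of x y] v c walk_vertices[OF c(1)] False by auto
      then show ?thesis using ab by auto
    qed
  next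
    assume x: "a \<le> x \<and> x \<le> b"
    show "(x, y) \<in> \<Union> P"
    proof (cases "x < b")
      case True
      then have "x \<in> hor_edges P y" using x ab by auto
      then show ?thesis by (auto simp: hor_edges_def)
    next
      case False
      then have "x - 1 \<in> hor_edges P y" "Suc (x - 1) = x" using x ab by auto
      then show ?thesis by (auto simp: hor_edges_def)
    qed
  qed
  then show ?thesis using ab by blast
qed

text \<open>
  The UL and BR records are increasing chains, on which \<open>x + y\<close> is injective, and the UR and BL
  records are decreasing chains, on which \<open>x - y\<close> is injective. The ranges of these functions are
  bounded by the ends of the four extreme sides. Every vertex is a record, and every extreme line on
  which it lies makes it a record of one more type. So the lengths of the extreme sides, which enter
  the bounds, cancel against their vertices, which are counted repeatedly.
\<close>

lemma vertex_count: "card (\<Union> P) \<le> 4 * (n - 1)"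
proof -
  let ?V = "\<Union> P"
  obtain y1 y2 where L: "y1 < y2" "\<And>y. (1, y) \<in> ?V \<longleftrightarrow> y1 \<le> y \<and> y \<le> y2" using extreme_col[of 1] by auto
  obtain z1 z2 where R: "z1 < z2" "\<And>y. (n, y) \<in> ?V \<longleftrightarrow> z1 \<le> y \<and> y \<le> z2" using extreme_col[of n] by auto
  obtain b1 b2 where B: "b1 < b2" "\<And>x. (x, 1) \<in> ?V \<longleftrightarrow> b1 \<le> x \<and> x \<le> b2" using extreme_row[of 1] by auto
  obtain a1 a2 where T: "a1 < a2" "\<And>x. (x, n) \<in> ?V \<longleftrightarrow> a1 \<le> x \<and> x \<le> a2" using extreme_row[of n] by auto
  have bnd: "y1 \<le> n" "1 \<le> y1" "y2 \<le> n" "1 \<le> z1" "z2 \<le> n" "1 \<le> b1" "b2 \<le> n" "1 \<le> a1" "a2 \<le> n"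
    using vertex_range[of 1 y1] vertex_range[of 1 y2] vertex_range[of n z1] vertex_range[of n z2]
      vertex_range[of b1 1] vertex_range[of b2 1] vertex_range[of a1 n] vertex_range[of a2 n] L R B T by auto
  have fin: "finite ?V" by (rule finite_subset[of _ "{1..n} \<times> {1..n}"]) (use Pm in \<open>auto simp: permutomino_def\<close>)
  define UL where "UL = UL_records ?V"
  define UR where "UR = UR_records ?V"
  define BL where "BL = BL_records ?V"
  define BR where "BR = BR_records ?V"
  have ul: "(x, y) \<in> UL \<longleftrightarrow> (x, y) \<in> ?V \<and> (\<forall>x' y'. (x', y') \<in> ?V \<longrightarrow> x' < x \<longrightarrow> y' \<le> y)" for x y
    unfolding UL_def by (rule UL_records_iff)
  have ur: "(x, y) \<in> UR \<longleftrightarrow> (x, y) \<in> ?V \<and> (\<forall>x' y'. (x', y') \<in> ?V \<longrightarrow> x < x' \<longrightarrow> y' \<le> y)" for x y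
    unfolding UR_def by (rule UR_records_iff)
  have bl: "(x, y) \<in> BL \<longleftrightarrow> (x, y) \<in> ?V \<and> (\<forall>x' y'. (x', y') \<in> ?V \<longrightarrow> x' < x \<longrightarrow> y \<le> y')" for x y
    unfolding BL_def by (rule BL_records_iff)
  have br: "(x, y) \<in> BR \<longleftrightarrow> (x, y) \<in> ?V \<and> (\<forall>x' y'. (x', y') \<in> ?V \<longrightarrow> x < x' \<longrightarrow> y \<le> y')" for x y
    unfolding BR_def by (rule BR_records_iff)
  have vL: "(1, y1) \<in> ?V" "(1, y2) \<in> ?V" and vR: "(n, z1) \<in> ?V" "(n, z2) \<in> ?V" and vB: "(b1, 1) \<in> ?V" "(b2, 1) \<in> ?V"
    and vT: "(a1, n) \<in> ?V" "(a2, n) \<in> ?V" using L R B T by simp_all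
  have rng: "1 \<le> x \<and> x \<le> n \<and> 1 \<le> y \<and> y \<le> n \<and> (x = 1 \<longrightarrow> y1 \<le> y \<and> y \<le> y2) \<and> (x = n \<longrightarrow> z1 \<le> y \<and> y \<le> z2) \<and>
      (y = 1 \<longrightarrow> b1 \<le> x \<and> x \<le> b2) \<and> (y = n \<longrightarrow> a1 \<le> x \<and> x \<le> a2)" if "(x, y) \<in> ?V" for x y
    using vertex_range[OF that] L(2)[of y] R(2)[of y] B(2)[of x] T(2)[of x] that by blast
  have cUL: "int (card UL) \<le> int a2 + int n - int y1"
  proof -
    have r: "1 + y1 \<le> x + y \<and> x + y \<le> a2 + n" if u: "(x, y) \<in> UL" for x y
    proof -
      have v: "(x, y) \<in> ?V" and rec: "\<And>x' y'. (x', y') \<in> ?V \<Longrightarrow> x' < x \<Longrightarrow> y' \<le> y" using u ul by blast+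
      have "y1 \<le> y" using rng[OF v] rec[OF vL(1)] by (cases "x = 1") auto
      moreover have "x \<le> a2" using rng[OF v] rec[OF vT(2)] by (cases "a2 < x") auto
      ultimately show ?thesis using rng[OF v] by linarith
    qed
    have "inj_on (\<lambda>(x, y). x + y) UL"
    proof (rule inj_onI, clarify)
      fix x y x' y' assume a: "(x, y) \<in> UL" "(x', y') \<in> UL" "x + y = x' + y'"
      have "x < x' \<Longrightarrow> y \<le> y'" "x' < x \<Longrightarrow> y' \<le> y" using a(1,2) ul[of x y] ul[of x' y'] by blast+
      then show "x = x' \<and> y = y'" using a(3) by linarith
    qed
    moreover have "(\<lambda>(x, y). x + y) ` UL \<subseteq> {1 + y1..a2 + n}" using r by auto
    ultimately have "card UL \<le> card {1 + y1..a2 + n}" by (rule card_inj_on_le) simp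
    then show ?thesis using bnd T L by simp
  qed
  have cBR: "int (card BR) \<le> int n + int z2 - int b1"
  proof -
    have r: "b1 + 1 \<le> x + y \<and> x + y \<le> n + z2" if u: "(x, y) \<in> BR" for x y
    proof -
      have v: "(x, y) \<in> ?V" and rec: "\<And>x' y'. (x', y') \<in> ?V \<Longrightarrow> x < x' \<Longrightarrow> y \<le> y'" using u br by blast+
      have "y \<le> z2" using rng[OF v] rec[OF vR(2)] by (cases "x = n") auto
      moreover have "b1 \<le> x" using rng[OF v] rec[OF vB(1)] by (cases "x < b1") auto
      ultimately show ?thesis using rng[OF v] by linarith
    qed
    have "inj_on (\<lambda>(x, y). x + y) BR"
    proof (rule inj_onI, clarify)
      fix x y x' y' assume a: "(x, y) \<in> BR" "(x', y') \<in> BR" "x + y = x' + y'"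
      have "x < x' \<Longrightarrow> y \<le> y'" "x' < x \<Longrightarrow> y' \<le> y" using a(1,2) br[of x y] br[of x' y'] by blast+
      then show "x = x' \<and> y = y'" using a(3) by linarith
    qed
    moreover have "(\<lambda>(x, y). x + y) ` BR \<subseteq> {b1 + 1..n + z2}" using r by auto
    ultimately have "card BR \<le> card {b1 + 1..n + z2}" by (rule card_inj_on_le) simp
    then show ?thesis using bnd R B by simp
  qed
  have cUR: "int (card UR) \<le> 2 * int n - int z1 - int a1 + 1"
  proof -
    have r: "int a1 - int n \<le> int x - int y \<and> int x - int y \<le> int n - int z1" if u: "(x, y) \<in> UR" for x y
    proof -
      have v: "(x, y) \<in> ?V" and rec: "\<And>x' y'. (x', y') \<in> ?V \<Longrightarrow> x < x' \<Longrightarrow> y' \<le> y" using u ur by blast+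
      have "z1 \<le> y" using rng[OF v] rec[OF vR(1)] by (cases "x = n") auto
      moreover have "a1 \<le> x" using rng[OF v] rec[OF vT(1)] by (cases "x < a1") auto
      ultimately show ?thesis using rng[OF v] by linarith
    qed
    have "inj_on (\<lambda>(x, y). int x - int y) UR"
    proof (rule inj_onI, clarify)
      fix x y x' y' assume a: "(x, y) \<in> UR" "(x', y') \<in> UR" "int x - int y = int x' - int y'"
      have "x < x' \<Longrightarrow> y' \<le> y" "x' < x \<Longrightarrow> y \<le> y'" using a(1,2) ur[of x y] ur[of x' y'] by blast+
      then show "x = x' \<and> y = y'" using a(3) by linarith
    qed
    moreover have "(\<lambda>(x, y). int x - int y) ` UR \<subseteq> {int a1 - int n..int n - int z1}" using r by auto
    ultimately have "card UR \<le> card {int a1 - int n..int n - int z1}" by (rule card_inj_on_le) simp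
    then show ?thesis using bnd R T by simp
  qed
  have cBL: "int (card BL) \<le> int b2 + int y2 - 1"
  proof -
    have r: "1 - int y2 \<le> int x - int y \<and> int x - int y \<le> int b2 - 1" if u: "(x, y) \<in> BL" for x y
    proof -
      have v: "(x, y) \<in> ?V" and rec: "\<And>x' y'. (x', y') \<in> ?V \<Longrightarrow> x' < x \<Longrightarrow> y \<le> y'" using u bl by blast+
      have "y \<le> y2" using rng[OF v] rec[OF vL(2)] by (cases "x = 1") auto
      moreover have "x \<le> b2" using rng[OF v] rec[OF vB(2)] by (cases "b2 < x") auto
      ultimately show ?thesis using rng[OF v] by linarith
    qed
    have "inj_on (\<lambda>(x, y). int x - int y) BL"
    proof (rule inj_onI, clarify)
      fix x y x' y' assume a: "(x, y) \<in> BL" "(x', y') \<in> BL" "int x - int y = int x' - int y'"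
      have "x < x' \<Longrightarrow> y' \<le> y" "x' < x \<Longrightarrow> y \<le> y'" using a(1,2) bl[of x y] bl[of x' y'] by blast+
      then show "x = x' \<and> y = y'" using a(3) by linarith
    qed
    moreover have "(\<lambda>(x, y). int x - int y) ` BL \<subseteq> {1 - int y2..int b2 - 1}" using r by auto
    ultimately have "card BL \<le> card {1 - int y2..int b2 - 1}" by (rule card_inj_on_le) simp
    then show ?thesis using bnd L B by simp
  qed
  \<comment> \<open>A vertex on one extreme line is a record of at least two types, and a vertex in a corner of the
    bounding square a record of at least three types.\<close>
  have pt: "1 + (of_bool (fst v = 1) + of_bool (fst v = n) + of_bool (snd v = 1) + of_bool (snd v = n))
      \<le> (of_bool (v \<in> UL) + of_bool (v \<in> UR) + of_bool (v \<in> BL) + of_bool (v \<in> BR) :: nat)" if v: "v \<in> ?V" for v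
  proof -
    obtain x y where xy: "v = (x, y)" by (metis surj_pair)
    have V: "(x, y) \<in> ?V" using v xy by simp
    have ext: "(x, y) \<in> UL \<or> (x, y) \<in> UR \<or> (x, y) \<in> BL \<or> (x, y) \<in> BR"
      using conv V unfolding interior_points_def exterior_points_def UL_def UR_def BL_def BR_def by blast
    have r: "1 \<le> x' \<and> x' \<le> n \<and> 1 \<le> y' \<and> y' \<le> n" if "(x', y') \<in> ?V" for x' y' using vertex_range[OF that] .
    have "x = 1 \<longrightarrow> (x, y) \<in> UL \<and> (x, y) \<in> BL" unfolding ul bl using V r by (metis not_less)
    moreover have "x = n \<longrightarrow> (x, y) \<in> UR \<and> (x, y) \<in> BR" unfolding ur br using V r by (metis not_less)
    moreover have "y = 1 \<longrightarrow> (x, y) \<in> BL \<and> (x, y) \<in> BR" unfolding bl br using V r by metis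
    moreover have "y = n \<longrightarrow> (x, y) \<in> UL \<and> (x, y) \<in> UR" unfolding ul ur using V r by metis
    ultimately show ?thesis unfolding xy fst_conv snd_conv using ext n
      by (cases "(x, y) \<in> UL"; cases "(x, y) \<in> UR"; cases "(x, y) \<in> BL"; cases "(x, y) \<in> BR") auto
  qed
  have cs: "(\<Sum>v\<in>?V. of_bool (v \<in> S) :: nat) = card S" if "S \<subseteq> ?V" for S
    using that fin by (simp add: of_bool_def sum.If_cases Int_absorb1)
  have sub: "UL \<subseteq> ?V" "UR \<subseteq> ?V" "BL \<subseteq> ?V" "BR \<subseteq> ?V" using ul ur bl br by auto
  have side: "(\<Sum>v\<in>?V. of_bool (Q v) :: nat) = card {v \<in> ?V. Q v}" for Q
    using fin by (simp add: of_bool_def sum.If_cases Int_def)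
  have "{v \<in> ?V. fst v = 1} = (\<lambda>y. (1, y)) ` {y1..y2}" using L by force
  then have s1: "card {v \<in> ?V. fst v = 1} = Suc y2 - y1" by (simp add: card_image inj_on_def)
  have "{v \<in> ?V. fst v = n} = (\<lambda>y. (n, y)) ` {z1..z2}" using R by force
  then have s2: "card {v \<in> ?V. fst v = n} = Suc z2 - z1" by (simp add: card_image inj_on_def)
  have "{v \<in> ?V. snd v = 1} = (\<lambda>x. (x, 1)) ` {b1..b2}" using B by force
  then have s3: "card {v \<in> ?V. snd v = 1} = Suc b2 - b1" by (simp add: card_image inj_on_def)
  have "{v \<in> ?V. snd v = n} = (\<lambda>x. (x, n)) ` {a1..a2}" using T by force
  then have s4: "card {v \<in> ?V. snd v = n} = Suc a2 - a1" by (simp add: card_image inj_on_def)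
  have "(\<Sum>v\<in>?V. 1 + (of_bool (fst v = 1) + of_bool (fst v = n) + of_bool (snd v = 1) + of_bool (snd v = n)))
      \<le> (\<Sum>v\<in>?V. of_bool (v \<in> UL) + of_bool (v \<in> UR) + of_bool (v \<in> BL) + of_bool (v \<in> BR) :: nat)"
    by (rule sum_mono) (rule pt)
  then have "card ?V + ((Suc y2 - y1) + (Suc z2 - z1) + (Suc b2 - b1) + (Suc a2 - a1)) \<le> card UL + card UR + card BL +
      card BR"
    unfolding sum.distrib cs[OF sub(1)] cs[OF sub(2)] cs[OF sub(3)] cs[OF sub(4)] side s1 s2 s3 s4 by simp
  then show ?thesis using cUL cUR cBL cBR L(1) R(1) B(1) T(1) n by linarith
qed

lemma xmin_P: "xmin P = 1" and xmax_P: "xmax P = n"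
proof -
  have fin: "finite (\<Union> P)" by (rule finite_subset[of _ "{1..n} \<times> {1..n}"]) (use Pm in \<open>auto simp: permutomino_def\<close>)
  obtain y1 where y1: "(1, y1) \<in> \<Union> P" using extreme_col[of 1] by (metis less_imp_le order_refl)
  obtain z1 where z1: "(n, z1) \<in> \<Union> P" using extreme_col[of n] by (metis less_imp_le order_refl)
  show "xmin P = 1" unfolding xmin_def
  proof (rule Min_eqI)
    show "1 \<in> fst ` \<Union> P" using y1 by (metis fst_conv imageI)
    show "1 \<le> x" if "x \<in> fst ` \<Union> P" for x using that vertex_range by fastforce
  qed (use fin in simp)
  show "xmax P = n" unfolding xmax_def
  proof (rule Max_eqI)
    show "n \<in> fst ` \<Union> P" using z1 by (metis fst_conv imageI)
    show "x \<le> n" if "x \<in> fst ` \<Union> P" for x using that vertex_range by fastforce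
  qed (use fin in simp)
qed

end

section \<open>Top and bottom rows of a convex permutomino\<close>

text \<open>
  The row of the black point in column \<open>x\<close>, where \<open>t\<close> and \<open>b\<close> are the top and bottom rows over the
  cuts: clockwise, the upper path arrives in the old top row and leaves column \<open>x\<close> in the new one,
  while the lower path comes from the right in the new bottom row.
\<close>

definition black_row :: "nat \<Rightarrow> (nat \<Rightarrow> nat) \<Rightarrow> (nat \<Rightarrow> nat) \<Rightarrow> nat \<Rightarrow> nat" where
  "black_row n t b x = (if x = 1 then b 1 else if x = n then t (n - 1) else if t (x - 1) \<noteq> t x then t (x - 1) else b x)"

definition top_row :: "polygon \<Rightarrow> nat \<Rightarrow> nat" where
  "top_row P k = Max {y. k \<in> hor_edges P y}"

definition bot_row :: "polygon \<Rightarrow> nat \<Rightarrow> nat" where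
  "bot_row P k = Min {y. k \<in> hor_edges P y}"

lemma interval_pair:
  assumes "a < (b::nat)" "p \<noteq> q" "\<And>y. y = a \<or> y = b \<longleftrightarrow> y = p \<or> y = q"
  shows "a = min p q \<and> b = max p q"
proof -
  have "a = p \<or> a = q" "b = p \<or> b = q" using assms(3) by blast+
  then show ?thesis using assms(1) by (auto simp: min_def max_def)
qed

context
  fixes n :: nat and P :: polygon and c :: "point list"
  assumes n: "2 \<le> n" and Pm: "permutomino n P" and conv: "interior_points (\<Union> P) = {}"
    and saw: "closed_saw c" and wk: "walk_edges c = P"
begin

lemma wV: "\<Union> P = set c" using walk_vertices[OF saw] wk by simp

lemma w_range: "(x, y) \<in> set c \<Longrightarrow> 1 \<le> x \<and> x \<le> n \<and> 1 \<le> y \<and> y \<le> n"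
  using vertex_range[OF n Pm conv] wV by blast

lemma adj_cases:
  assumes "adjacent p q"
  shows "fst q = fst p \<or> fst q = Suc (fst p) \<or> fst p = Suc (fst q)" "snd q = snd p \<or> snd q = Suc (snd p) \<or>
      snd p = Suc (snd q)"
    "fst q = fst p \<or> snd q = snd p"
  using assms by (auto simp: adjacent_def)

lemma east_card: assumes "1 \<le> k" "k < n"
  shows "card {i. i < length c \<and> fst (at c i) = k \<and> fst (at c (Suc i)) = Suc k} = 1"
proof -
  have ex: "\<exists>i<length c. at c i = v" if "v \<in> \<Union> P" for v
    using that unfolding wV by (metis at_nth[OF saw] in_set_conv_nth)
  obtain y1 where "(1, y1) \<in> \<Union> P" using extreme_col[OF n Pm conv, of 1] by (metis less_imp_le order_refl)
  then obtain a where a: "a < length c" "fst (at c a) = 1" using ex by force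
  obtain y2 where "(n, y2) \<in> \<Union> P" using extreme_col[OF n Pm conv, of n] by (metis less_imp_le order_refl)
  then obtain b where b: "b < length c" "fst (at c b) = n" using ex by force
  obtain x1 where "(x1, 1) \<in> \<Union> P" using extreme_row[OF n Pm conv, of 1] by (metis less_imp_le order_refl)
  then obtain a' where a': "a' < length c" "snd (at c a') = 1" using ex by force
  obtain x2 where "(x2, n) \<in> \<Union> P" using extreme_row[OF n Pm conv, of n] by (metis less_imp_le order_refl)
  then obtain b' where b': "b' < length c" "snd (at c b') = n" using ex by force
  have per: "at c (length c) = at c 0" by (simp add: at_def)
  have len: "length c \<le> 4 * (n - 1)"
    using vertex_count[OF n Pm conv] distinct_card[OF saw_distinct[OF saw]] wV by simp
  show ?thesis
    by (rule crossings_unique[where f = "\<lambda>i. fst (at c i)"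
        and g = "\<lambda>i. snd (at c i)", OF _ _ _ _ _ a b a' b' len assms])
      (use adj_cases[OF at_adjacent[OF saw]] per in \<open>auto\<close>)
qed

lemma west_card: assumes "1 \<le> k" "k < n"
  shows "card {i. i < length c \<and> fst (at c i) = Suc k \<and> fst (at c (Suc i)) = k} = 1"
  using east_card[OF assms] crossings_balanced[of "\<lambda>i. fst (at c i)" "length c" k] adj_cases(1)[OF at_adjacent[OF saw]]
  by (simp add: at_def)

lemma east_index_unique:
  assumes "1 \<le> k" "k < n" "i < length c" "j < length c"
    "fst (at c i) = k" "fst (at c (Suc i)) = Suc k" "fst (at c j) = k" "fst (at c (Suc j)) = Suc k"
  shows "i = j"
proof -
  obtain z where z: "{i. i < length c \<and> fst (at c i) = k \<and> fst (at c (Suc i)) = Suc k} = {z}"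
    using east_card[OF assms(1,2)] card_1_singletonE by blast
  have "i \<in> {z}" "j \<in> {z}" unfolding z[symmetric] using assms by simp_all
  then show ?thesis by simp
qed

lemma step_range: assumes "walk_step c (x, y) (x', y')" shows "1 \<le> x" "x \<le> n" "1 \<le> x'" "x' \<le> n"
  using step_in[OF saw assms] w_range by blast+

lemma step_index: assumes "walk_step c u v" shows "\<exists>i<length c. at c i = u \<and> at c (Suc i) = v"
proof -
  obtain k where k: "at c k = u" "at c (Suc k) = v" using assms by (auto simp: walk_step_def)
  have "at c (k mod length c) = at c k" by (rule at_mod[OF saw])
  then show ?thesis using k at_eq_Suc[OF saw, of "k mod length c" k] saw_mod[OF saw, of k] by metis
qed

lemma east_step: "walk_step c (k, y) (Suc k, y') \<longleftrightarrow> 1 \<le> k \<and> k < n \<and> y = east_row c k \<and> y' = east_row c k"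
proof -
  have uni: "y = z \<and> y' = y" if a: "walk_step c (k, y) (Suc k, y')" "walk_step c (k, z) (Suc k, z')" for y y' z z'
  proof -
    have k: "1 \<le> k" "k < n" using step_range[OF a(1)] by auto
    obtain i j where "i < length c" "at c i = (k, y)" "at c (Suc i) = (Suc k, y')" "j < length c" "at c j = (k, z)"
        "at c (Suc j) = (Suc k, z')"
      using step_index[OF a(1)] step_index[OF a(2)] by blast
    then have "i = j" using east_index_unique[OF k, of i j] by simp
    then show ?thesis using \<open>at c i = _\<close> \<open>at c j = _\<close> adj_cases(3)[OF step_adjacent[OF saw a(1)]] by simp
  qed
  have the: "walk_step c (k, east_row c k) (Suc k, east_row c k)" if k: "1 \<le> k" "k < n"
  proof -
    have "{i. i < length c \<and> fst (at c i) = k \<and> fst (at c (Suc i)) = Suc k} \<noteq> {}" using east_card[OF k]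
        by (metis card.empty zero_neq_one)
    then obtain i where "fst (at c i) = k" "fst (at c (Suc i)) = Suc k" by blast
    then have s: "walk_step c (k, snd (at c i)) (Suc k, snd (at c (Suc i)))" unfolding walk_step_def
        by (metis prod.collapse)
    then have t: "walk_step c (k, snd (at c i)) (Suc k, snd (at c i))" using uni[OF s s] by simp
    then show ?thesis unfolding east_row_def by (rule theI[where P =
        "\<lambda>y. walk_step c (k, y) (Suc k, y)"]) (use uni[OF _ t] in blast)
  qed
  show ?thesis
  proof
    assume a: "walk_step c (k, y) (Suc k, y')"
    have k: "1 \<le> k" "k < n" using step_range[OF a] by auto
    show "1 \<le> k \<and> k < n \<and> y = east_row c k \<and> y' = east_row c k" using uni[OF a the[OF k]] k by simp
  qed (use the in simp)
qed

lemma west_step: "walk_step c (Suc k, y) (k, y') \<longleftrightarrow> 1 \<le> k \<and> k < n \<and> y = west_row c k \<and> y' = west_row c k"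
proof -
  have uni: "y = z \<and> y' = y" if a: "walk_step c (Suc k, y) (k, y')" "walk_step c (Suc k, z) (k, z')" for y y' z z'
  proof -
    have k: "1 \<le> k" "k < n" using step_range[OF a(1)] by auto
    obtain i j where ij: "i < length c" "at c i = (Suc k, y)" "at c (Suc i) = (k, y')" "j < length c"
        "at c j = (Suc k, z)" "at c (Suc j) = (k, z')"
      using step_index[OF a(1)] step_index[OF a(2)] by blast
    obtain q where q: "{i. i < length c \<and> fst (at c i) = Suc k \<and> fst (at c (Suc i)) = k} = {q}"
      using west_card[OF k] card_1_singletonE by blast
    have "i \<in> {q}" "j \<in> {q}" unfolding q[symmetric] using ij by simp_all
    then have "i = j" by simp
    then show ?thesis using ij adj_cases(3)[OF step_adjacent[OF saw a(1)]] by simp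
  qed
  have the: "walk_step c (Suc k, west_row c k) (k, west_row c k)" if k: "1 \<le> k" "k < n"
  proof -
    have "{i. i < length c \<and> fst (at c i) = Suc k \<and> fst (at c (Suc i)) = k} \<noteq> {}" using west_card[OF k]
        by (metis card.empty zero_neq_one)
    then obtain i where "fst (at c i) = Suc k" "fst (at c (Suc i)) = k" by blast
    then have s: "walk_step c (Suc k, snd (at c i)) (k, snd (at c (Suc i)))" unfolding walk_step_def
        by (metis prod.collapse)
    then have t: "walk_step c (Suc k, snd (at c i)) (k, snd (at c i))" using uni[OF s s] by simp
    then show ?thesis unfolding west_row_def by (rule theI[where P =
        "\<lambda>y. walk_step c (Suc k, y) (k, y)"]) (use uni[OF _ t] in blast)
  qed
  show ?thesis
  proof
    assume a: "walk_step c (Suc k, y) (k, y')"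
    have k: "1 \<le> k" "k < n" using step_range[OF a] by auto
    show "1 \<le> k \<and> k < n \<and> y = west_row c k \<and> y' = west_row c k" using uni[OF a the[OF k]] k by simp
  qed (use the in simp)
qed

lemma er_ne_wr: assumes "1 \<le> k" "k < n" shows "east_row c k \<noteq> west_row c k"
  using step_no_return[OF saw, of "(k, east_row c k)" "(Suc k, east_row c k)"] east_step[of k] west_step[of k] assms
      by metis

lemma er_ne_wr_Suc: assumes "1 \<le> k" "Suc k < n" shows "east_row c k \<noteq> west_row c (Suc k)"
    "west_row c k \<noteq> east_row c (Suc k)"
proof -
  show "east_row c k \<noteq> west_row c (Suc k)"
  proof
    assume a: "east_row c k = west_row c (Suc k)"
    have "walk_step c (k, east_row c k) (Suc k, east_row c k)"
        "walk_step c (Suc (Suc k), east_row c k) (Suc k, east_row c k)"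
      using east_step[of k "east_row c k" "east_row c k"] west_step[of "Suc k" "east_row c k" "east_row c k"] a assms
          by simp_all
    from step_pred_unique[OF saw this] show False by simp
  qed
  show "west_row c k \<noteq> east_row c (Suc k)"
  proof
    assume a: "west_row c k = east_row c (Suc k)"
    have "walk_step c (Suc k, west_row c k) (k, west_row c k)"
        "walk_step c (Suc k, west_row c k) (Suc (Suc k), west_row c k)"
      using east_step[of "Suc k" "west_row c k" "west_row c k"] west_step[of k "west_row c k" "west_row c k"] a assms
          by simp_all
    from step_succ_unique[OF saw this] show False by simp
  qed
qed

lemma hor_iff: "k \<in> hor_edges P y \<longleftrightarrow> 1 \<le> k \<and> k < n \<and> (y = east_row c k \<or> y = west_row c k)"
  unfolding hor_edges_def mem_Collect_eq wk[symmetric] step_edge[OF saw] east_step west_step by blast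

lemma turn_mid: assumes "1 \<le> k" "Suc k < n"
  shows "(Suc k, y) \<in> turnpoints P \<longleftrightarrow> (y = east_row c (Suc k) \<or> y = west_row c (Suc k)) \<noteq> (y = east_row c k \<or>
      y = west_row c k)"
  using turnpoint_iff_hor[OF saw, of "Suc k" y] assms by (simp add: wk hor_iff)

lemma turn_first: "(1, y) \<in> turnpoints P \<longleftrightarrow> y = east_row c 1 \<or> y = west_row c 1"
  using turnpoint_iff_hor[OF saw, of 1 y] n by (simp add: wk hor_iff)

lemma turn_last: "(n, y) \<in> turnpoints P \<longleftrightarrow> y = east_row c (n - 1) \<or> y = west_row c (n - 1)"
proof -
  have "(n, y) \<in> turnpoints P \<longleftrightarrow> n - 1 \<in> hor_edges P y"
    using turnpoint_iff_hor[OF saw, of n y] hor_iff[of n y] n by (simp add: wk)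
  then show ?thesis using n by (auto simp: hor_iff)
qed

text \<open>
  The column carries only one side and hence two turnpoints. The turnpoints are the rows that are
  used on one side of the column only, and there would be four or none of them if both rows or no
  row changed.
\<close>

lemma dichotomy: assumes k: "1 \<le> k" "Suc k < n"
    shows "(east_row c k = east_row c (Suc k)) \<noteq> (west_row c k = west_row c (Suc k))"
proof -
  obtain a b where ab: "a < b" "\<And>y. (Suc k, y) \<in> turnpoints P \<longleftrightarrow> y = a \<or> y = b"
    using col_line[OF n Pm conv, of "Suc k"] k by auto
  note t = ab(2)[unfolded turn_mid[OF k]]
  have ne: "east_row c k \<noteq> west_row c k" "east_row c k \<noteq> west_row c (Suc k)" "west_row c k \<noteq> east_row c (Suc k)"
      using er_ne_wr[of k] er_ne_wr_Suc[OF k] k by auto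
  show ?thesis
  proof (cases "east_row c k = east_row c (Suc k)")
    case True
    then show ?thesis using t[of a] by auto
  next
    case False
    then show ?thesis using t[of "east_row c k"] t[of "west_row c k"] t[of "east_row c (Suc k)"] ne by metis
  qed
qed

lemma vert_first: "vert_edges P 1 = {min (east_row c 1) (west_row c 1)..<max (east_row c 1) (west_row c 1)}"
  using col_line[OF n Pm conv, of 1] n er_ne_wr[of 1] interval_pair[of _ _ "east_row c 1" "west_row c 1"]
      unfolding turn_first by force

lemma vert_last: "vert_edges P n = {min (east_row c (n - 1)) (west_row c (n - 1))..<max (east_row c (n - 1)) (west_row c
    (n - 1))}"
proof -
  obtain a b where ab: "a < b" "vert_edges P n = {a..<b}" "\<And>y. y = a \<or> y = b \<longleftrightarrow> y = east_row c (n - 1) \<or>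
      y = west_row c (n - 1)"
    using col_line[OF n Pm conv, of n] n unfolding turn_last by auto
  have "1 \<le> n - 1" "n - 1 < n" using n by auto
  then show ?thesis using interval_pair[OF ab(1) er_ne_wr ab(3)] ab(2) by simp
qed

lemma vert_mid: assumes k: "1 \<le> k" "Suc k < n"
  shows "vert_edges P (Suc k) = (if west_row c k = west_row c (Suc k) then {min (east_row c k) (east_row c (Suc
      k))..<max (east_row c k) (east_row c (Suc k))}
    else {min (west_row c k) (west_row c (Suc k))..<max (west_row c k) (west_row c (Suc k))})"
proof -
  obtain a b where ab: "a < b" "vert_edges P (Suc k) = {a..<b}" "\<And>y. (Suc k, y) \<in> turnpoints P \<longleftrightarrow> y = a \<or> y = b"
    using col_line[OF n Pm conv, of "Suc k"] k by auto
  note t = ab(3)[unfolded turn_mid[OF k]]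
  have ne: "east_row c k \<noteq> west_row c k" "east_row c (Suc k) \<noteq> west_row c (Suc k)" using er_ne_wr[of k] er_ne_wr[of
      "Suc k"] k by auto
  show ?thesis
  proof (cases "west_row c k = west_row c (Suc k)")
    case True
    then have d: "east_row c k \<noteq> east_row c (Suc k)" using dichotomy[OF k] by simp
    have "y = a \<or> y = b \<longleftrightarrow> y = east_row c k \<or> y = east_row c (Suc k)" for y using t[of y] True ne d by metis
    from interval_pair[OF ab(1) d this] show ?thesis using True ab(2) by simp
  next
    case False
    then have d: "east_row c k = east_row c (Suc k)" using dichotomy[OF k] by simp
    have "y = a \<or> y = b \<longleftrightarrow> y = west_row c k \<or> y = west_row c (Suc k)" for y using t[of y] False ne d by metis
    from interval_pair[OF ab(1) False this] show ?thesis using False ab(2) by simp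
  qed
qed

text \<open>
  In each inner column one of the two paths goes straight, and the vertical side of the other path
  does not meet it, so that the paths do not change sides.
\<close>

lemma rows_ordered: assumes "west_row c 1 < east_row c 1" shows "1 \<le> k \<Longrightarrow> k < n \<Longrightarrow> west_row c k < east_row c k"
proof (induction k)
  case (Suc k)
  show ?case
  proof (cases "k = 0")
    case True then show ?thesis using assms by simp
  next
    case False
    then have k: "1 \<le> k" "Suc k < n" and IH: "west_row c k < east_row c k" using Suc by auto
    have no: "y \<notin> vert_edges P (Suc k)" if "y = east_row c k \<or> y = west_row c k"
        "y = east_row c (Suc k) \<or> y = west_row c (Suc k)" for y
      using straight_no_vert[OF saw, of k y] that k by (simp add: wk hor_iff)
    show ?thesis
    proof (cases "west_row c k = west_row c (Suc k)")
      case True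
      then show ?thesis using no[of "west_row c k"] vert_mid[OF k] IH er_ne_wr[of "Suc k"] k by auto
    next
      case False
      then have "east_row c k = east_row c (Suc k)" using dichotomy[OF k] by simp
      then show ?thesis using no[of "east_row c k"] vert_mid[OF k] IH False er_ne_wr[of "Suc k"] k by auto
    qed
  qed
qed simp

text \<open>
  The first eastward step starts at an end of the leftmost side, into which the walk came upwards.
\<close>

lemma clockwise_imp: assumes cw: "clockwise_walk P c" shows "west_row c 1 < east_row c 1"
proof -
  have cw': "walk_step c u v \<Longrightarrow> fst u = 1 \<Longrightarrow> fst v = 1 \<Longrightarrow> snd u < snd v" for u v
    using cw unfolding clockwise_step xmin_P[OF n Pm conv] by blast
  have e: "walk_step c (1, east_row c 1) (Suc 1, east_row c 1)" using east_step[of 1] n by simp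
  then have "(1, east_row c 1) \<in> set c" using step_in[OF saw] by blast
  then obtain u where u: "walk_step c u (1, east_row c 1)" using step_ex[OF saw] by blast
  obtain x y where xy: "u = (x, y)" by (metis surj_pair)
  have a: "adjacent (x, y) (1, east_row c 1)" using step_adjacent[OF saw u] xy by simp
  have r: "1 \<le> x" using step_range[of x y 1 "east_row c 1"] u xy by simp
  have "x = 1"
  proof (rule ccontr)
    assume "x \<noteq> 1"
    then have "u = (Suc 1, east_row c 1)" using a r xy by (auto simp: adjacent_def)
    then show False using step_no_return[OF saw e] u by simp
  qed
  then have "y < east_row c 1" using cw'[OF u] xy by simp
  then have "Suc y = east_row c 1" using a \<open>x = 1\<close> by (auto simp: adjacent_def)
  then have "y \<in> vert_edges P 1" using u xy \<open>x = 1\<close> step_edge[OF saw, of "(1, y)" "(1, Suc y)"]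
      by (simp add: vert_edges_def wk)
  then show ?thesis using vert_first \<open>Suc y = east_row c 1\<close> by auto
qed

lemma clockwise_if: assumes lt: "west_row c 1 < east_row c 1" shows "clockwise_walk P c"
proof -
  have v1: "vert_edges P 1 = {west_row c 1..<east_row c 1}" using vert_first lt by simp
  have e1: "{(1, y), (1, Suc y)} \<in> P \<longleftrightarrow> west_row c 1 \<le> y \<and> y < east_row c 1" for y
  proof -
    have "y \<in> vert_edges P 1 \<longleftrightarrow> west_row c 1 \<le> y \<and> y < east_row c 1" unfolding v1 by simp
    then show ?thesis unfolding vert_edges_def by simp
  qed
  have up: "west_row c 1 + j < east_row c 1 \<Longrightarrow> walk_step c (1, west_row c 1 + j) (1, Suc (west_row c 1 + j))" for j
  proof (induction j)
    case j: (0)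
    have "walk_step c (Suc 1, west_row c 1) (1, west_row c 1)" using west_step[of 1] n by simp
    then have "(1, west_row c 1) \<in> set c" using step_in[OF saw] by blast
    then obtain x y where s: "walk_step c (1, west_row c 1) (x, y)" using step_ex[OF saw] by (metis surj_pair)
    have a: "adjacent (1, west_row c 1) (x, y)" using step_adjacent[OF saw s] .
    have r: "1 \<le> x" using step_range[OF s] by simp
    have "x = 1"
    proof (rule ccontr)
      assume "x \<noteq> 1"
      then have "x = Suc 1" using a r by (auto simp: adjacent_def)
      then show False using east_step[of 1 "west_row c 1" y] s lt by simp
    qed
    have "{(1, west_row c 1), (1, y)} \<in> P" using s \<open>x = 1\<close> step_edge[OF saw] wk by blast
    then have "y = Suc (west_row c 1)" using a \<open>x = 1\<close> e1[of y] by (auto simp: adjacent_def insert_commute)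
    then show ?case using s \<open>x = 1\<close> by simp
  next
    case (Suc j)
    then have p: "walk_step c (1, west_row c 1 + j) (1, Suc (west_row c 1 + j))" by simp
    then have "(1, Suc (west_row c 1 + j)) \<in> set c" using step_in[OF saw] by blast
    then obtain x y where s: "walk_step c (1, Suc (west_row c 1 + j)) (x, y)" using step_ex[OF saw] by (metis surj_pair)
    have a: "adjacent (1, Suc (west_row c 1 + j)) (x, y)" using step_adjacent[OF saw s] .
    have r: "1 \<le> x" using step_range[OF s] by simp
    have "x = 1"
    proof (rule ccontr)
      assume "x \<noteq> 1"
      then have "x = Suc 1" using a r by (auto simp: adjacent_def)
      then show False using east_step[of 1 "Suc (west_row c 1 + j)" y] s Suc.prems by simp
    qed
    have "y \<noteq> west_row c 1 + j" using step_no_return[OF saw p] s \<open>x = 1\<close> by auto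
    then have "y = Suc (Suc (west_row c 1 + j))" using a \<open>x = 1\<close> by (auto simp: adjacent_def)
    then show ?case using s \<open>x = 1\<close> by simp
  qed
  have "snd u < snd v" if s: "walk_step c u v" "fst u = 1" "fst v = 1" for u v
  proof -
    obtain y y' where yy: "u = (1, y)" "v = (1, y')" using s by (metis prod.collapse)
    have "\<not> y = Suc y'"
    proof
      assume y: "y = Suc y'"
      have "{(1, y'), (1, Suc y')} \<in> P" using s yy y step_edge[OF saw, of u v] wk by (simp add: insert_commute)
      then obtain j where "y' = west_row c 1 + j" "west_row c 1 + j < east_row c 1" using e1 le_Suc_ex by blast
      then have "walk_step c v u" using up[of j] yy y by simp
      then show False using step_no_return[OF saw] s by blast
    qed
    then show ?thesis using step_adjacent[OF saw s(1)] yy by (auto simp: adjacent_def)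
  qed
  then show ?thesis unfolding clockwise_step xmin_P[OF n Pm conv] using saw wk by blast
qed

lemma top_bot: assumes "west_row c 1 < east_row c 1" "1 \<le> k" "k < n" shows "top_row P k = east_row c k"
    "bot_row P k = west_row c k"
proof -
  have "{y. k \<in> hor_edges P y} = {east_row c k, west_row c k}" using assms hor_iff by auto
  then show "top_row P k = east_row c k" "bot_row P k = west_row c k" using rows_ordered[OF assms]
      by (auto simp: top_row_def bot_row_def)
qed

text \<open>
  A turnpoint is left vertically if it was entered by an eastward or westward step and is not the
  start of such a step.
\<close>

lemma out_vertical:
  "(x, y) \<in> turnpoints P \<and> (\<exists>u. walk_step c (x, y) u \<and> fst u = x) \<longleftrightarrow> 1 \<le> x \<and> x \<le> n \<and>
      y = black_row n (east_row c) (west_row c) x"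
proof -
  have "(x, y) \<in> turnpoints P \<and> (\<exists>u. walk_step c (x, y) u \<and> fst u = x) \<longleftrightarrow>
    ((2 \<le> x \<and> x \<le> n \<and> y = east_row c (x - 1)) \<or> (1 \<le> x \<and> x < n \<and> y = west_row c x)) \<and>
    \<not> ((1 \<le> x \<and> x < n \<and> y = east_row c x) \<or> (2 \<le> x \<and> x \<le> n \<and> y = west_row c (x - 1)))" (is "?T \<longleftrightarrow> ?I \<and> \<not> ?O")
  proof (cases "(x, y) \<in> set c")
    case True
    then obtain p u where pu: "walk_step c p (x, y)" "walk_step c (x, y) u" using step_ex[OF saw] by blast
    obtain px py ux uy where d: "p = (px, py)" "u = (ux, uy)" by (metis surj_pair)
    have T: "?T \<longleftrightarrow> px \<noteq> x \<and> ux = x"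
    proof -
      have a: "(x, y) \<in> turnpoints P \<longleftrightarrow> (px = x) \<noteq> (x = ux)" using step_turn[OF saw pu] d wk by simp
      have b: "(\<exists>v. walk_step c (x, y) v \<and> fst v = x) \<longleftrightarrow> ux = x"
      proof
        assume "\<exists>v. walk_step c (x, y) v \<and> fst v = x"
        then obtain v where v: "walk_step c (x, y) v" "fst v = x" by blast
        have "u = v" by (rule step_succ_unique[OF saw pu(2) v(1)])
        then show "ux = x" using v d by (metis fst_conv)
      next
        assume "ux = x"
        then show "\<exists>v. walk_step c (x, y) v \<and> fst v = x" using pu(2) d by (intro exI[of _ u]) simp
      qed
      show ?thesis unfolding a b by blast
    qed
    have I: "px \<noteq> x \<longleftrightarrow> ?I"
    proof
      assume "px \<noteq> x"
      then consider "x = Suc px" | "px = Suc x" using adj_cases(1)[OF step_adjacent[OF saw pu(1)]] d by auto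
      then show ?I using pu(1) d east_step[of px py y] west_step[of x py y] by cases auto
    next
      assume ?I
      then have "walk_step c (x - 1, y) (x, y) \<and> x \<noteq> 0 \<or> walk_step c (Suc x, y) (x, y)"
        using east_step[of "x - 1" y y] west_step[of x y y] by auto
      then consider "walk_step c (x - 1, y) (x, y)" "x \<noteq> 0" | "walk_step c (Suc x, y) (x, y)" by blast
      then show "px \<noteq> x"
      proof cases
        case 1
        from step_pred_unique[OF saw pu(1) 1(1)] show ?thesis using 1(2) d by simp
      next
        case 2
        from step_pred_unique[OF saw pu(1) 2] show ?thesis using d by simp
      qed
    qed
    have O: "ux \<noteq> x \<longleftrightarrow> ?O"
    proof
      assume "ux \<noteq> x"
      then consider "x = Suc ux" | "ux = Suc x" using adj_cases(1)[OF step_adjacent[OF saw pu(2)]] d by auto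
      then show ?O using pu(2) d east_step[of x y uy] west_step[of ux y uy] by cases auto
    next
      assume ?O
      then have "walk_step c (x, y) (x - 1, y) \<and> x \<noteq> 0 \<or> walk_step c (x, y) (Suc x, y)"
        using east_step[of x y y] west_step[of "x - 1" y y] by auto
      then consider "walk_step c (x, y) (x - 1, y)" "x \<noteq> 0" | "walk_step c (x, y) (Suc x, y)" by blast
      then show "ux \<noteq> x"
      proof cases
        case 1
        from step_succ_unique[OF saw pu(2) 1(1)] show ?thesis using 1(2) d by simp
      next
        case 2
        from step_succ_unique[OF saw pu(2) 2] show ?thesis using d by simp
      qed
    qed
    show ?thesis using T I O by blast
  next
    case False
    have "\<not> ?T" using False step_in[OF saw] by blast
    moreover have "\<not> ?I"
    proof
      assume ?I
      then have "walk_step c (x - 1, y) (x, y) \<or> walk_step c (Suc x, y) (x, y)"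
        using east_step[of "x - 1" y y] west_step[of x y y] by auto
      then show False using False step_in[OF saw] by blast
    qed
    ultimately show ?thesis by blast
  qed
  also have "\<dots> \<longleftrightarrow> 1 \<le> x \<and> x \<le> n \<and> y = black_row n (east_row c) (west_row c) x"
  proof -
    consider "x = 1" | "x = n" "x \<noteq> 1" | k where "x = Suc k" "1 \<le> k" "Suc k < n" | "\<not> (1 \<le> x \<and> x \<le> n)"
      by (metis One_nat_def Suc_le_eq Suc_lessI Suc_pred' le_neq_implies_less less_one linorder_not_less
          not0_implies_Suc)
    then show ?thesis
    proof cases
      case 1
      then show ?thesis using n er_ne_wr[of 1] by (auto simp: black_row_def)
    next
      case 2
      have "1 \<le> n - 1" "n - 1 < n" using n by linarith+
      then show ?thesis using 2 n er_ne_wr[of "n - 1"] by (auto simp: black_row_def)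
    next
      case 3
      then show ?thesis using dichotomy[of k] er_ne_wr[of k] er_ne_wr[of "Suc k"] er_ne_wr_Suc[of k]
        by (auto simp: black_row_def)
    next
      case 4
      then show ?thesis by auto
    qed
  qed
  finally show ?thesis .
qed

text \<open>
  Two black points in one row would be the ends of its side. Both are entered along this side, the
  left one by a westward and the right one by an eastward step, but the whole side is traversed in
  one direction.
\<close>

lemma black_row_inj:
  assumes x: "1 \<le> x" "x < x'" "x' \<le> n"
  shows "black_row n (east_row c) (west_row c) x \<noteq> black_row n (east_row c) (west_row c) x'"
proof
  assume eq: "black_row n (east_row c) (west_row c) x = black_row n (east_row c) (west_row c) x'"
  define y where "y = black_row n (east_row c) (west_row c) x"
  have T: "(x, y) \<in> turnpoints P" "(x', y) \<in> turnpoints P"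
    using out_vertical[of x y] out_vertical[of x' y] x eq by (auto simp: y_def)
  have "(x, y) \<in> set c" using out_vertical[of x y] step_in[OF saw] x by (auto simp: y_def)
  then obtain a b where ab: "a < b" "hor_edges P y = {a..<b}" "\<And>x. (x, y) \<in> turnpoints P \<longleftrightarrow> x = a \<or> x = b"
    using row_line[OF n Pm conv, of y] w_range by blast
  have xa: "x = a" "x' = b" using T ab x by auto
  have "x \<in> hor_edges P y" "x' - 1 \<in> hor_edges P y" "x' \<notin> hor_edges P y" "\<not> (x - 1 \<in> hor_edges P y \<and> 2 \<le> x)"
    using ab(1,2) xa by auto
  note h = this[unfolded hor_iff]
  have w0: "y = west_row c x"
  proof (cases "x = 1")
    case True then show ?thesis by (simp add: y_def black_row_def)
  next
    case False
    then show ?thesis using h(4) x unfolding y_def black_row_def by (auto split: if_splits)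
  qed
  have w: "j < x' - x \<Longrightarrow> y = west_row c (x + j)" for j
  proof (induction j)
    case (Suc j)
    then have "y = west_row c (x + j)" by simp
    moreover have "x + Suc j \<in> hor_edges P y" using ab xa Suc.prems by auto
    ultimately show ?case using er_ne_wr_Suc(2)[of "x + j"] x Suc.prems hor_iff by auto
  qed (use w0 in simp)
  have "y = west_row c (x' - 1)" using w[of "x' - 1 - x"] x by simp
  moreover have "y = east_row c (x' - 1)"
  proof (cases "x' = n")
    case True then show ?thesis using eq x by (simp add: y_def black_row_def)
  next
    case False
    then show ?thesis using eq h(3) x unfolding y_def by (auto simp: black_row_def split: if_splits)
  qed
  moreover have "1 \<le> x' - 1" "x' - 1 < n" using x by linarith+
  ultimately show False using er_ne_wr[of "x' - 1"] by simp
qed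

text \<open>
  On its way from the first to the last column the walk crosses the cut before \<open>x\<close>, and it does so
  in the row in which this cut is crossed eastwards.
\<close>

lemma upper_walk_pos:
  assumes x: "1 < x" "x < n" and hd: "c ! 0 = (1, east_row c 1)" and k: "k < length c" "c ! k = (n, east_row c (n - 1))"
  shows "(x, east_row c (x - 1)) \<in> set (take (Suc k) c)"
proof -
  have "0 < length c" using k(1) by linarith
  then have a0: "at c 0 = (1, east_row c 1)" "at c k = (n, east_row c (n - 1))" using hd k at_nth[OF saw] by auto
  have "\<exists>i. 0 \<le> i \<and> i < k \<and> fst (at c i) = x - 1 \<and> fst (at c (Suc i)) = Suc (x - 1)"
    by (rule crossing_between) (use adj_cases(1)[OF at_adjacent[OF saw]] a0 x in auto)
  then obtain i where i: "i < k" "fst (at c i) = x - 1" "fst (at c (Suc i)) = Suc (x - 1)" by blast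
  then have "walk_step c (x - 1, snd (at c i)) (Suc (x - 1), snd (at c (Suc i)))" unfolding walk_step_def
      by (metis prod.collapse)
  then have "snd (at c (Suc i)) = east_row c (x - 1)" using east_step by blast
  then have "at c (Suc i) = (x, east_row c (x - 1))" using i x by (simp add: prod_eq_iff)
  then have "c ! Suc i = (x, east_row c (x - 1))" using at_nth[OF saw, of "Suc i"] i k by simp
  then show ?thesis using i k by (metis in_set_conv_nth length_take less_Suc_eq_le min_less_iff_conj nth_take Suc_leI
      not_less_eq le_less_trans)
qed

text \<open>
  This vertex is entered from the right. If it were on the way from the first to the last column,
  the cut behind \<open>x\<close> would be crossed eastwards both before and after it, but it is crossed
  eastwards only once.
\<close>

lemma upper_walk_neg:
  assumes x: "1 < x" "x < n" and hd: "c ! 0 = (1, east_row c 1)" and k: "k < length c" "c ! k = (n, east_row c (n - 1))"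
  shows "(x, west_row c x) \<notin> set (take (Suc k) c)"
proof
  assume "(x, west_row c x) \<in> set (take (Suc k) c)"
  then obtain j where j: "j \<le> k" "c ! j = (x, west_row c x)" using k by (auto simp: in_set_conv_nth less_Suc_eq_le)
  have "0 < length c" using k(1) by linarith
  then have a0: "at c 0 = (1, east_row c 1)" "at c k = (n, east_row c (n - 1))" "at c j = (x, west_row c x)"
      using hd k j at_nth[OF saw] by auto
  then obtain l where l: "j = Suc l" using x by (cases j) auto
  have "walk_step c (Suc x, west_row c x) (x, west_row c x)" using west_step[of x] x by simp
  moreover have "walk_step c (at c l) (x, west_row c x)" using a0 l by (auto simp: walk_step_def)
  ultimately have al: "at c l = (Suc x, west_row c x)" using step_pred_unique[OF saw] by metis
  have "\<exists>i. 0 \<le> i \<and> i < l \<and> fst (at c i) = x \<and> fst (at c (Suc i)) = Suc x"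
    by (rule crossing_between) (use adj_cases(1)[OF at_adjacent[OF saw]] a0 al x in auto)
  then obtain i where i: "i < l" "fst (at c i) = x" "fst (at c (Suc i)) = Suc x" by blast
  have "\<exists>i. j \<le> i \<and> i < k \<and> fst (at c i) = x \<and> fst (at c (Suc i)) = Suc x"
    by (rule crossing_between) (use adj_cases(1)[OF at_adjacent[OF saw]] a0 j x in auto)
  then obtain i' where i': "j \<le> i'" "i' < k" "fst (at c i') = x" "fst (at c (Suc i')) = Suc x" by blast
  have "i = i'" using east_index_unique[of x i i'] i i' l k x by simp
  then show False using i i' l by simp
qed

end

section \<open>The skeleton of a convex permutomino\<close>

context
  fixes n :: nat and P :: polygon
  assumes n: "2 \<le> n" and cp: "P \<in> convex_permutominoes n"
begin

lemma cp_Pm: "permutomino n P" and cp_conv: "interior_points (\<Union> P) = {}"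
  using cp by (auto simp: convex_permutominoes_def convex_polygon_def)

lemma cp_clockwise_rows:
  assumes "clockwise_walk P c"
  shows "closed_saw c" "walk_edges c = P" "west_row c 1 < east_row c 1"
    "1 \<le> k \<Longrightarrow> k < n \<Longrightarrow> top_row P k = east_row c k" "1 \<le> k \<Longrightarrow> k < n \<Longrightarrow> bot_row P k = west_row c k"
proof -
  show s: "closed_saw c" "walk_edges c = P" using assms by (auto simp: clockwise_walk_def)
  show w: "west_row c 1 < east_row c 1" by (rule clockwise_imp[OF n cp_Pm cp_conv s assms])
  show "1 \<le> k \<Longrightarrow> k < n \<Longrightarrow> top_row P k = east_row c k" "1 \<le> k \<Longrightarrow> k < n \<Longrightarrow> bot_row P k = west_row c k"
    using top_bot[OF n cp_Pm cp_conv s w] by auto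
qed

text \<open>
  One of the two orientations of a walk crosses the first cut eastwards above the westward crossing;
  then the starting point is moved.
\<close>

lemma cp_clockwise_exists:
  assumes "v \<in> \<Union> P" shows "\<exists>c. clockwise_walk P c \<and> hd c = v \<and> c ! 0 = v"
proof -
  obtain c where c: "closed_saw c" "walk_edges c = P" using saw_exists[OF n cp_Pm cp_conv] by blast
  have l: "0 < length c" using saw_len[OF c(1)] by (cases c) auto
  obtain d where d: "clockwise_walk P d"
  proof (cases "west_row c 1 < east_row c 1")
    case True then show ?thesis using clockwise_if[OF n cp_Pm cp_conv c] that by blast
  next
    case False
    then have "west_row (rev c) 1 < east_row (rev c) 1"
      using er_ne_wr[OF n cp_Pm cp_conv c, of 1] n east_row_rev[OF l] by simp
    then show ?thesis using clockwise_if[OF n cp_Pm cp_conv, of "rev c"] saw_rev[OF c(1)] c that by blast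
  qed
  have sd: "closed_saw d" "walk_edges d = P" using d by (auto simp: clockwise_walk_def)
  have ld: "0 < length d" using saw_len[OF sd(1)] by (cases d) auto
  have "\<Union> P = set d" using walk_vertices[OF sd(1)] sd(2) by simp
  then have "v \<in> set d" using assms by blast
  then obtain i where i: "i < length d" "d ! i = v" by (auto simp: in_set_conv_nth)
  have "clockwise_walk P (rotate i d)"
    using d saw_rotate[OF sd(1), of i] step_rotate[OF ld, of i] unfolding clockwise_step by simp
  moreover have "hd (rotate i d) = v" using i hd_rotate_conv_nth[of d i] ld by simp
  moreover have "rotate i d ! 0 = v" using i nth_rotate[of 0 d i] ld by simp
  ultimately show ?thesis by blast
qed

text \<open>
  These facts hold for the rows of every clockwise walk and are stated in terms of the polygon
  alone.
\<close>

lemma cp_skeleton: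
  shows "k \<in> hor_edges P y \<longleftrightarrow> 1 \<le> k \<and> k < n \<and> (y = top_row P k \<or> y = bot_row P k)"
    and "1 \<le> k \<Longrightarrow> k < n \<Longrightarrow> bot_row P k < top_row P k"
    and "1 \<le> k \<Longrightarrow> Suc k < n \<Longrightarrow> (top_row P k = top_row P (Suc k)) \<noteq> (bot_row P k = bot_row P (Suc k))"
    and "vert_edges P 1 = {bot_row P 1..<top_row P 1}" and "vert_edges P n = {bot_row P (n - 1)..<top_row P (n - 1)}"
    and "1 \<le> k \<Longrightarrow> Suc k < n \<Longrightarrow> vert_edges P (Suc k) =
      (if bot_row P k = bot_row P (Suc k) then {min (top_row P k) (top_row P (Suc k))..<max (top_row P k) (top_row P
          (Suc k))} else {min (bot_row P k) (bot_row P (Suc k))..<max (bot_row P k) (bot_row P (Suc k))})"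
proof -
  obtain y0 where "(1, y0) \<in> \<Union> P" using extreme_col[OF n cp_Pm cp_conv, of 1] by (metis less_imp_le order_refl)
  then obtain c where c: "clockwise_walk P c" using cp_clockwise_exists by blast
  note r = cp_clockwise_rows[OF c]
  note o = rows_ordered[OF n cp_Pm cp_conv r(1,2,3)]
  show "k \<in> hor_edges P y \<longleftrightarrow> 1 \<le> k \<and> k < n \<and> (y = top_row P k \<or> y = bot_row P k)"
    using hor_iff[OF n cp_Pm cp_conv r(1,2)] r(4,5) by metis
  show "1 \<le> k \<Longrightarrow> k < n \<Longrightarrow> bot_row P k < top_row P k" using o r(4,5) by simp
  have n1: "1 \<le> n - 1" "n - 1 < n" "1 < n" using n by auto
  show "vert_edges P 1 = {bot_row P 1..<top_row P 1}" using vert_first[OF n cp_Pm cp_conv r(1,2)] r(3,4,5) n1 by simp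
  show "vert_edges P n = {bot_row P (n - 1)..<top_row P (n - 1)}"
      using vert_last[OF n cp_Pm cp_conv r(1,2)] r(4,5)[OF n1(1,2)] o[OF n1(1,2)] by simp
  show "1 \<le> k \<Longrightarrow> Suc k < n \<Longrightarrow> (top_row P k = top_row P (Suc k)) \<noteq> (bot_row P k = bot_row P (Suc k))"
    using dichotomy[OF n cp_Pm cp_conv r(1,2)] r(4,5) by simp
  show "1 \<le> k \<Longrightarrow> Suc k < n \<Longrightarrow> vert_edges P (Suc k) =
      (if bot_row P k = bot_row P (Suc k) then {min (top_row P k) (top_row P (Suc k))..<max (top_row P k) (top_row P
          (Suc k))} else {min (bot_row P k) (bot_row P (Suc k))..<max (bot_row P k) (bot_row P (Suc k))})"
    using vert_mid[OF n cp_Pm cp_conv r(1,2)] r(4,5) by simp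
qed

lemma cp_black_row: assumes "clockwise_walk P c" "1 \<le> x" "x \<le> n"
  shows "black_row n (east_row c) (west_row c) x = black_row n (top_row P) (bot_row P) x"
  using cp_clockwise_rows(4,5)[OF assms(1)] assms n by (auto simp: black_row_def)

lemma cp_black_points: "(x, y) \<in> black_points P \<longleftrightarrow> 1 \<le> x \<and> x \<le> n \<and> y = black_row n (top_row P) (bot_row P) x"
proof -
  note v1 = cp_skeleton(4)
  note xm = xmin_P[OF n cp_Pm cp_conv]
  have side: "(y1, y2) \<in> vertical_sides P 1 \<longleftrightarrow> y1 = bot_row P 1 \<and> y2 = top_row P 1" for y1 y2
  proof -
    obtain c where c: "closed_saw c" "walk_edges c = P" using saw_exists[OF n cp_Pm cp_conv] by blast
    have "line_sides {bot_row P 1..<top_row P 1} (\<lambda>y. (1, y) \<in> turnpoints P) = {(bot_row P 1, top_row P 1)}"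
      using line_sides_interval[of "\<lambda>y. (1, y) \<in> turnpoints P" "bot_row P 1"
          "top_row P 1"] turnpoint_iff_vert[OF c(1), of 1] c(2) v1 cp_skeleton(2)[of 1] n by simp
    then show ?thesis unfolding vertical_sides_line v1 by simp
  qed
  have out: "\<exists>u0. walk_step c (1, bot_row P 1) u0 \<and> fst u0 = 1" if c: "clockwise_walk P c" for c
    using out_vertical[OF n cp_Pm cp_conv cp_clockwise_rows(1,2)[OF c], of 1
        "bot_row P 1"] cp_clockwise_rows(5)[OF c, of 1] n
    by (auto simp: black_row_def)
  have char: "(\<exists>j. j < length (filter (\<lambda>p. p \<in> turnpoints P) c) \<and> even j \<and> (x, y) = filter (\<lambda>p. p \<in> turnpoints P) c ! j)
      \<longleftrightarrow>
      1 \<le> x \<and> x \<le> n \<and> y = black_row n (top_row P) (bot_row P) x"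
    if c: "clockwise_walk P c" and hd: "hd c = (1, bot_row P 1)" for c
  proof -
    obtain u0 where u0: "walk_step c (1, bot_row P 1) u0" "fst u0 = 1" using out[OF c] by blast
    have "(bot_row P 1, top_row P 1) \<in> vertical_sides P (xmin P)" using side xm by simp
    from black_points_step[OF c this _ , of u0 "(x, y)"] have
      "(\<exists>j. j < length (filter (\<lambda>p. p \<in> turnpoints P) c) \<and> even j \<and> (x, y) = filter (\<lambda>p. p \<in> turnpoints P) c ! j) \<longleftrightarrow>
       (x, y) \<in> turnpoints P \<and> (\<exists>u. walk_step c (x, y) u \<and> fst u = x)" using u0 hd xm by simp
    then show ?thesis
      using out_vertical[OF n cp_Pm cp_conv cp_clockwise_rows(1,2)[OF c], of x y] cp_black_row[OF c, of x] by auto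
  qed
  show ?thesis
  proof
    assume "(x, y) \<in> black_points P"
    then obtain c y1 y2 j where c: "clockwise_walk P c" "(y1, y2) \<in> vertical_sides P (xmin P)" "hd c = (xmin P, y1)"
      "j < length (filter (\<lambda>p. p \<in> turnpoints P) c)" "even j" "(x, y) = filter (\<lambda>p. p \<in> turnpoints P) c ! j"
      unfolding black_points_def by blast
    then show "1 \<le> x \<and> x \<le> n \<and> y = black_row n (top_row P) (bot_row P) x" using char[OF c(1)] side xm by auto
  next
    assume a: "1 \<le> x \<and> x \<le> n \<and> y = black_row n (top_row P) (bot_row P) x"
    have "bot_row P 1 \<in> vert_edges P 1" using v1 cp_skeleton(2)[of 1] n by simp
    then have "(1, bot_row P 1) \<in> \<Union> P" unfolding vert_edges_def by blast
    then obtain c where c: "clockwise_walk P c" "hd c = (1, bot_row P 1)" using cp_clockwise_exists by blast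
    have s: "(bot_row P 1, top_row P 1) \<in> vertical_sides P (xmin P)" using side xm by simp
    show "(x, y) \<in> black_points P" unfolding black_points_def mem_Collect_eq
      using char[OF c] a c s xm by metis
  qed
qed

lemma cp_black_perm: "black_perm n P x = (if 1 \<le> x \<and> x \<le> n then black_row n (top_row P) (bot_row P) x else x)"
  unfolding black_perm_def cp_black_points by auto

lemma cp_black_vertex: assumes "1 \<le> x" "x \<le> n" shows "(x, black_row n (top_row P) (bot_row P) x) \<in> \<Union> P"
proof -
  obtain y where "(1, y) \<in> \<Union> P" using extreme_col[OF n cp_Pm cp_conv, of 1] by (metis less_imp_le order_refl)
  then obtain c where c: "clockwise_walk P c" using cp_clockwise_exists by blast
  note r = cp_clockwise_rows(1,2)[OF c]
  have "(x, black_row n (top_row P) (bot_row P) x) \<in> turnpoints P \<and> (\<exists>u. walk_step c (x, black_row n (top_row P)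
      (bot_row P) x) u \<and> fst u = x)"
    unfolding out_vertical[OF n cp_Pm cp_conv r] cp_black_row[OF c assms] using assms by simp
  then show ?thesis using step_in[OF r(1)] walk_vertices[OF r(1)] r(2) by blast
qed

lemma cp_black_permutes: "black_perm n P permutes {1..n}"
proof (rule bij_imp_permutes)
  obtain y where "(1, y) \<in> \<Union> P" using extreme_col[OF n cp_Pm cp_conv, of 1] by (metis less_imp_le order_refl)
  then obtain c where c: "clockwise_walk P c" using cp_clockwise_exists by blast
  note r = cp_clockwise_rows(1,2)[OF c]
  have lt: "black_row n (top_row P) (bot_row P) x \<noteq> black_row n (top_row P) (bot_row P) x'" if "1 \<le> x" "x < x'" "x' \<le> n"
      for x x'
    using black_row_inj[OF n cp_Pm cp_conv r that] cp_black_row[OF c, of x] cp_black_row[OF c, of x'] that by simp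
  have inj: "inj_on (black_perm n P) {1..n}"
  proof (rule inj_onI)
    fix x x' assume "x \<in> {1..n}" "x' \<in> {1..n}" "black_perm n P x = black_perm n P x'"
    then show "x = x'" using lt[of x x'] lt[of x' x] unfolding cp_black_perm by (cases x x' rule: linorder_cases) auto
  qed
  have "black_perm n P ` {1..n} \<subseteq> {1..n}"
  proof
    fix z assume "z \<in> black_perm n P ` {1..n}"
    then obtain x where "1 \<le> x" "x \<le> n" "z = black_row n (top_row P) (bot_row P) x" unfolding cp_black_perm by auto
    then show "z \<in> {1..n}" using cp_black_vertex[of x] vertex_range[OF n cp_Pm cp_conv] by auto
  qed
  then show "bij_betw (black_perm n P) {1..n} {1..n}"
    using inj endo_inj_surj[of "{1..n}" "black_perm n P"] by (simp add: bij_betw_def)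
qed (auto simp: cp_black_perm)

lemma cp_upper_walk:
  assumes x: "1 < x" "x < n"
  shows "(x, top_row P (x - 1)) \<in> upper_walk P" "(x, bot_row P x) \<notin> upper_walk P"
proof -
  have n1: "1 \<le> n - 1" "n - 1 < n" "1 < n" using n by auto
  have mx: "Max {a..b} = b" if "a < b" for a b :: nat by (rule Max_eqI) (use that in auto)
  obtain a b where ab: "a < b" "vert_edges P 1 = {a..<b}" "\<And>y. (1, y) \<in> \<Union> P \<longleftrightarrow> a \<le> y \<and> y \<le> b"
    using extreme_col[OF n cp_Pm cp_conv, of 1] by blast
  have b: "b = top_row P 1" using ab(1,2) cp_skeleton(4) atLeastLessThan_eq_iff[OF ab(1) cp_skeleton(2)[of 1]] n1
      by simp
  have "{y. (1, y) \<in> \<Union> P} = {a..b}" using ab(3) by auto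
  then have hl: "highest_leftmost P = (1, top_row P 1)"
    unfolding highest_leftmost_def xmin_P[OF n cp_Pm cp_conv] using mx[of a b] ab(1) b by simp
  obtain a' b' where ab': "a' < b'" "vert_edges P n = {a'..<b'}" "\<And>y. (n, y) \<in> \<Union> P \<longleftrightarrow> a' \<le> y \<and> y \<le> b'"
    using extreme_col[OF n cp_Pm cp_conv, of n] by blast
  have b': "b' = top_row P (n - 1)" using ab'(1,2) cp_skeleton(5) atLeastLessThan_eq_iff[OF ab'(1) cp_skeleton(2)[of
      "n - 1"]] n1 by simp
  have "{y. (n, y) \<in> \<Union> P} = {a'..b'}" using ab'(3) by auto
  then have hr: "highest_rightmost P = (n, top_row P (n - 1))"
    unfolding highest_rightmost_def xmax_P[OF n cp_Pm cp_conv] using mx[of a' b'] ab'(1) b' by simp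
  have "(1, top_row P 1) \<in> \<Union> P" using ab b by simp
  then obtain c where c: "clockwise_walk P c" "hd c = (1, top_row P 1)" "c ! 0 = (1, top_row P 1)"
      using cp_clockwise_exists by blast
  note r = cp_clockwise_rows[OF c(1)]
  have "(n, top_row P (n - 1)) \<in> set c" using ab' b' walk_vertices[OF r(1)] r(2) by auto
  then obtain k where k: "k < length c" "c ! k = (n, top_row P (n - 1))" by (auto simp: in_set_conv_nth)
  have x1: "1 \<le> x - 1" "x - 1 < n" using x by auto
  have "(x, east_row c (x - 1)) \<in> set (take (Suc k) c)"
    by (rule upper_walk_pos[OF n cp_Pm cp_conv r(1,2) x]) (use c k r(4) n1 in auto)
  then have "(x, top_row P (x - 1)) \<in> set (take (Suc k) c)" using r(4)[OF x1] by simp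
  then show "(x, top_row P (x - 1)) \<in> upper_walk P" unfolding upper_walk_def mem_Collect_eq hl hr using c k by blast
  show "(x, bot_row P x) \<notin> upper_walk P"
  proof
    assume "(x, bot_row P x) \<in> upper_walk P"
    then obtain c k where c: "clockwise_walk P c" "hd c = (1, top_row P 1)" "k < length c"
        "c ! k = (n, top_row P (n - 1))" "(x, bot_row P x) \<in> set (take (Suc k) c)"
      unfolding upper_walk_def mem_Collect_eq hl hr by blast
    note r = cp_clockwise_rows[OF c(1)]
    have "c ! 0 = (1, top_row P 1)" using c(2,3) by (cases c) auto
    then have "(x, west_row c x) \<notin> set (take (Suc k) c)"
      using upper_walk_neg[OF n cp_Pm cp_conv r(1,2) x, of k] c r(4) n1 by auto
    then show False using c(5) r(5)[of x] x by simp
  qed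
qed

end

section \<open>From convex permutominoes to colored square permutations\<close>

text \<open>
  The columns whose black points lie on the upper path, read off from the colored permutation: by
  \<open>upper_lower_exclusive\<close> the type of record decides, except at free fixed points, where the color
  does.
\<close>

definition on_upper :: "nat \<Rightarrow> (nat \<Rightarrow> nat) \<Rightarrow> point set \<Rightarrow> nat \<Rightarrow> bool" where
  "on_upper n \<sigma> C x \<longleftrightarrow> 1 < x \<and> x < n \<and>
     (if (x, \<sigma> x) \<in> free_fixed_points n \<sigma> then (x, \<sigma> x) \<in> C else ulr \<sigma> x \<or> urr n \<sigma> x)"

text \<open>
  A UL and BL record is the first point and a UR and BR record the last one. A UR and BL record
  would follow an antidiagonal block, and a UL and BR record that is not free is excluded by the
  other cases.
\<close>

lemma upper_lower_exclusive:
  assumes sq: "\<sigma> \<in> square_perms n" and co: "\<not> co_decomposable n \<sigma>" and x: "1 < x" "x < n"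
    and nf: "(x, \<sigma> x) \<notin> free_fixed_points n \<sigma>" and u: "ulr \<sigma> x \<or> urr n \<sigma> x" and l: "blr \<sigma> x \<or> brr n \<sigma> x"
  shows False
proof -
  have perm: "\<sigma> permutes {1..n}" using sq by (simp add: square_perms_def)
  have x': "1 \<le> x" "x \<le> n" using x by auto
  have "\<not> (ulr \<sigma> x \<and> blr \<sigma> x)" using ulr_blr_first[of x \<sigma>] x by auto
  moreover have "\<not> (urr n \<sigma> x \<and> brr n \<sigma> x)" using urr_brr_last[of x n \<sigma>] x by auto
  moreover have "\<not> (blr \<sigma> x \<and> urr n \<sigma> x)"
  proof
    assume "blr \<sigma> x \<and> urr n \<sigma> x"
    then have "\<sigma> ` {1..x - 1} = {Suc n - (x - 1)..n}" using blr_urr_iff[OF perm x'] by simp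
    moreover have "Suc n - (x - 1) = n - (x - 1) + 1" "x - 1 \<in> {1..n - 1}" using x by auto
    ultimately have "co_decomposable n \<sigma>" unfolding co_decomposable_def by metis
    then show False using co by simp
  qed
  ultimately have "ulr \<sigma> x" "brr n \<sigma> x" "\<not> blr \<sigma> x" "\<not> urr n \<sigma> x" using u l by auto
  then show False using ulr_brr_fixed[OF perm x'] nf x' by (auto simp: free_fixed_iff[OF perm])
qed

context
  fixes n :: nat and P :: polygon
  assumes n: "2 \<le> n" and cp: "P \<in> convex_permutominoes n"
begin

lemmas cp_skel = cp_skeleton[OF n cp]

lemma bp_row: "1 \<le> x \<Longrightarrow> x \<le> n \<Longrightarrow> black_perm n P x = black_row n (top_row P) (bot_row P) x"
  using cp_black_perm[OF n cp] by simp

lemma bp_perm: "black_perm n P permutes {1..n}" by (rule cp_black_permutes[OF n cp])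

lemma bp_vertex: "1 \<le> x \<Longrightarrow> x \<le> n \<Longrightarrow> (x, black_perm n P x) \<in> \<Union> P"
  using cp_black_vertex[OF n cp] bp_row by simp

lemma bp_lt_of_le: "x \<noteq> z \<Longrightarrow> black_perm n P z \<le> black_perm n P x \<Longrightarrow> black_perm n P z < black_perm n P x"
  using perm_inj[OF bp_perm, of z x] by fastforce

lemma bp_records:
  assumes "1 \<le> x" "x \<le> n"
  shows "(x, black_perm n P x) \<in> UL_records (\<Union> P) \<Longrightarrow> ulr (black_perm n P) x" "(x, black_perm n P x) \<in> UR_records (\<Union> P) \<Longrightarrow>
      urr n (black_perm n P) x"
    "(x, black_perm n P x) \<in> BL_records (\<Union> P) \<Longrightarrow> blr (black_perm n P) x" "(x, black_perm n P x) \<in> BR_records (\<Union> P) \<Longrightarrow>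
        brr n (black_perm n P) x"
proof -
  show "(x, black_perm n P x) \<in> UL_records (\<Union> P) \<Longrightarrow> ulr (black_perm n P) x"
    unfolding UL_records_iff ulr_def using bp_vertex bp_lt_of_le assms by (metis less_imp_le less_irrefl order_trans)
  show "(x, black_perm n P x) \<in> UR_records (\<Union> P) \<Longrightarrow> urr n (black_perm n P) x"
    unfolding UR_records_iff urr_def using bp_vertex bp_lt_of_le assms by (metis less_imp_le less_irrefl order_trans)
  show "(x, black_perm n P x) \<in> BL_records (\<Union> P) \<Longrightarrow> blr (black_perm n P) x"
    unfolding BL_records_iff blr_def using bp_vertex bp_lt_of_le assms by (metis less_imp_le less_irrefl order_trans)
  show "(x, black_perm n P x) \<in> BR_records (\<Union> P) \<Longrightarrow> brr n (black_perm n P) x"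
    unfolding BR_records_iff brr_def using bp_vertex bp_lt_of_le assms by (metis less_imp_le less_irrefl order_trans)
qed

lemma vertex_exterior: "v \<in> \<Union> P \<Longrightarrow> v \<in> UL_records (\<Union> P) \<or> v \<in> UR_records (\<Union> P) \<or> v \<in> BL_records (\<Union> P) \<or>
    v \<in> BR_records (\<Union> P)"
  using cp_conv[OF n cp] unfolding interior_points_def exterior_points_def by blast

lemma bp_square: "black_perm n P \<in> square_perms n"
  unfolding square_iff using bp_perm bp_records vertex_exterior bp_vertex by blast

lemma phi_csq: "phi n P \<in> colored_square_perms n"
  using bp_square by (simp add: phi_def colored_square_perms_def)

lemma hor_vertices: "1 \<le> k \<Longrightarrow> k < n \<Longrightarrow> (k, top_row P k) \<in> \<Union> P \<and> (Suc k, top_row P k) \<in> \<Union> P \<and> (k, bot_row P k) \<in> \<Union> P \<and>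
    (Suc k, bot_row P k) \<in> \<Union> P"
proof -
  assume k: "1 \<le> k" "k < n"
  have "k \<in> hor_edges P (top_row P k)" "k \<in> hor_edges P (bot_row P k)" using cp_skel(1) k by auto
  then show ?thesis unfolding hor_edges_def by blast
qed

text \<open>
  The black point lies in the top row over the cut before it, and the bottom row, which does not
  change here, has vertices to the lower left and to the lower right of it.
\<close>

lemma upper_col_record:
  assumes k: "1 \<le> k" "Suc k < n" and d: "top_row P k \<noteq> top_row P (Suc k)"
  shows "black_perm n P (Suc k) = top_row P k" "bot_row P (Suc k) = bot_row P k"
      "ulr (black_perm n P) (Suc k) \<or> urr n (black_perm n P) (Suc k)"
proof -
  show b: "black_perm n P (Suc k) = top_row P k" using bp_row[of "Suc k"] k d by (simp add: black_row_def)
  show w: "bot_row P (Suc k) = bot_row P k" using cp_skel(3)[OF k] d by simp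
  have lt: "bot_row P k < top_row P k" using cp_skel(2)[of k] k by simp
  have "(Suc k, black_perm n P (Suc k)) \<notin> BL_records (\<Union> P)"
    unfolding BL_records_iff using hor_vertices[of k] k lt b by (metis lessI not_less less_imp_le Suc_lessD)
  moreover have "(Suc k, black_perm n P (Suc k)) \<notin> BR_records (\<Union> P)"
    unfolding BR_records_iff using hor_vertices[of "Suc k"] k lt b w by (metis lessI not_less le_SucI)
  ultimately show "ulr (black_perm n P) (Suc k) \<or> urr n (black_perm n P) (Suc k)"
    using vertex_exterior[OF bp_vertex[of "Suc k"]] bp_records[of "Suc k"] k by auto
qed

lemma lower_col_record:
  assumes k: "1 \<le> k" "Suc k < n" and d: "top_row P k = top_row P (Suc k)"
  shows "black_perm n P (Suc k) = bot_row P (Suc k)" "blr (black_perm n P) (Suc k) \<or> brr n (black_perm n P) (Suc k)"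
proof -
  show b: "black_perm n P (Suc k) = bot_row P (Suc k)" using bp_row[of "Suc k"] k d by (simp add: black_row_def)
  have lt: "bot_row P (Suc k) < top_row P (Suc k)" using cp_skel(2)[of "Suc k"] k by simp
  have "(Suc k, black_perm n P (Suc k)) \<notin> UL_records (\<Union> P)"
    unfolding UL_records_iff using hor_vertices[of k] k lt b d by (metis lessI not_less less_imp_le Suc_lessD)
  moreover have "(Suc k, black_perm n P (Suc k)) \<notin> UR_records (\<Union> P)"
    unfolding UR_records_iff using hor_vertices[of "Suc k"] k lt b by (metis lessI not_less le_SucI)
  ultimately show "blr (black_perm n P) (Suc k) \<or> brr n (black_perm n P) (Suc k)"
    using vertex_exterior[OF bp_vertex[of "Suc k"]] bp_records[of "Suc k"] k by auto
qed

text \<open>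
  The top row remains in use until a column in which it changes, or until the last column, and the
  black point of this column lies in it.
\<close>

lemma top_is_later_black: assumes "1 \<le> k" "k < n" shows "\<exists>x. k < x \<and> x \<le> n \<and> black_perm n P x = top_row P k"
proof -
  have "k \<le> n - 1" using assms by simp
  then show ?thesis
  proof (induction rule: inc_induct)
    case base
    have "black_perm n P n = top_row P (n - 1)" using bp_row[of n] n by (simp add: black_row_def)
    then show ?case using n by (intro exI[of _ n]) auto
  next
    case (step j)
    then have j: "1 \<le> j" "Suc j < n" using assms by auto
    show ?case
    proof (cases "top_row P j = top_row P (Suc j)")
      case True then show ?thesis using step.IH by (metis Suc_lessD)
    next
      case False then show ?thesis using upper_col_record(1)[OF j False] j by (intro exI[of _ "Suc j"]) simp
    qed
  qed
qed

lemma bottom_is_earlier_black: "1 \<le> k \<Longrightarrow> k < n \<Longrightarrow> \<exists>x. 1 \<le> x \<and> x \<le> k \<and> black_perm n P x = bot_row P k"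
proof (induction k)
  case (Suc k)
  show ?case
  proof (cases "k = 0")
    case True
    then show ?thesis using bp_row[of 1] n by (intro exI[of _ 1]) (simp add: black_row_def)
  next
    case False
    then have k: "1 \<le> k" "Suc k < n" using Suc by auto
    show ?thesis
    proof (cases "top_row P k = top_row P (Suc k)")
      case True then show ?thesis using lower_col_record(1)[OF k True] by (intro exI[of _ "Suc k"]) simp
    next
      case False
      then show ?thesis using upper_col_record(2)[OF k False] Suc.IH k by (metis Suc_lessD le_SucI)
    qed
  qed
qed simp

text \<open>
  Over each cut the bottom row, which is the value of an earlier column, is below the top row, which
  is the value of a later column. Behind an antidiagonal block it would be the other way round.
\<close>

lemma phi_co_indecomposable: "\<not> co_decomposable n (black_perm n P)"
proof
  assume "co_decomposable n (black_perm n P)"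
  then obtain k where k: "1 \<le> k" "k \<le> n - 1" "black_perm n P ` {1..k} = {n - k + 1..n}"
      by (auto simp: co_decomposable_def)
  then have kn: "k < n" using n by simp
  obtain x where x: "k < x" "x \<le> n" "black_perm n P x = top_row P k" using top_is_later_black[OF k(1) kn] by blast
  obtain z where z: "1 \<le> z" "z \<le> k" "black_perm n P z = bot_row P k" using bottom_is_earlier_black[OF k(1) kn] by blast
  have "black_perm n P z \<in> black_perm n P ` {1..k}" using z by (intro imageI) simp
  then have 1: "n - k + 1 \<le> bot_row P k" unfolding k(3) z(3) by simp
  have "black_perm n P x \<notin> black_perm n P ` {1..k}"
  proof
    assume "black_perm n P x \<in> black_perm n P ` {1..k}"
    then obtain j where "j \<le> k" "black_perm n P x = black_perm n P j" by auto
    then show False using perm_inj[OF bp_perm, of x j] x by simp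
  qed
  then have 2: "top_row P k < n - k + 1" unfolding k(3) using perm_range[OF bp_perm, of x] x k by auto
  show False using 1 2 cp_skel(2)[OF k(1) kn] by simp
qed

text \<open>
  At a free fixed point the color tells whether the black point lies on the upper walk. At the other
  points the types of records on the upper and on the lower path exclude each other.
\<close>

lemma upper_col_iff: assumes k: "1 \<le> k" "Suc k < n"
  shows "top_row P k \<noteq> top_row P (Suc k) \<longleftrightarrow> on_upper n (black_perm n P) (snd (phi n P)) (Suc k)"
proof -
  have x: "1 < Suc k" "Suc k < n" using k by auto
  have w: "top_row P k \<noteq> top_row P (Suc k) \<Longrightarrow> (Suc k, black_perm n P (Suc k)) \<in> upper_walk P"
      "top_row P k = top_row P (Suc k) \<Longrightarrow> (Suc k, black_perm n P (Suc k)) \<notin> upper_walk P"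
    using cp_upper_walk[OF n cp x] upper_col_record(1)[OF k] lower_col_record(1)[OF k] by auto
  show ?thesis
  proof (cases "(Suc k, black_perm n P (Suc k)) \<in> free_fixed_points n (black_perm n P)")
    case True
    then show ?thesis using w x by (auto simp: on_upper_def phi_def)
  next
    case False
    have "\<not> (ulr (black_perm n P) (Suc k) \<or> urr n (black_perm n P) (Suc k))" if "top_row P k = top_row P (Suc k)"
      using upper_lower_exclusive[OF bp_square phi_co_indecomposable x False] lower_col_record(2)[OF k that] by blast
    then show ?thesis using upper_col_record(3)[OF k] False x by (auto simp: on_upper_def)
  qed
qed

end

lemma polygon_subset:
  assumes P: "is_polygon P" and v: "\<And>x. vert_edges P x \<subseteq> vert_edges Q x" and h: "\<And>y. hor_edges P y \<subseteq> hor_edges Q y"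
  shows "P \<subseteq> Q"
proof
  fix E assume E: "E \<in> P"
  obtain c where c: "closed_saw c" "walk_edges c = P" using P by (auto simp: is_polygon_def)
  obtain i where i: "E = {at c i, at c (Suc i)}" using walk_edge_form[OF c(1)] E c(2) by blast
  have a: "adjacent (at c i) (at c (Suc i))" using at_adjacent[OF c(1)] .
  obtain x y x' y' where d: "at c i = (x, y)" "at c (Suc i) = (x', y')" by (metis surj_pair)
  consider "x' = x" "y' = Suc y" | "x' = x" "y = Suc y'" | "y' = y" "x' = Suc x" | "y' = y" "x = Suc x'"
    using a d by (auto simp: adjacent_def)
  then show "E \<in> Q"
  proof cases
    case 1
    then have e: "E = {(x, y), (x, Suc y)}" using i d by simp
    then have "y \<in> vert_edges P x" using E by (simp add: vert_edges_def)
    then show ?thesis using v[of x] e by (auto simp: vert_edges_def)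
  next
    case 2
    then have e: "E = {(x, y'), (x, Suc y')}" using i d by auto
    then have "y' \<in> vert_edges P x" using E by (simp add: vert_edges_def)
    then show ?thesis using v[of x] e by (auto simp: vert_edges_def)
  next
    case 3
    then have e: "E = {(x, y), (Suc x, y)}" using i d by simp
    then have "x \<in> hor_edges P y" using E by (simp add: hor_edges_def)
    then show ?thesis using h[of y] e by (auto simp: hor_edges_def)
  next
    case 4
    then have e: "E = {(x', y), (Suc x', y)}" using i d by auto
    then have "x' \<in> hor_edges P y" using E by (simp add: hor_edges_def)
    then show ?thesis using h[of y] e by (auto simp: hor_edges_def)
  qed
qed

lemma cp_subset_of_rows:
  assumes n: "2 \<le> n" and P: "P \<in> convex_permutominoes n" and Q: "Q \<in> convex_permutominoes n"
    and t: "\<And>k. 1 \<le> k \<Longrightarrow> k < n \<Longrightarrow> top_row P k = top_row Q k" and b: "\<And>k. 1 \<le> k \<Longrightarrow> k < n \<Longrightarrow> bot_row P k = bot_row Q k"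
  shows "P \<subseteq> Q"
proof (rule polygon_subset)
  show "is_polygon P" using cp_Pm[OF n P] by (simp add: permutomino_def)
  show "hor_edges P y \<subseteq> hor_edges Q y" for y using cp_skeleton(1)[OF n P] cp_skeleton(1)[OF n Q] t b by auto
  fix x
  have n1: "1 \<le> n - 1" "n - 1 < n" "1 < n" using n by auto
  consider "x = 1" | "x = n" | k where "x = Suc k" "1 \<le> k" "Suc k < n" | "\<not> (1 \<le> x \<and> x \<le> n)"
    by (metis One_nat_def Suc_le_eq Suc_lessI Suc_pred' le_neq_implies_less less_one linorder_not_less not0_implies_Suc)
  then show "vert_edges P x \<subseteq> vert_edges Q x"
  proof cases
    case 1 then show ?thesis using cp_skeleton(4)[OF n P] cp_skeleton(4)[OF n Q] t[of 1] b[of 1] n1 by simp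
  next
    case 2 then show ?thesis using cp_skeleton(5)[OF n P] cp_skeleton(5)[OF n Q] t[OF n1(1,2)] b[OF n1(1,2)] by simp
  next
    case 3
    have "1 \<le> k" "k < n" "1 \<le> Suc k" using 3 by auto
    then show ?thesis unfolding 3(1) cp_skeleton(6)[OF n P 3(2,3)] cp_skeleton(6)[OF n Q 3(2,3)]
      using t[of k] t[of "Suc k"] b[of k] b[of "Suc k"] 3(3) by simp
  next
    case 4
    have "y \<notin> vert_edges P x" for y
    proof
      assume "y \<in> vert_edges P x"
      then have "(x, y) \<in> \<Union> P" unfolding vert_edges_def by blast
      then show False using vertex_range[OF n cp_Pm[OF n P] cp_conv[OF n P]] 4 by blast
    qed
    then show ?thesis by blast
  qed
qed

text \<open>
  The colored permutation determines in which columns the top row changes. As the black point of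
  such a column lies in the top row over the cut before it, the top rows are recovered from right to
  left, and similarly the bottom rows from left to right.
\<close>

lemma phi_inj_on: assumes n: "2 \<le> n" shows "inj_on (phi n) (convex_permutominoes n)"
proof (rule inj_onI)
  fix P Q assume P: "P \<in> convex_permutominoes n" and Q: "Q \<in> convex_permutominoes n" and eq: "phi n P = phi n Q"
  have bp: "black_perm n P = black_perm n Q" using eq by (simp add: phi_def)
  have up: "(top_row P k \<noteq> top_row P (Suc k)) = (top_row Q k \<noteq> top_row Q (Suc k))" if "1 \<le> k" "Suc k < n" for k
    using upper_col_iff[OF n P that] upper_col_iff[OF n Q that] bp eq by simp
  have t: "top_row P k = top_row Q k" if k: "1 \<le> k" "k < n" for k
  proof -
    have "k \<le> n - 1" using k by simp
    then show ?thesis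
    proof (induction rule: inc_induct)
      case base
      show ?case using bp_row[OF n P, of n] bp_row[OF n Q, of n] bp n by (simp add: black_row_def)
    next
      case (step j)
      then have j: "1 \<le> j" "Suc j < n" using k by auto
      show ?case
      proof (cases "top_row P j = top_row P (Suc j)")
        case True then show ?thesis using up[OF j] step.IH by simp
      next
        case False
        then show ?thesis using up[OF j] upper_col_record(1)[OF n P j] upper_col_record(1)[OF n Q j] bp by simp
      qed
    qed
  qed
  have b: "1 \<le> k \<Longrightarrow> k < n \<Longrightarrow> bot_row P k = bot_row Q k" for k
  proof (induction k)
    case (Suc k)
    show ?case
    proof (cases "k = 0")
      case True then show ?thesis using bp_row[OF n P, of 1] bp_row[OF n Q, of 1] bp n by (simp add: black_row_def)
    next
      case False
      then have k: "1 \<le> k" "Suc k < n" using Suc by auto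
      show ?thesis
      proof (cases "top_row P k = top_row P (Suc k)")
        case True
        then show ?thesis using up[OF k] lower_col_record(1)[OF n P k] lower_col_record(1)[OF n Q k] bp by simp
      next
        case False
        then show ?thesis using up[OF k] upper_col_record(2)[OF n P k] upper_col_record(2)[OF n Q k] Suc.IH k by simp
      qed
    qed
  qed simp
  show "P = Q" using cp_subset_of_rows[OF n P Q] cp_subset_of_rows[OF n Q P] t b by (simp add: subset_antisym)
qed

section \<open>Walks assembled from vertical segments\<close>

definition list_steps :: "'a list \<Rightarrow> ('a \<times> 'a) set" where
  "list_steps xs = set (zip xs (tl xs))"

lemma list_steps_nth: "(u, v) \<in> list_steps xs \<longleftrightarrow> (\<exists>i. Suc i < length xs \<and> u = xs ! i \<and> v = xs ! Suc i)"
proof -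
  have "(u, v) \<in> list_steps xs \<longleftrightarrow> (\<exists>i. xs ! i = u \<and> tl xs ! i = v \<and> i < length xs \<and> i < length (tl xs))"
    unfolding list_steps_def in_set_zip by simp
  moreover have "xs ! i = u \<and> tl xs ! i = v \<and> i < length xs \<and> i < length (tl xs) \<longleftrightarrow> Suc i < length xs \<and> u = xs ! i \<and>
      v = xs ! Suc i" for i
    by (cases xs) auto
  ultimately show ?thesis by simp
qed

lemma list_steps_append:
  assumes "ys \<noteq> []" shows "xs \<noteq> [] \<Longrightarrow> list_steps (xs @ ys) = list_steps xs \<union> {(last xs, hd ys)} \<union> list_steps ys"
proof (induction xs)
  case (Cons x xs)
  show ?case
  proof (cases "xs = []")
    case True
    then show ?thesis using assms by (cases ys) (auto simp: list_steps_def)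
  next
    case False
    then have "list_steps (xs @ ys) = list_steps xs \<union> {(last xs, hd ys)} \<union> list_steps ys" using Cons.IH by blast
    then show ?thesis using False by (cases xs) (auto simp: list_steps_def)
  qed
qed simp

lemma ex_le_Suc: "a \<le> Suc k \<Longrightarrow> (\<exists>x. a \<le> x \<and> x \<le> Suc k \<and> Q x) \<longleftrightarrow> (\<exists>x. a \<le> x \<and> x \<le> k \<and> Q x) \<or> Q (Suc k)"
  by (metis le_Suc_eq)

lemma ex_less_Suc_split: "a \<le> k \<Longrightarrow> (\<exists>x. a \<le> x \<and> x < Suc k \<and> Q x) \<longleftrightarrow> (\<exists>x. a \<le> x \<and> x < k \<and> Q x) \<or> Q k"
  by (metis less_Suc_eq)

lemma walk_step_list: assumes "c \<noteq> []" shows "walk_step c u v \<longleftrightarrow> (u, v) \<in> list_steps c \<or> u = last c \<and> v = hd c"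
proof
  assume "walk_step c u v"
  then obtain k where k: "at c k = u" "at c (Suc k) = v" by (auto simp: walk_step_def)
  define i where "i = k mod length c"
  have i: "i < length c" using assms by (simp add: i_def)
  have u: "u = c ! i" using k by (simp add: at_def i_def)
  show "(u, v) \<in> list_steps c \<or> u = last c \<and> v = hd c"
  proof (cases "Suc i < length c")
    case True
    then have "Suc k mod length c = Suc i" using mod_Suc[of k "length c"] by (simp add: i_def)
    then have "v = c ! Suc i" using k by (simp add: at_def)
    then have "(u, v) \<in> list_steps c" unfolding list_steps_nth using True u by (intro exI[of _ i]) simp
    then show ?thesis by simp
  next
    case False
    then have s: "Suc i = length c" using i by simp
    then have "Suc k mod length c = 0" using mod_Suc[of k "length c"] by (simp add: i_def)
    then have "v = hd c" using k assms by (simp add: at_def hd_conv_nth)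
    moreover have "u = last c" using u s assms by (metis diff_Suc_1 last_conv_nth)
    ultimately show ?thesis by simp
  qed
next
  assume "(u, v) \<in> list_steps c \<or> u = last c \<and> v = hd c"
  then show "walk_step c u v"
  proof
    assume "(u, v) \<in> list_steps c"
    then obtain i where "Suc i < length c" "u = c ! i" "v = c ! Suc i" unfolding list_steps_nth by (elim exE conjE)
    then have "at c i = u" "at c (Suc i) = v" by (auto simp: at_def)
    then show ?thesis unfolding walk_step_def by blast
  next
    assume a: "u = last c \<and> v = hd c"
    have "Suc (length c - 1) = length c" using assms by (cases c) auto
    then have "at c (length c - 1) = u" "at c (Suc (length c - 1)) = v"
      using a assms by (auto simp: at_def last_conv_nth hd_conv_nth)
    then show ?thesis unfolding walk_step_def by blast
  qed
qed

definition seg :: "nat \<Rightarrow> nat \<Rightarrow> nat \<Rightarrow> point list" where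
  "seg x a b = map (Pair x) (if a \<le> b then [a..<Suc b] else rev [b..<Suc a])"

lemma seg_simps:
  "seg x a b \<noteq> []" "hd (seg x a b) = (x, a)" "last (seg x a b) = (x, b)" "distinct (seg x a b)"
  "set (seg x a b) = Pair x ` {min a b..max a b}"
proof -
  show "seg x a b \<noteq> []" by (simp add: seg_def)
  show "hd (seg x a b) = (x, a)"
  proof (cases "a \<le> b")
    case True
    then have "hd [a..<Suc b] = a" by (simp add: upt_conv_Cons del: upt_Suc)
    then show ?thesis using True by (simp add: seg_def hd_map del: upt_Suc)
  next
    case False
    then show ?thesis by (simp add: seg_def hd_rev)
  qed
  show "last (seg x a b) = (x, b)"
  proof (cases "a \<le> b")
    case True
    then show ?thesis by (simp add: seg_def last_map)
  next
    case False
    then have "hd [b..<Suc a] = b" by (simp add: upt_conv_Cons del: upt_Suc)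
    moreover have "[b..<Suc a] \<noteq> []" using False by simp
    ultimately show ?thesis using False by (simp add: seg_def last_map last_rev del: upt_Suc)
  qed
  show "distinct (seg x a b)" by (auto simp: seg_def distinct_map inj_on_def simp del: upt_Suc)
  show "set (seg x a b) = Pair x ` {min a b..max a b}" by (auto simp: seg_def simp del: upt_Suc)
qed

lemma seg_steps: "(u, v) \<in> list_steps (seg x a b) \<longleftrightarrow>
    (\<exists>y. a \<le> y \<and> y < b \<and> u = (x, y) \<and> v = (x, Suc y)) \<or> (\<exists>y. b \<le> y \<and> y < a \<and> u = (x, Suc y) \<and> v = (x, y))"
proof (cases "a \<le> b")
  case True
  have len: "length (seg x a b) = Suc b - a" using True by (simp add: seg_def del: upt_Suc)
  have nth: "seg x a b ! i = (x, a + i)" if "i < Suc b - a" for i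
    using that True by (simp add: seg_def nth_map del: upt_Suc)
  have "(u, v) \<in> list_steps (seg x a b) \<longleftrightarrow> (\<exists>i. Suc i < Suc b - a \<and> u = (x, a + i) \<and> v = (x, a + Suc i))"
    unfolding list_steps_nth len using nth by auto
  also have "\<dots> \<longleftrightarrow> (\<exists>y. a \<le> y \<and> y < b \<and> u = (x, y) \<and> v = (x, Suc y))"
  proof
    assume "\<exists>i. Suc i < Suc b - a \<and> u = (x, a + i) \<and> v = (x, a + Suc i)"
    then obtain i where "Suc i < Suc b - a" "u = (x, a + i)" "v = (x, a + Suc i)" by blast
    then show "\<exists>y. a \<le> y \<and> y < b \<and> u = (x, y) \<and> v = (x, Suc y)" by (intro exI[of _ "a + i"]) auto
  next
    assume "\<exists>y. a \<le> y \<and> y < b \<and> u = (x, y) \<and> v = (x, Suc y)"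
    then obtain y where "a \<le> y" "y < b" "u = (x, y)" "v = (x, Suc y)" by blast
    then show "\<exists>i. Suc i < Suc b - a \<and> u = (x, a + i) \<and> v = (x, a + Suc i)" by (intro exI[of _ "y - a"]) auto
  qed
  finally show ?thesis using True by auto
next
  case False
  have len: "length (seg x a b) = Suc a - b" using False by (simp add: seg_def del: upt_Suc)
  have nth: "seg x a b ! i = (x, a - i)" if "i < Suc a - b" for i
    using that False by (simp add: seg_def nth_map rev_nth del: upt_Suc)
  have "(u, v) \<in> list_steps (seg x a b) \<longleftrightarrow> (\<exists>i. Suc i < Suc a - b \<and> u = (x, a - i) \<and> v = (x, a - Suc i))"
    unfolding list_steps_nth len using nth by auto
  also have "\<dots> \<longleftrightarrow> (\<exists>y. b \<le> y \<and> y < a \<and> u = (x, Suc y) \<and> v = (x, y))"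
  proof
    assume "\<exists>i. Suc i < Suc a - b \<and> u = (x, a - i) \<and> v = (x, a - Suc i)"
    then obtain i where "Suc i < Suc a - b" "u = (x, a - i)" "v = (x, a - Suc i)" by blast
    then show "\<exists>y. b \<le> y \<and> y < a \<and> u = (x, Suc y) \<and> v = (x, y)" by (intro exI[of _ "a - Suc i"]) auto
  next
    assume "\<exists>y. b \<le> y \<and> y < a \<and> u = (x, Suc y) \<and> v = (x, y)"
    then obtain y where "b \<le> y" "y < a" "u = (x, Suc y)" "v = (x, y)" by blast
    then show "\<exists>i. Suc i < Suc a - b \<and> u = (x, a - i) \<and> v = (x, a - Suc i)" by (intro exI[of _ "a - Suc y"]) auto
  qed
  finally show ?thesis using False by auto
qed

section \<open>The polygon of a pair of row sequences\<close>

context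
  fixes n :: nat and t b :: "nat \<Rightarrow> nat"
begin

text \<open>
  The upper path enters column \<open>x\<close> in row \<open>up_start x\<close> and leaves it in row \<open>up_end x\<close>; in the outer
  columns it runs along the whole extreme side, so the lower path is only concerned with the inner
  columns.
\<close>

definition up_start :: "nat \<Rightarrow> nat" where "up_start x = (if x = 1 then b 1 else t (x - 1))"

definition up_end :: "nat \<Rightarrow> nat" where "up_end x = (if x = n then b (n - 1) else t x)"

primrec up_path :: "nat \<Rightarrow> point list" where
  "up_path 0 = []"
| "up_path (Suc k) = up_path k @ seg (Suc k) (up_start (Suc k)) (up_end (Suc k))"

primrec low_path :: "nat \<Rightarrow> point list" where
  "low_path 0 = []"
| "low_path (Suc k) = (if k = 0 then [] else seg (Suc k) (b (Suc k)) (b k)) @ low_path k"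

definition row_walk :: "point list" where "row_walk = up_path n @ low_path (n - 1)"

lemma up_path_props:
  "1 \<le> k \<Longrightarrow> up_path k \<noteq> [] \<and> hd (up_path k) = (1, b 1) \<and> last (up_path k) = (k, up_end k) \<and> distinct (up_path k) \<and>
    set (up_path k) = {(x, y). 1 \<le> x \<and> x \<le> k \<and> min (up_start x) (up_end x) \<le> y \<and> y \<le> max (up_start x) (up_end x)} \<and>
    list_steps (up_path k) = {(u, v). (\<exists>x. 1 \<le> x \<and> x \<le> k \<and> (u, v) \<in> list_steps (seg x (up_start x) (up_end x))) \<or>
       (\<exists>x. 1 \<le> x \<and> x < k \<and> u = (x, up_end x) \<and> v = (Suc x, up_start (Suc x)))}"
proof (induction k)
  case (Suc k)
  let ?s = "seg (Suc k) (up_start (Suc k)) (up_end (Suc k))"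
  show ?case
  proof (cases "k = 0")
    case True
    have st: "up_start (Suc 0) = b 1" by (simp add: up_start_def)
    have up: "up_path (Suc k) = seg 1 (b 1) (up_end 1)" using True st by simp
    have set: "set (up_path (Suc k)) = {(x, y). 1 \<le> x \<and> x \<le> Suc k \<and> min (up_start x) (up_end x) \<le> y \<and>
        y \<le> max (up_start x) (up_end x)}"
      unfolding up seg_simps(5) using True st by (auto simp: le_Suc_eq)
    have steps: "list_steps (up_path (Suc k)) = {(u, v). (\<exists>x. 1 \<le> x \<and> x \<le> Suc k \<and> (u, v) \<in> list_steps (seg x (up_start
        x) (up_end x))) \<or>
       (\<exists>x. 1 \<le> x \<and> x < Suc k \<and> u = (x, up_end x) \<and> v = (Suc x, up_start (Suc x)))}"
    proof -
      have e: "(\<exists>x. 1 \<le> x \<and> x \<le> Suc k \<and> Q x) \<longleftrightarrow> Q 1" "(\<exists>x. 1 \<le> x \<and> x < Suc k \<and> Q x) \<longleftrightarrow> False" for Q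
        using True by (auto simp: le_Suc_eq)
      show ?thesis unfolding up e using st by auto
    qed
    have "up_path (Suc k) \<noteq> []" "hd (up_path (Suc k)) = (1, b 1)" "last (up_path (Suc k)) = (Suc k, up_end (Suc k))"
        "distinct (up_path (Suc k))"
      unfolding up using seg_simps(1-4)[of 1 "b 1" "up_end 1"] True by simp_all
    then show ?thesis using set steps by blast
  next
    case False
    then have IH: "up_path k \<noteq> []" "hd (up_path k) = (1, b 1)" "last (up_path k) = (k, up_end k)" "distinct (up_path k)"
      "set (up_path k) = {(x, y). 1 \<le> x \<and> x \<le> k \<and> min (up_start x) (up_end x) \<le> y \<and> y \<le> max (up_start x) (up_end x)}"
      "list_steps (up_path k) = {(u, v). (\<exists>x. 1 \<le> x \<and> x \<le> k \<and> (u, v) \<in> list_steps (seg x (up_start x) (up_end x))) \<or>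
         (\<exists>x. 1 \<le> x \<and> x < k \<and> u = (x, up_end x) \<and> v = (Suc x, up_start (Suc x)))}" using Suc.IH by auto
    have set: "set (up_path (Suc k)) = {(x, y). 1 \<le> x \<and> x \<le> Suc k \<and> min (up_start x) (up_end x) \<le> y \<and>
        y \<le> max (up_start x) (up_end x)}"
    proof -
      have "set (up_path (Suc k)) = set (up_path k) \<union> Pair (Suc k) ` {min (up_start (Suc k)) (up_end (Suc k))..max
          (up_start (Suc k)) (up_end (Suc k))}"
        by (simp add: seg_simps(5))
      also have "\<dots> = {(x, y). 1 \<le> x \<and> x \<le> Suc k \<and> min (up_start x) (up_end x) \<le> y \<and> y \<le> max (up_start x) (up_end x)}"
        unfolding IH(5) by (auto simp: le_Suc_eq)
      finally show ?thesis .
    qed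
    have dist: "distinct (up_path (Suc k))"
    proof -
      have "set (up_path k) \<inter> set ?s = {}" unfolding IH(5) seg_simps(5) by auto
      then show ?thesis using IH(4) seg_simps(4) by simp
    qed
    have steps: "list_steps (up_path (Suc k)) = {(u, v). (\<exists>x. 1 \<le> x \<and> x \<le> Suc k \<and> (u, v) \<in> list_steps (seg x (up_start
        x) (up_end x))) \<or>
       (\<exists>x. 1 \<le> x \<and> x < Suc k \<and> u = (x, up_end x) \<and> v = (Suc x, up_start (Suc x)))}"
    proof -
      have "list_steps (up_path (Suc k)) = list_steps (up_path k) \<union> {((k, up_end k), (Suc k, up_start (Suc k)))} \<union>
          list_steps ?s"
        using list_steps_append[OF seg_simps(1) IH(1)] IH(3) seg_simps(2) by simp
      moreover have "1 \<le> Suc k" "1 \<le> k" using False by auto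
      ultimately show ?thesis unfolding IH(6) by (simp only: ex_le_Suc ex_less_Suc_split) auto
    qed
    show ?thesis using set dist steps IH(1,2) seg_simps(1,3) by simp
  qed
qed simp

lemma low_path_props:
  "distinct (low_path k) \<and> set (low_path k) = {(x, y). 2 \<le> x \<and> x \<le> k \<and> min (b x) (b (x - 1)) \<le> y \<and>
      y \<le> max (b x) (b (x - 1))} \<and>
    list_steps (low_path k) = {(u, v). (\<exists>x. 2 \<le> x \<and> x \<le> k \<and> (u, v) \<in> list_steps (seg x (b x) (b (x - 1)))) \<or>
       (\<exists>x. 2 \<le> x \<and> x < k \<and> u = (Suc x, b x) \<and> v = (x, b x))} \<and>
    (if 2 \<le> k then low_path k \<noteq> [] \<and> hd (low_path k) = (k, b k) \<and> last (low_path k) = (2, b 1) else low_path k = [])"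
proof (induction k)
  case 0
  then show ?case by (auto simp: list_steps_def)
next
  case (Suc k)
  show ?case
  proof (cases "k = 0")
    case True
    then have "low_path (Suc k) = []" by simp
    then show ?thesis using True by (auto simp: list_steps_def)
  next
    case False
    let ?s = "seg (Suc k) (b (Suc k)) (b k)"
    have lp: "low_path (Suc k) = ?s @ low_path k" using False by simp
    have IH: "distinct (low_path k)"
      "set (low_path k) = {(x, y). 2 \<le> x \<and> x \<le> k \<and> min (b x) (b (x - 1)) \<le> y \<and> y \<le> max (b x) (b (x - 1))}"
      "list_steps (low_path k) = {(u, v). (\<exists>x. 2 \<le> x \<and> x \<le> k \<and> (u, v) \<in> list_steps (seg x (b x) (b (x - 1)))) \<or>
       (\<exists>x. 2 \<le> x \<and> x < k \<and> u = (Suc x, b x) \<and> v = (x, b x))}"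
      "if 2 \<le> k then low_path k \<noteq> [] \<and> hd (low_path k) = (k, b k) \<and> last (low_path k) = (2, b 1) else low_path k = []"
      using Suc.IH by auto
    have set: "set (low_path (Suc k)) = {(x, y). 2 \<le> x \<and> x \<le> Suc k \<and> min (b x) (b (x - 1)) \<le> y \<and>
        y \<le> max (b x) (b (x - 1))}"
    proof -
      have "set (low_path (Suc k)) = Pair (Suc k) ` {min (b (Suc k)) (b k)..max (b (Suc k)) (b k)} \<union> set (low_path k)"
        unfolding lp by (simp add: seg_simps(5))
      also have "\<dots> = {(x, y). 2 \<le> x \<and> x \<le> Suc k \<and> min (b x) (b (x - 1)) \<le> y \<and> y \<le> max (b x) (b (x - 1))}"
        unfolding IH(2) using False by (auto simp: le_Suc_eq)
      finally show ?thesis .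
    qed
    have dist: "distinct (low_path (Suc k))"
    proof -
      have "set ?s \<inter> set (low_path k) = {}" unfolding IH(2) seg_simps(5) by auto
      then show ?thesis unfolding lp using IH(1) seg_simps(4) by simp
    qed
    show ?thesis
    proof (cases "2 \<le> k")
      case True
      then have l: "low_path k \<noteq> []" "hd (low_path k) = (k, b k)" "last (low_path k) = (2, b 1)" using IH(4) by auto
      have "list_steps (low_path (Suc k)) = list_steps ?s \<union> {((Suc k, b k), (k, b k))} \<union> list_steps (low_path k)"
        unfolding lp using list_steps_append[OF l(1) seg_simps(1)] l(2) seg_simps(3) by simp
      moreover have "2 \<le> Suc k" using True by simp
      ultimately have steps: "list_steps (low_path (Suc k)) = {(u, v). (\<exists>x. 2 \<le> x \<and> x \<le> Suc k \<and>
          (u, v) \<in> list_steps (seg x (b x) (b (x - 1)))) \<or>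
       (\<exists>x. 2 \<le> x \<and> x < Suc k \<and> u = (Suc x, b x) \<and> v = (x, b x))}" unfolding IH(3) using True by (simp only: ex_le_Suc
           ex_less_Suc_split diff_Suc_1) auto
      show ?thesis using set dist steps l seg_simps(1,2)[of "Suc k" "b (Suc k)" "b k"] True unfolding lp by simp
    next
      case f: False
      then have k1: "k = 1" using False by simp
      then have lp': "low_path (Suc k) = seg 2 (b 2) (b 1)" using IH(4) lp by (simp add: numeral_2_eq_2)
      have e: "(\<exists>x. 2 \<le> x \<and> x \<le> Suc k \<and> Q x) \<longleftrightarrow> Q 2" "(\<exists>x. 2 \<le> x \<and> x < Suc k \<and> Q x) \<longleftrightarrow> False" for Q
        using k1 by (auto simp: le_Suc_eq numeral_2_eq_2)
      have "seg 2 (b 2) (b 1) = seg 2 (b 2) (b (2 - 1))" by simp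
      then have steps: "list_steps (low_path (Suc k)) = {(u, v). (\<exists>x. 2 \<le> x \<and> x \<le> Suc k \<and>
          (u, v) \<in> list_steps (seg x (b x) (b (x - 1)))) \<or>
       (\<exists>x. 2 \<le> x \<and> x < Suc k \<and> u = (Suc x, b x) \<and> v = (x, b x))}" unfolding lp' e by auto
      show ?thesis using set dist steps seg_simps(1-3)[of 2 "b 2" "b 1"] k1 lp' by (simp add: numeral_2_eq_2)
    qed
  qed
qed

end

context
  fixes n :: nat and t b :: "nat \<Rightarrow> nat"
  assumes n: "2 \<le> n" and lt: "\<And>k. 1 \<le> k \<Longrightarrow> k < n \<Longrightarrow> b k < t k"
    and dich: "\<And>k. 1 \<le> k \<Longrightarrow> Suc k < n \<Longrightarrow> (t k = t (Suc k)) \<noteq> (b k = b (Suc k))"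
    and rng: "\<And>k. 1 \<le> k \<Longrightarrow> k < n \<Longrightarrow> 1 \<le> b k \<and> t k \<le> n"
begin

lemma row_walk_set: "(x, y) \<in> set (row_walk n t b) \<longleftrightarrow>
    1 \<le> x \<and> x \<le> n \<and> min (up_start t b x) (up_end n t b x) \<le> y \<and> y \<le> max (up_start t b x) (up_end n t b x) \<or>
    2 \<le> x \<and> x < n \<and> min (b x) (b (x - 1)) \<le> y \<and> y \<le> max (b x) (b (x - 1))"
  using up_path_props[of n n t b] low_path_props[of b "n - 1"] n by (auto simp: row_walk_def)

lemma row_walk_ne: "row_walk n t b \<noteq> []" using up_path_props[of n n t b] n by (simp add: row_walk_def)

lemma row_walk_step: "walk_step (row_walk n t b) u v \<longleftrightarrow>
    (\<exists>x. 1 \<le> x \<and> x < n \<and> u = (x, t x) \<and> v = (Suc x, t x)) \<or> (\<exists>x. 1 \<le> x \<and> x < n \<and> u = (Suc x, b x) \<and> v = (x, b x)) \<or>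
    (\<exists>x. 1 \<le> x \<and> x \<le> n \<and> (u, v) \<in> list_steps (seg x (up_start t b x) (up_end n t b x))) \<or>
    (\<exists>x. 2 \<le> x \<and> x < n \<and> (u, v) \<in> list_steps (seg x (b x) (b (x - 1))))"
proof -
  have "1 \<le> n" using n by simp
  note U = up_path_props[OF this, of n t b] and L = low_path_props[of b "n - 1"]
  have E: "(\<exists>x. 1 \<le> x \<and> x < n \<and> u = (x, up_end n t b x) \<and> v = (Suc x, up_start t b (Suc x))) \<longleftrightarrow>
      (\<exists>x. 1 \<le> x \<and> x < n \<and> u = (x, t x) \<and> v = (Suc x, t x))"
  proof -
    have "up_end n t b x = t x" "up_start t b (Suc x) = t x" if "1 \<le> x" "x < n" for x using that
        by (auto simp: up_end_def up_start_def)
    then show ?thesis by auto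
  qed
  have ue: "up_end n t b n = b (n - 1)" by (simp add: up_end_def)
  show ?thesis
  proof (cases "n = 2")
    case True
    have lp: "low_path b (n - 1) = []" using L True by simp
    have W: "(\<exists>x. 1 \<le> x \<and> x < n \<and> u = (Suc x, b x) \<and> v = (x, b x)) \<longleftrightarrow> u = (2, b 1) \<and> v = (1, b 1)"
    proof -
      have "(\<exists>x. 1 \<le> x \<and> x < n \<and> Q x) \<longleftrightarrow> Q 1" for Q
      proof
        assume "\<exists>x. 1 \<le> x \<and> x < n \<and> Q x"
        then obtain x where "1 \<le> x" "x < n" "Q x" by blast
        moreover have "x = 1" using calculation True by simp
        ultimately show "Q 1" by simp
      qed (use True in \<open>auto intro!: exI[of _ 1]\<close>)
      moreover have "Suc 1 = 2" by simp
      ultimately show ?thesis by (simp only:)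
    qed
    have "\<not> (2 \<le> x \<and> x < n)" for x using True by auto
    moreover have "last (row_walk n t b) = (2, b 1)" "hd (row_walk n t b) = (1, b 1)"
        "list_steps (row_walk n t b) = list_steps (up_path n t b n)"
      using U ue True lp by (auto simp: row_walk_def)
    ultimately show ?thesis unfolding walk_step_list[OF row_walk_ne] W using U E by auto
  next
    case False
    then have n2: "2 \<le> n - 1" using n by simp
    then have l: "low_path b (n - 1) \<noteq> []" "hd (low_path b (n - 1)) = (n - 1, b (n - 1))"
        "last (low_path b (n - 1)) = (2, b 1)"
      using L by auto
    have ls: "list_steps (row_walk n t b) = list_steps (up_path n t b n) \<union> {((n, b (n - 1)), (n - 1, b (n - 1)))} \<union>
        list_steps (low_path b (n - 1))"
      unfolding row_walk_def using list_steps_append[OF l(1), of "up_path n t b n"] U ue l(2) by simp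
    have W: "(\<exists>x. 1 \<le> x \<and> x < n \<and> u = (Suc x, b x) \<and> v = (x, b x)) \<longleftrightarrow>
      (\<exists>x. 2 \<le> x \<and> x < n - 1 \<and> u = (Suc x, b x) \<and> v = (x, b x)) \<or> u = (n, b (n - 1)) \<and> v = (n - 1, b (n - 1)) \<or> u = (2,
          b 1) \<and> v = (1, b 1)"
    proof -
      have "1 \<le> x \<and> x < n \<longleftrightarrow> 2 \<le> x \<and> x < n - 1 \<or> x = n - 1 \<or> x = 1" for x using n2 by auto
      then have "(\<exists>x. 1 \<le> x \<and> x < n \<and> Q x) \<longleftrightarrow> (\<exists>x. 2 \<le> x \<and> x < n - 1 \<and> Q x) \<or> Q (n - 1) \<or> Q 1" for Q by blast
      moreover have "Suc (n - 1) = n" "Suc 1 = 2" using n by auto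
      ultimately show ?thesis by (simp only:)
    qed
    have c: "2 \<le> x \<and> x \<le> n - 1 \<longleftrightarrow> 2 \<le> x \<and> x < n" for x using n by auto
    have "last (row_walk n t b) = (2, b 1)" "hd (row_walk n t b) = (1, b 1)" using U l by (auto simp: row_walk_def)
    then have "walk_step (row_walk n t b) u v \<longleftrightarrow> (u, v) \<in> list_steps (up_path n t b n) \<or> u = (n, b (n - 1)) \<and>
        v = (n - 1, b (n - 1)) \<or>
        (u, v) \<in> list_steps (low_path b (n - 1)) \<or> u = (2, b 1) \<and> v = (1, b 1)"
      unfolding walk_step_list[OF row_walk_ne] ls by auto
    moreover have "(u, v) \<in> list_steps (up_path n t b n) \<longleftrightarrow> (\<exists>x. 1 \<le> x \<and> x \<le> n \<and> (u, v) \<in> list_steps (seg x (up_start t b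
        x) (up_end n t b x))) \<or>
       (\<exists>x. 1 \<le> x \<and> x < n \<and> u = (x, t x) \<and> v = (Suc x, t x))" using U E by auto
    moreover have "(u, v) \<in> list_steps (low_path b (n - 1)) \<longleftrightarrow> (\<exists>x. 2 \<le> x \<and> x < n \<and> (u, v) \<in> list_steps (seg x (b x) (b
        (x - 1)))) \<or>
       (\<exists>x. 2 \<le> x \<and> x < n - 1 \<and> u = (Suc x, b x) \<and> v = (x, b x))" using L c by auto
    ultimately show ?thesis unfolding W by blast
  qed
qed

text \<open>
  Only one of the two rows changes, so the vertical segments of the two paths are as disjoint as the
  rows over the two adjacent cuts.
\<close>

lemma row_walk_disjoint:
  assumes "2 \<le> x" "x < n" "min (up_start t b x) (up_end n t b x) \<le> y" "min (b x) (b (x - 1)) \<le> y"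
      "y \<le> max (b x) (b (x - 1))"
  shows False
proof -
  obtain k where k: "x = Suc k" "1 \<le> k" using assms by (cases x) auto
  have u: "up_start t b x = t k" "up_end n t b x = t (Suc k)" using k assms by (auto simp: up_start_def up_end_def)
  have "b k < t k" "b (Suc k) < t (Suc k)" using lt k assms by auto
  then show False using dich[of k] assms u k by (auto simp: min_def max_def split: if_splits)
qed

lemma row_walk_saw: "closed_saw (row_walk n t b)"
proof -
  have "1 \<le> n" using n by simp
  note U = up_path_props[OF this, of n t b] and L = low_path_props[of b "n - 1"]
  have d: "distinct (row_walk n t b)"
  proof -
    have "set (up_path n t b n) \<inter> set (low_path b (n - 1)) = {}"
    proof (rule ccontr)
      assume "\<not> ?thesis"
      then obtain x y where m: "(x, y) \<in> set (up_path n t b n)" "(x, y) \<in> set (low_path b (n - 1))" by auto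
      have "2 \<le> x" "x \<le> n - 1" "min (b x) (b (x - 1)) \<le> y" "y \<le> max (b x) (b (x - 1))" using m(2) L by auto
      moreover have "min (up_start t b x) (up_end n t b x) \<le> y" using m(1) U by auto
      ultimately show False using row_walk_disjoint[of x y] n by linarith
    qed
    then show ?thesis unfolding row_walk_def using U L by simp
  qed
  have b1: "b 1 < t 1" using lt n by simp
  have "walk_step (row_walk n t b) (1, t 1) (Suc 1, t 1)" unfolding row_walk_step using n by fastforce
  have m: "(1, b 1) \<in> set (row_walk n t b)" "(1, t 1) \<in> set (row_walk n t b)" "(2, t 1) \<in> set (row_walk n t b)"
    unfolding row_walk_set using n by (auto simp: up_start_def up_end_def)
  have "card {(1, b 1), (1, t 1), (2::nat, t 1)} = 3" using b1 by simp
  moreover have "card {(1, b 1), (1, t 1), (2::nat, t 1)} \<le> card (set (row_walk n t b))"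
      by (rule card_mono) (use m in auto)
  ultimately have len: "2 < length (row_walk n t b)" using card_length[of "row_walk n t b"] by linarith
  have "adjacent u v" if "walk_step (row_walk n t b) u v" for u v
    using that unfolding row_walk_step seg_steps by (auto simp: adjacent_def)
  then show ?thesis unfolding closed_saw_step using d len by blast
qed

definition row_poly :: polygon where "row_poly = walk_edges (row_walk n t b)"

lemma row_poly_hor: "k \<in> hor_edges row_poly y \<longleftrightarrow> 1 \<le> k \<and> k < n \<and> (y = t k \<or> y = b k)"
  unfolding row_poly_def hor_edges_def mem_Collect_eq step_edge[OF row_walk_saw] row_walk_step seg_steps by auto

lemma row_poly_vert: "y \<in> vert_edges row_poly x \<longleftrightarrow>
    1 \<le> x \<and> x \<le> n \<and> min (up_start t b x) (up_end n t b x) \<le> y \<and> y < max (up_start t b x) (up_end n t b x) \<or>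
    2 \<le> x \<and> x < n \<and> min (b x) (b (x - 1)) \<le> y \<and> y < max (b x) (b (x - 1))"
  unfolding row_poly_def vert_edges_def mem_Collect_eq step_edge[OF row_walk_saw] row_walk_step seg_steps
  by (auto simp: min_def max_def)

lemma row_poly_vert_interval: assumes "1 \<le> x" "x \<le> n" shows "\<exists>lo hi. lo < hi \<and> vert_edges row_poly x = {lo..<hi}"
proof -
  have int: "\<exists>lo hi. lo < hi \<and> vert_edges row_poly x = {lo..<hi}"
      if "p \<noteq> q" "\<And>y. y \<in> vert_edges row_poly x \<longleftrightarrow> min p q \<le> y \<and> y < max p q" for p q :: nat
  proof -
    have "vert_edges row_poly x = {min p q..<max p q}" by (intro set_eqI) (simp only: that(2) atLeastLessThan_iff)
    moreover have "min p q < max p q" using that(1) by (simp add: min_def max_def)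
    ultimately show ?thesis by blast
  qed
  show ?thesis
  proof (cases "x = 1 \<or> x = n")
    case True
    have "1 \<le> n - 1" "n - 1 < n" "b 1 < t 1" using n lt[of 1] by auto
    then have "up_start t b x \<noteq> up_end n t b x" using True n lt[of "n - 1"] by (auto simp: up_start_def up_end_def)
    then show ?thesis by (rule int) (use row_poly_vert True assms in auto)
  next
    case False
    then obtain k where k: "x = Suc k" "1 \<le> k" "Suc k < n" using assms by (cases x) auto
    have u: "up_start t b x = t k" "up_end n t b x = t (Suc k)" using k by (auto simp: up_start_def up_end_def)
    show ?thesis
    proof (cases "t k = t (Suc k)")
      case True
      then have "b (Suc k) \<noteq> b k" using dich[OF k(2,3)] by auto
      then show ?thesis by (rule int) (use row_poly_vert u k True in auto)
    next
      case False
      then have "b k = b (Suc k)" using dich[OF k(2,3)] by auto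
      show ?thesis by (rule int[OF False]) (use row_poly_vert u k \<open>b k = b (Suc k)\<close> in auto)
    qed
  qed
qed

lemma row_poly_vertex_bounds:
  assumes "(x, y) \<in> \<Union> row_poly"
  shows "1 \<le> x \<and> x \<le> n \<and> (\<exists>j. (j = x \<or> Suc j = x) \<and> 1 \<le> j \<and> j < n \<and> y \<le> t j) \<and> (\<exists>j. (j = x \<or> Suc j = x) \<and> 1 \<le> j \<and>
      j < n \<and> b j \<le> y)"
proof -
  have m: "(x, y) \<in> set (row_walk n t b)" using assms walk_vertices[OF row_walk_saw] by (simp add: row_poly_def)
  then have xr: "1 \<le> x" "x \<le> n" using n unfolding row_walk_set by auto
  consider "x = 1" | "x = n" "x \<noteq> 1" | k where "x = Suc k" "1 \<le> k" "Suc k < n" using xr by (cases x) force+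
  then show ?thesis
  proof cases
    case 1
    then have "b 1 \<le> y \<and> y \<le> t 1" using m lt[of 1] n unfolding row_walk_set by (auto simp: up_start_def up_end_def)
    then show ?thesis using 1 n by (intro conjI exI[of _ 1]) auto
  next
    case 2
    have n1: "1 \<le> n - 1" "n - 1 < n" using n by auto
    have "b (n - 1) \<le> y \<and> y \<le> t (n - 1)" using 2 m lt[OF n1] n unfolding row_walk_set
        by (auto simp: up_start_def up_end_def)
    then show ?thesis using 2 n1 by (intro conjI exI[of _ "n - 1"]) auto
  next
    case 3
    have u: "up_start t b x = t k" "up_end n t b x = t (Suc k)" using 3 by (auto simp: up_start_def up_end_def)
    have l: "b k < t k" "b (Suc k) < t (Suc k)" using lt 3 by auto
    have "(y \<le> t k \<or> y \<le> t (Suc k)) \<and> (b k \<le> y \<or> b (Suc k) \<le> y)"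
    proof -
      have "min (t k) (t (Suc k)) \<le> y \<and> y \<le> max (t k) (t (Suc k)) \<or> min (b (Suc k)) (b k) \<le> y \<and>
          y \<le> max (b (Suc k)) (b k)"
        using m unfolding row_walk_set u unfolding 3(1) diff_Suc_1 by blast
      then show ?thesis using l unfolding min_le_iff_disj le_max_iff_disj by linarith
    qed
    then have "\<exists>j. (j = x \<or> Suc j = x) \<and> 1 \<le> j \<and> j < n \<and> y \<le> t j" "\<exists>j. (j = x \<or> Suc j = x) \<and> 1 \<le> j \<and> j < n \<and> b j \<le> y"
      using 3 by (metis Suc_lessD le_SucI)+
    then show ?thesis using xr by blast
  qed
qed

end

section \<open>The permutomino of a colored square permutation\<close>

text \<open>If all earlier values exceed all later ones, then by counting they are the largest values.\<close>

lemma block_of_separated: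
  assumes perm: "\<sigma> permutes {1..n}" and k: "1 \<le> k" "k < n"
    and sep: "\<And>z z'. 1 \<le> z \<Longrightarrow> z \<le> k \<Longrightarrow> k < z' \<Longrightarrow> z' \<le> n \<Longrightarrow> \<sigma> z' < \<sigma> z"
  shows "co_decomposable n \<sigma>"
proof -
  have inj: "inj_on \<sigma> S" for S using permutes_inj[OF perm] by (auto intro: inj_onI dest: injD)
  have sub: "\<sigma> ` {1..k} \<subseteq> {n - k + 1..n}"
  proof
    fix y assume "y \<in> \<sigma> ` {1..k}"
    then obtain z where z: "1 \<le> z" "z \<le> k" "y = \<sigma> z" by auto
    have "\<sigma> ` {k + 1..n} \<subseteq> {1..\<sigma> z - 1}"
    proof
      fix y' assume "y' \<in> \<sigma> ` {k + 1..n}"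
      then obtain z' where z': "k + 1 \<le> z'" "z' \<le> n" "y' = \<sigma> z'" by auto
      then show "y' \<in> {1..\<sigma> z - 1}" using sep[of z z'] perm_range[OF perm, of z'] z k by auto
    qed
    from card_mono[OF _ this] have "n - k \<le> \<sigma> z - 1" by (simp add: card_image[OF inj])
    then show "y \<in> {n - k + 1..n}" using z perm_range[OF perm, of z] k by auto
  qed
  have "\<sigma> ` {1..k} = {n - k + 1..n}"
    by (rule card_subset_eq[OF _ sub]) (use k in \<open>auto simp: card_image[OF inj]\<close>)
  moreover have "k \<in> {1..n - 1}" using k by auto
  ultimately show ?thesis unfolding co_decomposable_def by blast
qed

lemma convex_set_interval:
  assumes "finite (S::nat set)" "S \<noteq> {}" "\<And>a b z. a \<in> S \<Longrightarrow> b \<in> S \<Longrightarrow> a \<le> z \<Longrightarrow> z \<le> b \<Longrightarrow> z \<in> S"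
  shows "\<exists>p q. p < q \<and> S = {p..<q}"
proof -
  have "Min S \<in> S" "Max S \<in> S" using assms(1,2) by auto
  have "S = {Min S..<Suc (Max S)}"
  proof (intro equalityI subsetI)
    fix z assume "z \<in> S"
    then show "z \<in> {Min S..<Suc (Max S)}" using assms(1) by (simp add: less_Suc_eq_le)
  next
    fix z assume "z \<in> {Min S..<Suc (Max S)}"
    then show "z \<in> S" using assms(3)[OF \<open>Min S \<in> S\<close> \<open>Max S \<in> S\<close>] by (simp add: less_Suc_eq_le)
  qed
  moreover have "Min S < Suc (Max S)" using assms(1) \<open>Min S \<in> S\<close> by (simp add: less_Suc_eq_le)
  ultimately show ?thesis by blast
qed

context
  fixes n :: nat and \<sigma> :: "nat \<Rightarrow> nat" and C :: "point set"
  assumes csq: "(\<sigma>, C) \<in> colored_square_perms n" and n: "2 \<le> n" and co: "\<not> co_decomposable n \<sigma>"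
begin

text \<open>
  The last column belongs to the upper and the first column to the lower path as far as black points
  are concerned. The top row over the cut behind column \<open>k\<close> ends in the column \<open>next_upper k\<close>, the
  bottom row starts in the column \<open>last_lower k\<close>.
\<close>

definition next_upper :: "nat \<Rightarrow> nat" where
  "next_upper k = (LEAST x. k < x \<and> (on_upper n \<sigma> C x \<or> x = n))"

definition last_lower :: "nat \<Rightarrow> nat" where
  "last_lower k = Max {x. 1 \<le> x \<and> x \<le> k \<and> \<not> on_upper n \<sigma> C x}"

lemma s_perm: "\<sigma> permutes {1..n}" by (rule csq_perm[OF csq n])

lemma s_inj: "\<sigma> x = \<sigma> y \<Longrightarrow> x = y" by (rule perm_inj[OF s_perm])

lemma s_eq: "\<sigma> x = \<sigma> y \<longleftrightarrow> x = y" using s_inj by blast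

lemma s_range: "1 \<le> x \<Longrightarrow> x \<le> n \<Longrightarrow> 1 \<le> \<sigma> x \<and> \<sigma> x \<le> n" by (rule perm_range[OF s_perm])

lemma next_upper_props:
  assumes "k < n"
  shows "k < next_upper k" "next_upper k \<le> n" "on_upper n \<sigma> C (next_upper k) \<or> next_upper k = n"
    "\<And>z. k < z \<Longrightarrow> z < next_upper k \<Longrightarrow> \<not> on_upper n \<sigma> C z"
proof -
  let ?Q = "\<lambda>x. k < x \<and> (on_upper n \<sigma> C x \<or> x = n)"
  have Q: "?Q n" using assms by simp
  show "k < next_upper k" "on_upper n \<sigma> C (next_upper k) \<or> next_upper k = n"
    using LeastI[of ?Q, OF Q] by (auto simp: next_upper_def)
  show "next_upper k \<le> n" unfolding next_upper_def by (rule Least_le[of ?Q, OF Q])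
  show "\<And>z. k < z \<Longrightarrow> z < next_upper k \<Longrightarrow> \<not> on_upper n \<sigma> C z"
    unfolding next_upper_def using not_less_Least[of _ ?Q] by blast
qed

lemma next_upper_eqI:
  assumes "k < x" "on_upper n \<sigma> C x \<or> x = n" "\<And>z. k < z \<Longrightarrow> z < x \<Longrightarrow> \<not> on_upper n \<sigma> C z" "x \<le> n"
  shows "next_upper k = x"
  unfolding next_upper_def
proof (rule Least_equality)
  fix y assume "k < y \<and> (on_upper n \<sigma> C y \<or> y = n)"
  then show "x \<le> y" using assms(3)[of y] assms(4) by (cases "y < x") auto
qed (use assms in blast)

lemma not_upper_1: "\<not> on_upper n \<sigma> C 1" "\<not> on_upper n \<sigma> C n" by (auto simp: on_upper_def)

lemma last_lower_props:
  assumes "1 \<le> k"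
  shows "1 \<le> last_lower k" "last_lower k \<le> k" "\<not> on_upper n \<sigma> C (last_lower k)"
    "\<And>z. last_lower k < z \<Longrightarrow> z \<le> k \<Longrightarrow> on_upper n \<sigma> C z"
proof -
  let ?S = "{x. 1 \<le> x \<and> x \<le> k \<and> \<not> on_upper n \<sigma> C x}"
  have f: "finite ?S" by simp
  have "1 \<in> ?S" using assms not_upper_1 by simp
  then have "Max ?S \<in> ?S" by (intro Max_in[OF f]) blast
  then show "1 \<le> last_lower k" "last_lower k \<le> k" "\<not> on_upper n \<sigma> C (last_lower k)" by (auto simp: last_lower_def)
  fix z assume z: "last_lower k < z" "z \<le> k"
  show "on_upper n \<sigma> C z"
  proof (rule ccontr)
    assume "\<not> on_upper n \<sigma> C z"
    then have "z \<in> ?S" using z by simp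
    then have "z \<le> last_lower k" unfolding last_lower_def by (rule Max_ge[OF f])
    then show False using z by simp
  qed
qed

lemma last_lower_eqI:
  assumes "1 \<le> x" "x \<le> k" "\<not> on_upper n \<sigma> C x" "\<And>z. x < z \<Longrightarrow> z \<le> k \<Longrightarrow> on_upper n \<sigma> C z"
  shows "last_lower k = x"
  unfolding last_lower_def by (rule Max_eqI) (use assms in \<open>auto intro: finite_subset[of _
      "{..k}"] simp: not_less[symmetric]\<close>)

definition top_seq :: "nat \<Rightarrow> nat" where "top_seq k = \<sigma> (next_upper k)"

definition bot_seq :: "nat \<Rightarrow> nat" where "bot_seq k = \<sigma> (last_lower k)"

lemma upper_rec: assumes "on_upper n \<sigma> C x \<or> x = n" shows "ulr \<sigma> x \<or> urr n \<sigma> x"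
  using assms csq_free[OF csq n, of x "\<sigma> x"] urr_n by (auto simp: on_upper_def split: if_splits)

lemma lower_rec: assumes "1 \<le> x" "x < n" "\<not> on_upper n \<sigma> C x" shows "blr \<sigma> x \<or> brr n \<sigma> x"
proof (cases "x = 1")
  case True then show ?thesis using ulr_1 by simp
next
  case False
  then show ?thesis using assms csq_free[OF csq n, of x "\<sigma> x"] csq_ext[OF csq n, of x]
      by (auto simp: on_upper_def split: if_splits)
qed

text \<open>
  Suppose that the point \<open>(x', \<sigma> x')\<close> of the last lower column before the cut is above the point
  \<open>(x, \<sigma> x)\<close> of the next upper column. Then it can only be a BL record and the latter only a UR
  record. Columns strictly between \<open>x'\<close> and the cut are upper and those strictly between the cut and
  \<open>x\<close> are lower, and it follows that all points before the cut are above all points behind it,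
  contrary to co-indecomposability.
\<close>

lemma bot_less_top: assumes k: "1 \<le> k" "k < n" shows "bot_seq k < top_seq k"
proof (rule ccontr)
  define x where "x = next_upper k"
  define x' where "x' = last_lower k"
  have x: "k < x" "x \<le> n" "on_upper n \<sigma> C x \<or> x = n" "\<And>z. k < z \<Longrightarrow> z < x \<Longrightarrow> \<not> on_upper n \<sigma> C z"
    using next_upper_props[OF k(2)] by (auto simp: x_def)
  have x': "1 \<le> x'" "x' \<le> k" "\<not> on_upper n \<sigma> C x'" "\<And>z. x' < z \<Longrightarrow> z \<le> k \<Longrightarrow> on_upper n \<sigma> C z"
    using last_lower_props[OF k(1)] by (auto simp: x'_def)
  assume "\<not> bot_seq k < top_seq k"
  then have le: "\<sigma> x \<le> \<sigma> x'" by (simp add: bot_seq_def top_seq_def x_def x'_def)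
  have lt: "\<sigma> x < \<sigma> x'" using le s_inj[of x x'] x x' by (cases "\<sigma> x = \<sigma> x'") auto
  have UR: "urr n \<sigma> x" using upper_rec[OF x(3)] lt x x' unfolding ulr_def by (metis le_less_trans less_asym)
  have BL: "blr \<sigma> x'" using lower_rec[of x'] lt x x' k unfolding brr_def by (metis le_less_trans less_asym)
  have zu: "\<sigma> x < \<sigma> z \<and> (ulr \<sigma> z \<or> urr n \<sigma> z)" if z: "x' < z" "z \<le> k" for z
  proof -
    have u: "ulr \<sigma> z \<or> urr n \<sigma> z" using upper_rec[of z] x'(4)[OF z] by blast
    have "\<sigma> x \<noteq> \<sigma> z" using s_inj[of x z] x z by auto
    moreover have "\<not> \<sigma> z < \<sigma> x"
    proof
      assume a: "\<sigma> z < \<sigma> x"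
      then have "\<not> urr n \<sigma> z" using x z unfolding urr_def by (metis le_less_trans less_asym)
      then have "\<sigma> x' < \<sigma> z" using u x' z unfolding ulr_def by blast
      then show False using a lt by simp
    qed
    ultimately show ?thesis using u by simp
  qed
  have zl: "\<sigma> z' < \<sigma> x'" if z: "k < z'" "z' < x" for z'
  proof -
    have l: "blr \<sigma> z' \<or> brr n \<sigma> z'" using lower_rec[of z'] x(4)[OF z] z x k by auto
    have "\<sigma> x' \<noteq> \<sigma> z'" using s_inj[of x' z'] x' z by auto
    moreover have "\<not> \<sigma> x' < \<sigma> z'"
    proof
      assume a: "\<sigma> x' < \<sigma> z'"
      then have "\<not> blr \<sigma> z'" using x' z unfolding blr_def by (metis le_less_trans less_asym)
      then have "\<sigma> z' < \<sigma> x" using l x z unfolding brr_def by blast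
      then show False using a lt by simp
    qed
    ultimately show ?thesis by simp
  qed
  have "co_decomposable n \<sigma>"
  proof (rule block_of_separated[OF s_perm k])
    fix z z' assume z: "1 \<le> z" "z \<le> k" "k < z'" "z' \<le> n"
    have l: "\<sigma> x' \<le> \<sigma> z" if "z \<le> x'" using BL that z by (cases "z = x'") (auto simp: blr_def intro: less_imp_le)
    have r: "\<sigma> z' \<le> \<sigma> x" if "x \<le> z'" using UR that z by (cases "z' = x") (auto simp: urr_def intro: less_imp_le)
    show "\<sigma> z' < \<sigma> z"
    proof (cases "z \<le> x'"; cases "x \<le> z'")
      assume "z \<le> x'" "x \<le> z'" then show ?thesis using l r lt by simp
    next
      assume "z \<le> x'" "\<not> x \<le> z'" then show ?thesis using l zl[of z'] z by simp
    next
      assume "\<not> z \<le> x'" "x \<le> z'" then show ?thesis using r zu[of z] z by simp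
    next
      assume a: "\<not> z \<le> x'" "\<not> x \<le> z'"
      have u: "ulr \<sigma> z \<or> urr n \<sigma> z" using zu[of z] a z by simp
      have "\<sigma> z \<noteq> \<sigma> z'" using s_inj[of z z'] z by auto
      moreover have "\<not> \<sigma> z < \<sigma> z'"
      proof
        assume b: "\<sigma> z < \<sigma> z'"
        then have "\<not> urr n \<sigma> z" using z unfolding urr_def by (metis le_less_trans less_asym)
        then have "\<sigma> x' < \<sigma> z" using u x' a unfolding ulr_def by (meson not_le)
        then show False using b zl[of z'] a z by simp
      qed
      ultimately show ?thesis by simp
    qed
  qed
  then show False using co by simp
qed

lemma next_upper_last: "next_upper (n - 1) = n"
  by (rule next_upper_eqI) (use n in auto)

lemma last_lower_first: "last_lower 1 = 1"
  by (rule last_lower_eqI) (use not_upper_1 in auto)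

lemma upper_col: assumes "1 \<le> k" "Suc k < n" "on_upper n \<sigma> C (Suc k)"
  shows "next_upper k = Suc k" "last_lower (Suc k) = last_lower k" "top_seq k \<noteq> top_seq (Suc k)"
      "bot_seq (Suc k) = bot_seq k"
proof -
  show nu: "next_upper k = Suc k" by (rule next_upper_eqI) (use assms in auto)
  show ll: "last_lower (Suc k) = last_lower k"
  proof (rule last_lower_eqI)
    fix z assume "last_lower k < z" "z \<le> Suc k"
    then show "on_upper n \<sigma> C z" using last_lower_props(4)[OF assms(1), of z] assms(3) by (cases "z = Suc k") auto
  qed (use last_lower_props[OF assms(1)] in auto)
  show "top_seq k \<noteq> top_seq (Suc k)"
    unfolding top_seq_def nu using next_upper_props(1)[OF assms(2)] s_inj by fastforce
  show "bot_seq (Suc k) = bot_seq k" by (simp add: bot_seq_def ll)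
qed

lemma lower_col: assumes "1 \<le> k" "Suc k < n" "\<not> on_upper n \<sigma> C (Suc k)"
  shows "next_upper k = next_upper (Suc k)" "last_lower (Suc k) = Suc k" "top_seq k = top_seq (Suc k)"
      "bot_seq (Suc k) \<noteq> bot_seq k"
proof -
  note p = next_upper_props[OF assms(2)]
  show nu: "next_upper k = next_upper (Suc k)"
  proof (rule next_upper_eqI)
    fix z assume "k < z" "z < next_upper (Suc k)"
    then show "\<not> on_upper n \<sigma> C z" using p(4)[of z] assms(3) by (cases "z = Suc k") auto
  qed (use p in auto)
  show ll: "last_lower (Suc k) = Suc k" by (rule last_lower_eqI) (use assms in auto)
  show "top_seq k = top_seq (Suc k)" by (simp add: top_seq_def nu)
  show "bot_seq (Suc k) \<noteq> bot_seq k"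
    unfolding bot_seq_def ll using last_lower_props(2)[OF assms(1)] s_inj by fastforce
qed

lemma seq_dichotomy: assumes "1 \<le> k" "Suc k < n"
  shows "(top_seq k = top_seq (Suc k)) \<noteq> (bot_seq k = bot_seq (Suc k))"
  using upper_col[OF assms] lower_col[OF assms] by (cases "on_upper n \<sigma> C (Suc k)") auto

lemma seq_range: assumes "1 \<le> k" "k < n" shows "1 \<le> bot_seq k \<and> top_seq k \<le> n"
  using last_lower_props[OF assms(1)] next_upper_props[OF assms(2)] s_range[of "last_lower k"] s_range[of
      "next_upper k"] assms
  by (auto simp: bot_seq_def top_seq_def)

lemma black_row_seq: assumes "1 \<le> x" "x \<le> n" shows "black_row n top_seq bot_seq x = \<sigma> x"
proof -
  consider "x = 1" | "x = n" "x \<noteq> 1" | k where "x = Suc k" "1 \<le> k" "Suc k < n" using assms by (cases x) force+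
  then show ?thesis
  proof cases
    case 1 then show ?thesis using last_lower_first by (simp add: black_row_def bot_seq_def)
  next
    case 2 then show ?thesis using next_upper_last by (simp add: black_row_def top_seq_def)
  next
    case 3
    then show ?thesis using upper_col[OF 3(2,3)] lower_col[OF 3(2,3)]
      by (cases "on_upper n \<sigma> C (Suc k)") (auto simp: black_row_def top_seq_def bot_seq_def)
  qed
qed

abbreviation (input) the_poly :: polygon where "the_poly \<equiv> row_poly n top_seq bot_seq"

lemma poly_hor: "k \<in> hor_edges the_poly y \<longleftrightarrow> 1 \<le> k \<and> k < n \<and> (y = top_seq k \<or> y = bot_seq k)"
  by (rule row_poly_hor) (fact n bot_less_top seq_dichotomy seq_range)+

lemma poly_vert_interval:
  assumes "1 \<le> x" "x \<le> n"
  shows "\<exists>lo hi. lo < hi \<and> vert_edges the_poly x = {lo..<hi}"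
  by (rule row_poly_vert_interval) (fact n bot_less_top seq_dichotomy seq_range assms)+

lemma poly_bounds:
  assumes "(x, y) \<in> \<Union> the_poly"
  shows "1 \<le> x" "x \<le> n" "\<exists>j. (j = x \<or> Suc j = x) \<and> 1 \<le> j \<and> j < n \<and> y \<le> top_seq j"
    "\<exists>j. (j = x \<or> Suc j = x) \<and> 1 \<le> j \<and> j < n \<and> bot_seq j \<le> y"
proof -
  have "1 \<le> x \<and> x \<le> n \<and> (\<exists>j. (j = x \<or> Suc j = x) \<and> 1 \<le> j \<and> j < n \<and> y \<le> top_seq j) \<and>
      (\<exists>j. (j = x \<or> Suc j = x) \<and> 1 \<le> j \<and> j < n \<and> bot_seq j \<le> y)"
    by (rule row_poly_vertex_bounds) (fact n bot_less_top seq_dichotomy seq_range assms)+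
  then show "1 \<le> x" "x \<le> n" "\<exists>j. (j = x \<or> Suc j = x) \<and> 1 \<le> j \<and> j < n \<and> y \<le> top_seq j"
    "\<exists>j. (j = x \<or> Suc j = x) \<and> 1 \<le> j \<and> j < n \<and> bot_seq j \<le> y" by auto
qed

lemma poly_saw: "closed_saw (row_walk n top_seq bot_seq)"
  by (rule row_walk_saw) (fact n bot_less_top seq_dichotomy seq_range)+

lemma poly_walk: "walk_edges (row_walk n top_seq bot_seq) = the_poly"
  by (rule row_poly_def[symmetric]) (fact n bot_less_top seq_dichotomy seq_range)+

lemma poly_vertices: "(x, y) \<in> set (row_walk n top_seq bot_seq) \<longleftrightarrow>
    1 \<le> x \<and> x \<le> n \<and> min (up_start top_seq bot_seq x) (up_end n top_seq bot_seq x) \<le> y \<and>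
      y \<le> max (up_start top_seq bot_seq x) (up_end n top_seq bot_seq x) \<or>
    2 \<le> x \<and> x < n \<and> min (bot_seq x) (bot_seq (x - 1)) \<le> y \<and> y \<le> max (bot_seq x) (bot_seq (x - 1))"
  by (rule row_walk_set) (fact n bot_less_top seq_dichotomy seq_range)+

text \<open>
  The row of the point in column \<open>x\<close> is used over the cuts between the last preceding upper column
  (or column \<open>1\<close>) and \<open>x\<close> if \<open>x\<close> is upper, and over those from \<open>x\<close> to the next lower column (or
  column \<open>n\<close>) if it is lower.
\<close>

lemma poly_hor_interval: assumes y: "1 \<le> y" "y \<le> n" shows "\<exists>p q. p < q \<and> hor_edges the_poly y = {p..<q}"
proof (rule convex_set_interval)
  obtain x where x: "1 \<le> x" "x \<le> n" "\<sigma> x = y" using perm_ex[OF s_perm y] by blast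
  have H: "k \<in> hor_edges the_poly y \<longleftrightarrow> 1 \<le> k \<and> k < n \<and> (next_upper k = x \<or> last_lower k = x)" for k
    unfolding poly_hor top_seq_def bot_seq_def x(3)[symmetric] s_eq by auto
  show "finite (hor_edges the_poly y)" by (rule finite_subset[of _ "{1..<n}"]) (auto simp: H)
  show "hor_edges the_poly y \<noteq> {}"
  proof (cases "on_upper n \<sigma> C x \<or> x = n")
    case True
    then have "1 < x" using n by (auto simp: on_upper_def)
    then have "next_upper (x - 1) = x" "1 \<le> x - 1" "x - 1 < n" using True x by (auto intro!: next_upper_eqI)
    then show ?thesis using H by blast
  next
    case False
    then have "last_lower x = x" "x < n" using x by (auto intro!: last_lower_eqI)
    then show ?thesis using H x by blast
  qed
  fix a b z assume a: "a \<in> hor_edges the_poly y" and b: "b \<in> hor_edges the_poly y" and z: "a \<le> z" "z \<le> b"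
  note ab = a[unfolded H] b[unfolded H]
  have zn: "1 \<le> z" "z < n" using ab z by auto
  show "z \<in> hor_edges the_poly y"
  proof (cases "on_upper n \<sigma> C x \<or> x = n")
    case True
    then have nl: "last_lower k \<noteq> x" if "1 \<le> k" "k < n" for k using last_lower_props[OF that(1)] that by auto
    then have na: "next_upper a = x" "next_upper b = x" using ab by auto
    have "z < x" using next_upper_props(1)[of b] na ab z by simp
    then have "next_upper z = x" using True x next_upper_props(4)[of a] na ab z by (intro next_upper_eqI) auto
    then show ?thesis using H zn by simp
  next
    case False
    then have "next_upper k \<noteq> x" if "k < n" for k using next_upper_props(3)[OF that] by auto
    then have na: "last_lower a = x" "last_lower b = x" using ab by auto
    have "x \<le> z" using last_lower_props(2)[of a] na ab z by simp
    then have "last_lower z = x" using False x last_lower_props(4)[of b] na ab z by (intro last_lower_eqI) auto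
    then show ?thesis using H zn by simp
  qed
qed

lemma poly_permutomino: "permutomino n the_poly"
proof -
  have "is_polygon the_poly" unfolding is_polygon_def using poly_saw poly_walk by blast
  moreover have "\<Union> the_poly \<subseteq> {1..n} \<times> {1..n}"
  proof
    fix v assume v: "v \<in> \<Union> the_poly"
    obtain x y where xy: "v = (x, y)" by (metis surj_pair)
    obtain j j' where "1 \<le> x" "x \<le> n" "1 \<le> j" "j < n" "y \<le> top_seq j" "1 \<le> j'" "j' < n" "bot_seq j' \<le> y"
      using poly_bounds[of x y] v xy by blast
    then show "v \<in> {1..n} \<times> {1..n}" using seq_range[of j] seq_range[of j'] xy by auto
  qed
  moreover have "\<exists>!s. s \<in> vertical_sides the_poly x" if x: "x \<in> {1..n}" for x
  proof -
    obtain lo hi where lh: "lo < hi" "vert_edges the_poly x = {lo..<hi}" using poly_vert_interval[of x] x by auto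
    have "vertical_sides the_poly x = {(lo, hi)}"
      unfolding vertical_sides_line lh(2)
      by (rule line_sides_interval[OF _ lh(1)]) (use turnpoint_iff_vert[OF poly_saw, of x] lh(2) in \<open>simp add:
          poly_walk\<close>)
    then show ?thesis by simp
  qed
  moreover have "\<exists>!s. s \<in> horizontal_sides the_poly y" if y: "y \<in> {1..n}" for y
  proof -
    obtain lo hi where lh: "lo < hi" "hor_edges the_poly y = {lo..<hi}" using poly_hor_interval[of y] y by auto
    have "horizontal_sides the_poly y = {(lo, hi)}"
      unfolding horizontal_sides_line lh(2)
      by (rule line_sides_interval[OF _ lh(1)]) (use turnpoint_iff_hor[OF poly_saw, of _ y] lh(2) in \<open>simp add:
          poly_walk\<close>)
    then show ?thesis by simp
  qed
  ultimately show ?thesis unfolding permutomino_def by blast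
qed

text \<open>The value \<open>n\<close> in the first column would be an antidiagonal block of size one.\<close>

lemma top_pos: "\<exists>X. 1 < X \<and> X \<le> n \<and> \<sigma> X = n \<and> (on_upper n \<sigma> C X \<or> X = n)"
proof -
  obtain X where X: "1 \<le> X" "X \<le> n" "\<sigma> X = n" using perm_ex[OF s_perm, of n] n by auto
  have "X \<noteq> 1"
  proof
    assume "X = 1"
    have "co_decomposable n \<sigma>"
    proof (rule block_of_separated[OF s_perm, of 1])
      fix z z' :: nat assume "1 \<le> z" "z \<le> 1" "1 < z'" "z' \<le> n"
      then show "\<sigma> z' < \<sigma> z" using X \<open>X = 1\<close> s_range[of z'] s_inj[of z' 1] by (cases "\<sigma> z' = n") auto
    qed (use n in auto)
    then show False using co by simp
  qed
  moreover have "ulr \<sigma> X \<and> urr n \<sigma> X" using ulr_urr_top[OF s_perm X(1,2)] X by simp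
  moreover have "on_upper n \<sigma> C X \<or> X = n"
    using calculation X csq_free[OF csq n, of X "\<sigma> X"] by (auto simp: on_upper_def)
  ultimately show ?thesis using X by (intro exI[of _ X]) auto
qed

text \<open>The value \<open>1\<close> in the last column would leave an antidiagonal block of size \<open>n - 1\<close> before it.\<close>

lemma bot_pos: "\<exists>X. 1 \<le> X \<and> X < n \<and> \<sigma> X = 1 \<and> \<not> on_upper n \<sigma> C X"
proof -
  obtain X where X: "1 \<le> X" "X \<le> n" "\<sigma> X = 1" using perm_ex[OF s_perm, of 1] n by auto
  have "X \<noteq> n"
  proof
    assume "X = n"
    have "co_decomposable n \<sigma>"
    proof (rule block_of_separated[OF s_perm, of "n - 1"])
      fix z z' :: nat assume z: "1 \<le> z" "z \<le> n - 1" "n - 1 < z'" "z' \<le> n"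
      then have "z' = n" by simp
      moreover have "\<sigma> z \<noteq> 1" using s_inj[of z n] X \<open>X = n\<close> z n by auto
      ultimately show "\<sigma> z' < \<sigma> z" using X \<open>X = n\<close> s_range[of z] z by auto
    qed (use n in auto)
    then show False using co by simp
  qed
  moreover have bb: "blr \<sigma> X \<and> brr n \<sigma> X" using blr_brr_bottom[OF s_perm X(1,2)] X by simp
  moreover have "\<not> on_upper n \<sigma> C X"
  proof
    assume u: "on_upper n \<sigma> C X"
    then have "1 < X" "X < n" by (auto simp: on_upper_def)
    then show False using upper_rec[of X] u bb ulr_blr_first[of X \<sigma>] urr_brr_last[of X n \<sigma>] by auto
  qed
  ultimately show ?thesis using X by (intro exI[of _ X]) auto
qed

lemma next_upper_mono: assumes "k \<le> k'" "k' < n" shows "next_upper k \<le> next_upper k'"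
  unfolding next_upper_def[of k] by (rule Least_le) (use next_upper_props[OF assms(2)] assms in auto)

lemma last_lower_mono: assumes "1 \<le> k" "k \<le> k'" shows "last_lower k \<le> last_lower k'"
proof (rule ccontr)
  assume "\<not> ?thesis"
  then have "on_upper n \<sigma> C (last_lower k)"
    using last_lower_props(4)[of k' "last_lower k"] last_lower_props(2)[OF assms(1)] assms by simp
  then show False using last_lower_props(3)[OF assms(1)] by simp
qed

text \<open>
  The points of upper columns are UL records up to the column \<open>X\<close> of the value \<open>n\<close> and UR records
  from there on; the points of lower columns are BL records up to the column \<open>Z\<close> of the value \<open>1\<close>
  and BR records from there on. So the top rows rise and then fall, the bottom rows fall and then
  rise, and each vertex between two consecutive top or bottom rows is a record of the type of its
  quarter.
\<close>

lemma poly_convex: "interior_points (\<Union> the_poly) = {}"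
proof -
  let ?V = "\<Union> the_poly"
  let ?t = top_seq and ?b = bot_seq
  obtain X where X: "1 < X" "X \<le> n" "\<sigma> X = n" "on_upper n \<sigma> C X \<or> X = n" using top_pos by blast
  obtain Z where Z: "1 \<le> Z" "Z < n" "\<sigma> Z = 1" "\<not> on_upper n \<sigma> C Z" using bot_pos by blast
  have tX: "ulr \<sigma> z" if z: "on_upper n \<sigma> C z \<or> z = n" "z \<le> X" for z
  proof (cases "z = X")
    case True then show ?thesis using ulr_urr_top[OF s_perm, of X] X by simp
  next
    case False
    have zX: "z < X" "z \<le> n" "1 \<le> z" using False z X n by (auto simp: on_upper_def)
    then have "\<not> urr n \<sigma> z" unfolding urr_def using X(2,3) s_range[of z] by (metis not_less)
    then show ?thesis using upper_rec[OF z(1)] by simp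
  qed
  have tX': "urr n \<sigma> z" if z: "on_upper n \<sigma> C z \<or> z = n" "X \<le> z" for z
  proof (cases "z = X")
    case True then show ?thesis using ulr_urr_top[OF s_perm, of X] X by simp
  next
    case False
    have zX: "X < z" "z \<le> n" "1 \<le> z" using False z X n by (auto simp: on_upper_def)
    then have "\<not> ulr \<sigma> z" unfolding ulr_def using X(1,3) s_range[of z] by (metis not_less less_imp_le)
    then show ?thesis using upper_rec[OF z(1)] by simp
  qed
  have bZ: "blr \<sigma> z" if z: "\<not> on_upper n \<sigma> C z" "1 \<le> z" "z \<le> Z" for z
  proof (cases "z = Z")
    case True then show ?thesis using blr_brr_bottom[OF s_perm, of Z] Z by simp
  next
    case False
    then have "z < Z" using z by simp
    then have "\<not> brr n \<sigma> z" unfolding brr_def using Z s_range[of z] z by (metis not_less less_imp_le less_le_trans)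
    then show ?thesis using lower_rec[of z] z Z by simp
  qed
  have bZ': "brr n \<sigma> z" if z: "\<not> on_upper n \<sigma> C z" "Z \<le> z" "z < n" for z
  proof (cases "z = Z")
    case True then show ?thesis using blr_brr_bottom[OF s_perm, of Z] Z by simp
  next
    case False
    then have "Z < z" using z by simp
    then have "\<not> blr \<sigma> z" unfolding blr_def using Z s_range[of z] z by (metis not_less less_imp_le le_trans)
    then show ?thesis using lower_rec[of z] z Z by simp
  qed
  have mono1: "?t k \<le> ?t k'" if k: "1 \<le> k" "k \<le> k'" "k' < X" for k k'
  proof -
    have kn: "k < n" "k' < n" using k X by auto
    have "next_upper k' \<le> X" unfolding next_upper_def by (rule Least_le) (use k X in auto)
    moreover have "next_upper k \<le> next_upper k'" using next_upper_mono k kn by simp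
    moreover have "1 \<le> next_upper k" using next_upper_props(1)[OF kn(1)] by simp
    ultimately show ?thesis using tX[of "next_upper k'"] next_upper_props(3)[OF kn(2)]
      unfolding top_seq_def ulr_def by (metis le_neq_implies_less less_imp_le order_refl)
  qed
  have mono2: "?t k' \<le> ?t k" if k: "X \<le> k" "k \<le> k'" "k' < n" for k k'
  proof -
    have kn: "k < n" "k' < n" using k X by auto
    have "X \<le> next_upper k" using next_upper_props(1)[OF kn(1)] k by simp
    moreover have "next_upper k \<le> next_upper k'" using next_upper_mono k kn by simp
    moreover have "next_upper k' \<le> n" using next_upper_props(2)[OF kn(2)] by simp
    ultimately show ?thesis using tX'[of "next_upper k"] next_upper_props(3)[OF kn(1)]
      unfolding top_seq_def urr_def by (metis le_neq_implies_less less_imp_le order_refl)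
  qed
  have mono3: "?b k' \<le> ?b k" if k: "1 \<le> k" "k \<le> k'" "k' \<le> Z" for k k'
  proof -
    have k': "1 \<le> k'" using k by simp
    have "last_lower k' \<le> Z" using last_lower_props(2)[OF k'] k by simp
    moreover have "last_lower k \<le> last_lower k'" using last_lower_mono k by simp
    moreover have "1 \<le> last_lower k" "1 \<le> last_lower k'" using last_lower_props(1) k k' by auto
    ultimately show ?thesis using bZ[of "last_lower k'"] last_lower_props(3)[OF k']
      unfolding bot_seq_def blr_def by (metis le_neq_implies_less less_imp_le order_refl)
  qed
  have mono4: "?b k \<le> ?b k'" if k: "Z \<le> k" "k \<le> k'" "k' < n" for k k'
  proof -
    have k1: "1 \<le> k" "1 \<le> k'" using k Z by auto
    have "Z \<le> last_lower k"
    proof (rule ccontr)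
      assume "\<not> Z \<le> last_lower k"
      then show False using last_lower_props(4)[OF k1(1), of Z] k Z by simp
    qed
    moreover have "last_lower k \<le> last_lower k'" using last_lower_mono k k1 by simp
    moreover have "last_lower k < n" "last_lower k' \<le> n"
        using last_lower_props(2)[OF k1(1)] last_lower_props(2)[OF k1(2)] k by auto
    ultimately show ?thesis using bZ'[of "last_lower k"] last_lower_props(3)[OF k1(1)]
      unfolding bot_seq_def brr_def by (metis le_neq_implies_less less_imp_le order_refl)
  qed
  have rec: "(x, y) \<in> UL_records ?V \<or> (x, y) \<in> UR_records ?V \<or> (x, y) \<in> BL_records ?V \<or> (x, y) \<in> BR_records ?V"
    if v: "(x, y) \<in> ?V" for x y
  proof -
    have xr: "1 \<le> x" "x \<le> n" using poly_bounds[OF v] by auto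
    consider "x = 1" | "x = n" "x \<noteq> 1" | k where "x = Suc k" "1 \<le> k" "Suc k < n" using xr by (cases x) force+
    then show ?thesis
    proof cases
      case 1
      have "(x, y) \<in> UL_records ?V" unfolding UL_records_iff using v 1 poly_bounds by (metis not_less)
      then show ?thesis by simp
    next
      case 2
      have "(x, y) \<in> UR_records ?V" unfolding UR_records_iff using v 2 poly_bounds by (metis not_less)
      then show ?thesis by simp
    next
      case 3
      have m: "(x, y) \<in> set (row_walk n ?t ?b)"
        using v unfolding walk_vertices[OF poly_saw, unfolded poly_walk] .
      have u: "up_start ?t ?b x = ?t k" "up_end n ?t ?b x = ?t (Suc k)" using 3 by (auto simp: up_start_def up_end_def)
      have "min (?t k) (?t (Suc k)) \<le> y \<or> y \<le> max (?b (Suc k)) (?b k)"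
        using m unfolding poly_vertices u unfolding 3(1) diff_Suc_1 by blast
      then show ?thesis
      proof
        assume up: "min (?t k) (?t (Suc k)) \<le> y"
        show ?thesis
        proof (cases "x < X")
          case True
          then have "?t k \<le> ?t (Suc k)" using mono1[of k "Suc k"] 3 by simp
          then have ty: "?t k \<le> y" using up by simp
          have "y' \<le> y" if v': "(x', y') \<in> ?V" "x' < x" for x' y'
          proof -
            obtain j where j: "j = x' \<or> Suc j = x'" "1 \<le> j" "y' \<le> ?t j" using poly_bounds[OF v'(1)] by blast
            have "?t j \<le> ?t k" using mono1[of j k] j v' 3 True by auto
            then show ?thesis using j ty by simp
          qed
          then have "(x, y) \<in> UL_records ?V" unfolding UL_records_iff using v by blast
          then show ?thesis by simp
        next
          case False
          have ty: "?t (Suc k) \<le> y"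
          proof (cases "x = X")
            case True
            have "next_upper k = X" by (rule next_upper_eqI) (use True 3 X in auto)
            then have "?t k = n" using X by (simp add: top_seq_def)
            then show ?thesis using up seq_range[of "Suc k"] 3 by (simp add: min_def split: if_splits)
          next
            case False
            then have "?t (Suc k) \<le> ?t k" using mono2[of k "Suc k"] \<open>\<not> x < X\<close> 3 by simp
            then show ?thesis using up by simp
          qed
          have "y' \<le> y" if v': "(x', y') \<in> ?V" "x < x'" for x' y'
          proof -
            obtain j where j: "j = x' \<or> Suc j = x'" "j < n" "y' \<le> ?t j" using poly_bounds[OF v'(1)] by blast
            have "?t j \<le> ?t (Suc k)" using mono2[of "Suc k" j] j v' 3 False by auto
            then show ?thesis using j ty by simp
          qed
          then have "(x, y) \<in> UR_records ?V" unfolding UR_records_iff using v by blast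
          then show ?thesis by simp
        qed
      next
        assume low: "y \<le> max (?b (Suc k)) (?b k)"
        show ?thesis
        proof (cases "x \<le> Z")
          case True
          then have "?b (Suc k) \<le> ?b k" using mono3[of k "Suc k"] 3 by simp
          then have ty: "y \<le> ?b k" using low by simp
          have "y \<le> y'" if v': "(x', y') \<in> ?V" "x' < x" for x' y'
          proof -
            obtain j where j: "j = x' \<or> Suc j = x'" "1 \<le> j" "?b j \<le> y'" using poly_bounds[OF v'(1)] by blast
            have "?b k \<le> ?b j" using mono3[of j k] j v' 3 True by auto
            then show ?thesis using j ty by simp
          qed
          then have "(x, y) \<in> BL_records ?V" unfolding BL_records_iff using v by blast
          then show ?thesis by simp
        next
          case False
          then have "?b k \<le> ?b (Suc k)" using mono4[of k "Suc k"] 3 by simp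
          then have ty: "y \<le> ?b (Suc k)" using low by simp
          have "y \<le> y'" if v': "(x', y') \<in> ?V" "x < x'" for x' y'
          proof -
            obtain j where j: "j = x' \<or> Suc j = x'" "j < n" "?b j \<le> y'" using poly_bounds[OF v'(1)] by blast
            have "?b (Suc k) \<le> ?b j" using mono4[of "Suc k" j] j v' 3 False by auto
            then show ?thesis using j ty by simp
          qed
          then have "(x, y) \<in> BR_records ?V" unfolding BR_records_iff using v by blast
          then show ?thesis by simp
        qed
      qed
    qed
  qed
  then show ?thesis unfolding interior_points_def exterior_points_def by fastforce
qed

lemma phi_surj: "\<exists>P\<in>convex_permutominoes n. phi n P = (\<sigma>, C)"
proof
  have "is_polygon the_poly" using poly_permutomino by (simp add: permutomino_def)
  then show cp: "the_poly \<in> convex_permutominoes n"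
    using poly_permutomino poly_convex by (simp add: convex_permutominoes_def convex_polygon_def)
  have tb: "top_row the_poly k = top_seq k" "bot_row the_poly k = bot_seq k" if k: "1 \<le> k" "k < n" for k
  proof -
    have "{y. k \<in> hor_edges the_poly y} = {top_seq k, bot_seq k}" using k poly_hor by auto
    then show "top_row the_poly k = top_seq k" "bot_row the_poly k = bot_seq k"
      using bot_less_top[OF k] by (auto simp: top_row_def bot_row_def)
  qed
  have row: "black_row n (top_row the_poly) (bot_row the_poly) x = \<sigma> x" if x: "1 \<le> x" "x \<le> n" for x
  proof -
    have "black_row n (top_row the_poly) (bot_row the_poly) x = black_row n top_seq bot_seq x"
      using tb n x by (auto simp: black_row_def)
    then show ?thesis using black_row_seq[OF x] by simp
  qed
  have bp: "black_perm n the_poly = \<sigma>"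
  proof
    fix x
    show "black_perm n the_poly x = \<sigma> x"
      unfolding cp_black_perm[OF n cp] using row permutes_not_in[OF s_perm, of x] by auto
  qed
  have "free_fixed_points n \<sigma> \<inter> upper_walk the_poly = C"
  proof (rule set_eqI)
    fix p :: point
    obtain x y where xy: "p = (x, y)" by (metis surj_pair)
    show "p \<in> free_fixed_points n \<sigma> \<inter> upper_walk the_poly \<longleftrightarrow> p \<in> C"
    proof (cases "p \<in> free_fixed_points n \<sigma>")
      case True
      then have f: "y = x" "1 < x" "x < n" "\<sigma> x = x" using csq_free[OF csq n, of x y] xy by auto
      then obtain k where k: "x = Suc k" "1 \<le> k" "Suc k < n" by (cases x) auto
      have up: "on_upper n \<sigma> C (Suc k) \<longleftrightarrow> p \<in> C" using True f xy k by (auto simp: on_upper_def)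
      have w: "(Suc k, top_seq k) \<in> upper_walk the_poly" "(Suc k, bot_seq (Suc k)) \<notin> upper_walk the_poly"
        using cp_upper_walk[OF n cp, of "Suc k"] tb[of k] tb[of "Suc k"] k by auto
      have "on_upper n \<sigma> C (Suc k) \<Longrightarrow> top_seq k = \<sigma> (Suc k)" "\<not> on_upper n \<sigma> C (Suc k) \<Longrightarrow> bot_seq (Suc k) = \<sigma> (Suc k)"
        using upper_col(1)[OF k(2,3)] lower_col(2)[OF k(2,3)] by (auto simp: top_seq_def bot_seq_def)
      then have "p \<in> upper_walk the_poly \<longleftrightarrow> on_upper n \<sigma> C (Suc k)" using w f k xy by metis
      then show ?thesis using up True by simp
    next
      case False
      then show ?thesis using csq_sub[OF csq n] by auto
    qed
  qed
  then show "phi n the_poly = (\<sigma>, C)" by (simp add: phi_def bp)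
qed

end

text \<open>
  The polygon with the top and bottom rows of a colored permutation has that permutation as its
  black points, and its upper walk contains the black points of the columns in \<open>on_upper\<close>.
\<close>

theorem phi_bij_betw:
  assumes n: "2 \<le> n"
  shows "bij_betw (phi n) (convex_permutominoes n) {(\<sigma>, C) \<in> colored_square_perms n. \<not> co_decomposable n \<sigma>}"
  unfolding bij_betw_def
proof (intro conjI equalityI subsetI)
  show "inj_on (phi n) (convex_permutominoes n)" by (rule phi_inj_on[OF n])
  fix x assume "x \<in> phi n ` convex_permutominoes n"
  then obtain P where P: "P \<in> convex_permutominoes n" "x = phi n P" by auto
  then show "x \<in> {(\<sigma>, C) \<in> colored_square_perms n. \<not> co_decomposable n \<sigma>}"
    using phi_csq[OF n P(1)] phi_co_indecomposable[OF n P(1)] by (simp add: phi_def)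
next
  fix x assume "x \<in> {(\<sigma>, C) \<in> colored_square_perms n. \<not> co_decomposable n \<sigma>}"
  then obtain \<sigma> C where s: "x = (\<sigma>, C)" "(\<sigma>, C) \<in> colored_square_perms n" "\<not> co_decomposable n \<sigma>" by auto
  then show "x \<in> phi n ` convex_permutominoes n" using phi_surj[OF s(2) n s(3)] unfolding s(1) by (metis imageI)
qed

theorem theorem6:
  fixes n :: nat
  assumes "n \<ge> 2"
  shows "(inj_on (\<lambda>\<sigma>. code n (\<sigma>, {})) (square_perms n) \<and>
          A_words n \<subseteq> marked_words n \<and> B_words n \<subseteq> marked_words n \<and>
          A_words n \<inter> B_words n = {} \<and>
          (\<lambda>\<sigma>. code n (\<sigma>, {})) ` square_perms n = marked_words n - (A_words n \<union> B_words n)) \<and>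
         (inj_on (\<lambda>P. code n (phi n P)) (convex_permutominoes n) \<and>
          A'_words n \<subseteq> marked_words n \<and> B'_words n \<subseteq> marked_words n \<and>
          A'_words n \<inter> B'_words n = {} \<and>
          (\<lambda>P. code n (phi n P)) ` convex_permutominoes n =
            marked_words n - (A'_words n \<union> B'_words n))"
proof -
  have sub: "A_words n \<subseteq> marked_words n" "B_words n \<subseteq> marked_words n" "A'_words n \<subseteq> marked_words n" "B'_words n \<subseteq> marked_words n"
    unfolding A_words_def B_words_def A'_words_def B'_words_def by (simp_all add: subset_eq Ball_def split_paired_all del: One_nat_def)
  have n: "2 \<le> n" using assms .
  note phi = phi_bij_betw[OF n, unfolded bij_betw_def]
  have "inj_on (code n) (phi n ` convex_permutominoes n)"
    by (rule inj_on_subset[OF code_inj_on[OF n]]) (use phi in auto)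
  then have "inj_on (\<lambda>P. code n (phi n P)) (convex_permutominoes n)"
    using comp_inj_on[of "phi n" "convex_permutominoes n" "code n"] phi by (simp add: comp_def)
  moreover have "(\<lambda>P. code n (phi n P)) ` convex_permutominoes n = marked_words n - (A'_words n \<union> B'_words n)"
    using code_square_perms(5)[OF n] phi by (metis image_image)
  ultimately show ?thesis using code_square_perms(1-4)[OF n] sub by simp
qed

end
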